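(* For each $N$, the map $\mathcal T\mapsto\boxplus_{\mathcal T}$ defines a continuous function $\mathrm{Tree}(N)\to\mathrm{Func}(\mathcal B,N)$. (In particular $\boxplus_{\mathcal T}\in\mathrm{Func}(\mathcal B,N)$ for every $\mathcal T\in\mathrm{Tree}(N)$.)
   Context: $\mathcal B$ is a unital $C^*$-algebra. For a right Hilbert $\mathcal B$-module $\mathcal H$, $\mathcal L(\mathcal H)$ is the $C^*$-algebra of bounded adjointable right-$\mathcal B$-modular operators. A $\mathcal B$-$\mathcal B$-correspondence is a right Hilbert $\mathcal B$-module with a left action given by a unital $*$-homomorphism $\mathcal B\to\mathcal L(\mathcal H)$. A $\mathcal B$-central unit vector is $\xi\in\mathcal H$ with $\langle\xi,\xi\rangle=1$, $b\xi=\xi b$ for all $b\in\mathcal B$; then $\mathcal H=\mathcal B\xi\oplus\mathcal H^\circ$, $\mathcal H^\circ=\{h:\langle h,\xi\rangle=0\}$. Laws: $\mathcal B\langle X\rangle$ is the universal unital $*$-algebra generated by $\mathcal B$ and a self-adjoint indeterminate $X$. A $\mathcal B$-valued law is a unital $\mathcal B$-$\mathcal B$-bimodule map $\mu:\mathcal B\langle X\rangle\to\mathcal B$ that is completely positive ($\mu^{(m)}(P^*P)\ge0$ for all $P\in M_m(\mathcal B\langle X\rangle)$, all $m$) and exponentially bounded (there are $M,R>0$ with $\|\mu(b_0Xb_1\cdots Xb_\ell)\|\le MR^\ell\|b_0\|\cdots\|b_\ell\|$ for all $\ell\ge0$, $b_i\in\mathcal B$); $\mathrm{rad}(\mu)$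 is the infimum of the $R$ for which such $M$ exists. $\Sigma(\mathcal B)$ is the set of laws, $\Sigma_R(\mathcal B)=\{\mu:\mathrm{rad}(\mu)\le R\}$. For $c\in\mathbb R$, $\mathrm{dil}_c(\mu)(f(X))=\mu(f(cX))$. $\mathrm{Mom}_\ell(\mu)[b_0,\dots,b_\ell]=\mu(b_0Xb_1\cdots Xb_\ell)$, and $\|\Lambda\|=\sup_{\|b_i\|\le1}\|\Lambda[b_0,\dots,b_\ell]\|$ for multilinear maps. On $\Sigma_R(\mathcal B)$ use the metric $d_R(\mu,\nu)=\sup_{\ell\ge1}(2R)^{-\ell}\|\mathrm{Mom}_\ell(\mu)-\mathrm{Mom}_\ell(\nu)\|$. $\mathrm{Func}(\mathcal B,N)$ is the set of functions $F:\Sigma(\mathcal B)^N\to\Sigma(\mathcal B)$ such that (1) $\mathrm{rad}(F(\mu_1,\dots,\mu_N))\le\mathrm{rad}(\mu_1)+\dots+\mathrm{rad}(\mu_N)$; (2) $F(\mathrm{dil}_c(\mu_1),\dots,\mathrm{dil}_c(\mu_N))=\mathrm{dil}_c(F(\mu_1,\dots,\mu_N))$ for $c \in \mathbb R$; (3) $F$ restricts to a uniformly continuous function $\Sigma_1(\mathcal B)^N\to\Sigma_N(\mathcal B)$. Its metric is $d(F,G)=\sup_{\mu_1,\dots,\mu_N\in\Sigma_1(\mathcal B)}d_N(F(\mu_1,\dots,\mu_N),G(\mu_1,\dots,\mu_N))$. Trees: $[N]=\{1,\dots,N\}$. A string on $[N]$ is alternating if consecutive letters differ. $\mathcal T_{N,\mathrm{free}}$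 is the graph whose vertices are the alternating strings on $[N]$ (including the empty string $\emptyset$), with an edge between $s$ and $js$ whenever $js$ is alternating, rooted at $\emptyset$. $\mathrm{Tree}(N)$ is the set of connected subgraphs containing $\emptyset$, each identified with its vertex set. For $\mathcal T\in\mathrm{Tree}(N)$, $B_\ell(\mathcal T)$ is the set of strings in $\mathcal T$ of length $\le\ell$; the metric on $\mathrm{Tree}(N)$ is $\rho_N(\mathcal T,\mathcal T')=\exp(-\sup\{\ell\ge0:B_\ell(\mathcal T)=B_\ell(\mathcal T')\})$, with $\exp(-\infty)=0$. $\mathcal T$-free convolution: given correspondences with $\mathcal B$-central unit vectors $(\mathcal H_j,\xi_j)$, $j\in[N]$, put $\mathcal H=\bigoplus_{s\in\mathcal T}\mathcal H_s^\circ$, $\mathcal H_\emptyset^\circ=\mathcal B$, $\mathcal H^\circ_{j_1\cdots j_m}=\mathcal H_{j_1}^\circ\otimes_{\mathcal B}\cdots\otimes_{\mathcal B}\mathcal H_{j_m}^\circ$, $\xi=1\in\mathcal H_\emptyset^\circ$. $\lambda_{\mathcal T,j}:\mathcal L(\mathcal H_j)\to\mathcal L(\mathcal H)$ is the $*$-homomorphism for which $\lambda_{\mathcal T,j}(x)$ acts on $\mathcal H_s^\circ\oplus\mathcal H_{js}^\circ\cong\mathcal H_j\otimes_{\mathcal B}\mathcal H_s^\circ$ as $x\otimes\mathrm{id}$ when $s\in\mathcal T$ does not begin with $j$ and $js\in\mathcal T$, and as zero on $\mathcal H_s^\circ$ when $s\in\mathcal T$ does not begin with $j$ and $js\notin\mathcal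 T$. For laws $\mu_1,\dots,\mu_N$, let $\mathcal H_j=L^2(\mathcal B\langle X\rangle,\mu_j)$ (separation-completion for $\langle p,q\rangle=\mu_j(p^*q)$), $\xi_j$ the class of $1$, $X_j\in\mathcal L(\mathcal H_j)$ multiplication by $X$; then $\boxplus_{\mathcal T}(\mu_1,\dots,\mu_N)$ is the law of $\sum_{j=1}^N\lambda_{\mathcal T,j}(X_j)$ with respect to $a\mapsto\langle\xi,a\xi\rangle$. *)

theory Defs
  imports "HOL-Analysis.Analysis"
begin

section \<open>Unital $*$-algebras and unital C*-algebras\<close>

class star_algebra_1 = ring_1 +
  fixes scaleC :: "complex \<Rightarrow> 'a \<Rightarrow> 'a"  (infixr \<open>*\<^sub>C\<close> 75)
    and star :: "'a \<Rightarrow> 'a"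
  assumes scaleC_add_right: "c *\<^sub>C (x + y) = c *\<^sub>C x + c *\<^sub>C y"
    and scaleC_add_left: "(c + d) *\<^sub>C x = c *\<^sub>C x + d *\<^sub>C x"
    and scaleC_scaleC: "c *\<^sub>C d *\<^sub>C x = (c * d) *\<^sub>C x"
    and scaleC_one: "1 *\<^sub>C x = x"
    and mult_scaleC_left: "(c *\<^sub>C x) * y = c *\<^sub>C (x * y)"
    and mult_scaleC_right: "x * (c *\<^sub>C y) = c *\<^sub>C (x * y)"
    and star_add: "star (x + y) = star x + star y"
    and star_scaleC: "star (c *\<^sub>C x) = cnj c *\<^sub>C star x"
    and star_mult: "star (x * y) = star y * star x"
    and star_star: "star (star x) = x"
begin

lemma star_one: "star 1 = 1"
  using star_mult[of "star 1" 1] by (simp add: star_star)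

lemma star_zero: "star 0 = 0"
  using star_add[of 0 0] by simp

lemma star_minus_one: "star (- 1) = - 1"
  using star_add[of "- 1" 1] by (simp add: star_one star_zero eq_neg_iff_add_eq_0)

lemma scaleC_zero_left: "0 *\<^sub>C x = 0"
  using scaleC_add_left[of 0 0 x] by simp

lemma scaleC_minus_one: "(- 1) *\<^sub>C 1 = - 1"
  using scaleC_add_left[of "- 1" 1 1] by (simp add: scaleC_zero_left scaleC_one eq_neg_iff_add_eq_0)

lemma scaleC_eq_mult: "c *\<^sub>C x = (c *\<^sub>C 1) * x"
  by (simp add: mult_scaleC_left)

lemma scaleC_one_central: "(c *\<^sub>C 1) * x = x * (c *\<^sub>C 1)"
  by (simp add: mult_scaleC_left mult_scaleC_right)

lemma scaleC_one_mult: "(c *\<^sub>C 1) * (d *\<^sub>C 1) = (c * d) *\<^sub>C 1"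
  by (simp add: mult_scaleC_left scaleC_scaleC)

end

class unital_cstar_algebra = star_algebra_1 + real_normed_algebra_1 + banach +
  assumes scaleR_eq_scaleC: "r *\<^sub>R x = complex_of_real r *\<^sub>C x"
    and cstar_identity: "norm (star x * x) = (norm x)\<^sup>2"


section \<open>The algebra \<open>B\<langle>X\<rangle>\<close>\<close>

text \<open>
  The universal unital $*$-algebra generated by the unital $*$-algebra \<open>B\<close> and a self-adjoint
  indeterminate is built from generators and relations: formal expressions modulo the congruence
  generated by the ring axioms, the requirement that \<open>NC_const\<close> be a unital ring homomorphism, and
  centrality of the scalars. The universal property is \<open>ncpoly_universal\<close> below.
\<close>

datatype 'b ncexp =
    NC_const 'b
  | NC_var
  | NC_add "'b ncexp" "'b ncexp"
  | NC_mult "'b ncexp" "'b ncexp"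

inductive nceq :: "'b::star_algebra_1 ncexp \<Rightarrow> 'b ncexp \<Rightarrow> bool" where
  refl: "nceq p p"
| sym: "nceq p q \<Longrightarrow> nceq q p"
| trans: "nceq p q \<Longrightarrow> nceq q r \<Longrightarrow> nceq p r"
| cong_add: "nceq p p' \<Longrightarrow> nceq q q' \<Longrightarrow> nceq (NC_add p q) (NC_add p' q')"
| cong_mult: "nceq p p' \<Longrightarrow> nceq q q' \<Longrightarrow> nceq (NC_mult p q) (NC_mult p' q')"
| add_assoc: "nceq (NC_add (NC_add p q) r) (NC_add p (NC_add q r))"
| add_comm: "nceq (NC_add p q) (NC_add q p)"
| add_zero: "nceq (NC_add (NC_const 0) p) p"
| add_neg: "nceq (NC_add (NC_mult (NC_const (- 1)) p) p) (NC_const 0)"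
| mult_assoc: "nceq (NC_mult (NC_mult p q) r) (NC_mult p (NC_mult q r))"
| distrib_right: "nceq (NC_mult (NC_add p q) r) (NC_add (NC_mult p r) (NC_mult q r))"
| distrib_left: "nceq (NC_mult p (NC_add q r)) (NC_add (NC_mult p q) (NC_mult p r))"
| mult_one_left: "nceq (NC_mult (NC_const 1) p) p"
| mult_one_right: "nceq (NC_mult p (NC_const 1)) p"
| const_add: "nceq (NC_const (a + b)) (NC_add (NC_const a) (NC_const b))"
| const_mult: "nceq (NC_const (a * b)) (NC_mult (NC_const a) (NC_const b))"
| scalar_central: "nceq (NC_mult (NC_const (c *\<^sub>C 1)) NC_var) (NC_mult NC_var (NC_const (c *\<^sub>C 1)))"

quotient_type (overloaded) 'b ncpoly = "'b::star_algebra_1 ncexp" / nceq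
proof (rule equivpI)
  show "reflp (nceq :: 'b ncexp \<Rightarrow> _)" by (rule reflpI, rule nceq.refl)
  show "symp (nceq :: 'b ncexp \<Rightarrow> _)" by (rule sympI, rule nceq.sym)
  show "transp (nceq :: 'b ncexp \<Rightarrow> _)" by (rule transpI, rule nceq.trans)
qed

primrec exp_star :: "'b::star_algebra_1 ncexp \<Rightarrow> 'b ncexp" where
  "exp_star (NC_const b) = NC_const (star b)"
| "exp_star NC_var = NC_var"
| "exp_star (NC_add p q) = NC_add (exp_star p) (exp_star q)"
| "exp_star (NC_mult p q) = NC_mult (exp_star q) (exp_star p)"

primrec exp_eval :: "('b \<Rightarrow> 'a::ring_1) \<Rightarrow> 'a \<Rightarrow> 'b ncexp \<Rightarrow> 'a" where
  "exp_eval h x (NC_const b) = h b"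
| "exp_eval h x NC_var = x"
| "exp_eval h x (NC_add p q) = exp_eval h x p + exp_eval h x q"
| "exp_eval h x (NC_mult p q) = exp_eval h x p * exp_eval h x q"

definition unital_hom :: "('b::star_algebra_1 \<Rightarrow> 'a::star_algebra_1) \<Rightarrow> bool" where
  "unital_hom h \<longleftrightarrow> (\<forall>a b. h (a + b) = h a + h b) \<and> (\<forall>a b. h (a * b) = h a * h b) \<and>
     h 1 = 1 \<and> (\<forall>c a. h (c *\<^sub>C a) = c *\<^sub>C h a)"

lemma exp_eval_cong:
  assumes "unital_hom h" "nceq p q"
  shows "exp_eval h x p = exp_eval h x q"
proof -
  have h: "h (a + b) = h a + h b" "h (a * b) = h a * h b" "h 1 = 1" "h (c *\<^sub>C a) = c *\<^sub>C h a" for a b c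
    using assms(1) by (auto simp: unital_hom_def)
  have h0: "h 0 = 0" using h(1)[of 0 0] by simp
  have hm: "h (- 1) = - 1"
    using h(1)[of "- 1" 1] h0 h(3) by (simp add: eq_neg_iff_add_eq_0)
  show ?thesis using assms(2)
  proof induction
    case (scalar_central c)
    then show ?case by (simp add: h mult_scaleC_left mult_scaleC_right)
  qed (simp_all add: h h0 hm algebra_simps)
qed

declare nceq.trans [trans]

lemma nceq_scalar_central:
  fixes p :: "'b::star_algebra_1 ncexp"
  shows "nceq (NC_mult (NC_const (c *\<^sub>C 1)) p) (NC_mult p (NC_const (c *\<^sub>C 1)))"
proof (induction p)
  case (NC_const b)
  have "nceq (NC_mult (NC_const (c *\<^sub>C 1)) (NC_const b)) (NC_const ((c *\<^sub>C 1) * b))"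
    by (rule nceq.sym, rule nceq.const_mult)
  also have "(c *\<^sub>C 1) * b = b * (c *\<^sub>C 1)" by (rule scaleC_one_central)
  also note nceq.const_mult
  finally show ?case .
next
  case NC_var
  show ?case by (rule nceq.scalar_central)
next
  case (NC_add p q)
  let ?c = "NC_const (c *\<^sub>C 1) :: 'b ncexp"
  have "nceq (NC_mult ?c (NC_add p q)) (NC_add (NC_mult ?c p) (NC_mult ?c q))"
    by (rule nceq.distrib_left)
  also have "nceq (NC_add (NC_mult ?c p) (NC_mult ?c q)) (NC_add (NC_mult p ?c) (NC_mult q ?c))"
    by (intro nceq.cong_add NC_add.IH)
  also have "nceq (NC_add (NC_mult p ?c) (NC_mult q ?c)) (NC_mult (NC_add p q) ?c)"
    by (rule nceq.sym, rule nceq.distrib_right)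
  finally show ?case .
next
  case (NC_mult p q)
  let ?c = "NC_const (c *\<^sub>C 1) :: 'b ncexp"
  have "nceq (NC_mult ?c (NC_mult p q)) (NC_mult (NC_mult ?c p) q)"
    by (rule nceq.sym, rule nceq.mult_assoc)
  also have "nceq (NC_mult (NC_mult ?c p) q) (NC_mult (NC_mult p ?c) q)"
    by (rule nceq.cong_mult[OF NC_mult.IH(1) nceq.refl])
  also have "nceq (NC_mult (NC_mult p ?c) q) (NC_mult p (NC_mult ?c q))"
    by (rule nceq.mult_assoc)
  also have "nceq (NC_mult p (NC_mult ?c q)) (NC_mult p (NC_mult q ?c))"
    by (rule nceq.cong_mult[OF nceq.refl NC_mult.IH(2)])
  also have "nceq (NC_mult p (NC_mult q ?c)) (NC_mult (NC_mult p q) ?c)"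
    by (rule nceq.sym, rule nceq.mult_assoc)
  finally show ?case .
qed

lemma exp_star_cong: "nceq p q \<Longrightarrow> nceq (exp_star p) (exp_star q)"
proof (induction rule: nceq.induct)
  case (trans p q r)
  show ?case by (rule nceq.trans[OF trans.IH])
next
  case (sym p q)
  show ?case by (rule nceq.sym[OF sym.IH])
next
  case (add_neg p)
  have "nceq (NC_mult (exp_star p) (NC_const (- 1))) (NC_mult (NC_const (- 1)) (exp_star p))"
    using nceq_scalar_central[of "- 1" "exp_star p"] by (simp add: scaleC_minus_one nceq.sym)
  from nceq.trans[OF nceq.cong_add[OF this nceq.refl] nceq.add_neg]
  show ?case by (simp add: star_minus_one star_zero)
next
  case (mult_assoc p q r)
  then show ?case by (simp add: nceq.mult_assoc nceq.sym)
next
  case (scalar_central c)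
  then show ?case by (simp add: star_scaleC star_one nceq.sym nceq.scalar_central)
qed (simp_all add: nceq.refl nceq.cong_add nceq.cong_mult nceq.add_assoc nceq.add_comm
      nceq.add_zero nceq.distrib_left nceq.distrib_right nceq.mult_one_left nceq.mult_one_right
      nceq.const_add nceq.const_mult star_add star_mult star_one star_zero)

instantiation ncpoly :: (star_algebra_1) star_algebra_1
begin

lift_definition zero_ncpoly :: "'a ncpoly" is "NC_const 0" .
lift_definition one_ncpoly :: "'a ncpoly" is "NC_const 1" .
lift_definition plus_ncpoly :: "'a ncpoly \<Rightarrow> 'a ncpoly \<Rightarrow> 'a ncpoly" is NC_add
  by (rule nceq.cong_add)
lift_definition times_ncpoly :: "'a ncpoly \<Rightarrow> 'a ncpoly \<Rightarrow> 'a ncpoly" is NC_mult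
  by (rule nceq.cong_mult)
lift_definition uminus_ncpoly :: "'a ncpoly \<Rightarrow> 'a ncpoly" is "NC_mult (NC_const (- 1))"
  by (rule nceq.cong_mult[OF nceq.refl])
lift_definition minus_ncpoly :: "'a ncpoly \<Rightarrow> 'a ncpoly \<Rightarrow> 'a ncpoly"
  is "\<lambda>p q. NC_add p (NC_mult (NC_const (- 1)) q)"
  by (intro nceq.cong_add nceq.cong_mult nceq.refl)
lift_definition scaleC_ncpoly :: "complex \<Rightarrow> 'a ncpoly \<Rightarrow> 'a ncpoly"
  is "\<lambda>c. NC_mult (NC_const (c *\<^sub>C 1))"
  by (rule nceq.cong_mult[OF nceq.refl])
lift_definition star_ncpoly :: "'a ncpoly \<Rightarrow> 'a ncpoly" is exp_star
  by (rule exp_star_cong)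

instance
proof
  fix p q r :: "'a ncpoly" and c d :: complex
  show "p + q + r = p + (q + r)" by transfer (rule nceq.add_assoc)
  show "p + q = q + p" by transfer (rule nceq.add_comm)
  show "0 + p = p" by transfer (rule nceq.add_zero)
  show "- p + p = 0" by transfer (rule nceq.add_neg)
  show "p - q = p + - q" by transfer (rule nceq.refl)
  show "p * q * r = p * (q * r)" by transfer (rule nceq.mult_assoc)
  show "(p + q) * r = p * r + q * r" by transfer (rule nceq.distrib_right)
  show "p * (q + r) = p * q + p * r" by transfer (rule nceq.distrib_left)
  show "1 * p = p" by transfer (rule nceq.mult_one_left)
  show "p * 1 = p" by transfer (rule nceq.mult_one_right)
  show "(0::'a ncpoly) \<noteq> 1"
  proof transfer
    have "unital_hom (id :: 'a \<Rightarrow> 'a)" by (simp add: unital_hom_def)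
    from exp_eval_cong[OF this, where x=0] show "\<not> nceq (NC_const (0::'a)) (NC_const 1)"
      by force
  qed
  show "c *\<^sub>C (p + q) = c *\<^sub>C p + c *\<^sub>C q" by transfer (rule nceq.distrib_left)
  show "(c + d) *\<^sub>C p = c *\<^sub>C p + d *\<^sub>C p"
    by transfer (simp only: scaleC_add_left,
        rule nceq.trans[OF nceq.cong_mult[OF nceq.const_add nceq.refl] nceq.distrib_right])
  show "c *\<^sub>C d *\<^sub>C p = (c * d) *\<^sub>C p"
    by transfer (simp only: scaleC_one_mult[symmetric],
        rule nceq.sym[OF nceq.trans[OF nceq.cong_mult[OF nceq.const_mult nceq.refl] nceq.mult_assoc]])
  show "1 *\<^sub>C p = p" by transfer (simp add: scaleC_one nceq.mult_one_left)
  show "(c *\<^sub>C p) * q = c *\<^sub>C (p * q)" by transfer (rule nceq.mult_assoc)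
  show "p * (c *\<^sub>C q) = c *\<^sub>C (p * q)"
    by transfer (rule nceq.trans[OF nceq.sym[OF nceq.mult_assoc]
        nceq.trans[OF nceq.cong_mult[OF nceq.sym[OF nceq_scalar_central] nceq.refl] nceq.mult_assoc]])
  show "star (p + q) = star p + star q" by transfer (simp add: nceq.refl)
  show "star (c *\<^sub>C p) = cnj c *\<^sub>C star p"
    by transfer (simp add: star_scaleC star_one nceq_scalar_central nceq.sym)
  show "star (p * q) = star q * star p" by transfer (simp add: nceq.refl)
  show "star (star p) = p"
  proof transfer
    fix p :: "'a ncexp"
    have "exp_star (exp_star p) = p" by (induction p) (simp_all add: star_star)
    then show "nceq (exp_star (exp_star p)) p" by (simp add: nceq.refl)
  qed
qed

end

lift_definition coef :: "'b::star_algebra_1 \<Rightarrow> 'b ncpoly" is NC_const .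

lift_definition indet :: "'b::star_algebra_1 ncpoly" is NC_var .

text \<open>\<open>nc_eval h x\<close> is the homomorphism extending \<open>h\<close> with \<open>X \<mapsto> x\<close>.\<close>

definition nc_eval :: "('b::star_algebra_1 \<Rightarrow> 'a::star_algebra_1) \<Rightarrow> 'a \<Rightarrow> 'b ncpoly \<Rightarrow> 'a" where
  "nc_eval h x p = exp_eval h x (rep_ncpoly p)"

lemma nc_eval_abs: "unital_hom h \<Longrightarrow> nc_eval h x (abs_ncpoly e) = exp_eval h x e"
  unfolding nc_eval_def
  by (rule exp_eval_cong, assumption) (rule rep_abs_rsp_left[OF Quotient3_ncpoly], rule nceq.refl)

lemma ncpoly_induct [case_names coef indet add mult]:
  assumes "\<And>b. P (coef b)" "P indet" "\<And>p q. P p \<Longrightarrow> P q \<Longrightarrow> P (p + q)"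
    "\<And>p q. P p \<Longrightarrow> P q \<Longrightarrow> P (p * q)"
  shows "P p"
proof -
  have "P (abs_ncpoly e)" for e
    by (induction e) (use assms in \<open>simp_all add: coef.abs_eq[symmetric] indet.abs_eq[symmetric]
        plus_ncpoly.abs_eq[symmetric] times_ncpoly.abs_eq[symmetric]\<close>)
  from this[of "rep_ncpoly p"] show ?thesis by (simp add: Quotient3_abs_rep[OF Quotient3_ncpoly])
qed

lemma unital_hom_coef: "unital_hom coef"
proof -
  have "coef (a + b) = coef a + coef b" for a b :: 'a by transfer (rule nceq.const_add)
  moreover have "coef (a * b) = coef a * coef b" for a b :: 'a by transfer (rule nceq.const_mult)
  moreover have "coef (1::'a) = 1" by transfer (rule nceq.refl)
  moreover have "coef (c *\<^sub>C a) = c *\<^sub>C coef a" for c and a :: 'a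
    by transfer (subst scaleC_eq_mult, rule nceq.const_mult)
  ultimately show ?thesis by (simp add: unital_hom_def)
qed

theorem ncpoly_universal:
  fixes h :: "'b::star_algebra_1 \<Rightarrow> 'a::star_algebra_1"
  assumes h: "unital_hom h" "\<And>b. h (star b) = star (h b)" and x: "star x = x"
  shows "\<exists>!f. unital_hom f \<and> (\<forall>p. f (star p) = star (f p)) \<and> (\<forall>b. f (coef b) = h b) \<and> f indet = x"
proof (rule ex1I[of _ "nc_eval h x"])
  have c: "nc_eval h x (coef b) = h b" for b
    by (simp add: coef.abs_eq nc_eval_abs[OF h(1)])
  have i: "nc_eval h x indet = x"
    by (simp add: indet.abs_eq nc_eval_abs[OF h(1)])
  have abs: "\<exists>e. p = abs_ncpoly e" for p :: "'b ncpoly"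
    by (rule exI[of _ "rep_ncpoly p"]) (simp add: Quotient3_abs_rep[OF Quotient3_ncpoly])
  have a: "nc_eval h x (p + q) = nc_eval h x p + nc_eval h x q" for p q
    using abs[of p] abs[of q] by (auto simp: plus_ncpoly.abs_eq nc_eval_abs[OF h(1)])
  have m: "nc_eval h x (p * q) = nc_eval h x p * nc_eval h x q" for p q
    using abs[of p] abs[of q] by (auto simp: times_ncpoly.abs_eq nc_eval_abs[OF h(1)])
  have one: "nc_eval h x 1 = 1"
    using c[of 1] h(1) unital_hom_coef[where 'a='b] by (simp add: unital_hom_def)
  have s: "nc_eval h x (c *\<^sub>C p) = c *\<^sub>C nc_eval h x p" for c p
  proof -
    have "c *\<^sub>C p = coef (c *\<^sub>C 1) * p"
      using unital_hom_coef[where 'a='b] scaleC_eq_mult[of c p] by (simp add: unital_hom_def)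
    then have "nc_eval h x (c *\<^sub>C p) = h (c *\<^sub>C 1) * nc_eval h x p" by (simp add: m c)
    also have "\<dots> = c *\<^sub>C nc_eval h x p"
      using h(1) by (simp add: unital_hom_def mult_scaleC_left)
    finally show ?thesis .
  qed
  have st: "nc_eval h x (star p) = star (nc_eval h x p)" for p
  proof (induction p rule: ncpoly_induct)
    case (coef b)
    have "star (coef b) = coef (star b)" by transfer (simp add: nceq.refl)
    then show ?case by (simp add: c h)
  next
    case indet
    have "star (indet :: 'b ncpoly) = indet" by transfer (simp add: nceq.refl)
    then show ?case by (simp add: i x)
  qed (simp_all add: star_add star_mult a m)
  show "unital_hom (nc_eval h x) \<and> (\<forall>p. nc_eval h x (star p) = star (nc_eval h x p)) \<and>
      (\<forall>b. nc_eval h x (coef b) = h b) \<and> nc_eval h x indet = x"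
    by (simp add: unital_hom_def a m s st c i one)
  fix f
  assume f: "unital_hom f \<and> (\<forall>p. f (star p) = star (f p)) \<and> (\<forall>b. f (coef b) = h b) \<and> f indet = x"
  show "f = nc_eval h x"
  proof
    fix p show "f p = nc_eval h x p"
      by (induction p rule: ncpoly_induct) (use f in \<open>simp_all add: c i a m unital_hom_def\<close>)
  qed
qed


section \<open>\<open>B\<close>-valued laws\<close>

type_synonym 'b law = "'b ncpoly \<Rightarrow> 'b"

text \<open>\<open>nc_monomial b\<^sub>0 [b\<^sub>1, \<dots>, b\<^sub>l] = b\<^sub>0 X b\<^sub>1 \<cdots> X b\<^sub>l\<close>.\<close>

definition nc_monomial :: "'b::star_algebra_1 \<Rightarrow> 'b list \<Rightarrow> 'b ncpoly" where
  "nc_monomial b bs = coef b * prod_list (map (\<lambda>c. indet * coef c) bs)"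

text \<open>Positivity in the C*-algebra \<open>M\<^sub>m(B)\<close>, in the form \<open>A = C\<^sup>* C\<close>; matrices are functions of two
  indices, of which only the values at indices \<open>< m\<close> matter.\<close>

definition mat_positive :: "nat \<Rightarrow> (nat \<Rightarrow> nat \<Rightarrow> 'b::unital_cstar_algebra) \<Rightarrow> bool" where
  "mat_positive m A \<longleftrightarrow> (\<exists>C. \<forall>i<m. \<forall>j<m. A i j = (\<Sum>k<m. star (C k i) * C k j))"

definition completely_positive :: "'b::unital_cstar_algebra law \<Rightarrow> bool" where
  "completely_positive \<mu> \<longleftrightarrow>
     (\<forall>m P. mat_positive m (\<lambda>i j. \<mu> (\<Sum>k<m. star (P k i) * P k j)))"

definition exp_bound :: "'b::unital_cstar_algebra law \<Rightarrow> real \<Rightarrow> real \<Rightarrow> bool" where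
  "exp_bound \<mu> M R \<longleftrightarrow>
     (\<forall>b bs. norm (\<mu> (nc_monomial b bs)) \<le> M * R ^ length bs * (norm b * prod_list (map norm bs)))"

text \<open>Complex linearity of a law follows from the bimodule property, as \<open>c \<cdot> p = (c 1) p\<close>.\<close>

definition laws :: "'b::unital_cstar_algebra law set" where
  "laws = {\<mu>. \<mu> 1 = 1 \<and> (\<forall>p q. \<mu> (p + q) = \<mu> p + \<mu> q) \<and>
     (\<forall>a p b. \<mu> (coef a * p * coef b) = a * \<mu> p * b) \<and>
     completely_positive \<mu> \<and> (\<exists>M>0. \<exists>R>0. exp_bound \<mu> M R)}"

definition law_rad :: "'b::unital_cstar_algebra law \<Rightarrow> real" where
  "law_rad \<mu> = Inf {R. R > 0 \<and> (\<exists>M>0. exp_bound \<mu> M R)}"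

definition laws_rad :: "real \<Rightarrow> 'b::unital_cstar_algebra law set" where
  "laws_rad R = {\<mu> \<in> laws. law_rad \<mu> \<le> R}"

definition dil :: "real \<Rightarrow> 'b::unital_cstar_algebra law \<Rightarrow> 'b law" where
  "dil c \<mu> = (\<lambda>p. \<mu> (nc_eval coef (complex_of_real c *\<^sub>C indet) p))"

text \<open>An \<open>(l+1)\<close>-linear map is represented as a function of its first argument and the list of
  its \<open>l\<close> remaining arguments.\<close>

definition Mom :: "'b::unital_cstar_algebra law \<Rightarrow> 'b \<Rightarrow> 'b list \<Rightarrow> 'b" where
  "Mom \<mu> b bs = \<mu> (nc_monomial b bs)"

definition multilinear_norm :: "nat \<Rightarrow> ('b::unital_cstar_algebra \<Rightarrow> 'b list \<Rightarrow> 'b) \<Rightarrow> real" where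
  "multilinear_norm l \<Lambda> =
     Sup {norm (\<Lambda> b bs) |b bs. norm b \<le> 1 \<and> length bs = l \<and> (\<forall>c\<in>set bs. norm c \<le> 1)}"

text \<open>The suprema are over bounded sets as long as \<open>\<mu>, \<nu> \<in> laws_rad R\<close>.\<close>

definition law_dist :: "real \<Rightarrow> 'b::unital_cstar_algebra law \<Rightarrow> 'b law \<Rightarrow> real" where
  "law_dist R \<mu> \<nu> =
     (SUP l\<in>{1..}. multilinear_norm l (\<lambda>b bs. Mom \<mu> b bs - Mom \<nu> b bs) / (2 * R) ^ l)"


section \<open>The space \<open>Func(B,N)\<close>\<close>

text \<open>An \<open>N\<close>-tuple is an extensional function on \<open>{1..N}\<close>.\<close>

abbreviation tuples :: "nat \<Rightarrow> 'a set \<Rightarrow> (nat \<Rightarrow> 'a) set" where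
  "tuples N S \<equiv> {1..N} \<rightarrow>\<^sub>E S"

definition Func_laws :: "nat \<Rightarrow> ((nat \<Rightarrow> 'b::unital_cstar_algebra law) \<Rightarrow> 'b law) set" where
  "Func_laws N = {F \<in> tuples N laws \<rightarrow>\<^sub>E laws.
     (\<forall>\<mu>\<in>tuples N laws. law_rad (F \<mu>) \<le> (\<Sum>i=1..N. law_rad (\<mu> i))) \<and>
     (\<forall>c. \<forall>\<mu>\<in>tuples N laws. F (\<lambda>i\<in>{1..N}. dil c (\<mu> i)) = dil c (F \<mu>)) \<and>
     F ` tuples N (laws_rad 1) \<subseteq> laws_rad (real N) \<and>
     (\<forall>\<epsilon>>0. \<exists>\<delta>>0. \<forall>\<mu>\<in>tuples N (laws_rad 1). \<forall>\<nu>\<in>tuples N (laws_rad 1).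
        (\<forall>i\<in>{1..N}. law_dist 1 (\<mu> i) (\<nu> i) < \<delta>) \<longrightarrow> law_dist (real N) (F \<mu>) (F \<nu>) < \<epsilon>)}"

definition func_dist ::
  "nat \<Rightarrow> ((nat \<Rightarrow> 'b::unital_cstar_algebra law) \<Rightarrow> 'b law) \<Rightarrow> ((nat \<Rightarrow> 'b law) \<Rightarrow> 'b law) \<Rightarrow> real"
where
  "func_dist N F G = (SUP \<mu>\<in>tuples N (laws_rad 1). law_dist (real N) (F \<mu>) (G \<mu>))"


section \<open>Rooted subtrees of the free tree\<close>

definition alternating :: "nat \<Rightarrow> nat list set" where
  "alternating N = {s. set s \<subseteq> {1..N} \<and> distinct_adj s}"

definition free_edges :: "nat \<Rightarrow> (nat list \<times> nat list) set" where
  "free_edges N = {(s, t). s \<in> alternating N \<and> t \<in> alternating N \<and> (\<exists>j. t = j # s \<or> s = j # t)}"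

text \<open>As the ambient graph is a tree, a connected subgraph is the subgraph induced on its
  vertex set.\<close>

definition Tree :: "nat \<Rightarrow> nat list set set" where
  "Tree N = {T. T \<subseteq> alternating N \<and> [] \<in> T \<and> (\<forall>s\<in>T. \<forall>t\<in>T. (s, t) \<in> (free_edges N \<inter> T \<times> T)\<^sup>*)}"

definition tree_ball :: "nat \<Rightarrow> nat list set \<Rightarrow> nat list set" where
  "tree_ball l T = {s \<in> T. length s \<le> l}"

definition tree_dist :: "nat list set \<Rightarrow> nat list set \<Rightarrow> real" where
  "tree_dist T T' =
     (let L = {l. tree_ball l T = tree_ball l T'}
      in if bdd_above L then exp (- real (Sup L)) else 0)"


section \<open>Hilbert modules and correspondences\<close>

text \<open>
  A \<open>B\<close>-\<open>B\<close>-correspondence, or a pre-Hilbert bimodule with a possibly degenerate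
  \<open>B\<close>-valued inner product (linear in the second argument). Scalars and negatives act through
  the right action of \<open>B\<close>.
\<close>

record ('h, 'b) bimod =
  bm_carrier :: "'h set"
  bm_zero :: 'h
  bm_add :: "'h \<Rightarrow> 'h \<Rightarrow> 'h"
  bm_left :: "'b \<Rightarrow> 'h \<Rightarrow> 'h"
  bm_right :: "'h \<Rightarrow> 'b \<Rightarrow> 'h"
  bm_inner :: "'h \<Rightarrow> 'h \<Rightarrow> 'b"

subsection \<open>Separation-completion\<close>

definition bm_dist :: "('v, 'b::unital_cstar_algebra) bimod \<Rightarrow> 'v \<Rightarrow> 'v \<Rightarrow> real" where
  "bm_dist V u v = (let w = bm_add V u (bm_right V v (- 1)) in sqrt (norm (bm_inner V w w)))"

definition bm_Cauchy :: "('v, 'b::unital_cstar_algebra) bimod \<Rightarrow> (nat \<Rightarrow> 'v) set" where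
  "bm_Cauchy V = {f. (\<forall>n. f n \<in> bm_carrier V) \<and>
     (\<forall>\<epsilon>>0. \<exists>K. \<forall>m\<ge>K. \<forall>n\<ge>K. bm_dist V (f m) (f n) < \<epsilon>)}"

type_synonym 'v completion = "(nat \<Rightarrow> 'v) set"

definition cl_class :: "('v, 'b::unital_cstar_algebra) bimod \<Rightarrow> (nat \<Rightarrow> 'v) \<Rightarrow> 'v completion" where
  "cl_class V f = {g \<in> bm_Cauchy V. (\<lambda>n. bm_dist V (f n) (g n)) \<longlonglongrightarrow> 0}"

definition cl_rep :: "'v completion \<Rightarrow> nat \<Rightarrow> 'v" where
  "cl_rep A = (SOME f. f \<in> A)"

definition cl_embed :: "('v, 'b::unital_cstar_algebra) bimod \<Rightarrow> 'v \<Rightarrow> 'v completion" where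
  "cl_embed V v = cl_class V (\<lambda>_. v)"

definition completion :: "('v, 'b::unital_cstar_algebra) bimod \<Rightarrow> ('v completion, 'b) bimod" where
  "completion V =
    \<lparr> bm_carrier = cl_class V ` bm_Cauchy V,
      bm_zero = cl_embed V (bm_zero V),
      bm_add = (\<lambda>A B. cl_class V (\<lambda>n. bm_add V (cl_rep A n) (cl_rep B n))),
      bm_left = (\<lambda>b A. cl_class V (\<lambda>n. bm_left V b (cl_rep A n))),
      bm_right = (\<lambda>A b. cl_class V (\<lambda>n. bm_right V (cl_rep A n) b)),
      bm_inner = (\<lambda>A B. lim (\<lambda>n. bm_inner V (cl_rep A n) (cl_rep B n))) \<rparr>"

text \<open>The continuous extension \<open>completion V \<rightarrow> completion W\<close> of a bounded map \<open>V \<rightarrow> W\<close>.\<close>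

definition cl_extend :: "('w, 'b::unital_cstar_algebra) bimod \<Rightarrow> ('v \<Rightarrow> 'w) \<Rightarrow>
    'v completion \<Rightarrow> 'w completion" where
  "cl_extend W f A = cl_class W (\<lambda>n. f (cl_rep A n))"

subsection \<open>Orthogonal complements, tensor products and direct sums\<close>

definition bm_compl :: "('h, 'b::unital_cstar_algebra) bimod \<Rightarrow> 'h \<Rightarrow> ('h, 'b) bimod" where
  "bm_compl H \<xi> = H\<lparr>bm_carrier := {h \<in> bm_carrier H. bm_inner H h \<xi> = 0}\<rparr>"

text \<open>
  Tensor product over \<open>B\<close> of a list \<open>[H\<^sub>1, \<dots>, H\<^sub>m]\<close> of correspondences. A formal sum of
  elementary tensors is a list of pairs \<open>([h\<^sub>1, \<dots>, h\<^sub>m], b)\<close>, each standing for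
  \<open>h\<^sub>1 \<otimes> \<cdots> \<otimes> h\<^sub>m b\<close>; the inner product is determined by
  \<open>\<langle>h\<^sub>1 \<otimes> \<cdots> \<otimes> h\<^sub>m, k\<^sub>1 \<otimes> \<cdots> \<otimes> k\<^sub>m\<rangle> = \<langle>h\<^sub>m, \<langle>\<dots> \<langle>h\<^sub>2, \<langle>h\<^sub>1, k\<^sub>1\<rangle> k\<^sub>2\<rangle> \<dots>\<rangle> k\<^sub>m\<rangle>\<close>.
  Separation-completion imposes all the bilinearity and \<open>B\<close>-balancing relations, and the empty
  tensor product is \<open>B\<close>, with \<open>([], b)\<close> standing for \<open>b\<close>.
\<close>

type_synonym ('h, 'b) pretensor = "('h list \<times> 'b) list"
type_synonym ('h, 'b) tensor = "('h, 'b) pretensor completion"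

fun elt_inner :: "('h, 'b::unital_cstar_algebra) bimod list \<Rightarrow> 'b \<Rightarrow> 'h list \<Rightarrow> 'h list \<Rightarrow> 'b" where
  "elt_inner (H # Hs) a (h # hs) (k # ks) = elt_inner Hs (bm_inner H h (bm_left H a k)) hs ks"
| "elt_inner _ a _ _ = a"

fun elt_left :: "('h, 'b::unital_cstar_algebra) bimod list \<Rightarrow> 'b \<Rightarrow> 'h list \<times> 'b \<Rightarrow> 'h list \<times> 'b" where
  "elt_left (H # Hs) a (h # hs, b) = (bm_left H a h # hs, b)"
| "elt_left _ a (hs, b) = (hs, a * b)"

definition pretensor :: "('h, 'b::unital_cstar_algebra) bimod list \<Rightarrow> (('h, 'b) pretensor, 'b) bimod"
where
  "pretensor Hs =
    \<lparr> bm_carrier = {u. \<forall>(hs, b)\<in>set u. list_all2 (\<lambda>h H. h \<in> bm_carrier H) hs Hs},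
      bm_zero = [],
      bm_add = (@),
      bm_left = (\<lambda>a. map (elt_left Hs a)),
      bm_right = (\<lambda>u a. map (\<lambda>(hs, b). (hs, b * a)) u),
      bm_inner = (\<lambda>u v. \<Sum>(hs, b)\<leftarrow>u. \<Sum>(ks, c)\<leftarrow>v. star b * elt_inner Hs 1 hs ks * c) \<rparr>"

definition tensor :: "('h, 'b::unital_cstar_algebra) bimod list \<Rightarrow> (('h, 'b) tensor, 'b) bimod" where
  "tensor Hs = completion (pretensor Hs)"

text \<open>The Hilbert module direct sum of a family indexed by \<open>T\<close>.\<close>

definition bm_dsum :: "'i set \<Rightarrow> ('i \<Rightarrow> ('h, 'b::unital_cstar_algebra) bimod) \<Rightarrow> ('i \<Rightarrow> 'h, 'b) bimod"
where
  "bm_dsum T K =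
    \<lparr> bm_carrier = {v \<in> (\<Pi>\<^sub>E s\<in>T. bm_carrier (K s)). (\<lambda>s. bm_inner (K s) (v s) (v s)) summable_on T},
      bm_zero = (\<lambda>s\<in>T. bm_zero (K s)),
      bm_add = (\<lambda>v w. \<lambda>s\<in>T. bm_add (K s) (v s) (w s)),
      bm_left = (\<lambda>b v. \<lambda>s\<in>T. bm_left (K s) b (v s)),
      bm_right = (\<lambda>v b. \<lambda>s\<in>T. bm_right (K s) (v s) b),
      bm_inner = (\<lambda>v w. \<Sum>\<^sub>\<infinity>s\<in>T. bm_inner (K s) (v s) (w s)) \<rparr>"

subsection \<open>Operators on a correspondence and their laws\<close>

definition op_sum :: "('h, 'b) bimod \<Rightarrow> ('h \<Rightarrow> 'h) list \<Rightarrow> 'h \<Rightarrow> 'h" where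
  "op_sum H xs v = foldr (\<lambda>x w. bm_add H (x v) w) xs (bm_zero H)"

primrec op_eval :: "('h, 'b) bimod \<Rightarrow> ('h \<Rightarrow> 'h) \<Rightarrow> 'b ncexp \<Rightarrow> 'h \<Rightarrow> 'h" where
  "op_eval H a (NC_const b) = bm_left H b"
| "op_eval H a NC_var = a"
| "op_eval H a (NC_add p q) = (\<lambda>v. bm_add H (op_eval H a p v) (op_eval H a q v))"
| "op_eval H a (NC_mult p q) = op_eval H a p \<circ> op_eval H a q"

text \<open>The law \<open>p \<mapsto> \<langle>\<xi>, p(a) \<xi>\<rangle>\<close> of a self-adjoint operator \<open>a\<close>, where \<open>p(a)\<close> does not depend on the
  expression representing \<open>p\<close>.\<close>

definition op_law :: "('h, 'b::unital_cstar_algebra) bimod \<Rightarrow> 'h \<Rightarrow> ('h \<Rightarrow> 'h) \<Rightarrow> 'b law" where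
  "op_law H \<xi> a p = bm_inner H \<xi> (op_eval H a (rep_ncpoly p) \<xi>)"


section \<open>\<open>T\<close>-free convolution\<close>

subsection \<open>The \<open>T\<close>-free product of pointed correspondences\<close>

definition word_factors :: "(nat \<Rightarrow> ('h, 'b::unital_cstar_algebra) bimod) \<Rightarrow> (nat \<Rightarrow> 'h) \<Rightarrow> nat list \<Rightarrow>
    ('h, 'b) bimod list" where
  "word_factors H \<xi> s = map (\<lambda>j. bm_compl (H j) (\<xi> j)) s"

definition word_space :: "(nat \<Rightarrow> ('h, 'b::unital_cstar_algebra) bimod) \<Rightarrow> (nat \<Rightarrow> 'h) \<Rightarrow> nat list \<Rightarrow>
    (('h, 'b) tensor, 'b) bimod" where
  "word_space H \<xi> s = tensor (word_factors H \<xi> s)"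

definition tree_space :: "(nat \<Rightarrow> ('h, 'b::unital_cstar_algebra) bimod) \<Rightarrow> (nat \<Rightarrow> 'h) \<Rightarrow>
    nat list set \<Rightarrow> (nat list \<Rightarrow> ('h, 'b) tensor, 'b) bimod" where
  "tree_space H \<xi> T = bm_dsum T (word_space H \<xi>)"

definition vacuum :: "(nat \<Rightarrow> ('h, 'b::unital_cstar_algebra) bimod) \<Rightarrow> (nat \<Rightarrow> 'h) \<Rightarrow>
    nat list set \<Rightarrow> nat list \<Rightarrow> ('h, 'b) tensor" where
  "vacuum H \<xi> T = (\<lambda>s\<in>T. if s = [] then cl_embed (pretensor []) [([], 1)] else bm_zero (word_space H \<xi> s))"

text \<open>\<open>left_factors H \<xi> j s\<close> are the factors of \<open>H\<^sub>j \<otimes> H\<^sub>s\<^sup>\<circ>\<close>, and \<open>left_iso\<close> is the unitary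
  \<open>H\<^sub>s\<^sup>\<circ> \<oplus> H\<^sub>j\<^sub>s\<^sup>\<circ> \<cong> H\<^sub>j \<otimes> H\<^sub>s\<^sup>\<circ>\<close>, \<open>(v, w) \<mapsto> \<xi>\<^sub>j \<otimes> v + w\<close>, where \<open>H\<^sub>j\<^sub>s\<^sup>\<circ> = H\<^sub>j\<^sup>\<circ> \<otimes> H\<^sub>s\<^sup>\<circ>\<close> is included in
  \<open>H\<^sub>j \<otimes> H\<^sub>s\<^sup>\<circ>\<close>.\<close>

definition left_factors :: "(nat \<Rightarrow> ('h, 'b::unital_cstar_algebra) bimod) \<Rightarrow> (nat \<Rightarrow> 'h) \<Rightarrow> nat \<Rightarrow>
    nat list \<Rightarrow> ('h, 'b) bimod list" where
  "left_factors H \<xi> j s = H j # word_factors H \<xi> s"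

definition left_iso :: "(nat \<Rightarrow> ('h, 'b::unital_cstar_algebra) bimod) \<Rightarrow> (nat \<Rightarrow> 'h) \<Rightarrow> nat \<Rightarrow>
    nat list \<Rightarrow> ('h, 'b) tensor \<times> ('h, 'b) tensor \<Rightarrow> ('h, 'b) tensor" where
  "left_iso H \<xi> j s = (\<lambda>(v, w).
     bm_add (tensor (left_factors H \<xi> j s))
       (cl_extend (pretensor (left_factors H \<xi> j s)) (map (\<lambda>(hs, b). (\<xi> j # hs, b))) v)
       (cl_extend (pretensor (left_factors H \<xi> j s)) id w))"

text \<open>\<open>x \<otimes> id\<close> on a tensor product, \<open>x\<close> acting on the first factor.\<close>

definition op_tensor_id :: "('h, 'b::unital_cstar_algebra) bimod list \<Rightarrow> ('h \<Rightarrow> 'h) \<Rightarrow>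
    ('h, 'b) tensor \<Rightarrow> ('h, 'b) tensor" where
  "op_tensor_id Hs x = cl_extend (pretensor Hs) (map (\<lambda>(hs, b). (x (hd hs) # tl hs, b)))"

text \<open>\<open>x \<otimes> id\<close> transported to \<open>H\<^sub>s\<^sup>\<circ> \<oplus> H\<^sub>j\<^sub>s\<^sup>\<circ>\<close>.\<close>

definition pair_action :: "(nat \<Rightarrow> ('h, 'b::unital_cstar_algebra) bimod) \<Rightarrow> (nat \<Rightarrow> 'h) \<Rightarrow> nat \<Rightarrow>
    ('h \<Rightarrow> 'h) \<Rightarrow> nat list \<Rightarrow> ('h, 'b) tensor \<times> ('h, 'b) tensor \<Rightarrow> ('h, 'b) tensor \<times> ('h, 'b) tensor"
where
  "pair_action H \<xi> j x s p =
     inv_into (bm_carrier (word_space H \<xi> s) \<times> bm_carrier (word_space H \<xi> (j # s))) (left_iso H \<xi> j s)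
       (op_tensor_id (left_factors H \<xi> j s) x (left_iso H \<xi> j s p))"

text \<open>The component of \<open>\<lambda>\<^bsub>T,j\<^esub>(x) v\<close> at a string \<open>t = j s\<close> belongs to the block of the pair
  \<open>s, j s\<close>, and at a string \<open>t\<close> not beginning with \<open>j\<close> to the block of the pair \<open>t, j t\<close> if \<open>j t \<in> T\<close>.\<close>

definition tree_rep :: "(nat \<Rightarrow> ('h, 'b::unital_cstar_algebra) bimod) \<Rightarrow> (nat \<Rightarrow> 'h) \<Rightarrow> nat list set \<Rightarrow>
    nat \<Rightarrow> ('h \<Rightarrow> 'h) \<Rightarrow> (nat list \<Rightarrow> ('h, 'b) tensor) \<Rightarrow> nat list \<Rightarrow> ('h, 'b) tensor" where
  "tree_rep H \<xi> T j x v = (\<lambda>t\<in>T.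
     if t \<noteq> [] \<and> hd t = j then snd (pair_action H \<xi> j x (tl t) (v (tl t), v t))
     else if j # t \<in> T then fst (pair_action H \<xi> j x t (v t, v (j # t)))
     else bm_zero (word_space H \<xi> t))"

subsection \<open>The convolution of laws\<close>

definition preL2 :: "'b::unital_cstar_algebra law \<Rightarrow> ('b ncpoly, 'b) bimod" where
  "preL2 \<mu> =
    \<lparr> bm_carrier = UNIV, bm_zero = 0, bm_add = (+),
      bm_left = (\<lambda>b p. coef b * p), bm_right = (\<lambda>p b. p * coef b),
      bm_inner = (\<lambda>p q. \<mu> (star p * q)) \<rparr>"

definition L2 :: "'b::unital_cstar_algebra law \<Rightarrow> ('b ncpoly completion, 'b) bimod" where
  "L2 \<mu> = completion (preL2 \<mu>)"

definition L2_one :: "'b::unital_cstar_algebra law \<Rightarrow> 'b ncpoly completion" where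
  "L2_one \<mu> = cl_embed (preL2 \<mu>) 1"

definition L2_mult_X :: "'b::unital_cstar_algebra law \<Rightarrow> 'b ncpoly completion \<Rightarrow> 'b ncpoly completion"
where
  "L2_mult_X \<mu> = cl_extend (preL2 \<mu>) (\<lambda>p. indet * p)"

definition tree_conv :: "nat \<Rightarrow> nat list set \<Rightarrow> (nat \<Rightarrow> 'b::unital_cstar_algebra law) \<Rightarrow> 'b law" where
  "tree_conv N T = (\<lambda>\<mu>\<in>tuples N laws.
     let H = (\<lambda>j. L2 (\<mu> j)); \<xi> = (\<lambda>j. L2_one (\<mu> j))
     in op_law (tree_space H \<xi> T) (vacuum H \<xi> T)
          (op_sum (tree_space H \<xi> T) (map (\<lambda>j. tree_rep H \<xi> T j (L2_mult_X (\<mu> j))) [1..<Suc N])))"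

end

theory Submission
  imports Defs
begin

text \<open>
  The vacuum vector generates, under \<open>B\<close> and the operators \<open>\<lambda>\<^bsub>T,j\<^esub>(X\<^sub>j)\<close>, only finite sums of elementary
  tensors of centered polynomials, on which these operators act by an explicit formula. All moments of
  \<open>\<boxplus>\<^sub>T(\<mu>)\<close> are therefore computed on formal sums; the completions enter only through the fact that
  the isometry \<open>H\<^sub>s\<^sup>\<circ> \<oplus> H\<^sub>j\<^sub>s\<^sup>\<circ> \<rightarrow> H\<^sub>j \<otimes> H\<^sub>s\<^sup>\<circ>\<close> is injective.

  Positivity of the inner product of a tensor product, and complete positivity of the convolution, reduce
  to writing a positive matrix over \<open>B\<close> as \<open>C\<^sup>* C\<close>, where \<open>C\<close> is given entrywise by the binomial series
  of the square root; no C*-norm on matrices is needed. By log-convexity of \<open>n \<mapsto> norm (X\<^sup>n p)\<close>,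
  multiplication by \<open>X\<close> on \<open>L\<^sup>2(\<mu>)\<close> is bounded by \<open>rad(\<mu>)\<close>, and Paschke's inequality carries this bound to
  \<open>X \<otimes> 1\<close>; this gives the bound on the radius of the convolution and on its moments.

  A moment of order \<open>l\<close> of the convolution involves only words of length at most \<open>l\<close>, hence only \<open>B\<^sub>l(T)\<close>,
  and depends on the laws through finitely many of their moments in a Lipschitz way, while the moments of
  order above \<open>L\<close> contribute at most \<open>2 \<cdot> 2\<^sup>-\<^sup>L\<close> to the distances. Both continuity statements follow.
\<close>

section \<open>Elementary facts on C*-algebras\<close>

text \<open>Formal sums are lists, so most algebraic identities hold for them only weakly, that is,
  under the inner product; separation turns weak equations into equalities in the completions.
  \<open>formal_eval\<close> respects \<open>nceq\<close> in this sense because each expression has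
  its starred expression as adjoint, and so the representative chosen by \<open>rep_ncpoly\<close>
  is harmless.

  A matrix over B is positive as a form on columns exactly when it factors. Forms are what can be
  verified; factors are what can be inserted between tensor legs. The order on B itself is derived
  from the same root series instead of from spectra, so that both levels rest on one absolutely
  convergent series.

  Laws of radius at most R have moments of order l bounded by R^l on unit arguments, so the weight
  (2R)^l in the metric leaves at most 2 (1/2)^l for each order. Below the cut the Lipschitz
  constants must be uniform over all arguments in the unit ball; this is why the computation of a
  moment is followed through families whose words and monomials are fixed and whose coefficients
  vary.\<close>

context star_algebra_1
begin

lemma star_minus: "star (- x) = - star x"
  using star_add[of "- x" x] by (simp add: star_zero eq_neg_iff_add_eq_0)

lemma star_diff: "star (x - y) = star x - star y"
  using star_add[of x "- y"] by (simp add: star_minus)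

lemma star_sum: "star (sum f A) = (\<Sum>i\<in>A. star (f i))"
  by (induction A rule: infinite_finite_induct) (simp_all add: star_zero star_add)

lemma star_sum_list: "star (sum_list xs) = sum_list (map star xs)"
  by (induction xs) (simp_all add: star_zero star_add)

lemma star_power: "star (x ^ n) = star x ^ n"
  by (induction n) (simp_all add: star_one star_mult power_commutes)

lemma scaleC_zero_right: "c *\<^sub>C 0 = 0"
  using scaleC_add_right[of c 0 0] by simp

lemma scaleC_minus_right: "c *\<^sub>C (- x) = - (c *\<^sub>C x)"
  using scaleC_add_right[of c "- x" x] by (simp add: scaleC_zero_right eq_neg_iff_add_eq_0)

lemma scaleC_minus_left: "(- c) *\<^sub>C x = - (c *\<^sub>C x)"
  using scaleC_add_left[of "- c" c x] by (simp add: scaleC_zero_left eq_neg_iff_add_eq_0)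

lemma scaleC_diff_right: "c *\<^sub>C (x - y) = c *\<^sub>C x - c *\<^sub>C y"
  using scaleC_add_right[of c x "- y"] by (simp add: scaleC_minus_right)

end

lemma star_scaleR: "star (r *\<^sub>R x) = r *\<^sub>R star (x :: 'b::unital_cstar_algebra)"
  by (simp add: scaleR_eq_scaleC star_scaleC)

lemma norm_star: "norm (star x) = norm (x :: 'b::unital_cstar_algebra)"
proof -
  have le: "norm x \<le> norm (star x)" for x :: 'b
  proof (cases "norm x = 0")
    case False
    have "norm x * norm x \<le> norm (star x) * norm x"
      using norm_mult_ineq[of "star x" x] by (simp add: cstar_identity power2_eq_square)
    then show ?thesis using False by (metis mult_le_cancel_right norm_ge_zero not_le order_le_less)
  qed simp
  show ?thesis using le[of x] le[of "star x"] by (simp add: star_star)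
qed

text \<open>The class makes the norm homogeneous for real scalars only; the C*-identity produces the
  real scalar \<open>(cmod c)\<^sup>2\<close> and so settles complex ones.\<close>

lemma norm_scaleC: "norm (c *\<^sub>C x) = cmod c * norm (x :: 'b::unital_cstar_algebra)"
proof -
  have "(norm (c *\<^sub>C x))\<^sup>2 = norm ((cnj c * c) *\<^sub>C (star x * x))"
    unfolding cstar_identity[symmetric]
    by (simp add: star_scaleC mult_scaleC_left mult_scaleC_right scaleC_scaleC mult.commute)
  also have "(cnj c * c) *\<^sub>C (star x * x) = (cmod c)\<^sup>2 *\<^sub>R (star x * x)"
    unfolding scaleR_eq_scaleC by (metis complex_norm_square mult.commute)
  also have "norm \<dots> = (cmod c * norm x)\<^sup>2"
    by (simp add: cstar_identity power_mult_distrib)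
  finally show ?thesis by (rule power2_eq_imp_eq) simp_all
qed

lemma tendsto_star [tendsto_intros]:
  fixes f :: "'x \<Rightarrow> 'b::unital_cstar_algebra"
  assumes "(f \<longlongrightarrow> a) F"
  shows "((\<lambda>x. star (f x)) \<longlongrightarrow> star a) F"
  using assms unfolding tendsto_dist_iff[of f] tendsto_dist_iff[of "\<lambda>x. star (f x)"] dist_norm
  by (simp add: star_diff[symmetric] norm_star)

lemma tendsto_scaleC [tendsto_intros]:
  fixes f :: "'x \<Rightarrow> 'b::unital_cstar_algebra"
  assumes "(f \<longlongrightarrow> a) F"
  shows "((\<lambda>x. c *\<^sub>C f x) \<longlongrightarrow> c *\<^sub>C a) F"
proof -
  have "((\<lambda>x. cmod c * norm (f x - a)) \<longlongrightarrow> cmod c * 0) F"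
    by (intro tendsto_mult tendsto_const) (use assms in \<open>simp add: tendsto_dist_iff[of f] dist_norm\<close>)
  then show ?thesis
    unfolding tendsto_dist_iff[of "\<lambda>x. c *\<^sub>C f x"] dist_norm
    by (simp add: scaleC_diff_right[symmetric] norm_scaleC)
qed

lemma star_of_real: "star (of_real r :: 'b::unital_cstar_algebra) = of_real r"
  by (simp add: of_real_def star_scaleR star_one)

lemma norm_unitary:
  fixes u :: "'b::unital_cstar_algebra"
  assumes "star u * u = 1" shows "norm u = 1"
  using cstar_identity[of u] assms by (simp add: power2_eq_1_iff) (metis norm_ge_zero not_one_le_zero
      neg_0_le_iff_le)

section \<open>Positivity\<close>

subsection \<open>The square root series\<close>

text \<open>The coefficients of the binomial series of the square root of 1 - y.\<close>

definition sqrt_coef :: "nat \<Rightarrow> real" where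
  "sqrt_coef n = (1/2 gchoose n) * (- 1) ^ n"

lemma sqrt_coef_0 [simp]: "sqrt_coef 0 = 1"
  by (simp add: sqrt_coef_def)

lemma sqrt_coef_Suc: "(real n + 1) * sqrt_coef (Suc n) = (real n - 1/2) * sqrt_coef n"
proof -
  have "(real n + 1) * (1/2 gchoose Suc n) = (1/2 - real n) * (1/2 gchoose n)"
    using gbinomial_mult_1[of "1/2 :: real" n] by (simp add: algebra_simps)
  then have "(real n + 1) * (1/2 gchoose Suc n) * (- 1) ^ Suc n = (1/2 - real n) * (1/2 gchoose n) * (- 1) ^ Suc n"
    by simp
  then show ?thesis by (simp add: sqrt_coef_def algebra_simps)
qed

text \<open>The recursion telescopes. Together with \<open>sqrt_coef_neg\<close> this shows the
  partial sums to be nonnegative without a limit theorem at y = 1.\<close>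

lemma sqrt_coef_sum: "(\<Sum>k\<le>n. sqrt_coef k) = - 2 * (real n + 1) * sqrt_coef (Suc n)"
proof (induction n)
  case 0
  show ?case using sqrt_coef_Suc[of 0] by simp
next
  case (Suc n)
  then show ?case using sqrt_coef_Suc[of "Suc n"] by (simp add: algebra_simps)
qed

lemma sqrt_coef_neg: "sqrt_coef (Suc n) < 0"
proof (induction n)
  case 0
  show ?case using sqrt_coef_Suc[of 0] by simp
next
  case (Suc n)
  have "(real (Suc n) + 1) * sqrt_coef (Suc (Suc n)) < 0"
    unfolding sqrt_coef_Suc by (rule mult_pos_neg) (use Suc in auto)
  then show ?case by (simp add: mult_less_0_iff)
qed

text \<open>Only the coefficient of order 0 is positive, so the absolute values sum to 2 minus a
  partial sum. The bound makes the series converge on the closed unit ball, boundary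
  included.\<close>

lemma sum_abs_sqrt_coef: "(\<Sum>k\<le>n. \<bar>sqrt_coef k\<bar>) \<le> 2"
proof -
  have "(\<Sum>k\<le>n. \<bar>sqrt_coef k\<bar>) = 2 - (\<Sum>k\<le>n. sqrt_coef k)" for n
    by (induction n) (use sqrt_coef_neg in \<open>auto simp: less_imp_le abs_of_neg\<close>)
  moreover have "(\<Sum>k\<le>n. sqrt_coef k) \<ge> 0"
    unfolding sqrt_coef_sum using sqrt_coef_neg[of n] by (intro mult_nonpos_nonpos) auto
  ultimately show ?thesis by simp
qed

lemma summable_sqrt_coef: "summable (\<lambda>n. \<bar>sqrt_coef n\<bar>)"
  using sum_abs_sqrt_coef by (intro bounded_imp_summable) auto

text \<open>Vandermonde's identity at 1/2 + 1/2 = 1: the square of the series is 1 - y.\<close>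

lemma sqrt_coef_convolution:
  "(\<Sum>i\<le>n. sqrt_coef i * sqrt_coef (n - i)) = (if n = 0 then 1 else if n = 1 then - 1 else 0)"
proof -
  have "(\<Sum>i\<le>n. sqrt_coef i * sqrt_coef (n - i)) =
      (\<Sum>i\<le>n. (1/2 gchoose i) * (1/2 gchoose (n - i)) * (- 1 :: real) ^ n)"
    by (intro sum.cong) (auto simp: sqrt_coef_def power_add[symmetric])
  also have "\<dots> = (1 gchoose n) * (- 1) ^ n"
    using gbinomial_Vandermonde[of "1/2 :: real" "1/2" n]
    by (simp add: sum_distrib_right[symmetric] atMost_atLeast0)
  also have "(1 gchoose n :: real) = of_nat (1 choose n)"
    using binomial_gbinomial[of 1 n, where 'a = real] by simp
  also have "of_nat (1 choose n) * (- 1) ^ n = (if n = 0 then 1 else if n = 1 then - 1 else (0::real))"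
    by (auto simp: binomial_eq_0)
  finally show ?thesis .
qed

definition sqrt_series :: "'b::unital_cstar_algebra \<Rightarrow> 'b" where
  "sqrt_series y = (\<Sum>n. sqrt_coef n *\<^sub>R y ^ n)"

context
  fixes y :: "'b::unital_cstar_algebra"
  assumes y: "norm y \<le> 1"
begin

lemma summable_norm_sqrt_series: "summable (\<lambda>n. norm (sqrt_coef n *\<^sub>R y ^ n))"
proof (rule summable_comparison_test'[OF summable_sqrt_coef])
  fix n
  have "norm (y ^ n) \<le> 1"
    using norm_power_ineq[of y n] power_le_one[OF norm_ge_zero y, of n] by linarith
  then show "norm (norm (sqrt_coef n *\<^sub>R y ^ n)) \<le> \<bar>sqrt_coef n\<bar>"
    by (simp add: mult_left_le)
qed

lemma sqrt_series_sums: "(\<lambda>n. sqrt_coef n *\<^sub>R y ^ n) sums sqrt_series y"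
  unfolding sqrt_series_def by (rule summable_sums[OF summable_norm_cancel[OF summable_norm_sqrt_series]])

lemma sqrt_series_square: "sqrt_series y * sqrt_series y = 1 - y"
proof -
  have "(\<lambda>k. \<Sum>i\<le>k. (sqrt_coef i *\<^sub>R y ^ i) * (sqrt_coef (k - i) *\<^sub>R y ^ (k - i)))
      sums (sqrt_series y * sqrt_series y)"
    unfolding sqrt_series_def by (rule Cauchy_product_sums) (rule summable_norm_sqrt_series)+
  also have "(\<lambda>k. \<Sum>i\<le>k. (sqrt_coef i *\<^sub>R y ^ i) * (sqrt_coef (k - i) *\<^sub>R y ^ (k - i))) =
      (\<lambda>k. (\<Sum>i\<le>k. sqrt_coef i * sqrt_coef (k - i)) *\<^sub>R y ^ k)"
    by (auto simp: scaleR_sum_left power_add[symmetric] intro!: sum.cong)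
  also have "\<dots> = (\<lambda>k. if k \<in> {0, 1} then (if k = 0 then 1 else - y) else 0)"
    unfolding sqrt_coef_convolution by auto
  finally have "(\<lambda>k. if k \<in> {0, 1} then (if k = 0 then 1 else - y) else 0)
      sums (sqrt_series y * sqrt_series y)" .
  moreover have "(\<lambda>k::nat. if k \<in> {0, 1} then (if k = 0 then 1 else - y) else 0)
      sums (\<Sum>k\<in>{0, 1::nat}. if k = 0 then 1 else - y)"
    by (rule sums_If_finite_set) simp
  ultimately show ?thesis using sums_unique2 by fastforce
qed

lemma sqrt_series_commute:
  assumes "z * y = y * z" shows "z * sqrt_series y = sqrt_series y * z"
proof -
  have "(\<lambda>n. z * (sqrt_coef n *\<^sub>R y ^ n)) = (\<lambda>n. (sqrt_coef n *\<^sub>R y ^ n) * z)"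
    using power_commuting_commutes[of y z] assms by (auto simp: fun_eq_iff)
  then show ?thesis
    using sums_mult[OF sqrt_series_sums, of z] sums_mult2[OF sqrt_series_sums, of z] sums_unique2 by metis
qed

text \<open>Without the term of order 0 the absolute values of the coefficients sum to at most 1.
  This lets the root satisfy the norm criterion of positivity in its turn.\<close>

lemma norm_one_minus_sqrt_series: "norm (1 - sqrt_series y) \<le> 1"
proof (rule Lim_norm_ubound)
  show "(\<lambda>n. 1 - (\<Sum>i<Suc n. sqrt_coef i *\<^sub>R y ^ i)) \<longlonglongrightarrow> 1 - sqrt_series y"
    using sqrt_series_sums by (intro tendsto_intros LIMSEQ_Suc) (simp add: sums_def)
  have "norm (1 - (\<Sum>i<Suc n. sqrt_coef i *\<^sub>R y ^ i)) \<le> (\<Sum>i\<le>n. \<bar>sqrt_coef i\<bar>) - 1" for n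
  proof -
    have "1 - (\<Sum>i<Suc n. sqrt_coef i *\<^sub>R y ^ i) = - (\<Sum>i<n. sqrt_coef (Suc i) *\<^sub>R y ^ Suc i)"
      by (subst sum.lessThan_Suc_shift) simp
    also have "norm \<dots> \<le> (\<Sum>i<n. norm (sqrt_coef (Suc i) *\<^sub>R y ^ Suc i))"
      using norm_sum by (simp only: norm_minus_cancel)
    also have "\<dots> \<le> (\<Sum>i<n. \<bar>sqrt_coef (Suc i)\<bar>)"
    proof (rule sum_mono)
      fix i
      have "norm (y ^ Suc i) \<le> 1"
        using norm_power_ineq[of y "Suc i"] power_le_one[OF norm_ge_zero y, of "Suc i"] by linarith
      then show "norm (sqrt_coef (Suc i) *\<^sub>R y ^ Suc i) \<le> \<bar>sqrt_coef (Suc i)\<bar>"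
        by (simp add: mult_left_le del: power_Suc)
    qed
    also have "\<dots> = (\<Sum>i<Suc n. \<bar>sqrt_coef i\<bar>) - 1"
      by (simp add: sum.lessThan_Suc_shift[of "\<lambda>i. \<bar>sqrt_coef i\<bar>"] del: sum.lessThan_Suc)
    finally show ?thesis by (simp only: lessThan_Suc_atMost)
  qed
  then show "eventually (\<lambda>n. norm (1 - (\<Sum>i<Suc n. sqrt_coef i *\<^sub>R y ^ i)) \<le> 1) sequentially"
    using sum_abs_sqrt_coef by (intro always_eventually) (smt (verit))
qed simp

lemma sqrt_series_selfadj:
  assumes "star y = y" shows "star (sqrt_series y) = sqrt_series y"
proof -
  have "(\<lambda>n. \<Sum>i<n. sqrt_coef i *\<^sub>R y ^ i) \<longlonglongrightarrow> sqrt_series y"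
    using sqrt_series_sums by (simp add: sums_def)
  moreover have "(\<lambda>n. star (\<Sum>i<n. sqrt_coef i *\<^sub>R y ^ i)) = (\<lambda>n. \<Sum>i<n. sqrt_coef i *\<^sub>R y ^ i)"
    using assms by (simp add: star_sum star_scaleR star_power)
  ultimately show ?thesis using tendsto_star LIMSEQ_unique by metis
qed

end

subsection \<open>Positivity in terms of the norm\<close>

text \<open>The criterion \<open>norm (t - a) \<le> t\<close> makes sums of positive elements positive; that it is the
  same as being of the form \<open>y\<^sup>* y\<close> is Fukamaya's theorem, \<open>cpos_iff_norm_positive\<close> below.\<close>

definition norm_positive :: "'b::unital_cstar_algebra \<Rightarrow> bool" where
  "norm_positive a \<longleftrightarrow> star a = a \<and> (\<exists>t\<ge>0. norm (of_real t - a) \<le> t)"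

text \<open>The criterion says that a = t (1 - y) with y in the unit ball, so the series gives a
  root. It is a limit of polynomials in a and therefore commutes with whatever commutes with a; as
  it is again positive, roots of roots can be taken.\<close>

lemma norm_positiveD:
  fixes a :: "'b::unital_cstar_algebra"
  assumes "norm_positive a"
  obtains s where "star s = s" "s * s = a" "\<And>z. z * a = a * z \<Longrightarrow> z * s = s * z" "norm_positive s"
proof -
  obtain t where t: "t \<ge> 0" "norm (of_real t - a) \<le> t" and sa: "star a = a"
    using assms by (auto simp: norm_positive_def)
  show thesis
  proof (cases "t = 0")
    case True
    then have "a = 0" using t by simp
    then show ?thesis by (intro that[of 0]) (auto simp: star_zero norm_positive_def)
  next
    case False
    define y where "y = (1 / t) *\<^sub>R (of_real t - a)"
    have y1: "norm y \<le> 1" using t False by (simp add: y_def divide_le_eq)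
    have ysa: "star y = y" by (simp add: y_def star_scaleR star_diff star_of_real sa)
    have ya: "1 - y = (1 / t) *\<^sub>R a"
      using False by (simp add: y_def algebra_simps of_real_def)
    define s where "s = sqrt t *\<^sub>R sqrt_series y"
    have "s * s = a"
      using t False sqrt_series_square[OF y1] ya by (simp add: s_def)
    moreover have "star s = s"
      by (simp add: s_def star_scaleR sqrt_series_selfadj[OF y1 ysa])
    moreover have "z * s = s * z" if "z * a = a * z" for z
    proof -
      have "z * y = y * z" using that by (simp add: y_def algebra_simps of_real_def)
      from sqrt_series_commute[OF y1 this] show ?thesis by (simp add: s_def)
    qed
    moreover have "norm_positive s"
      unfolding norm_positive_def
    proof (intro conjI exI[of _ "sqrt t"])
      have "of_real (sqrt t) - s = sqrt t *\<^sub>R (1 - sqrt_series y)"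
        by (simp add: s_def algebra_simps of_real_def)
      then show "norm (of_real (sqrt t) - s) \<le> sqrt t"
        using norm_one_minus_sqrt_series[OF y1] t by (simp add: mult_left_le)
    qed (use t \<open>star s = s\<close> in auto)
    ultimately show ?thesis by (intro that)
  qed
qed

text \<open>The element u = a + i b satisfies \<open>star u * u = 1\<close>, hence has norm one, and
  a is its real part.\<close>

lemma norm_le_1_of_squares:
  fixes a b :: "'b::unital_cstar_algebra"
  assumes "star a = a" "star b = b" "a * b = b * a" "a * a + b * b = 1"
  shows "norm a \<le> 1"
proof -
  define u where "u = a + \<i> *\<^sub>C b"
  have us: "star u = a - \<i> *\<^sub>C b"
    by (simp add: u_def star_add star_scaleC assms scaleC_minus_left)
  have "star u * u = a * a + b * b"
    unfolding us by (simp add: u_def algebra_simps mult_scaleC_left mult_scaleC_right scaleC_diff_right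
        scaleC_scaleC scaleC_minus_left scaleC_one assms(3))
  then have "norm u = 1" using norm_unitary assms(4) by simp
  moreover have "2 *\<^sub>R a = u + star u" unfolding us by (simp add: u_def scaleR_2)
  then have "2 * norm a \<le> norm u + norm (star u)"
    by (metis norm_triangle_ineq norm_scaleR abs_numeral)
  ultimately show ?thesis by (simp add: norm_star)
qed

text \<open>With b the root of 1 - a^2, the pair a, b satisfies \<open>norm_le_1_of_squares\<close>
  in either order. So b too has norm at most 1, and 1 - a^2 is its square.\<close>

lemma norm_one_minus_square:
  fixes a :: "'b::unital_cstar_algebra"
  assumes "star a = a" "norm a \<le> 1"
  shows "norm (1 - a * a) \<le> 1"
proof -
  have "norm (a * a) \<le> 1"
    using norm_mult_ineq[of a a] assms(2) mult_mono[OF assms(2) assms(2)] by simp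
  note s = sqrt_series_square[OF this] sqrt_series_commute[OF this, of a]
    sqrt_series_selfadj[OF this]
  define b where "b = sqrt_series (a * a)"
  have b: "b * b = 1 - a * a" "a * b = b * a" "star b = b"
    using s assms by (auto simp: b_def star_mult mult.assoc)
  have "norm b \<le> 1"
    by (rule norm_le_1_of_squares[of b a]) (use b assms in auto)
  then show ?thesis
    unfolding b(1)[symmetric] using norm_mult_ineq[of b b] mult_mono[of "norm b" 1 "norm b" 1] by simp
qed

lemma norm_square_selfadj:
  fixes a :: "'b::unital_cstar_algebra"
  assumes "star a = a" shows "norm (a * a) = (norm a)\<^sup>2"
  using cstar_identity[of a] assms by simp

text \<open>Rescaling to norm one reduces this to \<open>norm_one_minus_square\<close>; the norm of
  the square itself serves as witness t.\<close>

lemma norm_positive_square: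
  fixes a :: "'b::unital_cstar_algebra"
  assumes "star a = a"
  shows "norm_positive (a * a)" "norm (of_real (norm (a * a)) - a * a) \<le> norm (a * a)"
proof -
  show *: "norm (of_real (norm (a * a)) - a * a) \<le> norm (a * a)"
  proof (cases "a = 0")
    case False
    define c where "c = (1 / norm a) *\<^sub>R a"
    have "norm (1 - c * c) \<le> 1"
      by (rule norm_one_minus_square) (use False assms in \<open>auto simp: c_def star_scaleR\<close>)
    then have "norm ((norm a)\<^sup>2 *\<^sub>R (1 - c * c)) \<le> (norm a)\<^sup>2"
      by (simp add: mult_left_le)
    moreover have "(norm a)\<^sup>2 *\<^sub>R (1 - c * c) = of_real (norm (a * a)) - a * a"
      using False by (simp add: c_def norm_square_selfadj[OF assms] algebra_simps of_real_def power2_eq_square)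
    ultimately show ?thesis by (simp add: norm_square_selfadj[OF assms])
  qed simp
  show "norm_positive (a * a)"
    using * assms by (auto simp: norm_positive_def star_mult intro!: exI[of _ "norm (a * a)"])
qed

text \<open>Every positive element is the square of a self-adjoint one, so the witness t can always
  be the norm. In this form the criterion survives limits.\<close>

lemma norm_positive_norm:
  assumes "norm_positive a" shows "norm (of_real (norm a) - a) \<le> norm a"
  using norm_positiveD[OF assms] norm_positive_square(2) by metis

lemma norm_positive_add:
  assumes "norm_positive a" "norm_positive b" shows "norm_positive (a + b)"
proof -
  obtain t r where "t \<ge> 0" "norm (of_real t - a) \<le> t" "r \<ge> 0" "norm (of_real r - b) \<le> r"
    using assms by (auto simp: norm_positive_def)
  moreover have "norm (of_real (t + r) - (a + b)) \<le> norm (of_real t - a) + norm (of_real r - b)"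
    using norm_triangle_ineq[of "of_real t - a" "of_real r - b"] by (simp add: algebra_simps)
  ultimately show ?thesis
    using assms by (auto simp: norm_positive_def star_add intro!: exI[of _ "t + r"])
qed

lemma norm_positive_scaleR:
  assumes "norm_positive a" "r \<ge> 0" shows "norm_positive (r *\<^sub>R a)"
proof -
  obtain s where "star s = s" "s * s = a" using norm_positiveD[OF assms(1)] by metis
  then have "r *\<^sub>R a = (sqrt r *\<^sub>R s) * (sqrt r *\<^sub>R s)" "star (sqrt r *\<^sub>R s) = sqrt r *\<^sub>R s"
    using assms(2) by (auto simp: star_scaleR)
  then show ?thesis using norm_positive_square(1) by metis
qed

lemma norm_positive_norm_diff:
  fixes a :: "'b::unital_cstar_algebra"
  assumes "star a = a" shows "norm_positive (of_real (norm a) - a)"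
  using assms by (auto simp: norm_positive_def star_diff star_of_real intro!: exI[of _ "norm a"])

text \<open>After division by q > r, both a / q and 1 - a / q have roots; these commute and their
  squares sum to 1. The strict inequality leaves a nonzero divisor when r = 0.\<close>

lemma norm_le_of_norm_positive:
  fixes a :: "'b::unital_cstar_algebra"
  assumes a: "norm_positive a" and ra: "norm_positive (of_real r - a)" and r: "r \<ge> 0"
  shows "norm a \<le> r"
proof -
  have *: "norm a \<le> q" if q: "q > r" for q
  proof -
    have q0: "q > 0" using q r by simp
    have "norm_positive (of_real (q - r) :: 'b)"
      using norm_positive_scaleR[OF norm_positive_square(1)[OF star_one], of "q - r"] q
      by (simp add: of_real_def)
    from norm_positive_add[OF ra this] have "norm_positive (of_real q - a)" by simp
    from norm_positive_scaleR[OF this, of "1/q"]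
    have 2: "norm_positive (1 - (1/q) *\<^sub>R a)" using q0 by (simp add: algebra_simps of_real_def)
    have 1: "norm_positive ((1/q) *\<^sub>R a)" using norm_positive_scaleR[OF a, of "1/q"] q0 by simp
    obtain s where s: "star s = s" "s * s = (1/q) *\<^sub>R a"
      "\<And>z. z * ((1/q) *\<^sub>R a) = (1/q) *\<^sub>R a * z \<Longrightarrow> z * s = s * z"
      using norm_positiveD[OF 1] by metis
    obtain c where c: "star c = c" "c * c = 1 - (1/q) *\<^sub>R a"
      "\<And>z. z * (1 - (1/q) *\<^sub>R a) = (1 - (1/q) *\<^sub>R a) * z \<Longrightarrow> z * c = c * z"
      using norm_positiveD[OF 2] by metis
    have "s * (1 - (1/q) *\<^sub>R a) = (1 - (1/q) *\<^sub>R a) * s"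
      unfolding s(2)[symmetric] by (simp add: algebra_simps)
    from norm_le_1_of_squares[OF s(1) c(1) c(3)[OF this]] have "norm s \<le> 1"
      by (simp add: s(2) c(2))
    then have "norm (s * s) \<le> 1"
      using norm_mult_ineq[of s s] mult_mono[of "norm s" 1 "norm s" 1] by simp
    then show ?thesis unfolding s(2) using q0 by (simp add: divide_le_eq)
  qed
  show ?thesis by (rule dense_ge) (use * in auto)
qed

subsection \<open>Fukamaya's theorem\<close>

text \<open>This replaces the comparison of the spectra of \<open>star y * y\<close> and
  \<open>y * star y\<close>. With k the negative of \<open>star y * y\<close>, the identity
  \<open>(1 + k) ^ n * star y = star y * (1 - y * star y) ^ n\<close> keeps
  \<open>(1 + k) ^ n * k\<close> bounded, whereas the powers of 1 + k grow geometrically in norm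
  unless k = 0.\<close>

lemma star_mult_self_eq_0:
  fixes y :: "'b::unital_cstar_algebra"
  assumes k: "norm_positive (- (star y * y))" and h: "norm_positive (y * star y)"
  shows "y = 0"
proof -
  have 1: "y = 0" if k: "norm_positive (- (star y * y))" and h: "norm_positive (y * star y)"
    and y1: "norm y \<le> 1" for y :: 'b
  proof (rule ccontr)
    assume y0: "y \<noteq> 0"
    define k where "k = - (star y * y)"
    define \<rho> where "\<rho> = norm (1 + k)"
    have kk: "norm_positive k" using k by (simp add: k_def)
    \<comment> \<open>Otherwise t = 1 witnesses positivity of - k, which together with positivity of
      k forces k = 0.\<close>
    have \<rho>: "\<rho> > 1"
    proof (rule ccontr)
      assume "\<not> \<rho> > 1"
      moreover have "star (- k) = - k" by (simp add: k_def star_mult star_star)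
      ultimately have "norm_positive (- k)"
        unfolding norm_positive_def by (intro conjI exI[of _ 1]) (auto simp: \<rho>_def)
      then have "norm k \<le> 0" using norm_le_of_norm_positive[OF kk, of 0] by simp
      then show False using y0 cstar_identity[of y] by (simp add: k_def)
    qed
    have ysy: "norm (y * star y) \<le> 1"
      using norm_mult_ineq[of y "star y"] y1 mult_mono[of "norm y" 1 "norm y" 1]
      by (simp add: norm_star)
    have h1: "norm (1 - y * star y) \<le> 1"
    proof -
      obtain s where s: "star s = s" "s * s = y * star y" using norm_positiveD[OF h] by metis
      then have "norm s \<le> 1" using ysy norm_square_selfadj[of s]
        by (simp add: power_le_one_iff abs_square_le_1)
      then show ?thesis using norm_one_minus_square[of s] s by simp
    qed
    have pow: "(1 + k) ^ n * star y = star y * (1 - y * star y) ^ n" for n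
    proof (induction n)
      case (Suc n)
      have "(1 + k) ^ Suc n * star y = (1 + k) * (star y * (1 - y * star y) ^ n)"
        using Suc by (simp add: mult.assoc)
      also have "\<dots> = star y * ((1 - y * star y) * (1 - y * star y) ^ n)"
        by (simp add: k_def algebra_simps)
      finally show ?case by simp
    qed simp
    have le1: "norm ((1 + k) ^ n * k) \<le> 1" for n
    proof -
      have "norm ((1 + k) ^ n * k) = norm (star y * (1 - y * star y) ^ n * y)"
        by (simp add: k_def pow[symmetric] mult.assoc)
      also have "\<dots> \<le> norm (star y) * norm ((1 - y * star y) ^ n) * norm y"
        by (meson mult_right_mono norm_ge_zero norm_mult_ineq order_trans)
      also have "\<dots> \<le> 1 * 1 * 1"
        using y1 norm_power_ineq[of "1 - y * star y" n] power_le_one[OF norm_ge_zero h1, of n]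
        by (intro mult_mono) (auto simp: norm_star)
      finally show ?thesis by simp
    qed
    have sa: "star (1 + k) = 1 + k" by (simp add: k_def star_diff star_one star_mult star_star)
    have pow2: "norm ((1 + k) ^ (2 ^ m)) = \<rho> ^ (2 ^ m)" for m
    proof (induction m)
      case (Suc m)
      have "(1 + k) ^ (2 ^ Suc m) = (1 + k) ^ (2 ^ m) * (1 + k) ^ (2 ^ m)"
        by (simp add: power_add[symmetric] mult_2)
      also have "norm \<dots> = (norm ((1 + k) ^ (2 ^ m)))\<^sup>2"
        by (rule norm_square_selfadj) (simp add: star_power sa)
      finally show ?case using Suc by (simp add: power_mult[symmetric] mult.commute)
    qed (simp add: \<rho>_def)
    obtain m where m: "1 / (\<rho> - 1) + 1 < \<rho> ^ m" using real_arch_pow[OF \<rho>] by blast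
    \<comment> \<open>The norm of a power of 1 + k is known exactly only for exponents that are
      powers of 2, so n + 1 is one of them; the estimate then compares the powers n + 1 and
      n.\<close>
    define n where "n = (2::nat) ^ Suc m - 1"
    have n: "Suc n = 2 ^ Suc m" "m \<le> n"
      using less_exp[of "Suc m"] by (auto simp: n_def)
    have "\<rho> ^ Suc n = norm ((1 + k) ^ Suc n)" unfolding n pow2 ..
    also have "(1 + k) ^ Suc n = (1 + k) ^ n * k + (1 + k) ^ n" unfolding power_Suc2 by (simp add: algebra_simps)
    also have "norm \<dots> \<le> 1 + \<rho> ^ n"
      using norm_triangle_ineq[of "(1 + k) ^ n * k" "(1 + k) ^ n"] le1[of n] norm_power_ineq[of "1 + k" n]
      by (simp add: \<rho>_def)
    finally have "\<rho> ^ n * (\<rho> - 1) \<le> 1" by (simp add: algebra_simps)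
    then have "\<rho> ^ n \<le> 1 / (\<rho> - 1)" using \<rho> by (simp add: field_simps)
    moreover have "\<rho> ^ m \<le> \<rho> ^ n" using n \<rho> by (simp add: power_increasing)
    ultimately show False using m by simp
  qed
  show ?thesis
  proof (rule ccontr)
    assume y0: "y \<noteq> 0"
    define r where "r = 1 / norm y"
    have "norm_positive (r\<^sup>2 *\<^sub>R - (star y * y))" "norm_positive (r\<^sup>2 *\<^sub>R (y * star y))"
      using k h by (auto intro!: norm_positive_scaleR simp del: scaleR_minus_right)
    then have "r *\<^sub>R y = 0"
      by (intro 1) (use y0 in \<open>simp_all add: star_scaleR power2_eq_square r_def\<close>)
    then show False using y0 by (simp add: r_def)
  qed
qed

text \<open>Let a = \<open>star x * x\<close>, let p be the root of a^2 and w = p - a, twice the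
  negative part of a. For y = x w the element \<open>star y * y\<close> = w a w = - w p w is
  negative while \<open>y * star y\<close> is positive. Hence y = 0, then w = 0, and a = p is
  positive.\<close>

lemma norm_positive_star_mult:
  fixes x :: "'b::unital_cstar_algebra"
  shows "norm_positive (star x * x)"
proof -
  define a where "a = star x * x"
  have sa: "star a = a" by (simp add: a_def star_mult star_star)
  obtain p where p: "star p = p" "p * p = a * a" "\<And>z. z * (a * a) = a * a * z \<Longrightarrow> z * p = p * z"
    "norm_positive p"
    using norm_positiveD[OF norm_positive_square(1)[OF sa]] by metis
  obtain q where q: "star q = q" "q * q = p" "\<And>z. z * p = p * z \<Longrightarrow> z * q = q * z"
    using norm_positiveD[OF p(4)] by metis
  have pa: "a * p = p * a" by (rule p(3)) (simp add: mult.assoc)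
  define w where "w = p - a"
  have w: "star w = w" by (simp add: w_def star_diff p sa)
  have "w * p = p * w" by (simp add: w_def algebra_simps pa)
  from q(3)[OF this] have wq: "w * q = q * w" .
  have aw: "a * w = - (p * w)" by (simp add: w_def algebra_simps pa p(2))
  define y where "y = x * w"
  have "star y * y = w * (a * w)" by (simp add: y_def star_mult w a_def mult.assoc)
  also have "\<dots> = - ((w * q) * (q * w))"
    unfolding aw q(2)[symmetric] by (simp add: mult.assoc)
  also have "\<dots> = - ((q * w) * (q * w))" unfolding wq ..
  finally have ky: "- (star y * y) = (q * w) * (q * w)" by simp
  have qw: "star (q * w) = q * w" by (simp add: star_mult w q wq)
  have k: "norm_positive (- (star y * y))" unfolding ky by (rule norm_positive_square[OF qw])
  \<comment> \<open>The real and imaginary parts of y; \<open>y * star y + star y * y\<close> equals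
    2 u^2 + 2 v^2.\<close>
  define u v where "u = (1/2) *\<^sub>R (y + star y)" and "v = (1/2) *\<^sub>C (\<i> *\<^sub>C (star y - y))"
  have v: "star v = v"
    by (simp add: v_def star_scaleC star_diff star_star scaleC_diff_right scaleC_minus_left
        scaleC_minus_right)
  have u: "star u = u" by (simp add: u_def star_scaleR star_add star_star add.commute)
  have yy: "y * star y = 2 *\<^sub>R (u * u) + 2 *\<^sub>R (v * v) + - (star y * y)"
  proof -
    have "2 *\<^sub>R (u * u) = (1/2) *\<^sub>R ((y + star y) * (y + star y))" by (simp add: u_def)
    moreover have "v * v = ((1/2 * \<i>) * (1/2 * \<i>)) *\<^sub>C ((star y - y) * (star y - y))"
      by (simp only: v_def scaleC_scaleC mult_scaleC_left mult_scaleC_right)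
    then have "2 *\<^sub>R (v * v) = (- (1/2)) *\<^sub>R ((star y - y) * (star y - y))"
      by (simp add: scaleR_eq_scaleC scaleC_scaleC scaleC_minus_left scaleC_minus_right)
    moreover have "(y + star y) * (y + star y) - (star y - y) * (star y - y)
        = 2 *\<^sub>R (y * star y + star y * y)"
      by (simp add: algebra_simps scaleR_2)
    then have "(1/2) *\<^sub>R ((y + star y) * (y + star y)) + (- (1/2)) *\<^sub>R ((star y - y) * (star y - y))
        = (1/2) *\<^sub>R (2 *\<^sub>R (y * star y + star y * y))"
      unfolding scaleR_minus_left by (simp only: scaleR_diff_right[symmetric] diff_conv_add_uminus[symmetric])
    ultimately show ?thesis by simp
  qed
  have h: "norm_positive (y * star y)"
    unfolding yy by (intro norm_positive_add norm_positive_scaleR norm_positive_square k u v) simp_all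
  have "y = 0" by (rule star_mult_self_eq_0[OF k h])
  then have "(q * w) * (q * w) = 0" using ky by simp
  then have "q * w = 0" using norm_square_selfadj[OF qw] by simp
  then have "p * w = 0" by (simp add: q(2)[symmetric] mult.assoc)
  then have "w * w = 0" using aw by (simp add: w_def algebra_simps)
  then have "w = 0" using norm_square_selfadj[OF w] by simp
  then show ?thesis using p(4) by (simp add: w_def a_def)
qed


subsection \<open>The positive cone\<close>

definition cpos :: "'b::unital_cstar_algebra \<Rightarrow> bool" where
  "cpos a \<longleftrightarrow> (\<exists>y. a = star y * y)"

lemma cpos_iff_norm_positive: "cpos a \<longleftrightarrow> norm_positive a"
  unfolding cpos_def using norm_positive_star_mult norm_positiveD by metis

lemma cpos_star_mult [simp]: "cpos (star y * y)"
  by (auto simp: cpos_def)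

lemma cpos_selfadj: "cpos a \<Longrightarrow> star a = a"
  by (auto simp: cpos_def star_mult star_star)

lemma cpos_0 [simp]: "cpos 0" and cpos_1 [simp]: "cpos 1"
  using cpos_star_mult[of 0] cpos_star_mult[of 1] by (simp_all add: star_one)

lemma cpos_add: "cpos a \<Longrightarrow> cpos b \<Longrightarrow> cpos (a + b)"
  unfolding cpos_iff_norm_positive by (rule norm_positive_add)

lemma cpos_sum: "(\<And>i. i \<in> A \<Longrightarrow> cpos (f i)) \<Longrightarrow> cpos (sum f A)"
  by (induction A rule: infinite_finite_induct) (auto intro: cpos_add)

lemma cpos_scaleR: "cpos a \<Longrightarrow> r \<ge> 0 \<Longrightarrow> cpos (r *\<^sub>R a)"
  unfolding cpos_iff_norm_positive by (rule norm_positive_scaleR)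

lemma cpos_of_real: "r \<ge> 0 \<Longrightarrow> cpos (of_real r)"
  using cpos_scaleR[OF cpos_1] by (simp add: of_real_def)

lemma cpos_conj: "cpos a \<Longrightarrow> cpos (star z * a * z)"
proof -
  assume "cpos a"
  then obtain y where "a = star y * y" by (auto simp: cpos_def)
  then have "star z * a * z = star (y * z) * (y * z)" by (simp add: star_mult mult.assoc)
  then show ?thesis by simp
qed

lemma cpos_norm_diff: "star a = a \<Longrightarrow> cpos (of_real (norm a) - a)"
  unfolding cpos_iff_norm_positive by (rule norm_positive_norm_diff)

lemma cpos_of_real_diff:
  assumes "star a = a" "norm a \<le> r" shows "cpos (of_real r - a)"
  using cpos_add[OF cpos_norm_diff[OF assms(1)] cpos_of_real[of "r - norm a"]] assms(2) by simp

text \<open>Since b \<le> \<open>norm b\<close>, also a \<le> \<open>norm b\<close>, and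
  \<open>norm_le_of_norm_positive\<close> applies.\<close>

lemma cpos_norm_mono:
  assumes a: "cpos a" and ba: "cpos (b - a)" shows "norm a \<le> norm b"
proof -
  have "cpos b" using cpos_add[OF a ba] by simp
  then have "cpos (of_real (norm b) - a)"
    using cpos_add[OF cpos_norm_diff ba, of b] by (simp add: cpos_selfadj)
  then show ?thesis using norm_le_of_norm_positive[of a "norm b"] a by (simp add: cpos_iff_norm_positive)
qed

lemma cpos_antisym: "cpos a \<Longrightarrow> cpos (- a) \<Longrightarrow> a = 0"
  using cpos_norm_mono[of a 0] by simp

lemma cpos_limit:
  assumes f: "f \<longlonglongrightarrow> a" and pos: "\<And>n. cpos (f n)" shows "cpos a"
proof -
  have "(\<lambda>n. star (f n)) \<longlonglongrightarrow> star a" by (intro tendsto_intros f)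
  then have "star a = a" using f LIMSEQ_unique by (simp add: cpos_selfadj[OF pos])
  moreover have "norm (of_real (norm a) - a) \<le> norm a"
  proof (rule LIMSEQ_le)
    show "(\<lambda>n. norm (of_real (norm (f n)) - f n)) \<longlonglongrightarrow> norm (of_real (norm a) - a)"
      by (intro tendsto_intros f)
    show "(\<lambda>n. norm (f n)) \<longlonglongrightarrow> norm a" by (intro tendsto_intros f)
    show "\<exists>N. \<forall>n\<ge>N. norm (of_real (norm (f n)) - f n) \<le> norm (f n)"
      using pos norm_positive_norm by (auto simp: cpos_iff_norm_positive)
  qed
  ultimately show ?thesis unfolding cpos_iff_norm_positive norm_positive_def
    by (intro conjI exI[of _ "norm a"]) auto
qed

lemma neumann_inverse:
  fixes y :: "'a::{real_normed_algebra_1, banach}"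
  assumes "norm y < 1"
  obtains z where "z * (1 - y) = 1" "(1 - y) * z = 1"
proof -
  have sm: "summable (\<lambda>n. y ^ n)" using assms by (rule complete_algebra_summable_geometric)
  define z where "z = (\<Sum>n. y ^ n)"
  have "(\<lambda>n. y ^ n * y) sums (z * y)" "(\<lambda>n. y * y ^ n) sums (y * z)"
    unfolding z_def by (intro sums_mult sums_mult2 summable_sums sm)+
  then have "(\<Sum>n. y ^ Suc n) = z * y" "(\<Sum>n. y ^ Suc n) = y * z"
    by (simp_all add: sums_iff power_commutes)
  moreover have "(\<Sum>n. y ^ Suc n) = z - 1"
    unfolding z_def using suminf_split_head[OF sm] by simp
  ultimately show thesis by (intro that[of z]) (simp_all add: algebra_simps)
qed

text \<open>Write x + e = t (1 - y) with t = norm x + e, so that norm y < 1. The Neumann series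
  inverts x + e, and this inverse times the root s of x + e inverts s.\<close>

lemma cpos_sqrt_inverse:
  fixes x :: "'b::unital_cstar_algebra"
  assumes x: "cpos x" and e: "e > 0"
  obtains b s where "star b = b" "star s = s" "s * s = x + of_real e" "b * s = 1" "s * b = 1"
proof -
  have "cpos (x + of_real e)" using x e by (intro cpos_add cpos_of_real) auto
  then obtain s where s: "star s = s" "s * s = x + of_real e"
    unfolding cpos_iff_norm_positive using norm_positiveD by metis
  define t where "t = norm x + e"
  define y where "y = (1 / t) *\<^sub>R (of_real (norm x) - x)"
  have t: "t > 0" using e by (simp add: t_def add_nonneg_pos)
  have "norm (of_real (norm x) - x) \<le> norm x"
    using x norm_positive_norm by (simp add: cpos_iff_norm_positive)
  then have "norm y < 1" using e t by (simp add: y_def t_def divide_less_eq)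
  then obtain z where z: "z * (1 - y) = 1" "(1 - y) * z = 1" by (rule neumann_inverse)
  have "1 - y = (1 / t) *\<^sub>R (s * s)"
  proof -
    have "t *\<^sub>R (1 - y) = t *\<^sub>R 1 - (of_real (norm x) - x)"
      using t by (simp add: y_def scaleR_diff_right)
    also have "\<dots> = s * s" by (simp add: s(2) t_def of_real_def algebra_simps)
    finally have "(1 / t) *\<^sub>R (s * s) = (1 / t) *\<^sub>R (t *\<^sub>R (1 - y))" by simp
    then show ?thesis using t by simp
  qed
  with z have z1: "((1 / t) *\<^sub>R z) * (s * s) = 1" "(s * s) * ((1 / t) *\<^sub>R z) = 1" by simp_all
  define i where "i = (1 / t) *\<^sub>R z"
  have i: "i * (s * s) = 1" "(s * s) * i = 1" using z1 by (simp_all add: i_def)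
  have "i * s = i * s * ((s * s) * i)" by (simp add: i)
  also have "\<dots> = i * (s * s) * (s * i)" by (simp add: mult.assoc)
  finally have comm: "i * s = s * i" by (simp add: i)
  define b where "b = i * s"
  have bs: "b * s = 1" using i by (simp add: b_def mult.assoc)
  have sb: "s * b = 1" unfolding b_def comm using i by (simp add: mult.assoc)
  have "star b * s = 1" using arg_cong[OF sb, of star] by (simp add: star_mult s star_one)
  then have "star b = b" by (metis mult.assoc sb mult_1_left mult_1_right)
  then show thesis using that s bs sb by blast
qed

text \<open>Test the hypothesis at b = (x + e)^(-1/2). Then b x b \<le> 1, so b y b has norm at most
  R, that is b y b \<le> R; conjugating back gives y \<le> R (x + e), and e tends to 0.\<close>

lemma cpos_diff_by_norm:
  fixes x y :: "'b::unital_cstar_algebra"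
  assumes x: "cpos x" and y: "cpos y" and R: "R \<ge> 0"
    and le: "\<And>b. norm (star b * y * b) \<le> R * norm (star b * x * b)"
  shows "cpos (R *\<^sub>R x - y)"
proof (rule cpos_limit)
  have 1: "cpos (R *\<^sub>R (x + of_real e) - y)" if e: "e > 0" for e
  proof -
    obtain b s where bs: "star b = b" "star s = s" "s * s = x + of_real e" "b * s = 1" "s * b = 1"
      by (rule cpos_sqrt_inverse[OF x e])
    have "cpos (e *\<^sub>R (star b * b))" using e by (intro cpos_scaleR) auto
    also have "e *\<^sub>R (star b * b) = b * (x + of_real e) * b - b * x * b"
      by (simp add: bs algebra_simps of_real_def)
    also have "b * (x + of_real e) * b = (b * s) * (s * b)" by (simp add: bs(3)[symmetric] mult.assoc)
    also have "\<dots> = 1" by (simp add: bs)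
    finally have "norm (b * x * b) \<le> norm (1 :: 'b)"
      using cpos_norm_mono[of "b * x * b" 1] cpos_conj[OF x, of b] by (simp add: bs)
    then have "R * norm (b * x * b) \<le> R" using R by (simp add: mult_left_le)
    then have "norm (b * y * b) \<le> R" using le[of b] by (simp add: bs)
    moreover have "star (b * y * b) = b * y * b"
      by (simp add: star_mult bs cpos_selfadj[OF y] mult.assoc)
    ultimately have "cpos (star s * (of_real R - b * y * b) * s)"
      by (intro cpos_conj cpos_of_real_diff)
    also have "star s * (of_real R - b * y * b) * s = R *\<^sub>R (s * s) - (s * b) * y * (b * s)"
      by (simp add: bs(2) algebra_simps of_real_def)
    finally show ?thesis by (simp add: bs)
  qed
  show "cpos (R *\<^sub>R (x + of_real (inverse (real (Suc n)))) - y)" for n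
    by (rule 1) simp
  have "(\<lambda>n. R *\<^sub>R (x + of_real (inverse (real (Suc n)))) - y) \<longlonglongrightarrow> R *\<^sub>R (x + of_real 0) - y"
    by (intro tendsto_intros LIMSEQ_inverse_real_of_nat)
  then show "(\<lambda>n. R *\<^sub>R (x + of_real (inverse (real (Suc n)))) - y) \<longlonglongrightarrow> R *\<^sub>R x - y" by simp
qed

section \<open>Semi-inner product modules\<close>

text \<open>The module axioms are only required up to vectors of length zero, so that formal sums of
  tensors, represented by lists, form an instance.\<close>

locale pre_hilbert =
  fixes V :: "('v, 'b::unital_cstar_algebra) bimod"
  assumes add_mem: "\<And>u v. u \<in> bm_carrier V \<Longrightarrow> v \<in> bm_carrier V \<Longrightarrow> bm_add V u v \<in> bm_carrier V"
    and right_mem: "\<And>u b. u \<in> bm_carrier V \<Longrightarrow> bm_right V u b \<in> bm_carrier V"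
    and inner_add: "\<And>u v w. u \<in> bm_carrier V \<Longrightarrow> v \<in> bm_carrier V \<Longrightarrow> w \<in> bm_carrier V \<Longrightarrow>
      bm_inner V w (bm_add V u v) = bm_inner V w u + bm_inner V w v"
    and inner_right: "\<And>u w b. u \<in> bm_carrier V \<Longrightarrow> w \<in> bm_carrier V \<Longrightarrow>
      bm_inner V w (bm_right V u b) = bm_inner V w u * b"
    and star_inner: "\<And>u v. u \<in> bm_carrier V \<Longrightarrow> v \<in> bm_carrier V \<Longrightarrow>
      star (bm_inner V u v) = bm_inner V v u"
    and inner_pos: "\<And>u. u \<in> bm_carrier V \<Longrightarrow> cpos (bm_inner V u u)"
begin

lemma inner_add_left:
  "u \<in> bm_carrier V \<Longrightarrow> v \<in> bm_carrier V \<Longrightarrow> w \<in> bm_carrier V \<Longrightarrow>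
    bm_inner V (bm_add V u v) w = bm_inner V u w + bm_inner V v w"
  using inner_add[of u v w] by (metis star_add star_inner add_mem)

lemma inner_right_left:
  "u \<in> bm_carrier V \<Longrightarrow> w \<in> bm_carrier V \<Longrightarrow>
    bm_inner V (bm_right V u b) w = star b * bm_inner V u w"
  using inner_right[of u w b] by (metis star_mult star_inner right_mem)

definition diff :: "'v \<Rightarrow> 'v \<Rightarrow> 'v" where
  "diff u v = bm_add V u (bm_right V v (- 1))"

definition seminorm :: "'v \<Rightarrow> real" where
  "seminorm u = sqrt (norm (bm_inner V u u))"

lemma bm_dist_eq: "bm_dist V u v = seminorm (diff u v)"
  by (simp add: bm_dist_def seminorm_def diff_def Let_def)

lemma diff_mem: "u \<in> bm_carrier V \<Longrightarrow> v \<in> bm_carrier V \<Longrightarrow> diff u v \<in> bm_carrier V"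
  by (simp add: diff_def add_mem right_mem)

lemma inner_diff:
  "u \<in> bm_carrier V \<Longrightarrow> v \<in> bm_carrier V \<Longrightarrow> w \<in> bm_carrier V \<Longrightarrow>
    bm_inner V w (diff u v) = bm_inner V w u - bm_inner V w v"
  by (simp add: diff_def inner_add inner_right right_mem)

lemma inner_diff_left:
  "u \<in> bm_carrier V \<Longrightarrow> v \<in> bm_carrier V \<Longrightarrow> w \<in> bm_carrier V \<Longrightarrow>
    bm_inner V (diff u v) w = bm_inner V u w - bm_inner V v w"
  by (simp add: diff_def inner_add_left inner_right_left right_mem star_minus_one)

lemmas inner_simps = inner_add inner_add_left inner_right inner_right_left inner_diff inner_diff_left
  add_mem right_mem diff_mem

lemma seminorm_nonneg [simp]: "seminorm u \<ge> 0"
  by (simp add: seminorm_def)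

lemma seminorm_square: "(seminorm u)\<^sup>2 = norm (bm_inner V u u)"
  by (simp add: seminorm_def)

text \<open>Expand the square of u t a - v, where a is the inner product of u and v and t = 1 / K
  for a bound K of \<open>bm_inner V u u\<close>. This yields the order inequality
  \<open>star a * a\<close> \<le> K \<open>bm_inner V v v\<close>, and norms are monotone.\<close>

lemma Cauchy_Schwarz_square:
  assumes u: "u \<in> bm_carrier V" and v: "v \<in> bm_carrier V"
  shows "(norm (bm_inner V u v))\<^sup>2 \<le> norm (bm_inner V u u) * norm (bm_inner V v v)"
proof -
  define a where "a = bm_inner V u v"
  have sa: "bm_inner V v u = star a" unfolding a_def using u v by (simp add: star_inner)
  \<comment> \<open>K is an upper bound kept strictly positive, so that vectors u of length zero are
    covered; afterwards K decreases to the norm.\<close>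
  have *: "(norm a)\<^sup>2 \<le> K * norm (bm_inner V v v)" if K: "K > 0" "norm (bm_inner V u u) \<le> K" for K
  proof -
    define t where "t = 1 / K"
    have t: "t > 0" using K by (simp add: t_def)
    have "cpos (star a * (of_real K - bm_inner V u u) * a)"
      using K u by (intro cpos_conj cpos_of_real_diff cpos_selfadj inner_pos)
    from cpos_scaleR[OF this, of "t\<^sup>2"]
    have 1: "cpos (t\<^sup>2 *\<^sub>R (star a * (of_real K - bm_inner V u u) * a))" by simp
    define w where "w = diff (bm_right V u (t *\<^sub>R a)) v"
    have w: "w \<in> bm_carrier V" using u v by (simp add: w_def inner_simps)
    have 2: "bm_inner V w w = t\<^sup>2 *\<^sub>R (star a * bm_inner V u u * a) - (t *\<^sub>R (star a * a) + t *\<^sub>R (star a * a)) + bm_inner V v v"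
      using u v unfolding w_def
      by (simp add: inner_simps star_scaleR sa a_def[symmetric] algebra_simps power2_eq_square)
    have 3: "t\<^sup>2 *\<^sub>R (star a * (of_real K - bm_inner V u u) * a)
        = t *\<^sub>R (star a * a) - t\<^sup>2 *\<^sub>R (star a * bm_inner V u u * a)"
      using K by (simp add: t_def algebra_simps of_real_def power2_eq_square)
    have "cpos (bm_inner V w w + t\<^sup>2 *\<^sub>R (star a * (of_real K - bm_inner V u u) * a))"
      by (rule cpos_add[OF inner_pos[OF w] 1])
    then have "cpos (bm_inner V v v - t *\<^sub>R (star a * a))"
      unfolding 2 3 by simp
    then have "norm (t *\<^sub>R (star a * a)) \<le> norm (bm_inner V v v)"
      using t by (intro cpos_norm_mono cpos_scaleR) auto
    then show ?thesis using K t by (simp add: cstar_identity t_def field_simps)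
  qed
  have "(norm a)\<^sup>2 \<le> (norm (bm_inner V u u) + 0) * norm (bm_inner V v v)"
  proof (rule LIMSEQ_le_const)
    show "(\<lambda>n. (norm (bm_inner V u u) + inverse (real (Suc n))) * norm (bm_inner V v v))
      \<longlonglongrightarrow> (norm (bm_inner V u u) + 0) * norm (bm_inner V v v)"
      by (intro tendsto_intros LIMSEQ_inverse_real_of_nat)
    show "\<exists>N. \<forall>n\<ge>N. (norm a)\<^sup>2 \<le> (norm (bm_inner V u u) + inverse (real (Suc n))) * norm (bm_inner V v v)"
      by (intro exI[of _ 0] allI impI *) (auto intro: add_nonneg_pos)
  qed
  then show ?thesis by (simp add: a_def)
qed

lemma Cauchy_Schwarz:
  assumes "u \<in> bm_carrier V" "v \<in> bm_carrier V"
  shows "norm (bm_inner V u v) \<le> seminorm u * seminorm v"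
  using real_sqrt_le_mono[OF Cauchy_Schwarz_square[OF assms]]
  by (simp add: seminorm_def real_sqrt_mult)

lemma seminorm_add:
  assumes u: "u \<in> bm_carrier V" and v: "v \<in> bm_carrier V"
  shows "seminorm (bm_add V u v) \<le> seminorm u + seminorm v"
proof (rule power2_le_imp_le)
  have "(seminorm (bm_add V u v))\<^sup>2 =
      norm (bm_inner V u u + bm_inner V u v + (bm_inner V v u + bm_inner V v v))"
    using u v by (simp add: seminorm_square inner_simps algebra_simps)
  also have "\<dots> \<le> norm (bm_inner V u u) + norm (bm_inner V u v) + (norm (bm_inner V v u) + norm (bm_inner V v v))"
    by (intro norm_triangle_le add_mono norm_triangle_ineq)
  also have "\<dots> \<le> (seminorm u)\<^sup>2 + seminorm u * seminorm v + (seminorm v * seminorm u + (seminorm v)\<^sup>2)"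
    unfolding seminorm_square by (intro add_mono Cauchy_Schwarz u v order_refl)
  also have "\<dots> = (seminorm u + seminorm v)\<^sup>2" by (simp add: power2_eq_square algebra_simps)
  finally show "(seminorm (bm_add V u v))\<^sup>2 \<le> (seminorm u + seminorm v)\<^sup>2" .
qed simp

lemma seminorm_right:
  assumes u: "u \<in> bm_carrier V"
  shows "seminorm (bm_right V u b) \<le> seminorm u * norm b"
proof (rule power2_le_imp_le)
  have "(seminorm (bm_right V u b))\<^sup>2 = norm (star b * bm_inner V u u * b)"
    using u by (simp add: seminorm_square inner_simps mult.assoc)
  also have "\<dots> \<le> norm b * norm (bm_inner V u u) * norm b"
    using order_trans[OF norm_mult_ineq mult_right_mono[OF norm_mult_ineq norm_ge_zero],
        of "star b" "bm_inner V u u" b] by (simp add: norm_star)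
  also have "\<dots> = (seminorm u * norm b)\<^sup>2"
    unfolding power_mult_distrib seminorm_square by (simp add: power2_eq_square)
  finally show "(seminorm (bm_right V u b))\<^sup>2 \<le> (seminorm u * norm b)\<^sup>2" .
qed simp

end

section \<open>Positive matrices\<close>

text \<open>Positivity of \<open>A\<close> as a B-valued form on columns.
  \<open>mat_positive_iff\<close> identifies it with the existence of a factorization.\<close>

definition mat_nonneg :: "nat \<Rightarrow> (nat \<Rightarrow> nat \<Rightarrow> 'b::unital_cstar_algebra) \<Rightarrow> bool" where
  "mat_nonneg n A \<longleftrightarrow> (\<forall>i<n. \<forall>j<n. star (A i j) = A j i) \<and>
     (\<forall>x. cpos (\<Sum>i<n. \<Sum>j<n. star (x i) * A i j * x j))"

lemma mat_positive_imp_nonneg: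
  assumes "mat_positive n A" shows "mat_nonneg n A"
proof -
  obtain C where C: "\<And>i j. i < n \<Longrightarrow> j < n \<Longrightarrow> A i j = (\<Sum>k<n. star (C k i) * C k j)"
    using assms by (auto simp: mat_positive_def)
  have "cpos (\<Sum>i<n. \<Sum>j<n. star (x i) * A i j * x j)" for x
  proof -
    have "(\<Sum>i<n. \<Sum>j<n. star (x i) * A i j * x j) =
        (\<Sum>i<n. \<Sum>j<n. \<Sum>k<n. star (C k i * x i) * (C k j * x j))"
      by (intro sum.cong HOL.refl)
        (simp add: C sum_distrib_left sum_distrib_right star_mult mult.assoc)
    also have "\<dots> = (\<Sum>i<n. \<Sum>k<n. \<Sum>j<n. star (C k i * x i) * (C k j * x j))"
      by (intro sum.cong HOL.refl sum.swap)
    also have "\<dots> = (\<Sum>k<n. \<Sum>i<n. \<Sum>j<n. star (C k i * x i) * (C k j * x j))"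
      by (rule sum.swap)
    also have "\<dots> = (\<Sum>k<n. star (\<Sum>i<n. C k i * x i) * (\<Sum>j<n. C k j * x j))"
      by (simp add: star_sum sum_product)
    finally show ?thesis by (simp add: cpos_sum)
  qed
  moreover have "star (A i j) = A j i" if "i < n" "j < n" for i j
    using that by (simp add: C star_sum star_mult star_star)
  ultimately show ?thesis by (simp add: mat_nonneg_def)
qed

section \<open>The square root of a matrix, entry by entry\<close>

primrec mat_pow :: "nat \<Rightarrow> (nat \<Rightarrow> nat \<Rightarrow> 'b::ring_1) \<Rightarrow> nat \<Rightarrow> nat \<Rightarrow> nat \<Rightarrow> 'b" where
  "mat_pow n Y 0 = (\<lambda>i j. if i = j then 1 else 0)"
| "mat_pow n Y (Suc m) = (\<lambda>i j. \<Sum>k<n. Y i k * mat_pow n Y m k j)"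

lemma mat_pow_add:
  assumes "i < n"
  shows "mat_pow n Y (m + p) i j = (\<Sum>k<n. mat_pow n Y m i k * mat_pow n Y p k j)"
  using assms
proof (induction m arbitrary: i)
  case 0
  have "(\<Sum>k<n. mat_pow n Y 0 i k * mat_pow n Y p k j) = (\<Sum>k<n. if k = i then mat_pow n Y p k j else 0)"
    by (intro sum.cong) auto
  then show ?case using 0 by simp
next
  case (Suc m)
  have "mat_pow n Y (Suc m + p) i j = (\<Sum>l<n. Y i l * (\<Sum>k<n. mat_pow n Y m l k * mat_pow n Y p k j))"
    using Suc by simp
  also have "\<dots> = (\<Sum>k<n. (\<Sum>l<n. Y i l * mat_pow n Y m l k) * mat_pow n Y p k j)"
    unfolding sum_distrib_left sum_distrib_right mult.assoc by (rule sum.swap)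
  finally show ?case by simp
qed

lemma star_mat_pow:
  assumes "\<And>i j. i < n \<Longrightarrow> j < n \<Longrightarrow> star (Y i j) = Y j i" "i < n" "j < n"
  shows "star (mat_pow n Y m i j) = mat_pow n Y m j i"
  using assms(2,3)
proof (induction m arbitrary: i j)
  case (Suc m)
  have "star (mat_pow n Y (Suc m) i j) = (\<Sum>k<n. mat_pow n Y m j k * Y k i)"
    using Suc by (simp add: star_sum star_mult assms(1))
  also have "\<dots> = (\<Sum>k<n. mat_pow n Y m j k * mat_pow n Y 1 k i)"
  proof (intro sum.cong HOL.refl)
    fix k
    have "(\<Sum>l<n. Y k l * (if l = i then 1 else 0)) = (\<Sum>l<n. if l = i then Y k l else 0)"
      by (intro sum.cong) auto
    then show "mat_pow n Y m j k * Y k i = mat_pow n Y m j k * mat_pow n Y 1 k i"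
      using Suc.prems by simp
  qed
  also have "\<dots> = mat_pow n Y (m + 1) j i" using Suc.prems by (simp only: mat_pow_add)
  finally show ?case by simp
qed (auto simp: star_one star_zero)

lemma vec_norm_entry:
  fixes v :: "nat \<Rightarrow> 'b::unital_cstar_algebra"
  assumes "i < n"
  shows "(norm (v i))\<^sup>2 \<le> norm (\<Sum>k<n. star (v k) * v k)"
proof -
  have "(\<Sum>k<n. star (v k) * v k) - star (v i) * v i = (\<Sum>k\<in>{..<n} - {i}. star (v k) * v k)"
    using assms by (simp add: sum.remove[of "{..<n}" i])
  then have "cpos ((\<Sum>k<n. star (v k) * v k) - star (v i) * v i)" by (simp add: cpos_sum)
  then show ?thesis using cpos_norm_mono[of "star (v i) * v i"] by (simp add: cstar_identity)
qed

context
  fixes n :: nat and Y :: "nat \<Rightarrow> nat \<Rightarrow> 'b::unital_cstar_algebra"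
  assumes herm: "\<And>i j. i < n \<Longrightarrow> j < n \<Longrightarrow> star (Y i j) = Y j i"
    and pos: "\<And>x. cpos (\<Sum>i<n. \<Sum>j<n. star (x i) * Y i j * x j)"
    and le1: "\<And>x. cpos ((\<Sum>i<n. star (x i) * x i) - (\<Sum>i<n. \<Sum>j<n. star (x i) * Y i j * x j))"
begin

text \<open>The semi-inner product that \<open>Y\<close> induces on columns; its left action is a
  placeholder.\<close>

definition mat_form :: "(nat \<Rightarrow> 'b, 'b) bimod" where
  "mat_form = \<lparr>bm_carrier = UNIV, bm_zero = (\<lambda>_. 0), bm_add = (\<lambda>x y i. x i + y i),
     bm_left = (\<lambda>b x. x), bm_right = (\<lambda>x b i. x i * b),
     bm_inner = (\<lambda>x y. \<Sum>i<n. \<Sum>j<n. star (x i) * Y i j * y j)\<rparr>"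

lemma pre_hilbert_mat_form: "pre_hilbert mat_form"
proof
  fix u v :: "nat \<Rightarrow> 'b"
  have "star (\<Sum>i<n. \<Sum>j<n. star (u i) * Y i j * v j) = (\<Sum>i<n. \<Sum>j<n. star (v j) * Y j i * u i)"
    unfolding star_sum by (intro sum.cong HOL.refl) (simp add: star_mult star_star herm mult.assoc)
  also have "\<dots> = (\<Sum>j<n. \<Sum>i<n. star (v j) * Y j i * u i)" by (rule sum.swap)
  finally show "star (bm_inner mat_form u v) = bm_inner mat_form v u" by (simp add: mat_form_def)
qed (auto simp: mat_form_def algebra_simps sum.distrib sum_distrib_left sum_distrib_right pos[unfolded mult.assoc])

text \<open>The form of y = Y x against x is the squared length of y. Cauchy-Schwarz in
  \<open>mat_form\<close>, together with Y \<le> 1, then bounds the square of \<open>nrm y\<close>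
  by \<open>nrm y * nrm x\<close>; here \<open>nrm\<close> is a squared length.\<close>

lemma norm_mat_vec:
  defines "nrm \<equiv> \<lambda>x :: nat \<Rightarrow> 'b. norm (\<Sum>i<n. star (x i) * x i)"
  shows "nrm (\<lambda>i. \<Sum>j<n. Y i j * x j) \<le> nrm x"
proof -
  interpret pre_hilbert mat_form by (rule pre_hilbert_mat_form)
  define y where "y = (\<lambda>i. \<Sum>j<n. Y i j * x j)"
  have le: "norm (bm_inner mat_form z z) \<le> nrm z" for z
    using cpos_norm_mono[OF pos le1, of z] by (simp add: mat_form_def nrm_def)
  have "bm_inner mat_form y x = (\<Sum>i<n. star (y i) * y i)"
    by (simp add: mat_form_def y_def sum_distrib_left mult.assoc)
  then have "(nrm y)\<^sup>2 \<le> norm (bm_inner mat_form y y) * norm (bm_inner mat_form x x)"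
    using Cauchy_Schwarz_square[of y x] by (simp add: mat_form_def nrm_def)
  also have "\<dots> \<le> nrm y * nrm x" by (intro mult_mono le) (auto simp: nrm_def)
  finally have "nrm y * nrm y \<le> nrm y * nrm x" by (simp add: power2_eq_square)
  then have "nrm y \<le> nrm x \<or> nrm y = 0"
    using mult_le_cancel_left_pos[of "nrm y" "nrm y" "nrm x"] by (fastforce simp: nrm_def)
  then show ?thesis by (auto simp: y_def nrm_def)
qed

text \<open>A column of a power of \<open>Y\<close> arises from a unit column by repeated
  contractions, and an entry is dominated by its column. The uniform bound on entries makes the root
  series converge absolutely.\<close>

lemma norm_mat_pow:
  assumes "i < n" "j < n" shows "norm (mat_pow n Y m i j) \<le> 1"
proof -
  have "norm (\<Sum>i<n. star (mat_pow n Y m i j) * mat_pow n Y m i j) \<le> 1"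
  proof (induction m)
    case 0
    have "(\<Sum>i<n. star (mat_pow n Y 0 i j) * mat_pow n Y 0 i j) = (\<Sum>i<n. if i = j then 1 else 0)"
      by (intro sum.cong) (auto simp: star_one)
    then show ?case using assms by simp
  next
    case (Suc m)
    show ?case using norm_mat_vec[of "\<lambda>i. mat_pow n Y m i j"] Suc by simp
  qed
  then have "(norm (mat_pow n Y m i j))\<^sup>2 \<le> 1\<^sup>2"
    using vec_norm_entry[OF assms(1), of "\<lambda>i. mat_pow n Y m i j"] by simp
  then show ?thesis by (rule power2_le_imp_le) simp
qed

definition mat_sqrt :: "nat \<Rightarrow> nat \<Rightarrow> 'b" where
  "mat_sqrt i j = (\<Sum>m. sqrt_coef m *\<^sub>R mat_pow n Y m i j)"

lemma summable_norm_mat_sqrt: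
  assumes "i < n" "j < n"
  shows "summable (\<lambda>m. norm (sqrt_coef m *\<^sub>R mat_pow n Y m i j))"
  by (rule summable_comparison_test'[OF summable_sqrt_coef])
    (simp add: norm_mat_pow[OF assms] mult_left_le)

lemma mat_sqrt_square:
  assumes "i < n" "j < n"
  shows "(\<Sum>k<n. star (mat_sqrt k i) * mat_sqrt k j) = (if i = j then 1 else 0) - Y i j"
proof -
  have s: "star (mat_sqrt k i) = mat_sqrt i k" if "k < n" for k
  proof -
    have sm: "summable (\<lambda>m. sqrt_coef m *\<^sub>R mat_pow n Y m k i)"
      using summable_norm_mat_sqrt[OF that assms(1)] by (rule summable_norm_cancel)
    have "(\<lambda>N. star (\<Sum>m<N. sqrt_coef m *\<^sub>R mat_pow n Y m k i)) \<longlonglongrightarrow> star (mat_sqrt k i)"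
      unfolding mat_sqrt_def by (intro tendsto_intros summable_LIMSEQ sm)
    also have "(\<lambda>N. star (\<Sum>m<N. sqrt_coef m *\<^sub>R mat_pow n Y m k i)) =
        (\<lambda>N. \<Sum>m<N. sqrt_coef m *\<^sub>R mat_pow n Y m i k)"
      using that assms by (simp add: star_sum star_scaleR star_mat_pow herm)
    finally show ?thesis
      unfolding mat_sqrt_def using sums_unique by (simp add: sums_def[symmetric])
  qed
  have "(\<lambda>m. \<Sum>l\<le>m. (sqrt_coef l *\<^sub>R mat_pow n Y l i k) * (sqrt_coef (m - l) *\<^sub>R mat_pow n Y (m - l) k j))
      sums (mat_sqrt i k * mat_sqrt k j)" if "k < n" for k
    unfolding mat_sqrt_def using that assms by (intro Cauchy_product_sums summable_norm_mat_sqrt)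
  then have "(\<lambda>m. \<Sum>k<n. \<Sum>l\<le>m. (sqrt_coef l *\<^sub>R mat_pow n Y l i k) * (sqrt_coef (m - l) *\<^sub>R mat_pow n Y (m - l) k j))
      sums (\<Sum>k<n. mat_sqrt i k * mat_sqrt k j)"
    by (intro sums_sum) auto
  also have "(\<lambda>m. \<Sum>k<n. \<Sum>l\<le>m. (sqrt_coef l *\<^sub>R mat_pow n Y l i k) * (sqrt_coef (m - l) *\<^sub>R mat_pow n Y (m - l) k j))
     = (\<lambda>m. (\<Sum>l\<le>m. sqrt_coef l * sqrt_coef (m - l)) *\<^sub>R mat_pow n Y m i j)"
  proof
    fix m
    have "(\<Sum>k<n. \<Sum>l\<le>m. (sqrt_coef l *\<^sub>R mat_pow n Y l i k) * (sqrt_coef (m - l) *\<^sub>R mat_pow n Y (m - l) k j))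
      = (\<Sum>l\<le>m. (sqrt_coef l * sqrt_coef (m - l)) *\<^sub>R (\<Sum>k<n. mat_pow n Y l i k * mat_pow n Y (m - l) k j))"
      unfolding scaleR_sum_right by (subst sum.swap) (simp add: mult.commute)
    also have "\<dots> = (\<Sum>l\<le>m. (sqrt_coef l * sqrt_coef (m - l)) *\<^sub>R mat_pow n Y m i j)"
    proof (intro sum.cong HOL.refl)
      fix l assume "l \<in> {..m}"
      then show "(sqrt_coef l * sqrt_coef (m - l)) *\<^sub>R (\<Sum>k<n. mat_pow n Y l i k * mat_pow n Y (m - l) k j)
          = (sqrt_coef l * sqrt_coef (m - l)) *\<^sub>R mat_pow n Y m i j"
        using mat_pow_add[OF assms(1), of Y l "m - l" j] by simp
    qed
    finally show "(\<Sum>k<n. \<Sum>l\<le>m. (sqrt_coef l *\<^sub>R mat_pow n Y l i k) * (sqrt_coef (m - l) *\<^sub>R mat_pow n Y (m - l) k j))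
      = (\<Sum>l\<le>m. sqrt_coef l * sqrt_coef (m - l)) *\<^sub>R mat_pow n Y m i j"
      by (simp add: scaleR_sum_left)
  qed
  also have "\<dots> = (\<lambda>m. if m \<in> {0, 1} then (if m = 0 then (if i = j then 1 else 0) else - Y i j) else 0)"
  proof -
    have "(\<Sum>k<n. Y i k * (if k = j then 1 else 0)) = (\<Sum>k<n. if k = j then Y i k else 0)"
      by (intro sum.cong) auto
    then have "mat_pow n Y (Suc 0) i j = Y i j" using assms by simp
    then show ?thesis unfolding sqrt_coef_convolution by (auto simp: fun_eq_iff)
  qed
  finally have "(\<lambda>m. if m \<in> {0, 1} then (if m = 0 then (if i = j then 1 else 0) else - Y i j) else 0)
      sums (\<Sum>k<n. mat_sqrt i k * mat_sqrt k j)" .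
  moreover have "(\<lambda>m. if m \<in> {0, 1} then (if m = 0 then (if i = j then 1 else 0) else - Y i j) else 0)
      sums (\<Sum>m\<in>{0, 1::nat}. if m = 0 then (if i = j then 1 else 0) else - Y i j)"
    by (rule sums_If_finite_set) simp
  ultimately have "(\<Sum>k<n. mat_sqrt i k * mat_sqrt k j) = (if i = j then 1 else 0) - Y i j"
    using sums_unique2 by fastforce
  then show ?thesis by (simp add: s)
qed

end

text \<open>The factor \<open>n\<close> is the price of comparing a positive matrix with its diagonal.\<close>

lemma mat_nonneg_le_diag:
  assumes A: "mat_nonneg n A"
  shows "cpos (real n *\<^sub>R (\<Sum>i<n. star (x i) * A i i * x i) - (\<Sum>i<n. \<Sum>j<n. star (x i) * A i j * x j))"
proof -
  define q where "q i j = star (x i) * A i j * x j" for i j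
  have "cpos (q i i - q i j - q j i + q j j)" if ij: "i < n" "j < n" for i j
  proof -
    \<comment> \<open>The column x with all entries removed but the i-th and the j-th, the latter
      with opposite sign. Half the sum of its forms over all i and j is the claimed
      difference.\<close>
    define z where "z k = (if k = i then x i else 0) - (if k = j then x j else 0)" for k
    have l: "(\<Sum>l<n. star (z k) * A k l * z l) = star (z k) * A k i * x i - star (z k) * A k j * x j" for k
    proof -
      have "(\<Sum>l<n. star (z k) * A k l * z l) =
          (\<Sum>l<n. (if l = i then star (z k) * A k l * x l else 0) - (if l = j then star (z k) * A k l * x l else 0))"
        by (intro sum.cong HOL.refl) (auto simp: z_def[of l for l] algebra_simps)
      then show ?thesis using ij by (simp add: sum_subtractf)
    qed
    have "(\<Sum>k<n. star (z k) * y k) = star (x i) * y i - star (x j) * y j" for y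
    proof -
      have "(\<Sum>k<n. star (z k) * y k) =
          (\<Sum>k<n. (if k = i then star (x k) * y k else 0) - (if k = j then star (x k) * y k else 0))"
        by (intro sum.cong HOL.refl) (auto simp: z_def star_diff star_minus star_zero algebra_simps)
      then show ?thesis using ij by (simp add: sum_subtractf)
    qed
    from this[of "\<lambda>k. A k i * x i - A k j * x j"]
    have "(\<Sum>k<n. \<Sum>l<n. star (z k) * A k l * z l) = q i i - q i j - q j i + q j j"
      unfolding l by (simp add: q_def algebra_simps)
    moreover have "cpos (\<Sum>k<n. \<Sum>l<n. star (z k) * A k l * z l)"
      using A unfolding mat_nonneg_def by blast
    ultimately show ?thesis by simp
  qed
  then have "cpos ((1/2) *\<^sub>R (\<Sum>i<n. \<Sum>j<n. q i i - q i j - q j i + q j j))"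
    by (intro cpos_scaleR cpos_sum) auto
  also have "(\<Sum>i<n. \<Sum>j<n. q i i - q i j - q j i + q j j) =
      2 *\<^sub>R (real n *\<^sub>R (\<Sum>i<n. q i i) - (\<Sum>i<n. \<Sum>j<n. q i j))"
  proof -
    have "(\<Sum>i<n. \<Sum>j<n. q j i) = (\<Sum>i<n. \<Sum>j<n. q i j)" by (rule sum.swap)
    moreover have "(\<Sum>i<n. \<Sum>j<n. q i i) = real n *\<^sub>R (\<Sum>i<n. q i i)"
      by (simp add: scaleR_conv_of_real sum_distrib_left)
    moreover have "(\<Sum>i<n. \<Sum>j<n. q j j) = real n *\<^sub>R (\<Sum>i<n. q i i)"
      by (simp add: scaleR_conv_of_real)
    ultimately show ?thesis
      by (simp only: sum.distrib sum_subtractf scaleR_2) (simp add: algebra_simps)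
  qed
  finally show ?thesis by (simp add: q_def)
qed

text \<open>Take the root of A = K (1 - Y), that is Y = 1 - A / K. Here Y \<le> 1 because A is
  positive, and 0 \<le> Y because A \<le> n M by \<open>mat_nonneg_le_diag\<close>, where M bounds
  the diagonal.\<close>

lemma mat_nonneg_imp_positive:
  fixes A :: "nat \<Rightarrow> nat \<Rightarrow> 'b::unital_cstar_algebra"
  assumes A: "mat_nonneg n A" shows "mat_positive n A"
proof -
  have herm: "\<And>i j. i < n \<Longrightarrow> j < n \<Longrightarrow> star (A i j) = A j i"
    and pos: "\<And>x. cpos (\<Sum>i<n. \<Sum>j<n. star (x i) * A i j * x j)"
    using A by (auto simp: mat_nonneg_def)
  \<comment> \<open>The summands 1 in \<open>M\<close> and \<open>K\<close> keep K positive for the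
    zero matrix and for n = 0.\<close>
  define M where "M = (\<Sum>i<n. norm (A i i)) + 1"
  define K where "K = (real n + 1) * M"
  have M: "M > 0" by (simp add: M_def add_nonneg_pos sum_nonneg)
  have K: "K > 0" using M by (simp add: K_def)
  define Y where "Y i j = (if i = j then 1 else 0) - (1 / K) *\<^sub>R A i j" for i j
  have form: "(\<Sum>i<n. \<Sum>j<n. star (x i) * Y i j * x j) =
      (\<Sum>i<n. star (x i) * x i) - (1 / K) *\<^sub>R (\<Sum>i<n. \<Sum>j<n. star (x i) * A i j * x j)" for x
  proof -
    have "(\<Sum>j<n. star (x i) * Y i j * x j) =
      (\<Sum>j<n. (if j = i then star (x i) * x i else 0) - (1 / K) *\<^sub>R (star (x i) * A i j * x j))" for i
      by (intro sum.cong HOL.refl) (auto simp: Y_def algebra_simps)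
    then show ?thesis by (simp add: sum_subtractf scaleR_sum_right)
  qed
  have le: "cpos ((\<Sum>i<n. star (x i) * x i) - (\<Sum>i<n. \<Sum>j<n. star (x i) * Y i j * x j))" for x
    unfolding form using cpos_scaleR[OF pos[of x], of "1 / K"] K by simp
  have posY: "cpos (\<Sum>i<n. \<Sum>j<n. star (x i) * Y i j * x j)" for x
  proof -
    have "norm (A i i) \<le> M" if "i < n" for i
      using member_le_sum[of i "{..<n}" "\<lambda>i. norm (A i i)"] that by (simp add: M_def)
    then have "cpos (star (x i) * (of_real M - A i i) * x i)" if "i < n" for i
      using that by (intro cpos_conj cpos_of_real_diff herm) auto
    then have "cpos (real n *\<^sub>R (\<Sum>i<n. star (x i) * (of_real M - A i i) * x i))"
      by (intro cpos_scaleR cpos_sum) auto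
    from cpos_add[OF this mat_nonneg_le_diag[OF A, of x]]
    have "cpos ((real n * M) *\<^sub>R (\<Sum>i<n. star (x i) * x i) - (\<Sum>i<n. \<Sum>j<n. star (x i) * A i j * x j))"
      by (simp add: algebra_simps of_real_def sum_subtractf scaleR_sum_right[symmetric])
    moreover have "cpos (M *\<^sub>R (\<Sum>i<n. star (x i) * x i))"
      using M by (intro cpos_scaleR cpos_sum) auto
    ultimately have "cpos (M *\<^sub>R (\<Sum>i<n. star (x i) * x i) + ((real n * M) *\<^sub>R (\<Sum>i<n. star (x i) * x i) - (\<Sum>i<n. \<Sum>j<n. star (x i) * A i j * x j)))"
      by (rule cpos_add[rotated])
    also have "M *\<^sub>R (\<Sum>i<n. star (x i) * x i) + ((real n * M) *\<^sub>R (\<Sum>i<n. star (x i) * x i) - (\<Sum>i<n. \<Sum>j<n. star (x i) * A i j * x j))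
      = K *\<^sub>R (\<Sum>i<n. star (x i) * x i) - (\<Sum>i<n. \<Sum>j<n. star (x i) * A i j * x j)"
      by (simp add: K_def algebra_simps)
    finally have "cpos ((1 / K) *\<^sub>R (K *\<^sub>R (\<Sum>i<n. star (x i) * x i) - (\<Sum>i<n. \<Sum>j<n. star (x i) * A i j * x j)))"
      using K by (intro cpos_scaleR) auto
    then show ?thesis unfolding form using K by (simp add: algebra_simps)
  qed
  have hermY: "star (Y i j) = Y j i" if "i < n" "j < n" for i j
    using that by (auto simp: Y_def star_diff star_scaleR herm star_one star_zero star_minus)
  have "A i j = (\<Sum>k<n. star (sqrt K *\<^sub>R mat_sqrt n Y k i) * (sqrt K *\<^sub>R mat_sqrt n Y k j))"
    if "i < n" "j < n" for i j
  proof -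
    have "(\<Sum>k<n. star (sqrt K *\<^sub>R mat_sqrt n Y k i) * (sqrt K *\<^sub>R mat_sqrt n Y k j)) =
        K *\<^sub>R (\<Sum>k<n. star (mat_sqrt n Y k i) * mat_sqrt n Y k j)"
      using K by (simp add: star_scaleR scaleR_sum_right)
    also have "\<dots> = K *\<^sub>R ((if i = j then 1 else 0) - Y i j)"
      using mat_sqrt_square[OF hermY posY le that] by simp
    also have "\<dots> = A i j" using K by (simp add: Y_def)
    finally show ?thesis by simp
  qed
  then show ?thesis
    unfolding mat_positive_def by (intro exI[of _ "\<lambda>k i. sqrt K *\<^sub>R mat_sqrt n Y k i"]) blast
qed

lemma mat_positive_iff: "mat_positive n A \<longleftrightarrow> mat_nonneg n A"
  using mat_positive_imp_nonneg mat_nonneg_imp_positive by blast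

section \<open>Correspondences\<close>

context pre_hilbert
begin

text \<open>The norm bound at the vectors u b, for all b, is the hypothesis of
  \<open>cpos_diff_by_norm\<close>: right modularity turns an inequality of norms into one of
  positive elements.\<close>

lemma Paschke:
  assumes mem: "\<And>u. u \<in> bm_carrier V \<Longrightarrow> T u \<in> bm_carrier V"
    and T_right: "\<And>u b. u \<in> bm_carrier V \<Longrightarrow> T (bm_right V u b) = bm_right V (T u) b"
    and bound: "\<And>u. u \<in> bm_carrier V \<Longrightarrow> seminorm (T u) \<le> R * seminorm u"
    and u: "u \<in> bm_carrier V"
  shows "cpos (R\<^sup>2 *\<^sub>R bm_inner V u u - bm_inner V (T u) (T u))"
proof (rule cpos_diff_by_norm)
  fix b
  have "norm (star b * bm_inner V (T u) (T u) * b) = (seminorm (T (bm_right V u b)))\<^sup>2"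
    using u by (simp add: T_right seminorm_square inner_simps mem mult.assoc)
  also have "\<dots> \<le> (R * seminorm (bm_right V u b))\<^sup>2"
    using u by (intro power_mono bound) (auto simp: inner_simps)
  also have "\<dots> = R\<^sup>2 * norm (star b * bm_inner V u u * b)"
    using u by (simp add: power_mult_distrib seminorm_square inner_simps mult.assoc)
  finally show "norm (star b * bm_inner V (T u) (T u) * b) \<le> R\<^sup>2 * norm (star b * bm_inner V u u * b)" .
qed (use u in \<open>auto intro: inner_pos mem\<close>)

lemma bm_dist_refl: "u \<in> bm_carrier V \<Longrightarrow> bm_dist V u u = 0"
  by (simp add: bm_dist_eq seminorm_def inner_simps)

lemma bm_dist_nonneg [simp]: "bm_dist V u v \<ge> 0"
  by (simp add: bm_dist_eq)

lemma bm_dist_commute: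
  assumes "u \<in> bm_carrier V" "v \<in> bm_carrier V" shows "bm_dist V u v = bm_dist V v u"
proof -
  have "bm_inner V (diff u v) (diff u v) = bm_inner V (diff v u) (diff v u)"
    using assms by (simp add: inner_simps algebra_simps)
  then show ?thesis by (simp add: bm_dist_eq seminorm_def)
qed

lemma bm_dist_triangle:
  assumes "u \<in> bm_carrier V" "v \<in> bm_carrier V" "w \<in> bm_carrier V"
  shows "bm_dist V u w \<le> bm_dist V u v + bm_dist V v w"
proof -
  have "bm_inner V (diff u w) (diff u w) =
      bm_inner V (bm_add V (diff u v) (diff v w)) (bm_add V (diff u v) (diff v w))"
    using assms by (simp add: inner_simps algebra_simps)
  then have "bm_dist V u w = seminorm (bm_add V (diff u v) (diff v w))"
    by (simp add: bm_dist_eq seminorm_def)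
  also have "\<dots> \<le> bm_dist V u v + bm_dist V v w"
    unfolding bm_dist_eq using assms by (intro seminorm_add diff_mem)
  finally show ?thesis .
qed

lemma bm_dist_eq_0I:
  assumes "u \<in> bm_carrier V" "v \<in> bm_carrier V"
    and "\<And>z. z \<in> bm_carrier V \<Longrightarrow> bm_inner V z u = bm_inner V z v"
  shows "bm_dist V u v = 0"
  using assms(1,2) assms(3)[OF diff_mem[OF assms(1,2)]]
  by (simp add: bm_dist_eq seminorm_def inner_diff diff_mem)

lemma norm_inner_diff:
  assumes "u \<in> bm_carrier V" "v \<in> bm_carrier V" "u' \<in> bm_carrier V" "v' \<in> bm_carrier V"
  shows "norm (bm_inner V u v - bm_inner V u' v') \<le> bm_dist V u u' * seminorm v + seminorm u' * bm_dist V v v'"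
proof -
  have "bm_inner V u v - bm_inner V u' v' = bm_inner V (diff u u') v + bm_inner V u' (diff v v')"
    using assms by (simp add: inner_simps)
  then have "norm (bm_inner V u v - bm_inner V u' v') \<le>
      norm (bm_inner V (diff u u') v) + norm (bm_inner V u' (diff v v'))"
    by (simp add: norm_triangle_ineq)
  also have "\<dots> \<le> seminorm (diff u u') * seminorm v + seminorm u' * seminorm (diff v v')"
    using assms by (intro add_mono Cauchy_Schwarz diff_mem)
  finally show ?thesis by (simp add: bm_dist_eq)
qed

lemma seminorm_le_bm_dist:
  assumes "u \<in> bm_carrier V" "v \<in> bm_carrier V"
  shows "seminorm u \<le> bm_dist V u v + seminorm v"
proof -
  have "bm_inner V u u = bm_inner V (bm_add V (diff u v) v) (bm_add V (diff u v) v)"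
    using assms by (simp add: inner_simps algebra_simps)
  then have "seminorm u = seminorm (bm_add V (diff u v) v)" by (simp add: seminorm_def)
  also have "\<dots> \<le> bm_dist V u v + seminorm v"
    unfolding bm_dist_eq using assms by (intro seminorm_add diff_mem)
  finally show ?thesis .
qed

subsection \<open>Completion\<close>

lemma CauchyD: "f \<in> bm_Cauchy V \<Longrightarrow> f n \<in> bm_carrier V"
  by (simp add: bm_Cauchy_def)

lemma const_Cauchy: "u \<in> bm_carrier V \<Longrightarrow> (\<lambda>_. u) \<in> bm_Cauchy V"
  by (simp add: bm_Cauchy_def bm_dist_refl)

lemma Cauchy_bounded:
  assumes f: "f \<in> bm_Cauchy V"
  obtains B where "B > 0" "\<And>n. seminorm (f n) \<le> B"
proof -
  obtain K where K: "\<And>m n. m \<ge> K \<Longrightarrow> n \<ge> K \<Longrightarrow> bm_dist V (f m) (f n) < 1"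
    using f by (auto simp: bm_Cauchy_def dest!: spec[of _ "1::real"])
  define B where "B = (\<Sum>n<K. seminorm (f n)) + seminorm (f K) + 1"
  have s: "(\<Sum>n<K. seminorm (f n)) \<ge> 0" by (simp add: sum_nonneg)
  have "seminorm (f n) \<le> B" for n
  proof (cases "n < K")
    case True
    then have "seminorm (f n) \<le> (\<Sum>n<K. seminorm (f n))" by (intro member_le_sum) auto
    then show ?thesis using seminorm_nonneg[of "f K"] unfolding B_def by linarith
  next
    case False
    then have "bm_dist V (f n) (f K) < 1" using K by simp
    then show ?thesis
      using seminorm_le_bm_dist[OF CauchyD[OF f] CauchyD[OF f], of n K] s unfolding B_def by linarith
  qed
  moreover have "B > 0" using s seminorm_nonneg[of "f K"] unfolding B_def by linarith
  ultimately show thesis by (rule that[rotated])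
qed

lemma cl_class_eqI:
  assumes f: "f \<in> bm_Cauchy V" and g: "g \<in> bm_Cauchy V"
    and fg: "(\<lambda>n. bm_dist V (f n) (g n)) \<longlonglongrightarrow> 0"
  shows "cl_class V f = cl_class V g"
proof -
  have *: "cl_class V f \<subseteq> cl_class V g"
    if f: "f \<in> bm_Cauchy V" and g: "g \<in> bm_Cauchy V" and fg: "(\<lambda>n. bm_dist V (f n) (g n)) \<longlonglongrightarrow> 0" for f g
  proof
    fix h assume h: "h \<in> cl_class V f"
    then have hC: "h \<in> bm_Cauchy V" by (simp add: cl_class_def)
    have "(\<lambda>n. bm_dist V (g n) (h n)) \<longlonglongrightarrow> 0"
    proof (rule tendsto_sandwich[OF always_eventually always_eventually tendsto_const])
      show "\<forall>n. bm_dist V (g n) (h n) \<le> bm_dist V (f n) (g n) + bm_dist V (f n) (h n)"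
        using bm_dist_triangle[OF CauchyD[OF g] CauchyD[OF f] CauchyD[OF hC]]
          bm_dist_commute[OF CauchyD[OF g] CauchyD[OF f]] by metis
      show "(\<lambda>n. bm_dist V (f n) (g n) + bm_dist V (f n) (h n)) \<longlonglongrightarrow> 0"
        using tendsto_add[OF fg, of "\<lambda>n. bm_dist V (f n) (h n)" 0] h by (simp add: cl_class_def)
    qed simp
    then show "h \<in> cl_class V g" using hC by (simp add: cl_class_def)
  qed
  have "(\<lambda>n. bm_dist V (g n) (f n)) = (\<lambda>n. bm_dist V (f n) (g n))"
    by (intro ext bm_dist_commute CauchyD f g)
  then show ?thesis using *[OF f g fg] *[OF g f] fg by auto
qed

lemma cl_rep_class:
  assumes f: "f \<in> bm_Cauchy V"
  shows "cl_rep (cl_class V f) \<in> bm_Cauchy V" "cl_class V (cl_rep (cl_class V f)) = cl_class V f"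
    "(\<lambda>n. bm_dist V (cl_rep (cl_class V f) n) (f n)) \<longlonglongrightarrow> 0"
proof -
  have "f \<in> cl_class V f" using f by (simp add: cl_class_def bm_dist_refl CauchyD)
  then have r: "cl_rep (cl_class V f) \<in> cl_class V f"
    unfolding cl_rep_def using someI[of "\<lambda>g. g \<in> cl_class V f" f] by simp
  have m: "g \<in> bm_Cauchy V \<and> (\<lambda>n. bm_dist V (f n) (g n)) \<longlonglongrightarrow> 0" if "g \<in> cl_class V f" for g
    using that by (simp add: cl_class_def)
  show rC: "cl_rep (cl_class V f) \<in> bm_Cauchy V" using m[OF r] ..
  have d: "(\<lambda>n. bm_dist V (f n) (cl_rep (cl_class V f) n)) \<longlonglongrightarrow> 0"
    using m[OF r] ..
  show "cl_class V (cl_rep (cl_class V f)) = cl_class V f"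
    by (rule cl_class_eqI[OF f rC d, symmetric])
  show "(\<lambda>n. bm_dist V (cl_rep (cl_class V f) n) (f n)) \<longlonglongrightarrow> 0"
    unfolding bm_dist_commute[OF CauchyD[OF rC] CauchyD[OF f]] by (rule d)
qed

lemma completion_cases:
  assumes "A \<in> bm_carrier (completion V)"
  obtains f where "f \<in> bm_Cauchy V" "A = cl_class V f"
  using assms by (auto simp: completion_def)

lemma cl_class_mem: "f \<in> bm_Cauchy V \<Longrightarrow> cl_class V f \<in> bm_carrier (completion V)"
  by (simp add: completion_def)

lemma cl_embed_mem: "u \<in> bm_carrier V \<Longrightarrow> cl_embed V u \<in> bm_carrier (completion V)"
  by (simp add: cl_embed_def cl_class_mem const_Cauchy)

lemma inner_Cauchy_convergent:
  assumes f: "f \<in> bm_Cauchy V" and g: "g \<in> bm_Cauchy V"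
  shows "convergent (\<lambda>n. bm_inner V (f n) (g n))"
proof (rule Cauchy_convergent, rule metric_CauchyI)
  fix e :: real assume e: "e > 0"
  obtain B1 where B1: "B1 > 0" "\<And>n. seminorm (f n) \<le> B1" using Cauchy_bounded[OF f] by metis
  obtain B2 where B2: "B2 > 0" "\<And>n. seminorm (g n) \<le> B2" using Cauchy_bounded[OF g] by metis
  define S where "S = B1 + B2"
  define d where "d = e / 2 / S"
  have S: "S > 0" using B1 B2 by (simp add: S_def)
  have d: "d > 0" using e S by (simp add: d_def)
  obtain K1 where K1: "\<And>m n. m \<ge> K1 \<Longrightarrow> n \<ge> K1 \<Longrightarrow> bm_dist V (f m) (f n) < d"
    using f d unfolding bm_Cauchy_def by blast
  obtain K2 where K2: "\<And>m n. m \<ge> K2 \<Longrightarrow> n \<ge> K2 \<Longrightarrow> bm_dist V (g m) (g n) < d"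
    using g d unfolding bm_Cauchy_def by blast
  show "\<exists>M. \<forall>m\<ge>M. \<forall>n\<ge>M. dist (bm_inner V (f m) (g m)) (bm_inner V (f n) (g n)) < e"
  proof (intro exI[of _ "max K1 K2"] allI impI)
    fix m n assume mn: "max K1 K2 \<le> m" "max K1 K2 \<le> n"
    have "dist (bm_inner V (f m) (g m)) (bm_inner V (f n) (g n)) \<le>
        bm_dist V (f m) (f n) * seminorm (g m) + seminorm (f n) * bm_dist V (g m) (g n)"
      unfolding dist_norm by (intro norm_inner_diff CauchyD f g)
    also have "\<dots> \<le> d * B2 + B1 * d"
      using K1[of m n] K2[of m n] mn B1 B2 d by (intro add_mono mult_mono) (auto simp: less_imp_le)
    also have "\<dots> = d * S" by (simp add: S_def algebra_simps)
    also have "\<dots> = e / 2" using S by (simp add: d_def)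
    also have "\<dots> < e" using e by simp
    finally show "dist (bm_inner V (f m) (g m)) (bm_inner V (f n) (g n)) < e" .
  qed
qed

lemma tendsto_inner_diff_0:
  assumes f: "f \<in> bm_Cauchy V" and g: "g \<in> bm_Cauchy V" and f': "f' \<in> bm_Cauchy V" and g': "g' \<in> bm_Cauchy V"
    and ff': "(\<lambda>n. bm_dist V (f n) (f' n)) \<longlonglongrightarrow> 0" and gg': "(\<lambda>n. bm_dist V (g n) (g' n)) \<longlonglongrightarrow> 0"
  shows "(\<lambda>n. bm_inner V (f n) (g n) - bm_inner V (f' n) (g' n)) \<longlonglongrightarrow> 0"
proof -
  obtain B1 where B1: "B1 > 0" "\<And>n. seminorm (f' n) \<le> B1" using Cauchy_bounded[OF f'] by metis
  obtain B2 where B2: "B2 > 0" "\<And>n. seminorm (g n) \<le> B2" using Cauchy_bounded[OF g] by metis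
  show ?thesis
  proof (rule Lim_null_comparison[OF always_eventually])
    have "norm (bm_inner V (f n) (g n) - bm_inner V (f' n) (g' n))
        \<le> bm_dist V (f n) (f' n) * B2 + B1 * bm_dist V (g n) (g' n)" for n
      using norm_inner_diff[OF CauchyD[OF f] CauchyD[OF g] CauchyD[OF f'] CauchyD[OF g'], of n n n n]
        mult_left_mono[OF B2(2), of "bm_dist V (f n) (f' n)" n]
        mult_right_mono[OF B1(2), of "bm_dist V (g n) (g' n)" n] by simp
    then show "\<forall>n. norm (bm_inner V (f n) (g n) - bm_inner V (f' n) (g' n))
        \<le> bm_dist V (f n) (f' n) * B2 + B1 * bm_dist V (g n) (g' n)" by blast
    show "(\<lambda>n. bm_dist V (f n) (f' n) * B2 + B1 * bm_dist V (g n) (g' n)) \<longlonglongrightarrow> 0"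
      using tendsto_add[OF tendsto_mult_right[OF ff', of B2] tendsto_mult_left[OF gg', of B1]] by simp
  qed
qed

text \<open>The inner product of the completion is computed on chosen representatives; another
  choice changes the sequence of inner products by a null sequence.\<close>

lemma inner_completion:
  assumes f: "f \<in> bm_Cauchy V" and g: "g \<in> bm_Cauchy V"
  shows "(\<lambda>n. bm_inner V (f n) (g n)) \<longlonglongrightarrow> bm_inner (completion V) (cl_class V f) (cl_class V g)"
proof -
  let ?f = "cl_rep (cl_class V f)" and ?g = "cl_rep (cl_class V g)"
  have "(\<lambda>n. bm_inner V (?f n) (?g n)) \<longlonglongrightarrow> bm_inner (completion V) (cl_class V f) (cl_class V g)"
    using inner_Cauchy_convergent[OF cl_rep_class(1)[OF f] cl_rep_class(1)[OF g]]
    by (simp add: completion_def convergent_LIMSEQ_iff)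
  from tendsto_diff[OF this tendsto_inner_diff_0[OF cl_rep_class(1)[OF f] cl_rep_class(1)[OF g] f g
      cl_rep_class(3)[OF f] cl_rep_class(3)[OF g]]]
  show ?thesis by simp
qed

lemma inner_cl_embed:
  "u \<in> bm_carrier V \<Longrightarrow> v \<in> bm_carrier V \<Longrightarrow>
    bm_inner (completion V) (cl_embed V u) (cl_embed V v) = bm_inner V u v"
  using inner_completion[OF const_Cauchy const_Cauchy, of u v] LIMSEQ_unique tendsto_const
  by (metis cl_embed_def)

text \<open>Separation identifies vectors with the same inner products. This is how a weak equation
  between formal sums becomes an equality.\<close>

lemma cl_embed_eqI:
  assumes "u \<in> bm_carrier V" "v \<in> bm_carrier V"
    and "\<And>z. z \<in> bm_carrier V \<Longrightarrow> bm_inner V z u = bm_inner V z v"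
  shows "cl_embed V u = cl_embed V v"
  unfolding cl_embed_def
  by (rule cl_class_eqI) (use assms bm_dist_eq_0I[OF assms] in \<open>auto simp: const_Cauchy\<close>)

lemma add_completion:
  assumes f: "f \<in> bm_Cauchy V" and g: "g \<in> bm_Cauchy V"
  shows "(\<lambda>n. bm_add V (f n) (g n)) \<in> bm_Cauchy V"
    and "bm_add (completion V) (cl_class V f) (cl_class V g) = cl_class V (\<lambda>n. bm_add V (f n) (g n))"
proof -
  have le: "bm_dist V (bm_add V u v) (bm_add V u' v') \<le> bm_dist V u u' + bm_dist V v v'"
    if "u \<in> bm_carrier V" "v \<in> bm_carrier V" "u' \<in> bm_carrier V" "v' \<in> bm_carrier V" for u v u' v'
  proof -
    have "bm_inner V (diff (bm_add V u v) (bm_add V u' v')) (diff (bm_add V u v) (bm_add V u' v')) =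
        bm_inner V (bm_add V (diff u u') (diff v v')) (bm_add V (diff u u') (diff v v'))"
      using that by (simp add: inner_simps algebra_simps)
    then show ?thesis
      using seminorm_add[of "diff u u'" "diff v v'"] that by (simp add: bm_dist_eq seminorm_def diff_mem)
  qed
  have *: "(\<lambda>n. bm_add V (f n) (g n)) \<in> bm_Cauchy V"
    if f: "f \<in> bm_Cauchy V" and g: "g \<in> bm_Cauchy V" for f g
    unfolding bm_Cauchy_def
  proof (intro CollectI conjI allI impI)
    fix e :: real assume "e > 0"
    then have e: "e / 2 > 0" by simp
    obtain K1 where K1: "\<And>m n. m \<ge> K1 \<Longrightarrow> n \<ge> K1 \<Longrightarrow> bm_dist V (f m) (f n) < e / 2"
      using f e unfolding bm_Cauchy_def by blast
    obtain K2 where K2: "\<And>m n. m \<ge> K2 \<Longrightarrow> n \<ge> K2 \<Longrightarrow> bm_dist V (g m) (g n) < e / 2"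
      using g e unfolding bm_Cauchy_def by blast
    show "\<exists>K. \<forall>m\<ge>K. \<forall>n\<ge>K. bm_dist V (bm_add V (f m) (g m)) (bm_add V (f n) (g n)) < e"
    proof (intro exI[of _ "max K1 K2"] allI impI)
      fix m n assume "max K1 K2 \<le> m" "max K1 K2 \<le> n"
      then show "bm_dist V (bm_add V (f m) (g m)) (bm_add V (f n) (g n)) < e"
        using le[OF CauchyD[OF f] CauchyD[OF g] CauchyD[OF f] CauchyD[OF g], of m m n n]
          K1[of m n] K2[of m n] by simp
    qed
  qed (use f g in \<open>auto simp: add_mem CauchyD\<close>)
  show "(\<lambda>n. bm_add V (f n) (g n)) \<in> bm_Cauchy V" by (rule *[OF f g])
  let ?f = "cl_rep (cl_class V f)" and ?g = "cl_rep (cl_class V g)"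
  have "cl_class V (\<lambda>n. bm_add V (?f n) (?g n)) = cl_class V (\<lambda>n. bm_add V (f n) (g n))"
  proof (rule cl_class_eqI)
    show "(\<lambda>n. bm_dist V (bm_add V (?f n) (?g n)) (bm_add V (f n) (g n))) \<longlonglongrightarrow> 0"
    proof (rule tendsto_sandwich[OF always_eventually always_eventually tendsto_const])
      show "\<forall>n. bm_dist V (bm_add V (?f n) (?g n)) (bm_add V (f n) (g n))
          \<le> bm_dist V (?f n) (f n) + bm_dist V (?g n) (g n)"
        using le f g cl_rep_class(1) CauchyD by blast
      show "(\<lambda>n. bm_dist V (?f n) (f n) + bm_dist V (?g n) (g n)) \<longlonglongrightarrow> 0"
        using tendsto_add[OF cl_rep_class(3)[OF f] cl_rep_class(3)[OF g]] by simp
    qed simp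
  qed (use * f g cl_rep_class(1) in auto)
  then show "bm_add (completion V) (cl_class V f) (cl_class V g) = cl_class V (\<lambda>n. bm_add V (f n) (g n))"
    by (simp add: completion_def)
qed

end

text \<open>\<open>cl_extend\<close> applies the map to a chosen Cauchy representative; the
  Lipschitz bound makes the class of the result independent of the choice.\<close>

lemma cl_extend_class:
  assumes V: "pre_hilbert V" and W: "pre_hilbert W"
    and mem: "\<And>u. u \<in> bm_carrier V \<Longrightarrow> \<phi> u \<in> bm_carrier W"
    and lip: "\<And>u v. u \<in> bm_carrier V \<Longrightarrow> v \<in> bm_carrier V \<Longrightarrow> bm_dist W (\<phi> u) (\<phi> v) \<le> K * bm_dist V u v"
    and f: "f \<in> bm_Cauchy V"
  shows "(\<lambda>n. \<phi> (f n)) \<in> bm_Cauchy W"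
    and "cl_extend W \<phi> (cl_class V f) = cl_class W (\<lambda>n. \<phi> (f n))"
proof -
  interpret V: pre_hilbert V by (rule V)
  interpret W: pre_hilbert W by (rule W)
  define L where "L = \<bar>K\<bar> + 1"
  have L: "L > 0" by (simp add: L_def add_nonneg_pos)
  have KL: "K \<le> L" using abs_ge_self[of K] by (simp add: L_def)
  have lip': "bm_dist W (\<phi> u) (\<phi> v) \<le> L * bm_dist V u v" if "u \<in> bm_carrier V" "v \<in> bm_carrier V" for u v
    using lip[OF that] mult_right_mono[OF KL, of "bm_dist V u v"] by simp
  have *: "(\<lambda>n. \<phi> (f n)) \<in> bm_Cauchy W" if f: "f \<in> bm_Cauchy V" for f
    unfolding bm_Cauchy_def
  proof (intro CollectI conjI allI impI)
    fix e :: real assume e: "e > 0"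
    then have "e / L > 0" using L by simp
    then obtain k where k: "\<And>m n. m \<ge> k \<Longrightarrow> n \<ge> k \<Longrightarrow> bm_dist V (f m) (f n) < e / L"
      using f unfolding bm_Cauchy_def by blast
    have "bm_dist W (\<phi> (f m)) (\<phi> (f n)) < e" if "m \<ge> k" "n \<ge> k" for m n
    proof -
      have "bm_dist W (\<phi> (f m)) (\<phi> (f n)) \<le> L * bm_dist V (f m) (f n)"
        by (intro lip' V.CauchyD f)
      also have "\<dots> < e" using k[OF that] L by (simp add: field_simps)
      finally show ?thesis .
    qed
    then show "\<exists>K. \<forall>m\<ge>K. \<forall>n\<ge>K. bm_dist W (\<phi> (f m)) (\<phi> (f n)) < e" by blast
  qed (use f in \<open>auto simp: mem V.CauchyD\<close>)
  show "(\<lambda>n. \<phi> (f n)) \<in> bm_Cauchy W" by (rule *[OF f])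
  let ?f = "cl_rep (cl_class V f)"
  have "cl_class W (\<lambda>n. \<phi> (?f n)) = cl_class W (\<lambda>n. \<phi> (f n))"
  proof (rule W.cl_class_eqI)
    show "(\<lambda>n. bm_dist W (\<phi> (?f n)) (\<phi> (f n))) \<longlonglongrightarrow> 0"
    proof (rule tendsto_sandwich[OF always_eventually always_eventually tendsto_const])
      show "\<forall>n. bm_dist W (\<phi> (?f n)) (\<phi> (f n)) \<le> L * bm_dist V (?f n) (f n)"
        using lip' f V.cl_rep_class(1) V.CauchyD by blast
      show "(\<lambda>n. L * bm_dist V (?f n) (f n)) \<longlonglongrightarrow> 0"
        using tendsto_mult_left[OF V.cl_rep_class(3)[OF f], of L] by simp
    qed simp
  qed (use * f V.cl_rep_class(1) in auto)
  then show "cl_extend W \<phi> (cl_class V f) = cl_class W (\<lambda>n. \<phi> (f n))" by (simp add: cl_extend_def)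
qed

lemma cl_extend_embed:
  assumes "pre_hilbert V" "pre_hilbert W"
    and "\<And>u. u \<in> bm_carrier V \<Longrightarrow> \<phi> u \<in> bm_carrier W"
    and "\<And>u v. u \<in> bm_carrier V \<Longrightarrow> v \<in> bm_carrier V \<Longrightarrow> bm_dist W (\<phi> u) (\<phi> v) \<le> K * bm_dist V u v"
    and "u \<in> bm_carrier V"
  shows "cl_extend W \<phi> (cl_embed V u) = cl_embed W (\<phi> u)"
  unfolding cl_embed_def
  using cl_extend_class(2)[OF assms(1-4) pre_hilbert.const_Cauchy[OF assms(1,5)]] by simp

locale pre_correspondence = pre_hilbert V
  for V :: "('v, 'b::unital_cstar_algebra) bimod" +
  assumes zero_mem: "bm_zero V \<in> bm_carrier V"
    and left_mem: "\<And>u a. u \<in> bm_carrier V \<Longrightarrow> bm_left V a u \<in> bm_carrier V"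
    and inner_zero: "\<And>w. w \<in> bm_carrier V \<Longrightarrow> bm_inner V w (bm_zero V) = 0"
    and inner_left: "\<And>u w a. u \<in> bm_carrier V \<Longrightarrow> w \<in> bm_carrier V \<Longrightarrow>
      bm_inner V w (bm_left V a u) = bm_inner V (bm_left V (star a) w) u"
    and inner_left_add: "\<And>u w a b. u \<in> bm_carrier V \<Longrightarrow> w \<in> bm_carrier V \<Longrightarrow>
      bm_inner V w (bm_left V (a + b) u) = bm_inner V w (bm_left V a u) + bm_inner V w (bm_left V b u)"
    and inner_left_mult: "\<And>u w a b. u \<in> bm_carrier V \<Longrightarrow> w \<in> bm_carrier V \<Longrightarrow>
      bm_inner V w (bm_left V (a * b) u) = bm_inner V w (bm_left V a (bm_left V b u))"
    and inner_left_one: "\<And>u w. u \<in> bm_carrier V \<Longrightarrow> w \<in> bm_carrier V \<Longrightarrow>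
      bm_inner V w (bm_left V 1 u) = bm_inner V w u"
    and inner_left_scaleC: "\<And>u w c a. u \<in> bm_carrier V \<Longrightarrow> w \<in> bm_carrier V \<Longrightarrow>
      bm_inner V w (bm_left V (c *\<^sub>C a) u) = c *\<^sub>C bm_inner V w (bm_left V a u)"
begin

lemma inner_left_scaleR:
  "u \<in> bm_carrier V \<Longrightarrow> w \<in> bm_carrier V \<Longrightarrow>
    bm_inner V w (bm_left V (r *\<^sub>R a) u) = r *\<^sub>R bm_inner V w (bm_left V a u)"
  by (simp add: scaleR_eq_scaleC inner_left_scaleC)

lemma inner_left_left:
  assumes "u \<in> bm_carrier V" "w \<in> bm_carrier V"
  shows "bm_inner V (bm_left V a w) u = bm_inner V w (bm_left V (star a) u)"
  using inner_left[OF assms, of "star a"] by (simp add: star_star)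

lemma inner_zero_left: "w \<in> bm_carrier V \<Longrightarrow> bm_inner V (bm_zero V) w = 0"
  using star_inner[OF _ zero_mem, of w] by (simp add: inner_zero star_zero)

text \<open>Writing \<open>(norm a)\<^sup>2\<close> minus \<open>star a * a\<close> as
  \<open>star c * c\<close> exhibits the defect in the bound as the inner square of
  \<open>bm_left V c u\<close>; the left action is thus bounded automatically.\<close>

lemma seminorm_left:
  assumes u: "u \<in> bm_carrier V" shows "seminorm (bm_left V a u) \<le> norm a * seminorm u"
proof (rule power2_le_imp_le)
  obtain c where c: "of_real ((norm a)\<^sup>2) - star a * a = star c * c"
    using cpos_of_real_diff[of "star a * a" "(norm a)\<^sup>2"]
    by (auto simp: cpos_def star_mult star_star cstar_identity)
  have g: "bm_inner V (bm_left V b u) (bm_left V b u) = bm_inner V u (bm_left V (star b * b) u)" for b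
    using u by (simp add: inner_left_left left_mem inner_left_mult)
  have "star a * a + star c * c = (norm a)\<^sup>2 *\<^sub>R 1" unfolding c[symmetric] by (simp add: of_real_def)
  then have "(norm a)\<^sup>2 *\<^sub>R bm_inner V u u = bm_inner V (bm_left V a u) (bm_left V a u) + bm_inner V (bm_left V c u) (bm_left V c u)"
    unfolding g using u by (simp add: inner_left_add[symmetric] inner_left_scaleR inner_left_one)
  then have "cpos ((norm a)\<^sup>2 *\<^sub>R bm_inner V u u - bm_inner V (bm_left V a u) (bm_left V a u))"
    using u by (simp add: inner_pos left_mem)
  from cpos_norm_mono[OF inner_pos this] u
  have "(seminorm (bm_left V a u))\<^sup>2 \<le> norm ((norm a)\<^sup>2 *\<^sub>R bm_inner V u u)"
    by (simp add: seminorm_square left_mem)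
  then show "(seminorm (bm_left V a u))\<^sup>2 \<le> (norm a * seminorm u)\<^sup>2"
    by (simp add: power_mult_distrib seminorm_square)
qed (simp add: seminorm_nonneg)

lemma bm_dist_left:
  assumes "u \<in> bm_carrier V" "v \<in> bm_carrier V"
  shows "bm_dist V (bm_left V a u) (bm_left V a v) \<le> norm a * bm_dist V u v"
proof -
  have *: "bm_inner V w (diff (bm_left V a u) (bm_left V a v)) = bm_inner V w (bm_left V a (diff u v))"
    if "w \<in> bm_carrier V" for w
    using assms that by (simp add: inner_diff inner_left left_mem diff_mem)
  have "bm_inner V (diff (bm_left V a u) (bm_left V a v)) (diff (bm_left V a u) (bm_left V a v)) =
      bm_inner V (bm_left V a (diff u v)) (bm_left V a (diff u v))"
    using * assms by (metis diff_mem left_mem star_inner)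
  then show ?thesis
    using seminorm_left[OF diff_mem[OF assms], of a] by (simp add: bm_dist_eq seminorm_def)
qed

lemma bm_dist_right:
  assumes "u \<in> bm_carrier V" "v \<in> bm_carrier V"
  shows "bm_dist V (bm_right V u b) (bm_right V v b) \<le> norm b * bm_dist V u v"
proof -
  have "bm_inner V (diff (bm_right V u b) (bm_right V v b)) (diff (bm_right V u b) (bm_right V v b)) =
      bm_inner V (bm_right V (diff u v) b) (bm_right V (diff u v) b)"
    using assms by (simp add: inner_simps algebra_simps)
  then show ?thesis
    using seminorm_right[OF diff_mem[OF assms], of b] by (simp add: bm_dist_eq seminorm_def mult.commute)
qed

lemma left_completion:
  assumes f: "f \<in> bm_Cauchy V"
  shows "(\<lambda>n. bm_left V a (f n)) \<in> bm_Cauchy V"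
    and "bm_left (completion V) a (cl_class V f) = cl_class V (\<lambda>n. bm_left V a (f n))"
  using cl_extend_class[OF pre_hilbert_axioms pre_hilbert_axioms left_mem bm_dist_left f, of a]
  by (simp_all add: completion_def cl_extend_def)

lemma right_completion:
  assumes f: "f \<in> bm_Cauchy V"
  shows "(\<lambda>n. bm_right V (f n) b) \<in> bm_Cauchy V"
    and "bm_right (completion V) (cl_class V f) b = cl_class V (\<lambda>n. bm_right V (f n) b)"
  using cl_extend_class[of V V "\<lambda>u. bm_right V u b" "norm b" f,
      OF pre_hilbert_axioms pre_hilbert_axioms right_mem bm_dist_right f]
  by (simp_all add: completion_def cl_extend_def)

lemma cl_embed_add:
  "u \<in> bm_carrier V \<Longrightarrow> v \<in> bm_carrier V \<Longrightarrow>
    bm_add (completion V) (cl_embed V u) (cl_embed V v) = cl_embed V (bm_add V u v)"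
  by (simp add: cl_embed_def add_completion const_Cauchy)

lemma cl_embed_left:
  "u \<in> bm_carrier V \<Longrightarrow> bm_left (completion V) a (cl_embed V u) = cl_embed V (bm_left V a u)"
  by (simp add: cl_embed_def left_completion const_Cauchy)

lemma cl_embed_right:
  "u \<in> bm_carrier V \<Longrightarrow> bm_right (completion V) (cl_embed V u) b = cl_embed V (bm_right V u b)"
  by (simp add: cl_embed_def right_completion const_Cauchy)

text \<open>Each axiom is an equation between inner products or a closed condition on them, so it
  passes to the limit along representatives.\<close>

lemma pre_correspondence_completion: "pre_correspondence (completion V)"
proof
  fix A B C :: "'v completion" and a b :: 'b and c :: complex
  note cs = completion_cases
  have z: "bm_zero (completion V) = cl_class V (\<lambda>_. bm_zero V)" "(\<lambda>_. bm_zero V) \<in> bm_Cauchy V"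
    by (simp_all add: completion_def cl_embed_def const_Cauchy zero_mem)
  show "bm_zero (completion V) \<in> bm_carrier (completion V)" by (simp add: z cl_class_mem)
  {
    assume "A \<in> bm_carrier (completion V)"
    then obtain f where f: "f \<in> bm_Cauchy V" "A = cl_class V f" by (rule cs)
    show "bm_right (completion V) A b \<in> bm_carrier (completion V)"
      and "bm_left (completion V) a A \<in> bm_carrier (completion V)"
      using f by (simp_all add: right_completion left_completion cl_class_mem)
    show "cpos (bm_inner (completion V) A A)"
      unfolding f(2) by (rule cpos_limit[OF inner_completion[OF f(1) f(1)]]) (simp add: inner_pos CauchyD f(1))
    show "bm_inner (completion V) A (bm_zero (completion V)) = 0"
      using inner_completion[OF f(1) z(2)] unfolding f(2) z(1)
      by (simp add: inner_zero CauchyD[OF f(1)] LIMSEQ_const_iff)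
  }
  {
    assume "A \<in> bm_carrier (completion V)" "B \<in> bm_carrier (completion V)"
    then obtain f g where f: "f \<in> bm_Cauchy V" "A = cl_class V f" and g: "g \<in> bm_Cauchy V" "B = cl_class V g"
      by (metis cs)
    note fg = CauchyD[OF f(1)] CauchyD[OF g(1)]
    show "bm_add (completion V) A B \<in> bm_carrier (completion V)"
      using f g by (simp add: add_completion cl_class_mem)
    show "star (bm_inner (completion V) A B) = bm_inner (completion V) B A"
      unfolding f(2) g(2)
      by (rule LIMSEQ_unique[OF tendsto_star[OF inner_completion[OF f(1) g(1)]]])
        (simp add: star_inner fg inner_completion f(1) g(1))
    show "bm_inner (completion V) B (bm_right (completion V) A b) = bm_inner (completion V) B A * b"
      unfolding f(2) g(2) right_completion(2)[OF f(1)]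
      by (rule LIMSEQ_unique[OF inner_completion[OF g(1) right_completion(1)[OF f(1)]]])
        (simp add: inner_right fg tendsto_mult_right inner_completion f(1) g(1))
    note l = left_completion[OF f(1)] left_completion[OF g(1)]
    show "bm_inner (completion V) B (bm_left (completion V) a A) = bm_inner (completion V) (bm_left (completion V) (star a) B) A"
      unfolding f(2) g(2) l
      by (rule LIMSEQ_unique[OF inner_completion[OF g(1) l(1)]])
        (simp add: inner_left fg inner_completion f(1) l)
    show "bm_inner (completion V) B (bm_left (completion V) (a + b) A) =
        bm_inner (completion V) B (bm_left (completion V) a A) + bm_inner (completion V) B (bm_left (completion V) b A)"
      unfolding f(2) g(2) l
      by (rule LIMSEQ_unique[OF inner_completion[OF g(1) l(1)]])
        (simp add: inner_left_add fg tendsto_add inner_completion g(1) l)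
    show "bm_inner (completion V) B (bm_left (completion V) (a * b) A) =
        bm_inner (completion V) B (bm_left (completion V) a (bm_left (completion V) b A))"
      unfolding f(2) g(2) l left_completion(2)[OF l(1)]
      by (rule LIMSEQ_unique[OF inner_completion[OF g(1) l(1)]])
        (simp add: inner_left_mult fg inner_completion g(1) left_completion(1)[OF l(1)])
    show "bm_inner (completion V) B (bm_left (completion V) 1 A) = bm_inner (completion V) B A"
      unfolding f(2) g(2) l
      by (rule LIMSEQ_unique[OF inner_completion[OF g(1) l(1)]])
        (simp add: inner_left_one fg inner_completion f(1) g(1))
    show "bm_inner (completion V) B (bm_left (completion V) (c *\<^sub>C a) A) = c *\<^sub>C bm_inner (completion V) B (bm_left (completion V) a A)"
      unfolding f(2) g(2) l
      by (rule LIMSEQ_unique[OF inner_completion[OF g(1) l(1)]])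
        (simp add: inner_left_scaleC fg tendsto_scaleC inner_completion g(1) l)
  }
  {
    assume "A \<in> bm_carrier (completion V)" "B \<in> bm_carrier (completion V)" "C \<in> bm_carrier (completion V)"
    then obtain f g h where f: "f \<in> bm_Cauchy V" "A = cl_class V f" and g: "g \<in> bm_Cauchy V" "B = cl_class V g"
      and h: "h \<in> bm_Cauchy V" "C = cl_class V h"
      by (metis cs)
    note fgh = CauchyD[OF f(1)] CauchyD[OF g(1)] CauchyD[OF h(1)]
    show "bm_inner (completion V) C (bm_add (completion V) A B) =
        bm_inner (completion V) C A + bm_inner (completion V) C B"
      unfolding f(2) g(2) h(2) add_completion(2)[OF f(1) g(1)]
      by (rule LIMSEQ_unique[OF inner_completion[OF h(1) add_completion(1)[OF f(1) g(1)]]])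
        (simp add: inner_add fgh tendsto_add inner_completion f(1) g(1) h(1))
  }
qed

lemma completion_separated:
  assumes A: "A \<in> bm_carrier (completion V)" and B: "B \<in> bm_carrier (completion V)"
    and 0: "bm_dist (completion V) A B = 0"
  shows "A = B"
proof -
  interpret C: pre_correspondence "completion V" by (rule pre_correspondence_completion)
  obtain f g where f: "f \<in> bm_Cauchy V" "A = cl_class V f" and g: "g \<in> bm_Cauchy V" "B = cl_class V g"
    using A B by (metis completion_cases)
  have d: "(\<lambda>n. diff (f n) (g n)) \<in> bm_Cauchy V" "C.diff A B = cl_class V (\<lambda>n. diff (f n) (g n))"
    unfolding C.diff_def diff_def f(2) g(2)
    using add_completion[OF f(1) right_completion(1)[OF g(1)]] right_completion(2)[OF g(1)] by simp_all
  have "bm_inner (completion V) (C.diff A B) (C.diff A B) = 0"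
    using 0 by (simp add: C.bm_dist_eq C.seminorm_def)
  then have "(\<lambda>n. bm_inner V (diff (f n) (g n)) (diff (f n) (g n))) \<longlonglongrightarrow> 0"
    using inner_completion[OF d(1) d(1)] d(2) by simp
  from tendsto_real_sqrt[OF tendsto_norm[OF this]]
  have "(\<lambda>n. bm_dist V (f n) (g n)) \<longlonglongrightarrow> 0" by (simp add: bm_dist_eq seminorm_def)
  then show ?thesis unfolding f(2) g(2) by (rule cl_class_eqI[OF f(1) g(1)])
qed

text \<open>\<open>bm_add\<close> is not assumed associative or commutative, so a finite sum of
  vectors is described by its inner products.\<close>

lemma vector_sum_exists:
  fixes n :: nat
  assumes "\<And>i. i < n \<Longrightarrow> u i \<in> bm_carrier V"
  shows "\<exists>v\<in>bm_carrier V. \<forall>w\<in>bm_carrier V. bm_inner V w v = (\<Sum>i<n. bm_inner V w (u i))"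
  using assms
proof (induction n)
  case 0
  then show ?case by (intro bexI[of _ "bm_zero V"]) (auto simp: inner_zero zero_mem)
next
  case (Suc n)
  then obtain v where v: "v \<in> bm_carrier V" "\<forall>w\<in>bm_carrier V. bm_inner V w v = (\<Sum>i<n. bm_inner V w (u i))"
    by auto
  then show ?case
    by (intro bexI[of _ "bm_add V v (u n)"]) (auto simp: inner_add Suc.prems add_mem)
qed

lemma gram_sum_pos:
  fixes n :: nat
  assumes u: "\<And>i. i < n \<Longrightarrow> u i \<in> bm_carrier V"
  shows "cpos (\<Sum>i<n. \<Sum>j<n. bm_inner V (u i) (u j))"
proof -
  obtain v where v: "v \<in> bm_carrier V" "\<And>w. w \<in> bm_carrier V \<Longrightarrow> bm_inner V w v = (\<Sum>i<n. bm_inner V w (u i))"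
    using vector_sum_exists[of n u] u by blast
  have "bm_inner V v v = (\<Sum>i<n. star (bm_inner V (u i) v))"
    unfolding v(2)[OF v(1)] by (intro sum.cong HOL.refl) (simp add: star_inner u v(1))
  also have "\<dots> = star (\<Sum>i<n. \<Sum>j<n. bm_inner V (u i) (u j))"
    using u by (simp add: v(2) star_sum)
  finally have "(\<Sum>i<n. \<Sum>j<n. bm_inner V (u i) (u j)) = bm_inner V v v"
    using v(1) by (metis star_star star_inner)
  then show ?thesis using v(1) inner_pos by simp
qed

text \<open>Moving b across the inner product and then past the central vector \<xi> shows that the
  complement is stable under the left action.\<close>

lemma pre_correspondence_compl:
  assumes \<xi>: "\<xi> \<in> bm_carrier V"
    and central: "\<And>h b. h \<in> bm_carrier V \<Longrightarrow> bm_inner V h (bm_left V b \<xi>) = bm_inner V h (bm_right V \<xi> b)"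
  shows "pre_correspondence (bm_compl V \<xi>)"
proof
qed (auto simp: bm_compl_def \<xi> central inner_add inner_add_left inner_right inner_right_left star_inner
    inner_pos zero_mem left_mem inner_zero inner_zero_left inner_left_add inner_left_mult inner_left_one
    inner_left_scaleC inner_left_left add_mem right_mem star_star)

end

section \<open>Tensor products\<close>

lemma sum_list_swap:
  fixes f :: "'x \<Rightarrow> 'y \<Rightarrow> 'z::comm_monoid_add"
  shows "(\<Sum>x\<leftarrow>xs. \<Sum>y\<leftarrow>ys. f x y) = (\<Sum>y\<leftarrow>ys. \<Sum>x\<leftarrow>xs. f x y)"
  by (induction xs) (simp_all add: sum_list_addf)

lemma sum_list_scaleR: "(\<Sum>x\<leftarrow>xs. r *\<^sub>R f x) = r *\<^sub>R (\<Sum>x\<leftarrow>xs. f x :: 'a::real_vector)"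
  by (induction xs) (simp_all add: scaleR_add_right)

lemma sum_list_scaleC: "(\<Sum>x\<leftarrow>xs. c *\<^sub>C f x) = c *\<^sub>C (\<Sum>x\<leftarrow>xs. f x :: 'a::star_algebra_1)"
  by (induction xs) (simp_all add: scaleC_add_right scaleC_zero_right)

abbreviation tensor_valid :: "('h, 'b) bimod list \<Rightarrow> 'h list \<Rightarrow> bool" where
  "tensor_valid Hs hs \<equiv> list_all2 (\<lambda>h H. h \<in> bm_carrier H) hs Hs"

definition pair_inner :: "('h, 'b::unital_cstar_algebra) bimod list \<Rightarrow> 'h list \<times> 'b \<Rightarrow> 'h list \<times> 'b \<Rightarrow> 'b" where
  "pair_inner Hs e f = star (snd e) * elt_inner Hs 1 (fst e) (fst f) * snd f"

lemma pretensor_simps: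
  "bm_zero (pretensor Hs) = []" "bm_add (pretensor Hs) = (@)"
  "bm_left (pretensor Hs) a u = map (elt_left Hs a) u"
  "bm_right (pretensor Hs) u b = map (\<lambda>e. (fst e, snd e * b)) u"
  "bm_inner (pretensor Hs) u v = (\<Sum>e\<leftarrow>u. \<Sum>f\<leftarrow>v. pair_inner Hs e f)"
  "u \<in> bm_carrier (pretensor Hs) \<longleftrightarrow> (\<forall>e\<in>set u. tensor_valid Hs (fst e))"
  by (auto simp: pretensor_def pair_inner_def case_prod_beta')

lemma mat_nonneg_cong:
  assumes "\<And>i j. i < n \<Longrightarrow> j < n \<Longrightarrow> A i j = B i j"
  shows "mat_nonneg n A \<longleftrightarrow> mat_nonneg n B"
proof -
  have "(\<Sum>i<n. \<Sum>j<n. star (x i) * A i j * x j) = (\<Sum>i<n. \<Sum>j<n. star (x i) * B i j * x j)" for x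
    by (intro sum.cong HOL.refl) (simp add: assms)
  then show ?thesis using assms by (auto simp: mat_nonneg_def)
qed

lemma sum_list_form_pos:
  fixes F :: "'x \<times> 'b \<Rightarrow> 'x \<times> 'b \<Rightarrow> 'b::unital_cstar_algebra"
  assumes "mat_nonneg (length u) (\<lambda>i j. F (u ! i) (u ! j))"
  shows "cpos (\<Sum>e\<leftarrow>u. \<Sum>f\<leftarrow>u. star (snd e) * F e f * snd f)"
proof -
  have "cpos (\<Sum>i<length u. \<Sum>j<length u. star (snd (u ! i)) * F (u ! i) (u ! j) * snd (u ! j))"
    using assms unfolding mat_nonneg_def by (elim conjE allE[of _ "\<lambda>i. snd (u ! i)"])
  then show ?thesis by (simp add: sum_list_sum_nth atLeast0LessThan)
qed

lemma mat_nonneg_one: "mat_nonneg n (\<lambda>_ _. 1 :: 'b::unital_cstar_algebra)"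
proof -
  have "(\<Sum>i<n. \<Sum>j<n. star (x i) * x j) = star (\<Sum>i<n. x i) * (\<Sum>i<n. x i :: 'b::unital_cstar_algebra)" for x
    by (simp add: star_sum sum_product)
  then show ?thesis by (simp add: mat_nonneg_def star_one)
qed

context pre_correspondence
begin

lemma inner_left_zero:
  "u \<in> bm_carrier V \<Longrightarrow> w \<in> bm_carrier V \<Longrightarrow> bm_inner V w (bm_left V 0 u) = 0"
  using inner_left_scaleR[of u w 0 1] by simp

lemma inner_left_sum:
  "u \<in> bm_carrier V \<Longrightarrow> w \<in> bm_carrier V \<Longrightarrow>
    bm_inner V w (bm_left V (sum a A) u) = (\<Sum>k\<in>A. bm_inner V w (bm_left V (a k) u))"
  by (induction A rule: infinite_finite_induct) (simp_all add: inner_left_zero inner_left_add)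

text \<open>Insert a factorization of A as the sum over k of \<open>star (C k i) * C k j\<close>:
  the matrix becomes a sum over k of Gram matrices of the vectors
  \<open>bm_left V (C k i) (h i)\<close>.\<close>

lemma mat_nonneg_inner_left:
  assumes A: "mat_nonneg n A" and h: "\<And>i. i < n \<Longrightarrow> h i \<in> bm_carrier V"
  shows "mat_nonneg n (\<lambda>i j. bm_inner V (h i) (bm_left V (A i j) (h j)))"
  unfolding mat_nonneg_def
proof (intro conjI allI impI)
  fix i j assume "i < n" "j < n"
  then show "star (bm_inner V (h i) (bm_left V (A i j) (h j))) = bm_inner V (h j) (bm_left V (A j i) (h i))"
    using A h by (simp add: mat_nonneg_def star_inner left_mem inner_left_left)
next
  fix x
  obtain C where C: "\<And>i j. i < n \<Longrightarrow> j < n \<Longrightarrow> A i j = (\<Sum>k<n. star (C k i) * C k j)"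
    using mat_nonneg_imp_positive[OF A] by (auto simp: mat_positive_def)
  define g where "g k i = bm_right V (bm_left V (C k i) (h i)) (x i)" for k i
  have g: "g k i \<in> bm_carrier V" if "i < n" for k i
    using h[OF that] by (simp add: g_def left_mem right_mem)
  have "(\<Sum>i<n. \<Sum>j<n. star (x i) * bm_inner V (h i) (bm_left V (A i j) (h j)) * x j) =
      (\<Sum>i<n. \<Sum>j<n. \<Sum>k<n. bm_inner V (g k i) (g k j))"
    by (intro sum.cong HOL.refl)
      (simp add: C h g_def inner_left_sum inner_left_mult inner_right inner_right_left inner_left_left
        left_mem right_mem sum_distrib_left sum_distrib_right mult.assoc)
  also have "\<dots> = (\<Sum>i<n. \<Sum>k<n. \<Sum>j<n. bm_inner V (g k i) (g k j))"
    by (intro sum.cong HOL.refl sum.swap)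
  also have "\<dots> = (\<Sum>k<n. \<Sum>i<n. \<Sum>j<n. bm_inner V (g k i) (g k j))"
    by (rule sum.swap)
  finally show "cpos (\<Sum>i<n. \<Sum>j<n. star (x i) * bm_inner V (h i) (bm_left V (A i j) (h j)) * x j)"
    by (simp add: cpos_sum gram_sum_pos g)
qed

end

context
  fixes Hs :: "('h, 'b::unital_cstar_algebra) bimod list"
  assumes Hs: "\<And>H. H \<in> set Hs \<Longrightarrow> pre_correspondence H"
begin

lemma elt_inner_add:
  assumes "tensor_valid Hs hs" "tensor_valid Hs ks"
  shows "elt_inner Hs (a + b) hs ks = elt_inner Hs a hs ks + elt_inner Hs b hs ks"
  using assms Hs
proof (induction Hs arbitrary: a b hs ks rule: list.induct)
  case (Cons H Hs)
  interpret pre_correspondence H using Cons.prems(3) by simp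
  show ?case using Cons by (auto simp: list_all2_Cons2 inner_left_add)
qed simp

lemma elt_inner_scaleC:
  assumes "tensor_valid Hs hs" "tensor_valid Hs ks"
  shows "elt_inner Hs (c *\<^sub>C a) hs ks = c *\<^sub>C elt_inner Hs a hs ks"
  using assms Hs
proof (induction Hs arbitrary: a hs ks rule: list.induct)
  case (Cons H Hs)
  interpret pre_correspondence H using Cons.prems(3) by simp
  show ?case using Cons by (auto simp: list_all2_Cons2 inner_left_scaleC)
qed simp

lemma elt_inner_scaleR:
  assumes "tensor_valid Hs hs" "tensor_valid Hs ks"
  shows "elt_inner Hs (r *\<^sub>R a) hs ks = r *\<^sub>R elt_inner Hs a hs ks"
  by (simp add: scaleR_eq_scaleC elt_inner_scaleC[OF assms])

lemma elt_inner_zero: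
  assumes "tensor_valid Hs hs" "tensor_valid Hs ks" shows "elt_inner Hs 0 hs ks = 0"
  using elt_inner_scaleR[OF assms, of 0 0] by simp

lemma elt_inner_diff:
  assumes "tensor_valid Hs hs" "tensor_valid Hs ks"
  shows "elt_inner Hs (a - b) hs ks = elt_inner Hs a hs ks - elt_inner Hs b hs ks"
  using elt_inner_add[OF assms, of "a - b" b] by simp

lemma star_elt_inner:
  assumes "tensor_valid Hs hs" "tensor_valid Hs ks"
  shows "star (elt_inner Hs a hs ks) = elt_inner Hs (star a) ks hs"
  using assms Hs
proof (induction Hs arbitrary: a hs ks rule: list.induct)
  case (Cons H Hs)
  interpret pre_correspondence H using Cons.prems(3) by simp
  show ?case using Cons by (auto simp: list_all2_Cons2 star_inner left_mem inner_left_left)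
qed simp

lemma elt_left_valid:
  assumes "tensor_valid Hs ks" shows "tensor_valid Hs (fst (elt_left Hs a (ks, b)))"
proof (cases Hs)
  case (Cons H Hs')
  then interpret pre_correspondence H using Hs by simp
  show ?thesis using assms Cons by (auto simp: list_all2_Cons2 left_mem)
qed (use assms in simp)

text \<open>For the empty word \<open>elt_left\<close> acts on the coefficient instead of a tensor
  leg, so only the product of \<open>elt_inner\<close> with the coefficient obeys a uniform
  formula.\<close>

lemma elt_inner_left:
  assumes "tensor_valid Hs hs" "tensor_valid Hs ks"
  shows "elt_inner Hs a hs (fst (elt_left Hs c (ks, d))) * snd (elt_left Hs c (ks, d)) = elt_inner Hs (a * c) hs ks * d"
proof (cases Hs)
  case (Cons H Hs')
  then interpret pre_correspondence H using Hs by simp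
  show ?thesis using assms Cons by (auto simp: list_all2_Cons2 inner_left_mult)
qed (use assms in \<open>simp add: mult.assoc\<close>)

lemma elt_inner_left':
  assumes "tensor_valid Hs hs" "tensor_valid Hs ks"
  shows "star (snd (elt_left Hs c (hs, d))) * elt_inner Hs a (fst (elt_left Hs c (hs, d))) ks = star d * elt_inner Hs (star c * a) hs ks"
proof -
  have "star (elt_inner Hs (star a) ks (fst (elt_left Hs c (hs, d))) * snd (elt_left Hs c (hs, d))) =
      star (elt_inner Hs (star a * c) ks hs * d)"
    by (simp only: elt_inner_left[OF assms(2,1)])
  then show ?thesis
    using assms by (simp add: star_mult star_elt_inner elt_left_valid star_star)
qed

text \<open>Each factor replaces the middle matrix by the one in
  \<open>mat_nonneg_inner_left\<close>. Started at the matrix with all entries 1 this gives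
  positivity of the inner product of tensors; started at a general positive matrix it carries an
  operator inequality through the tensor product, as in \<open>tensor_map_bound\<close>.\<close>

lemma mat_nonneg_elt_inner:
  assumes "mat_nonneg n A" "\<And>i. i < n \<Longrightarrow> tensor_valid Hs (hs i)"
  shows "mat_nonneg n (\<lambda>i j. elt_inner Hs (A i j) (hs i) (hs j))"
  using assms Hs
proof (induction Hs arbitrary: A hs rule: list.induct)
  case Nil
  then show ?case by simp
next
  case (Cons H Hs)
  interpret pre_correspondence H using Cons.prems(3) by simp
  have hs: "hs i = hd (hs i) # tl (hs i)" "hd (hs i) \<in> bm_carrier H" "tensor_valid Hs (tl (hs i))"
    if "i < n" for i
    using Cons.prems(2)[OF that] by (auto simp: list_all2_Cons2)
  have "mat_nonneg n (\<lambda>i j. elt_inner Hs (bm_inner H (hd (hs i)) (bm_left H (A i j) (hd (hs j)))) (tl (hs i)) (tl (hs j)))"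
    using Cons.prems hs by (intro Cons.IH mat_nonneg_inner_left) auto
  also have "?this \<longleftrightarrow> ?case"
  proof (rule mat_nonneg_cong)
    fix i j assume ij: "i < n" "j < n"
    show "elt_inner Hs (bm_inner H (hd (hs i)) (bm_left H (A i j) (hd (hs j)))) (tl (hs i)) (tl (hs j)) =
        elt_inner (H # Hs) (A i j) (hs i) (hs j)"
      by (subst (3) hs(1)[OF ij(1)], subst (3) hs(1)[OF ij(2)]) simp
  qed
  finally show ?case .
qed

lemma pre_correspondence_pretensor: "pre_correspondence (pretensor Hs)"
proof
  fix u v w :: "('h, 'b) pretensor" and a b :: 'b and c :: complex
  show "bm_zero (pretensor Hs) \<in> bm_carrier (pretensor Hs)" by (simp add: pretensor_simps)
  {
    assume u: "u \<in> bm_carrier (pretensor Hs)"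
    show "bm_right (pretensor Hs) u b \<in> bm_carrier (pretensor Hs)"
      using u by (auto simp: pretensor_simps)
    show "bm_left (pretensor Hs) a u \<in> bm_carrier (pretensor Hs)"
      using u elt_left_valid by (fastforce simp: pretensor_simps)
    have "mat_nonneg (length u) (\<lambda>i j. elt_inner Hs 1 (fst (u ! i)) (fst (u ! j)))"
      using u by (intro mat_nonneg_elt_inner mat_nonneg_one) (auto simp: pretensor_simps)
    from sum_list_form_pos[OF this] show "cpos (bm_inner (pretensor Hs) u u)"
      by (simp add: pretensor_simps pair_inner_def)
    show "bm_inner (pretensor Hs) u (bm_zero (pretensor Hs)) = 0" by (simp add: pretensor_simps)
  }
  {
    assume u: "u \<in> bm_carrier (pretensor Hs)" and v: "v \<in> bm_carrier (pretensor Hs)"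
    have uv: "tensor_valid Hs (fst e)" "tensor_valid Hs (fst f)" if "e \<in> set u" "f \<in> set v" for e f
      using u v that by (auto simp: pretensor_simps)
    show "bm_add (pretensor Hs) u v \<in> bm_carrier (pretensor Hs)"
      using u v by (auto simp: pretensor_simps)
    have "star (pair_inner Hs e f) = pair_inner Hs f e" if "e \<in> set u" "f \<in> set v" for e f
      using uv[OF that] by (simp add: pair_inner_def star_mult star_star star_elt_inner star_one mult.assoc)
    then have "star (bm_inner (pretensor Hs) u v) = (\<Sum>e\<leftarrow>u. \<Sum>f\<leftarrow>v. pair_inner Hs f e)"
      by (simp add: pretensor_simps star_sum_list o_def cong: map_cong)
    also have "\<dots> = bm_inner (pretensor Hs) v u"
      unfolding pretensor_simps by (rule sum_list_swap)
    finally show "star (bm_inner (pretensor Hs) u v) = bm_inner (pretensor Hs) v u" .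
    show "bm_inner (pretensor Hs) v (bm_right (pretensor Hs) u b) = bm_inner (pretensor Hs) v u * b"
      by (simp add: pretensor_simps o_def pair_inner_def sum_list_mult_const[symmetric] mult.assoc)
    have pl: "pair_inner Hs f (elt_left Hs c e) = star (snd f) * elt_inner Hs c (fst f) (fst e) * snd e"
      if "e \<in> set u" "f \<in> set v" for e f c
      using elt_inner_left[of "fst f" "fst e" 1 c "snd e"] uv[OF that] by (simp add: pair_inner_def mult.assoc)
    have l: "bm_inner (pretensor Hs) v (bm_left (pretensor Hs) c u) =
        (\<Sum>f\<leftarrow>v. \<Sum>e\<leftarrow>u. star (snd f) * elt_inner Hs c (fst f) (fst e) * snd e)" for c
      by (simp add: pretensor_simps o_def pl cong: map_cong)
    have pl': "pair_inner Hs (elt_left Hs (star c) f) e = star (snd f) * elt_inner Hs c (fst f) (fst e) * snd e"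
      if "e \<in> set u" "f \<in> set v" for e f c
      using elt_inner_left'[of "fst f" "fst e" "star c" "snd f" 1] uv[OF that]
      by (simp add: pair_inner_def star_star)
    show "bm_inner (pretensor Hs) v (bm_left (pretensor Hs) a u) = bm_inner (pretensor Hs) (bm_left (pretensor Hs) (star a) v) u"
      unfolding l by (simp add: pretensor_simps o_def pl' cong: map_cong)
    show "bm_inner (pretensor Hs) v (bm_left (pretensor Hs) (a + b) u) =
        bm_inner (pretensor Hs) v (bm_left (pretensor Hs) a u) + bm_inner (pretensor Hs) v (bm_left (pretensor Hs) b u)"
      unfolding l using uv
      by (simp add: elt_inner_add algebra_simps sum_list_addf cong: map_cong)
    show "bm_inner (pretensor Hs) v (bm_left (pretensor Hs) (c *\<^sub>C a) u) = c *\<^sub>C bm_inner (pretensor Hs) v (bm_left (pretensor Hs) a u)"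
      unfolding l using uv
      by (simp add: elt_inner_scaleC sum_list_scaleC mult_scaleC_left mult_scaleC_right cong: map_cong)
    show "bm_inner (pretensor Hs) v (bm_left (pretensor Hs) 1 u) = bm_inner (pretensor Hs) v u"
      unfolding l by (simp add: pretensor_simps pair_inner_def)
    have "pair_inner Hs f (elt_left Hs a (elt_left Hs b e)) = star (snd f) * elt_inner Hs (a * b) (fst f) (fst e) * snd e"
      if "e \<in> set u" "f \<in> set v" for e f
      using elt_inner_left[of "fst f" "fst (elt_left Hs b e)" 1 a "snd (elt_left Hs b e)"]
        elt_inner_left[of "fst f" "fst e" a b "snd e"] elt_left_valid[of "fst e" b "snd e"] uv[OF that]
      by (simp add: pair_inner_def mult.assoc)
    then show "bm_inner (pretensor Hs) v (bm_left (pretensor Hs) (a * b) u) =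
        bm_inner (pretensor Hs) v (bm_left (pretensor Hs) a (bm_left (pretensor Hs) b u))"
      unfolding l by (simp add: pretensor_simps o_def cong: map_cong)
    assume "w \<in> bm_carrier (pretensor Hs)"
    show "bm_inner (pretensor Hs) w (bm_add (pretensor Hs) u v) = bm_inner (pretensor Hs) w u + bm_inner (pretensor Hs) w v"
      by (simp add: pretensor_simps sum_list_addf)
  }
qed

end

text \<open>\<open>K\<close> bounds the square of the norm.\<close>

locale bounded_module_map = pre_correspondence V
  for V :: "('v, 'b::unital_cstar_algebra) bimod" +
  fixes x :: "'v \<Rightarrow> 'v" and K :: real
  assumes map_mem: "\<And>u. u \<in> bm_carrier V \<Longrightarrow> x u \<in> bm_carrier V"
    and map_add: "\<And>u v w. u \<in> bm_carrier V \<Longrightarrow> v \<in> bm_carrier V \<Longrightarrow> w \<in> bm_carrier V \<Longrightarrow>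
      bm_inner V w (x (bm_add V u v)) = bm_inner V w (x u) + bm_inner V w (x v)"
    and map_right: "\<And>u w b. u \<in> bm_carrier V \<Longrightarrow> w \<in> bm_carrier V \<Longrightarrow>
      bm_inner V w (x (bm_right V u b)) = bm_inner V w (x u) * b"
    and map_bound: "\<And>u. u \<in> bm_carrier V \<Longrightarrow> cpos (K *\<^sub>R bm_inner V u u - bm_inner V (x u) (x u))"
begin

lemma map_zero:
  assumes w: "w \<in> bm_carrier V" shows "bm_inner V w (x (bm_zero V)) = 0"
proof -
  have "bm_inner V (x (bm_zero V)) (x (bm_zero V)) = 0"
    using map_bound[OF zero_mem] inner_pos[OF map_mem[OF zero_mem]]
    by (intro cpos_antisym) (simp_all add: inner_zero zero_mem)
  then show ?thesis
    using Cauchy_Schwarz_square[OF w map_mem[OF zero_mem]] by simp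
qed

lemma map_sum_exists:
  fixes n :: nat
  assumes "\<And>i. i < n \<Longrightarrow> u i \<in> bm_carrier V"
  shows "\<exists>v\<in>bm_carrier V. (\<forall>w\<in>bm_carrier V. bm_inner V w v = (\<Sum>i<n. bm_inner V w (u i))) \<and>
    (\<forall>w\<in>bm_carrier V. bm_inner V w (x v) = (\<Sum>i<n. bm_inner V w (x (u i))))"
  using assms
proof (induction n)
  case 0
  show ?case by (intro bexI[of _ "bm_zero V"]) (auto simp: inner_zero zero_mem map_zero)
next
  case (Suc n)
  then obtain v where v: "v \<in> bm_carrier V" "\<forall>w\<in>bm_carrier V. bm_inner V w v = (\<Sum>i<n. bm_inner V w (u i))"
    "\<forall>w\<in>bm_carrier V. bm_inner V w (x v) = (\<Sum>i<n. bm_inner V w (x (u i)))"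
    by auto
  then show ?case
    by (intro bexI[of _ "bm_add V v (u n)"]) (auto simp: inner_add map_add Suc.prems add_mem)
qed

lemma gram_eq:
  fixes n :: nat
  assumes u: "\<And>i. i < n \<Longrightarrow> u i \<in> bm_carrier V" and v: "v \<in> bm_carrier V"
    and vu: "\<forall>w\<in>bm_carrier V. bm_inner V w v = (\<Sum>i<n. bm_inner V w (u i))"
  shows "bm_inner V v v = (\<Sum>i<n. \<Sum>j<n. bm_inner V (u i) (u j))"
proof -
  have "bm_inner V v v = (\<Sum>j<n. star (bm_inner V (u j) v))"
    using vu v star_inner[OF u v] by simp
  also have "\<dots> = (\<Sum>j<n. \<Sum>i<n. bm_inner V (u i) (u j))"
    using vu by (intro sum.cong HOL.refl) (simp add: star_sum star_inner u)
  also have "\<dots> = (\<Sum>i<n. \<Sum>j<n. bm_inner V (u i) (u j))" by (rule sum.swap)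
  finally show ?thesis .
qed

text \<open>The form of this matrix at z is \<open>map_bound\<close> at a vector representing the
  sum of the \<open>bm_right V (u i) (z i)\<close>: a bound valid for every vector is automatically
  one for matrices.\<close>

lemma mat_nonneg_defect:
  assumes u: "\<And>i. i < n \<Longrightarrow> u i \<in> bm_carrier V"
  shows "mat_nonneg n (\<lambda>i j. K *\<^sub>R bm_inner V (u i) (u j) - bm_inner V (x (u i)) (x (u j)))"
  unfolding mat_nonneg_def
proof (intro conjI allI impI)
  fix i j assume "i < n" "j < n"
  then show "star (K *\<^sub>R bm_inner V (u i) (u j) - bm_inner V (x (u i)) (x (u j))) =
      K *\<^sub>R bm_inner V (u j) (u i) - bm_inner V (x (u j)) (x (u i))"
    by (simp add: star_diff star_scaleR star_inner u map_mem)
next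
  fix z :: "nat \<Rightarrow> 'b"
  have uz: "bm_right V (u i) (z i) \<in> bm_carrier V" if "i < n" for i using u[OF that] by (rule right_mem)
  obtain v where v: "v \<in> bm_carrier V"
    "\<forall>w\<in>bm_carrier V. bm_inner V w v = (\<Sum>i<n. bm_inner V w (bm_right V (u i) (z i)))"
    "\<forall>w\<in>bm_carrier V. bm_inner V w (x v) = (\<Sum>i<n. bm_inner V w (x (bm_right V (u i) (z i))))"
    using map_sum_exists[of n "\<lambda>i. bm_right V (u i) (z i)"] uz by blast
  have 1: "bm_inner V v v = (\<Sum>i<n. \<Sum>j<n. star (z i) * bm_inner V (u i) (u j) * z j)"
    using gram_eq[OF uz v(1,2)] by (simp add: inner_right inner_right_left u right_mem mult.assoc)
  have "\<forall>w\<in>bm_carrier V. bm_inner V w (x v) = (\<Sum>i<n. bm_inner V w (bm_right V (x (u i)) (z i)))"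
    using v(3) u by (simp add: map_right inner_right map_mem)
  from gram_eq[OF _ map_mem[OF v(1)] this]
  have 2: "bm_inner V (x v) (x v) = (\<Sum>i<n. \<Sum>j<n. star (z i) * bm_inner V (x (u i)) (x (u j)) * z j)"
    by (simp add: inner_right inner_right_left u map_mem right_mem mult.assoc)
  have "(\<Sum>i<n. \<Sum>j<n. star (z i) * (K *\<^sub>R bm_inner V (u i) (u j) - bm_inner V (x (u i)) (x (u j))) * z j)
      = K *\<^sub>R bm_inner V v v - bm_inner V (x v) (x v)"
    unfolding 1 2 by (simp add: algebra_simps sum_subtractf scaleR_sum_right)
  then show "cpos (\<Sum>i<n. \<Sum>j<n. star (z i) * (K *\<^sub>R bm_inner V (u i) (u j) - bm_inner V (x (u i)) (x (u j))) * z j)"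
    using map_bound[OF v(1)] by simp
qed

section \<open>A module map acting on the first tensor factor\<close>

definition tensor_map :: "('v, 'b) pretensor \<Rightarrow> ('v, 'b) pretensor" where
  "tensor_map = map (\<lambda>(hs, b). (x (hd hs) # tl hs, b))"

context
  fixes Hs :: "('v, 'b) bimod list"
  assumes Hs: "\<And>H. H \<in> set Hs \<Longrightarrow> pre_correspondence H"
begin

lemma VHs: "H \<in> set (V # Hs) \<Longrightarrow> pre_correspondence H"
  using Hs pre_correspondence_axioms by auto

lemma tensor_map_mem:
  "u \<in> bm_carrier (pretensor (V # Hs)) \<Longrightarrow> tensor_map u \<in> bm_carrier (pretensor (V # Hs))"
  by (fastforce simp: tensor_map_def pretensor_simps list_all2_Cons2 map_mem)

text \<open>The inner product of tensors is linear in the middle argument of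
  \<open>elt_inner\<close>, so the defect matrix of the first legs can be passed through the
  remaining factors by \<open>mat_nonneg_elt_inner\<close>.\<close>

lemma tensor_map_bound:
  assumes u: "u \<in> bm_carrier (pretensor (V # Hs))"
  shows "cpos (K *\<^sub>R bm_inner (pretensor (V # Hs)) u u
    - bm_inner (pretensor (V # Hs)) (tensor_map u) (tensor_map u))"
proof -
  have v: "fst e = hd (fst e) # tl (fst e)" "hd (fst e) \<in> bm_carrier V" "tensor_valid Hs (tl (fst e))"
    if "e \<in> set u" for e
    using u that by (auto simp: pretensor_simps list_all2_Cons2)
  define F where "F e f = elt_inner Hs (K *\<^sub>R bm_inner V (hd (fst e)) (hd (fst f)) -
    bm_inner V (x (hd (fst e))) (x (hd (fst f)))) (tl (fst e)) (tl (fst f))" for e f :: "'v list \<times> 'b"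
  have "mat_nonneg (length u) (\<lambda>i j. F (u ! i) (u ! j))"
    unfolding F_def using v
    by (intro mat_nonneg_elt_inner[OF Hs] mat_nonneg_defect[of "length u" "\<lambda>i. hd (fst (u ! i))"]) auto
  from sum_list_form_pos[OF this]
  have "cpos (\<Sum>e\<leftarrow>u. \<Sum>f\<leftarrow>u. star (snd e) * F e f * snd f)" .
  also have "(\<Sum>e\<leftarrow>u. \<Sum>f\<leftarrow>u. star (snd e) * F e f * snd f) =
      (\<Sum>e\<leftarrow>u. \<Sum>f\<leftarrow>u. K *\<^sub>R pair_inner (V # Hs) e f - pair_inner (V # Hs) (x (hd (fst e)) # tl (fst e), snd e) (x (hd (fst f)) # tl (fst f), snd f))"
  proof (intro arg_cong[where f = sum_list] map_cong HOL.refl)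
    fix e f assume e: "e \<in> set u" and f: "f \<in> set u"
    have "pair_inner (V # Hs) e f = star (snd e) * elt_inner Hs (bm_inner V (hd (fst e)) (hd (fst f))) (tl (fst e)) (tl (fst f)) * snd f"
      unfolding pair_inner_def using v(2)[OF e] v(2)[OF f]
      by (subst v(1)[OF e], subst v(1)[OF f]) (simp add: inner_left_one)
    then show "star (snd e) * F e f * snd f = K *\<^sub>R pair_inner (V # Hs) e f - pair_inner (V # Hs) (x (hd (fst e)) # tl (fst e), snd e) (x (hd (fst f)) # tl (fst f), snd f)"
      using v[OF e] v[OF f]
      by (simp add: pair_inner_def F_def elt_inner_diff[OF Hs] elt_inner_scaleR[OF Hs] inner_left_one map_mem algebra_simps)
  qed
  also have "\<dots> = K *\<^sub>R bm_inner (pretensor (V # Hs)) u u - bm_inner (pretensor (V # Hs)) (tensor_map u) (tensor_map u)"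
    by (simp add: pretensor_simps tensor_map_def o_def case_prod_beta' sum_list_subtractf sum_list_scaleR)
  finally show ?thesis .
qed

lemma tensor_map_dist:
  assumes u: "u \<in> bm_carrier (pretensor (V # Hs))" and v: "v \<in> bm_carrier (pretensor (V # Hs))"
  shows "bm_dist (pretensor (V # Hs)) (tensor_map u) (tensor_map v) \<le> sqrt \<bar>K\<bar> * bm_dist (pretensor (V # Hs)) u v"
proof -
  interpret P: pre_correspondence "pretensor (V # Hs)"
    by (rule pre_correspondence_pretensor[OF VHs])
  have "P.diff (tensor_map u) (tensor_map v) = tensor_map (P.diff u v)"
    by (simp add: P.diff_def pretensor_simps tensor_map_def o_def case_prod_beta')
  moreover have d: "P.diff u v \<in> bm_carrier (pretensor (V # Hs))" using u v by (rule P.diff_mem)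
  from cpos_norm_mono[OF P.inner_pos[OF tensor_map_mem[OF d]] tensor_map_bound[OF d]]
  have "sqrt (norm (bm_inner (pretensor (V # Hs)) (tensor_map (P.diff u v)) (tensor_map (P.diff u v))))
      \<le> sqrt (\<bar>K\<bar> * norm (bm_inner (pretensor (V # Hs)) (P.diff u v) (P.diff u v)))"
    by simp
  ultimately show ?thesis by (simp add: P.bm_dist_eq P.seminorm_def real_sqrt_mult)
qed

end

end

section \<open>Module maps on completions\<close>

context bounded_module_map
begin

lemma bm_dist_map:
  assumes u: "u \<in> bm_carrier V" and v: "v \<in> bm_carrier V"
  shows "bm_dist V (x u) (x v) \<le> sqrt \<bar>K\<bar> * bm_dist V u v"
proof -
  have d: "diff u v \<in> bm_carrier V" using u v by (rule diff_mem)
  have eq: "bm_inner V w (diff (x u) (x v)) = bm_inner V w (x (diff u v))" if "w \<in> bm_carrier V" for w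
    using that u v by (simp add: diff_def inner_add inner_right map_add map_right map_mem right_mem)
  have "bm_inner V (diff (x u) (x v)) (diff (x u) (x v)) = bm_inner V (x (diff u v)) (x (diff u v))"
    using eq[of "diff (x u) (x v)"] eq[of "x (diff u v)"] u v d
    by (metis diff_mem map_mem star_inner)
  moreover from cpos_norm_mono[OF inner_pos[OF map_mem[OF d]] map_bound[OF d]]
  have "sqrt (norm (bm_inner V (x (diff u v)) (x (diff u v)))) \<le> sqrt (\<bar>K\<bar> * norm (bm_inner V (diff u v) (diff u v)))"
    by simp
  ultimately show ?thesis by (simp add: bm_dist_eq seminorm_def real_sqrt_mult)
qed

lemma map_completion:
  assumes "f \<in> bm_Cauchy V"
  shows "(\<lambda>n. x (f n)) \<in> bm_Cauchy V" "cl_extend V x (cl_class V f) = cl_class V (\<lambda>n. x (f n))"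
  using cl_extend_class[OF pre_hilbert_axioms pre_hilbert_axioms map_mem bm_dist_map assms] by simp_all

lemma bounded_module_map_completion: "bounded_module_map (completion V) (cl_extend V x) K"
proof -
  interpret C: pre_correspondence "completion V" by (rule pre_correspondence_completion)
  show ?thesis
  proof
    fix A B C :: "'v completion" and b :: 'b
    {
      assume "A \<in> bm_carrier (completion V)"
      then obtain f where f: "f \<in> bm_Cauchy V" "A = cl_class V f" by (rule completion_cases)
      show "cl_extend V x A \<in> bm_carrier (completion V)"
        using f by (simp add: map_completion cl_class_mem)
      show "cpos (K *\<^sub>R bm_inner (completion V) A A - bm_inner (completion V) (cl_extend V x A) (cl_extend V x A))"
        unfolding f(2) map_completion(2)[OF f(1)]
        by (rule cpos_limit[OF tendsto_diff[OF tendsto_scaleR[OF tendsto_const inner_completion[OF f(1) f(1)]]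
              inner_completion[OF map_completion(1)[OF f(1)] map_completion(1)[OF f(1)]]]])
          (simp add: map_bound CauchyD f(1))
    }
    {
      assume "A \<in> bm_carrier (completion V)" "B \<in> bm_carrier (completion V)"
      then obtain f g where f: "f \<in> bm_Cauchy V" "A = cl_class V f" and g: "g \<in> bm_Cauchy V" "B = cl_class V g"
        by (metis completion_cases)
      note m = map_completion[OF f(1)]
      note fr = right_completion[OF f(1)]
      note mr = map_completion[OF fr(1)]
      show "bm_inner (completion V) B (cl_extend V x (bm_right (completion V) A b)) =
          bm_inner (completion V) B (cl_extend V x A) * b"
        unfolding f(2) g(2) fr(2) m(2) mr(2)
        by (rule LIMSEQ_unique[OF inner_completion[OF g(1) mr(1)]])
          (simp add: map_right CauchyD f(1) g(1) tendsto_mult_right inner_completion m(1))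
    }
    {
      assume "A \<in> bm_carrier (completion V)" "B \<in> bm_carrier (completion V)" "C \<in> bm_carrier (completion V)"
      then obtain f g h where f: "f \<in> bm_Cauchy V" "A = cl_class V f" and g: "g \<in> bm_Cauchy V" "B = cl_class V g"
        and h: "h \<in> bm_Cauchy V" "C = cl_class V h"
        by (metis completion_cases)
      note fg = add_completion[OF f(1) g(1)]
      note m = map_completion[OF f(1)] map_completion[OF g(1)] map_completion[OF fg(1)]
      show "bm_inner (completion V) C (cl_extend V x (bm_add (completion V) A B)) =
          bm_inner (completion V) C (cl_extend V x A) + bm_inner (completion V) C (cl_extend V x B)"
        unfolding f(2) g(2) h(2) fg(2) m(2,4,6)
        by (rule LIMSEQ_unique[OF inner_completion[OF h(1) m(5)]])
          (simp add: map_add CauchyD f(1) g(1) h(1) tendsto_add inner_completion m(1,3))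
    }
  qed
qed

lemma cl_extend_map_embed: "u \<in> bm_carrier V \<Longrightarrow> cl_extend V x (cl_embed V u) = cl_embed V (x u)"
  using map_completion(2)[OF const_Cauchy] by (simp add: cl_embed_def)

end

section \<open>The algebra \<open>B\<langle>X\<rangle>\<close> and laws\<close>

lemma coef_add: "coef (a + b) = coef a + coef b"
  and coef_mult: "coef (a * b) = coef a * coef b"
  and coef_one: "coef 1 = 1"
  and coef_scaleC: "coef (c *\<^sub>C a) = c *\<^sub>C coef a"
  using unital_hom_coef by (auto simp: unital_hom_def)

lemma coef_zero: "coef 0 = 0"
  using coef_add[of 0 0] by simp

lemma coef_diff: "coef (a - b) = coef a - coef b"
  using coef_add[of "a - b" b] by simp

lemma star_coef: "star (coef b) = coef (star b)"
  by transfer (simp add: nceq.refl)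

lemma star_indet: "star indet = indet"
  by transfer (simp add: nceq.refl)

lemma scaleC_eq_coef: "c *\<^sub>C p = coef (c *\<^sub>C 1) * p"
  by (metis coef_scaleC coef_one scaleC_eq_mult)

lemma nc_monomial_Nil: "nc_monomial b [] = coef b"
  and nc_monomial_Cons: "nc_monomial b (c # cs) = coef b * (indet * nc_monomial c cs)"
  by (simp_all add: nc_monomial_def mult.assoc)

lemma coef_mult_monomial: "coef a * nc_monomial b bs = nc_monomial (a * b) bs"
  by (simp add: nc_monomial_def coef_mult mult.assoc)

lemma indet_mult_monomial: "indet * nc_monomial b bs = nc_monomial 1 (b # bs)"
  by (simp add: nc_monomial_Cons coef_one)

section \<open>Weighted bounds on polynomials\<close>

definition monomial_weight :: "real \<Rightarrow> 'b::unital_cstar_algebra \<times> 'b list \<Rightarrow> real" where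
  "monomial_weight r m = norm (fst m) * prod_list (map norm (snd m)) * r ^ length (snd m)"

text \<open>An upper bound for the projective seminorm of p in which X has weight r; naming a
  representation by monomials avoids the infimum.\<close>

definition poly_bound :: "real \<Rightarrow> 'b::unital_cstar_algebra ncpoly \<Rightarrow> real \<Rightarrow> bool" where
  "poly_bound r p K \<longleftrightarrow> (\<exists>ms. p = (\<Sum>m\<leftarrow>ms. nc_monomial (fst m) (snd m)) \<and> (\<Sum>m\<leftarrow>ms. monomial_weight r m) \<le> K)"

lemma prod_list_norm_nonneg: "prod_list (map norm bs) \<ge> 0"
  by (induction bs) auto

context
  fixes r :: real
  assumes r: "r \<ge> 0"
begin

lemma poly_bound_one: "poly_bound r 1 1"
  unfolding poly_bound_def
  by (intro exI[of _ "[(1, [])]"]) (simp add: nc_monomial_Nil coef_one monomial_weight_def)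

lemma poly_bound_add:
  assumes "poly_bound r p K" "poly_bound r q L" shows "poly_bound r (p + q) (K + L)"
proof -
  obtain ms ns where "p = (\<Sum>m\<leftarrow>ms. nc_monomial (fst m) (snd m))" "(\<Sum>m\<leftarrow>ms. monomial_weight r m) \<le> K"
    "q = (\<Sum>m\<leftarrow>ns. nc_monomial (fst m) (snd m))" "(\<Sum>m\<leftarrow>ns. monomial_weight r m) \<le> L"
    using assms by (auto simp: poly_bound_def)
  then show ?thesis unfolding poly_bound_def by (intro exI[of _ "ms @ ns"]) simp
qed

lemma poly_bound_coef_mult:
  assumes "poly_bound r p K" shows "poly_bound r (coef a * p) (norm a * K)"
proof -
  obtain ms where ms: "p = (\<Sum>m\<leftarrow>ms. nc_monomial (fst m) (snd m))" "(\<Sum>m\<leftarrow>ms. monomial_weight r m) \<le> K"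
    using assms by (auto simp: poly_bound_def)
  have "monomial_weight r (a * b, bs) \<le> norm a * monomial_weight r (b, bs)" for b bs
    using r mult_right_mono[OF norm_mult_ineq[of a b], of "prod_list (map norm bs) * r ^ length bs"]
    by (simp add: monomial_weight_def prod_list_norm_nonneg mult.assoc)
  then have "(\<Sum>m\<leftarrow>ms. monomial_weight r (a * fst m, snd m)) \<le> (\<Sum>m\<leftarrow>ms. norm a * monomial_weight r m)"
    by (intro sum_list_mono) (metis prod.collapse)
  also have "\<dots> \<le> norm a * K"
    using ms(2) by (simp add: sum_list_const_mult mult_left_mono)
  finally show ?thesis
    unfolding poly_bound_def ms(1)
    by (intro exI[of _ "map (\<lambda>m. (a * fst m, snd m)) ms"])
      (simp add: o_def sum_list_const_mult[symmetric] coef_mult_monomial)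
qed

lemma poly_bound_indet_mult:
  assumes "poly_bound r p K" shows "poly_bound r (indet * p) (r * K)"
proof -
  obtain ms where ms: "p = (\<Sum>m\<leftarrow>ms. nc_monomial (fst m) (snd m))" "(\<Sum>m\<leftarrow>ms. monomial_weight r m) \<le> K"
    using assms by (auto simp: poly_bound_def)
  have "(\<Sum>m\<leftarrow>ms. monomial_weight r (1, fst m # snd m)) = r * (\<Sum>m\<leftarrow>ms. monomial_weight r m)"
    by (simp add: sum_list_const_mult[symmetric] monomial_weight_def algebra_simps)
  also have "\<dots> \<le> r * K" using ms(2) r by (rule mult_left_mono)
  finally show ?thesis
    unfolding poly_bound_def ms(1)
    by (intro exI[of _ "map (\<lambda>m. (1, fst m # snd m)) ms"])
      (simp add: o_def sum_list_const_mult[symmetric] indet_mult_monomial)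
qed

text \<open>Induction on q shows left multiplication by a fixed polynomial to be bounded for the
  weights. With it an exponential bound on moments controls
  \<mu>(\<open>star p * indet ^ (2 * n) * p\<close>) by a multiple of r^(2n).\<close>

lemma poly_bound_mult:
  obtains C where "C \<ge> 0" "\<And>p K. poly_bound r p K \<Longrightarrow> poly_bound r (q * p) (C * K)"
proof -
  have "\<exists>C\<ge>0. \<forall>p K. poly_bound r p K \<longrightarrow> poly_bound r (q * p) (C * K)"
  proof (induction q rule: ncpoly_induct)
    case (coef b)
    then show ?case using poly_bound_coef_mult by (intro exI[of _ "norm b"]) auto
  next
    case indet
    then show ?case using poly_bound_indet_mult r by (intro exI[of _ r]) auto
  next
    case (add p q)
    then obtain C D where CD: "C \<ge> 0" "D \<ge> 0" "\<forall>x K. poly_bound r x K \<longrightarrow> poly_bound r (p * x) (C * K)"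
      "\<forall>x K. poly_bound r x K \<longrightarrow> poly_bound r (q * x) (D * K)" by auto
    have "poly_bound r ((p + q) * x) ((C + D) * K)" if "poly_bound r x K" for x K
      using poly_bound_add[of "p * x" "C * K" "q * x" "D * K"] that CD by (simp add: algebra_simps)
    then show ?case using CD by (intro exI[of _ "C + D"]) auto
  next
    case (mult p q)
    then obtain C D where "C \<ge> 0" "D \<ge> 0" "\<forall>x K. poly_bound r x K \<longrightarrow> poly_bound r (p * x) (C * K)"
      "\<forall>x K. poly_bound r x K \<longrightarrow> poly_bound r (q * x) (D * K)" by auto
    then show ?case by (intro exI[of _ "C * D"]) (auto simp: mult.assoc)
  qed
  then show thesis using that by auto
qed

lemma poly_bound_pow:
  assumes "poly_bound r p K" shows "poly_bound r (indet ^ n * p) (r ^ n * K)"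
  by (induction n) (use assms poly_bound_indet_mult in \<open>simp_all add: mult.assoc\<close>)

end

text \<open>Log-convexity makes the ratios of consecutive terms nondecreasing. If the first ratio
  \<rho> exceeded r, the terms would grow at least like \<rho>^n and outrun the bound.\<close>

lemma log_convex_growth:
  fixes a :: "nat \<Rightarrow> real"
  assumes nn: "\<And>n. a n \<ge> 0" and lc: "\<And>n. (a (Suc n))\<^sup>2 \<le> a n * a (Suc (Suc n))"
    and gr: "\<And>n. (a n)\<^sup>2 \<le> C * r ^ (2 * n)" and r: "r > 0"
  shows "a 1 \<le> r * a 0"
proof (rule ccontr)
  assume c: "\<not> a 1 \<le> r * a 0"
  have a1: "a 1 > 0" using c r nn[of 0] by (smt (verit) mult_nonneg_nonneg)
  have "a 0 \<noteq> 0" using lc[of 0] a1 by auto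
  then have a0: "a 0 > 0" using nn[of 0] by simp
  define \<rho> where "\<rho> = a 1 / a 0"
  have \<rho>: "\<rho> > r" using c a0 by (simp add: \<rho>_def field_simps)
  then have \<rho>0: "\<rho> > 0" using r by simp
  have step: "a (Suc n) \<ge> \<rho> * a n \<and> a n > 0" for n
  proof (induction n)
    case 0
    show ?case using a0 by (simp add: \<rho>_def)
  next
    case (Suc n)
    then have p: "a (Suc n) > 0" using \<rho>0 by (smt (verit) mult_pos_pos)
    have "(\<rho> * a (Suc n)) * a n \<le> a (Suc n) * a (Suc n)"
      using Suc p by (simp add: mult.assoc mult.left_commute mult_left_mono)
    also have "\<dots> \<le> a (Suc (Suc n)) * a n" using lc[of n] by (simp add: power2_eq_square mult.commute)
    finally show ?case using Suc p by (simp add: mult_le_cancel_right)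
  qed
  have low: "a n \<ge> \<rho> ^ n * a 0" for n
  proof (induction n)
    case (Suc n)
    have "\<rho> ^ Suc n * a 0 \<le> \<rho> * a n" using Suc \<rho>0 by (simp add: mult.assoc mult_left_mono)
    then show ?case using step[of n] by simp
  qed simp
  have "((\<rho> / r)\<^sup>2) ^ n \<le> C / (a 0)\<^sup>2" for n
  proof -
    have "(\<rho> ^ n * a 0)\<^sup>2 \<le> (a n)\<^sup>2" using low[of n] \<rho>0 a0 by (intro power_mono) auto
    also have "\<dots> \<le> C * r ^ (2 * n)" by (rule gr)
    finally have "(\<rho> ^ n)\<^sup>2 * (a 0)\<^sup>2 \<le> C * (r ^ n)\<^sup>2"
      by (simp add: power_mult_distrib power_mult[symmetric] mult.commute)
    then have "(\<rho> ^ n)\<^sup>2 / (r ^ n)\<^sup>2 \<le> C / (a 0)\<^sup>2" using a0 r by (simp add: field_simps)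
    moreover have "((\<rho> / r)\<^sup>2) ^ n = (\<rho> ^ n)\<^sup>2 / (r ^ n)\<^sup>2"
      by (simp add: power_divide power_mult[symmetric] mult.commute)
    ultimately show ?thesis by simp
  qed
  moreover have "1 < (\<rho> / r)\<^sup>2" using \<rho> r by (simp add: one_less_power)
  then obtain n where "C / (a 0)\<^sup>2 < ((\<rho> / r)\<^sup>2) ^ n" using real_arch_pow by blast
  ultimately show False by (simp add: not_le[symmetric])
qed

section \<open>The pre-Hilbert module of a law\<close>

locale law =
  fixes \<mu> :: "'b::unital_cstar_algebra law"
  assumes law: "\<mu> \<in> laws"
begin

lemma law_one: "\<mu> 1 = 1" and law_add: "\<mu> (p + q) = \<mu> p + \<mu> q"
  and law_bimod: "\<mu> (coef a * p * coef b) = a * \<mu> p * b" and law_cp: "completely_positive \<mu>"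
  using law by (auto simp: laws_def)

lemma law_left: "\<mu> (coef a * p) = a * \<mu> p"
  using law_bimod[of a p 1] by (simp add: coef_one)

lemma law_right: "\<mu> (p * coef b) = \<mu> p * b"
  using law_bimod[of 1 p b] by (simp add: coef_one)

lemma law_coef: "\<mu> (coef b) = b"
  using law_left[of b 1] by (simp add: law_one)

lemma law_zero: "\<mu> 0 = 0"
  using law_add[of 0 0] by simp

lemma law_diff: "\<mu> (p - q) = \<mu> p - \<mu> q"
  using law_add[of "p - q" q] by simp

lemma law_minus: "\<mu> (- p) = - \<mu> p"
  using law_diff[of 0 p] by (simp add: law_zero)

lemma law_scaleC: "\<mu> (c *\<^sub>C p) = c *\<^sub>C \<mu> p"
  unfolding scaleC_eq_coef by (simp add: law_left mult_scaleC_left)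

lemma law_pos: "cpos (\<mu> (star p * p))"
proof -
  have "mat_positive 1 (\<lambda>i j. \<mu> (\<Sum>k<(1::nat). star p * p))"
    by (rule spec[OF spec[OF law_cp[unfolded completely_positive_def], of 1], of "\<lambda>_ _. p"])
  then show ?thesis by (auto simp: mat_positive_def)
qed

text \<open>Positivity at 1 + q and at q shows that \<mu>(q) + \<mu>(\<open>star q\<close>) is
  self-adjoint; taking q = p and q = i p separates the two summands.\<close>

lemma law_star: "\<mu> (star p) = star (\<mu> p)"
proof -
  have sa: "star (\<mu> (star q * q)) = \<mu> (star q * q)" for q by (rule cpos_selfadj[OF law_pos])
  have "\<mu> (star (1 + q) * (1 + q)) - \<mu> (star q * q) = 1 + (\<mu> q + \<mu> (star q))" for q
    by (simp add: star_add star_one algebra_simps law_add law_one)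
  then have "star (1 + (\<mu> q + \<mu> (star q))) = 1 + (\<mu> q + \<mu> (star q))" for q
    using sa[of "1 + q"] sa[of q] by (metis star_diff)
  then have *: "star (\<mu> q) + star (\<mu> (star q)) = \<mu> q + \<mu> (star q)" for q
    by (simp add: star_add star_one)
  have "\<i> *\<^sub>C (star (\<mu> (star p)) - star (\<mu> p)) = \<i> *\<^sub>C (\<mu> p - \<mu> (star p))"
    using *[of "\<i> *\<^sub>C p"]
    by (simp add: star_scaleC law_scaleC scaleC_minus_left scaleC_diff_right star_minus law_minus algebra_simps)
  then have "(- \<i>) *\<^sub>C (\<i> *\<^sub>C (star (\<mu> (star p)) - star (\<mu> p))) = (- \<i>) *\<^sub>C (\<i> *\<^sub>C (\<mu> p - \<mu> (star p)))"
    by simp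
  then have d: "star (\<mu> (star p)) - star (\<mu> p) = \<mu> p - \<mu> (star p)"
    by (simp add: scaleC_scaleC scaleC_one)
  have "(star (\<mu> p) + star (\<mu> (star p))) - (star (\<mu> (star p)) - star (\<mu> p)) =
      (\<mu> p + \<mu> (star p)) - (\<mu> p - \<mu> (star p))"
    by (simp only: * d)
  then have "2 *\<^sub>R star (\<mu> p) = 2 *\<^sub>R \<mu> (star p)"
    by (simp add: scaleR_2)
  then show ?thesis by simp
qed

lemma preL2_simps:
  "bm_carrier (preL2 \<mu>) = UNIV" "bm_zero (preL2 \<mu>) = 0" "bm_add (preL2 \<mu>) = (+)"
  "bm_left (preL2 \<mu>) b p = coef b * p" "bm_right (preL2 \<mu>) p b = p * coef b"
  "bm_inner (preL2 \<mu>) p q = \<mu> (star p * q)"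
  by (simp_all add: preL2_def)

sublocale pre: pre_correspondence "preL2 \<mu>"
proof
  show "star (bm_inner (preL2 \<mu>) u v) = bm_inner (preL2 \<mu>) v u" for u v
    by (simp add: preL2_simps law_star[symmetric] star_mult star_star)
  show "bm_inner (preL2 \<mu>) w (bm_left (preL2 \<mu>) (c *\<^sub>C a) u) = c *\<^sub>C bm_inner (preL2 \<mu>) w (bm_left (preL2 \<mu>) a u)" for c a u w
    by (simp add: preL2_simps coef_scaleC mult_scaleC_left mult_scaleC_right law_scaleC)
qed (simp_all add: preL2_simps algebra_simps law_add law_zero law_pos coef_one coef_add coef_mult star_mult
    star_coef star_star flip: mult.assoc, simp_all add: law_right)

lemma law_poly_bound:
  assumes e: "exp_bound \<mu> M r" and p: "poly_bound r p K" and r: "r \<ge> 0" and M: "M \<ge> 0"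
  shows "norm (\<mu> p) \<le> M * K"
proof -
  obtain ms where ms: "p = (\<Sum>m\<leftarrow>ms. nc_monomial (fst m) (snd m))" "(\<Sum>m\<leftarrow>ms. monomial_weight r m) \<le> K"
    using p by (auto simp: poly_bound_def)
  have "norm (\<mu> (\<Sum>m\<leftarrow>ms. nc_monomial (fst m) (snd m))) \<le> M * (\<Sum>m\<leftarrow>ms. monomial_weight r m)"
  proof (induction ms)
    case (Cons m ms)
    have "norm (\<mu> (nc_monomial (fst m) (snd m))) \<le> M * monomial_weight r m"
      using e by (simp add: exp_bound_def monomial_weight_def mult_ac)
    then show ?case using Cons by (simp add: law_add semiring_class.distrib_left norm_triangle_le)
  qed (simp add: law_zero)
  also have "\<dots> \<le> M * K" using ms(2) M by (rule mult_left_mono)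
  finally show ?thesis using ms(1) by simp
qed

text \<open>The lengths of \<open>indet ^ n * p\<close> are log-convex by Cauchy-Schwarz, because X
  is symmetric, and their squares are moments of order 2 n between fixed polynomials.
  \<open>log_convex_growth\<close> removes the constants that depend on p.\<close>

lemma seminorm_indet_exp_bound:
  assumes e: "exp_bound \<mu> M r" and r: "r > 0" and M: "M > 0"
  shows "pre.seminorm (indet * p) \<le> r * pre.seminorm p"
proof -
  define a where "a n = pre.seminorm (indet ^ n * p)" for n
  obtain C where C: "C \<ge> 0" "\<And>q K. poly_bound r q K \<Longrightarrow> poly_bound r (star p * q) (C * K)"
    using poly_bound_mult[of r "star p"] r by auto
  obtain D where D: "D \<ge> 0" "\<And>q K. poly_bound r q K \<Longrightarrow> poly_bound r (p * q) (D * K)"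
    using poly_bound_mult[of r p] r by auto
  have sX: "star (indet ^ n) = (indet ^ n :: 'b ncpoly)" for n by (simp add: star_power star_indet)
  have "a 1 \<le> r * a 0"
  proof (rule log_convex_growth)
    fix n
    show "a n \<ge> 0" by (simp add: a_def)
    have "norm (bm_inner (preL2 \<mu>) (indet ^ n * p) (indet ^ Suc (Suc n) * p)) \<le> a n * a (Suc (Suc n))"
      unfolding a_def by (rule pre.Cauchy_Schwarz) (simp_all add: preL2_simps)
    moreover have "bm_inner (preL2 \<mu>) (indet ^ n * p) (indet ^ Suc (Suc n) * p) =
        bm_inner (preL2 \<mu>) (indet ^ Suc n * p) (indet ^ Suc n * p)"
    proof -
      have "indet ^ n * (indet * q) = indet ^ Suc n * q" for q :: "'b ncpoly"
        by (simp add: power_Suc2 mult.assoc del: power_Suc)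
      then show ?thesis
        by (simp add: preL2_simps star_mult sX mult.assoc power_Suc[of _ "Suc n"] del: power_Suc)
    qed
    ultimately show "(a (Suc n))\<^sup>2 \<le> a n * a (Suc (Suc n))"
      by (simp add: a_def pre.seminorm_square del: power_Suc)
    have "poly_bound r (star p * (indet ^ (2 * n) * (p * 1))) (C * (r ^ (2 * n) * (D * 1)))"
      using r by (intro C(2) poly_bound_pow D(2) poly_bound_one) auto
    then have "norm (\<mu> (star p * (indet ^ (2 * n) * p))) \<le> M * (C * (r ^ (2 * n) * D))"
      using law_poly_bound[OF e] r M by simp
    moreover have "star (indet ^ n * p) * (indet ^ n * p) = star p * (indet ^ (2 * n) * p)"
      by (simp add: star_mult sX mult_2 power_add mult.assoc)
    ultimately show "(a n)\<^sup>2 \<le> (M * C * D) * r ^ (2 * n)"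
      by (simp add: a_def pre.seminorm_square preL2_simps mult_ac)
  qed (rule r)
  then show ?thesis by (simp add: a_def)
qed

lemma law_rad_nonneg: "law_rad \<mu> \<ge> 0"
  and law_rad_less: "law_rad \<mu> < r \<Longrightarrow> \<exists>R M. 0 < R \<and> R < r \<and> M > 0 \<and> exp_bound \<mu> M R"
proof -
  have ne: "{R. R > 0 \<and> (\<exists>M>0. exp_bound \<mu> M R)} \<noteq> {}" using law by (auto simp: laws_def)
  then show "law_rad \<mu> \<ge> 0" unfolding law_rad_def by (rule cInf_greatest) auto
  assume "law_rad \<mu> < r"
  from cInf_lessD[OF ne this[unfolded law_rad_def]]
  show "\<exists>R M. 0 < R \<and> R < r \<and> M > 0 \<and> exp_bound \<mu> M R" by auto
qed

text \<open>The operator bound by R carries no constant \<open>M\<close>, so it passes to the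
  infimum of the R even where an exponential bound at the infimum is not given.\<close>

lemma seminorm_indet: "pre.seminorm (indet * p) \<le> law_rad \<mu> * pre.seminorm p"
proof (rule field_le_epsilon)
  fix e :: real assume e: "e > 0"
  define y where "y = pre.seminorm p"
  have y: "y \<ge> 0" by (simp add: y_def)
  \<comment> \<open>The divisor y + 1 in place of y admits y = 0.\<close>
  have "law_rad \<mu> < law_rad \<mu> + e / (y + 1)" using e y by simp
  then obtain R M where R: "0 < R" "R < law_rad \<mu> + e / (y + 1)" "M > 0" "exp_bound \<mu> M R"
    using law_rad_less by blast
  have "pre.seminorm (indet * p) \<le> R * y"
    unfolding y_def by (rule seminorm_indet_exp_bound[OF R(4,1,3)])
  also have "\<dots> \<le> (law_rad \<mu> + e / (y + 1)) * y" using R(2) y by (intro mult_right_mono) auto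
  also have "\<dots> \<le> law_rad \<mu> * y + e"
    using e y by (simp add: semiring_class.distrib_right divide_le_eq)
  finally show "pre.seminorm (indet * p) \<le> law_rad \<mu> * pre.seminorm p + e" by (simp add: y_def)
qed

sublocale pre: bounded_module_map "preL2 \<mu>" "\<lambda>p. indet * p" "(law_rad \<mu>)\<^sup>2"
proof
  show "cpos ((law_rad \<mu>)\<^sup>2 *\<^sub>R bm_inner (preL2 \<mu>) u u - bm_inner (preL2 \<mu>) (indet * u) (indet * u))" for u
    by (rule pre.Paschke) (simp_all add: preL2_simps mult.assoc seminorm_indet)
qed (simp_all add: preL2_simps algebra_simps law_add law_right flip: mult.assoc)

lemma seminorm_monomial:
  "pre.seminorm (nc_monomial b bs) \<le> law_rad \<mu> ^ length bs * (norm b * prod_list (map norm bs))"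
proof (induction bs arbitrary: b)
  case Nil
  have "pre.seminorm (bm_left (preL2 \<mu>) b 1) \<le> norm b * pre.seminorm 1"
    by (rule pre.seminorm_left) (simp add: preL2_simps)
  then show ?case by (simp add: preL2_simps nc_monomial_Nil pre.seminorm_def[of 1] star_one law_one)
next
  case (Cons c cs)
  have "pre.seminorm (bm_left (preL2 \<mu>) b (indet * nc_monomial c cs)) \<le> norm b * pre.seminorm (indet * nc_monomial c cs)"
    by (rule pre.seminorm_left) (simp add: preL2_simps)
  also have "\<dots> \<le> norm b * (law_rad \<mu> * pre.seminorm (nc_monomial c cs))"
    by (intro mult_left_mono seminorm_indet) simp
  also have "\<dots> \<le> norm b * (law_rad \<mu> * (law_rad \<mu> ^ length cs * (norm c * prod_list (map norm cs))))"
    by (intro mult_left_mono Cons law_rad_nonneg) simp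
  finally show ?case by (simp add: nc_monomial_Cons preL2_simps mult_ac)
qed

text \<open>The moment is the inner product of the monomial with the unit vector 1. Thus an
  exponential bound holds with constant 1 at the radius itself, uniformly over all laws of bounded
  radius.\<close>

lemma norm_moment: "norm (\<mu> (nc_monomial b bs)) \<le> law_rad \<mu> ^ length bs * (norm b * prod_list (map norm bs))"
proof -
  have "norm (bm_inner (preL2 \<mu>) 1 (nc_monomial b bs)) \<le> pre.seminorm 1 * pre.seminorm (nc_monomial b bs)"
    by (rule pre.Cauchy_Schwarz) (simp_all add: preL2_simps)
  also have "pre.seminorm 1 = 1" by (simp add: pre.seminorm_def preL2_simps star_one law_one)
  finally show ?thesis using seminorm_monomial[of b bs] by (simp add: preL2_simps star_one)
qed

sublocale L2: bounded_module_map "L2 \<mu>" "L2_mult_X \<mu>" "(law_rad \<mu>)\<^sup>2"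
  unfolding L2_def L2_mult_X_def by (rule pre.bounded_module_map_completion)

abbreviation emb :: "'b ncpoly \<Rightarrow> 'b ncpoly completion" where
  "emb \<equiv> cl_embed (preL2 \<mu>)"

lemma emb_simps:
  "emb p \<in> bm_carrier (L2 \<mu>)" "bm_inner (L2 \<mu>) (emb p) (emb q) = \<mu> (star p * q)"
  "bm_add (L2 \<mu>) (emb p) (emb q) = emb (p + q)" "bm_left (L2 \<mu>) b (emb p) = emb (coef b * p)"
  "bm_right (L2 \<mu>) (emb p) b = emb (p * coef b)" "L2_mult_X \<mu> (emb p) = emb (indet * p)"
  "L2_one \<mu> = emb 1"
  unfolding L2_def L2_mult_X_def L2_one_def
  by (simp_all add: pre.cl_embed_mem pre.inner_cl_embed pre.cl_embed_add pre.cl_embed_left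
      pre.cl_embed_right pre.cl_extend_map_embed preL2_simps)

lemma pre_correspondence_L2_compl: "pre_correspondence (bm_compl (L2 \<mu>) (L2_one \<mu>))"
  by (rule L2.pre_correspondence_compl) (simp_all add: emb_simps)

end

section \<open>An algebraic model of the \<open>T\<close>-free product\<close>

subsection \<open>Algebraic direct sums of tensor products\<close>

text \<open>Formal sums of elementary tensors, each labelled by the summand it lives in.\<close>

definition key_inner :: "('k \<Rightarrow> ('h, 'b::unital_cstar_algebra) bimod list) \<Rightarrow> 'k \<times> 'h list \<times> 'b \<Rightarrow> 'k \<times> 'h list \<times> 'b \<Rightarrow> 'b" where
  "key_inner Hs e f = (if fst e = fst f then pair_inner (Hs (fst e)) (snd e) (snd f) else 0)"

definition keyed_sum :: "'k set \<Rightarrow> ('k \<Rightarrow> ('h, 'b::unital_cstar_algebra) bimod list) \<Rightarrow>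
    (('k \<times> 'h list \<times> 'b) list, 'b) bimod" where
  "keyed_sum S Hs =
    \<lparr> bm_carrier = {u. \<forall>e\<in>set u. fst e \<in> S \<and> tensor_valid (Hs (fst e)) (fst (snd e))},
      bm_zero = [], bm_add = (@),
      bm_left = (\<lambda>a. map (\<lambda>e. (fst e, elt_left (Hs (fst e)) a (snd e)))),
      bm_right = (\<lambda>u b. map (\<lambda>e. (fst e, fst (snd e), snd (snd e) * b)) u),
      bm_inner = (\<lambda>u v. \<Sum>e\<leftarrow>u. \<Sum>f\<leftarrow>v. key_inner Hs e f) \<rparr>"

definition component :: "'k \<Rightarrow> ('k \<times> 'x) list \<Rightarrow> 'x list" where
  "component s u = map snd (filter (\<lambda>e. fst e = s) u)"

lemma component_simps [simp]:
  "component s [] = []" "component s (u @ v) = component s u @ component s v"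
  "component s (e # u) = (if fst e = s then snd e # component s u else component s u)"
  by (simp_all add: component_def)

lemma sum_list_concat_map:
  fixes h :: "'y \<Rightarrow> 'z::monoid_add"
  shows "(\<Sum>z\<leftarrow>concat (map g xs). h z) = (\<Sum>x\<leftarrow>xs. \<Sum>z\<leftarrow>g x. h z)"
  by (induction xs) simp_all

lemma sum_list_components:
  fixes g :: "'k \<Rightarrow> 'x \<Rightarrow> 'z::comm_monoid_add"
  assumes "finite K" "fst ` set u \<subseteq> K"
  shows "(\<Sum>e\<leftarrow>u. g (fst e) (snd e)) = (\<Sum>s\<in>K. \<Sum>x\<leftarrow>component s u. g s x)"
  using assms(2)
proof (induction u)
  case (Cons e u)
  have "(\<Sum>s\<in>K. \<Sum>x\<leftarrow>component s (e # u). g s x) =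
      (\<Sum>s\<in>K. (if s = fst e then g s (snd e) else 0) + (\<Sum>x\<leftarrow>component s u. g s x))"
    by (intro sum.cong) auto
  then show ?case using Cons assms(1) by (simp add: sum.distrib)
qed simp

text \<open>K may be any finite set of labels containing those of u. A common K for two vectors
  reduces the axioms of a correspondence to the single summands.\<close>

lemma keyed_sum_inner:
  assumes "finite K" "fst ` set u \<subseteq> K"
  shows "bm_inner (keyed_sum S Hs) u v = (\<Sum>s\<in>K. bm_inner (pretensor (Hs s)) (component s u) (component s v))"
proof -
  have "(\<Sum>f\<leftarrow>v. key_inner Hs e f) = (\<Sum>y\<leftarrow>component (fst e) v. pair_inner (Hs (fst e)) (snd e) y)" for e
    by (induction v) (auto simp: key_inner_def)
  then show ?thesis
    using sum_list_components[OF assms, of "\<lambda>s x. \<Sum>y\<leftarrow>component s v. pair_inner (Hs s) x y"]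
    by (simp add: keyed_sum_def pretensor_simps)
qed

lemma component_left:
  "component s (bm_left (keyed_sum S Hs) a u) = bm_left (pretensor (Hs s)) a (component s u)"
  by (induction u) (auto simp: keyed_sum_def pretensor_simps)

lemma component_right:
  "component s (bm_right (keyed_sum S Hs) u b) = bm_right (pretensor (Hs s)) (component s u) b"
  by (induction u) (auto simp: keyed_sum_def pretensor_simps)

lemma keyed_sum_simps:
  "bm_zero (keyed_sum S Hs) = []" "bm_add (keyed_sum S Hs) = (@)"
  "u \<in> bm_carrier (keyed_sum S Hs) \<longleftrightarrow> (\<forall>e\<in>set u. fst e \<in> S \<and> tensor_valid (Hs (fst e)) (fst (snd e)))"
  "bm_right (keyed_sum S Hs) u b = map (\<lambda>e. (fst e, fst (snd e), snd (snd e) * b)) u"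
  by (simp_all add: keyed_sum_def)

lemma component_mem:
  "u \<in> bm_carrier (keyed_sum S Hs) \<Longrightarrow> component s u \<in> bm_carrier (pretensor (Hs s))"
  by (induction u) (auto simp: keyed_sum_def pretensor_simps)

lemma pre_correspondence_keyed_sum:
  assumes Hs: "\<And>s H. s \<in> S \<Longrightarrow> H \<in> set (Hs s) \<Longrightarrow> pre_correspondence H"
  shows "pre_correspondence (keyed_sum S Hs)"
proof
  let ?V = "keyed_sum S Hs"
  fix u v w :: "('a \<times> 'b list \<times> 'c) list" and a b :: 'c and c :: complex
  have P: "pre_correspondence (pretensor (Hs s))" if "s \<in> S" for s
    using Hs[OF that] by (rule pre_correspondence_pretensor)
  have cl: "component s (map (\<lambda>e. (fst e, elt_left (Hs (fst e)) a (snd e))) u) = bm_left (pretensor (Hs s)) a (component s u)" for s a u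
    using component_left[of s S Hs a u] by (simp add: keyed_sum_def)
  show "bm_zero ?V \<in> bm_carrier ?V" by (simp add: keyed_sum_simps)
  {
    assume u: "u \<in> bm_carrier ?V"
    show "bm_right ?V u b \<in> bm_carrier ?V" using u by (auto simp: keyed_sum_simps)
    show "bm_left ?V a u \<in> bm_carrier ?V"
      using u elt_left_valid[OF Hs] by (fastforce simp: keyed_sum_def)
    have "fst ` set u \<subseteq> S" using u by (auto simp: keyed_sum_simps)
    then show "cpos (bm_inner ?V u u)"
      unfolding keyed_sum_inner[OF finite_imageI[OF finite_set] subset_refl]
      by (intro cpos_sum pre_hilbert.inner_pos pre_correspondence.axioms(1)[OF P] component_mem[OF u]) auto
    show "bm_inner ?V u (bm_zero ?V) = 0" by (simp add: keyed_sum_def)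
  }
  {
    assume u: "u \<in> bm_carrier ?V" and v: "v \<in> bm_carrier ?V"
    define K where "K = fst ` set u \<union> fst ` set v"
    have K: "finite K" "K \<subseteq> S" "fst ` set u \<subseteq> K" "fst ` set v \<subseteq> K"
      using u v by (auto simp: K_def keyed_sum_simps)
    have KP: "pre_correspondence (pretensor (Hs s))" if "s \<in> K" for s using P K(2) that by blast
    have KH: "pre_hilbert (pretensor (Hs s))" if "s \<in> K" for s
      using KP[OF that] by (rule pre_correspondence.axioms)
    have I: "bm_inner ?V x y = (\<Sum>s\<in>K. bm_inner (pretensor (Hs s)) (component s x) (component s y))"
      if "fst ` set x \<subseteq> K" for x y
      by (rule keyed_sum_inner[OF K(1) that])
    have lk: "fst ` set (bm_left ?V a v) \<subseteq> K" for a using K by (auto simp: keyed_sum_def)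
    note m = component_mem[OF u] component_mem[OF v]
    show "bm_add ?V u v \<in> bm_carrier ?V" using u v by (auto simp: keyed_sum_simps)
    show "star (bm_inner ?V u v) = bm_inner ?V v u"
      unfolding I[OF K(3)] I[OF K(4)] star_sum
      by (intro sum.cong HOL.refl pre_hilbert.star_inner KH m)
    show "bm_inner ?V v (bm_right ?V u b) = bm_inner ?V v u * b"
      unfolding I[OF K(4)] component_right sum_distrib_right
      by (intro sum.cong HOL.refl pre_hilbert.inner_right KH m)
    show "bm_inner ?V v (bm_left ?V a u) = bm_inner ?V (bm_left ?V (star a) v) u"
      unfolding I[OF K(4)] I[OF lk] component_left
      by (intro sum.cong HOL.refl pre_correspondence.inner_left KP m)
    show "bm_inner ?V v (bm_left ?V (a + b) u) = bm_inner ?V v (bm_left ?V a u) + bm_inner ?V v (bm_left ?V b u)"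
      unfolding I[OF K(4)] component_left sum.distrib[symmetric]
      by (intro sum.cong HOL.refl pre_correspondence.inner_left_add KP m)
    show "bm_inner ?V v (bm_left ?V (a * b) u) = bm_inner ?V v (bm_left ?V a (bm_left ?V b u))"
      unfolding I[OF K(4)] component_left
      by (intro sum.cong HOL.refl pre_correspondence.inner_left_mult KP m)
    show "bm_inner ?V v (bm_left ?V 1 u) = bm_inner ?V v u"
      unfolding I[OF K(4)] component_left
      by (intro sum.cong HOL.refl pre_correspondence.inner_left_one KP m)
    have "(\<Sum>s\<in>K. c *\<^sub>C f s) = c *\<^sub>C (\<Sum>s\<in>K. f s)" for f :: "'a \<Rightarrow> 'c"
      by (induction K rule: infinite_finite_induct) (simp_all add: scaleC_zero_right scaleC_add_right)
    then show "bm_inner ?V v (bm_left ?V (c *\<^sub>C a) u) = c *\<^sub>C bm_inner ?V v (bm_left ?V a u)"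
      unfolding I[OF K(4)] component_left
      by (simp add: pre_correspondence.inner_left_scaleC[OF KP] m cong: sum.cong)
    assume w: "w \<in> bm_carrier ?V"
    show "bm_inner ?V w (bm_add ?V u v) = bm_inner ?V w u + bm_inner ?V w v"
      by (simp add: keyed_sum_def sum_list_addf)
  }
qed

subsection \<open>Operators on formal sums of words\<close>

text \<open>An entry \<open>(s, [p\<^sub>1, \<dots>, p\<^sub>m], b)\<close> stands for \<open>p\<^sub>1 \<otimes> \<cdots> \<otimes> p\<^sub>m b\<close> in the summand of the word \<open>s\<close>.\<close>

type_synonym 'b entry = "nat list \<times> 'b ncpoly list \<times> 'b"

text \<open>\<open>elt_left\<close> without the list of factors: on polynomial legs it depends only
  on whether the word is empty (\<open>elt_left_poly_factors\<close>).\<close>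

fun lact :: "'b::unital_cstar_algebra \<Rightarrow> 'b ncpoly list \<times> 'b \<Rightarrow> 'b ncpoly list \<times> 'b" where
  "lact a ([], b) = ([], a * b)"
| "lact a (p # ps, b) = ((coef a * p) # ps, b)"

definition center :: "'b::unital_cstar_algebra law \<Rightarrow> 'b ncpoly \<Rightarrow> 'b ncpoly" where
  "center m p = p - coef (m p)"

text \<open>\<open>strip j\<close> and \<open>emit m j\<close> are the two directions of the isomorphism
  \<open>H\<^sub>s\<^sup>\<circ> \<oplus> H\<^sub>j\<^sub>s\<^sup>\<circ> \<cong> H\<^sub>j \<otimes> H\<^sub>s\<^sup>\<circ>\<close> on elementary tensors.\<close>

definition strip :: "nat \<Rightarrow> 'b::unital_cstar_algebra entry \<Rightarrow> 'b entry" where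
  "strip j e = (if fst e \<noteq> [] \<and> hd (fst e) = j then (tl (fst e), snd e)
     else (fst e, 1 # fst (snd e), snd (snd e)))"

definition emit :: "'b::unital_cstar_algebra law \<Rightarrow> nat \<Rightarrow> 'b entry \<Rightarrow> 'b entry list" where
  "emit m j y = (let q = hd (fst (snd y)); qs = tl (fst (snd y)); c = snd (snd y)
     in [(j # fst y, center m q # qs, c), (fst y, lact (m q) (qs, c))])"

definition mult_hd :: "'b::unital_cstar_algebra entry \<Rightarrow> 'b entry" where
  "mult_hd y = (fst y, (indet * hd (fst (snd y))) # tl (fst (snd y)), snd (snd y))"

text \<open>The entry belongs to the block of the pair s, j s, where s is the word of
  \<open>strip j e\<close>; a block with j s outside the tree is sent to zero.\<close>

definition word_X :: "(nat \<Rightarrow> 'b::unital_cstar_algebra law) \<Rightarrow> nat list set \<Rightarrow> nat \<Rightarrow> 'b entry \<Rightarrow> 'b entry list" where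
  "word_X \<mu> T j e = (let y = strip j e in if j # fst y \<in> T then emit (\<mu> j) j (mult_hd y) else [])"

definition formal_X :: "(nat \<Rightarrow> 'b::unital_cstar_algebra law) \<Rightarrow> nat list set \<Rightarrow> nat \<Rightarrow> 'b entry list \<Rightarrow> 'b entry list" where
  "formal_X \<mu> T j v = concat (map (word_X \<mu> T j) v)"

definition formal_sum_X :: "nat \<Rightarrow> (nat \<Rightarrow> 'b::unital_cstar_algebra law) \<Rightarrow> nat list set \<Rightarrow> 'b entry list \<Rightarrow> 'b entry list" where
  "formal_sum_X N \<mu> T v = concat (map (\<lambda>j. formal_X \<mu> T j v) [1..<Suc N])"

definition formal_left :: "'b::unital_cstar_algebra \<Rightarrow> 'b entry list \<Rightarrow> 'b entry list" where
  "formal_left a v = map (\<lambda>e. (fst e, lact a (snd e))) v"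

primrec formal_eval :: "nat \<Rightarrow> (nat \<Rightarrow> 'b::unital_cstar_algebra law) \<Rightarrow> nat list set \<Rightarrow> 'b ncexp \<Rightarrow> 'b entry list \<Rightarrow> 'b entry list" where
  "formal_eval N \<mu> T (NC_const b) v = formal_left b v"
| "formal_eval N \<mu> T NC_var v = formal_sum_X N \<mu> T v"
| "formal_eval N \<mu> T (NC_add p q) v = formal_eval N \<mu> T p v @ formal_eval N \<mu> T q v"
| "formal_eval N \<mu> T (NC_mult p q) v = formal_eval N \<mu> T p (formal_eval N \<mu> T q v)"

definition formal_vac :: "'b::unital_cstar_algebra entry list" where
  "formal_vac = [([], [], 1)]"

definition formal_expect :: "'b::unital_cstar_algebra entry list \<Rightarrow> 'b" where
  "formal_expect v = (\<Sum>e\<leftarrow>v. if fst e = [] then snd (snd e) else 0)"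

definition formal_law :: "nat \<Rightarrow> (nat \<Rightarrow> 'b::unital_cstar_algebra law) \<Rightarrow> nat list set \<Rightarrow> 'b law" where
  "formal_law N \<mu> T p = formal_expect (formal_eval N \<mu> T (rep_ncpoly p) formal_vac)"

subsection \<open>Rooted subtrees\<close>

text \<open>Edges prepend or delete a first letter, so a path from j s to the root that avoids s
  could never lose the suffix j s.\<close>

lemma Tree_tl:
  assumes T: "T \<in> Tree N" and s: "j # s \<in> T" shows "s \<in> T"
proof -
  have "([] :: nat list) \<in> T" using T by (simp add: Tree_def)
  then have "(j # s, []) \<in> (free_edges N \<inter> T \<times> T)\<^sup>*" using T s by (simp add: Tree_def)
  then have "s \<in> T \<or> (\<exists>u. [] = u @ j # s)"
  proof (induction rule: rtrancl_induct)
    case (step y z)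
    show ?case
    proof (cases "s \<in> T")
      case False
      then obtain u where u: "y = u @ j # s" using step.IH by auto
      have yz: "(y, z) \<in> free_edges N" "y \<in> T" "z \<in> T" using step.hyps(2) by auto
      then obtain k where "z = k # y \<or> y = k # z" by (auto simp: free_edges_def)
      then have "\<exists>u. z = u @ j # s" using u yz(3) False by (cases u) auto
      then show ?thesis ..
    qed simp
  qed auto
  then show ?thesis by simp
qed

lemma Tree_alternating:
  assumes "T \<in> Tree N" "s \<in> T"
  shows "set s \<subseteq> {1..N}" "distinct_adj s"
  using assms by (auto simp: Tree_def alternating_def)

lemma Tree_Cons:
  assumes "T \<in> Tree N" "j # s \<in> T"
  shows "j \<in> {1..N}" "s = [] \<or> hd s \<noteq> j"
  using Tree_alternating[OF assms] by (auto simp: distinct_adj_Cons)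

subsection \<open>The algebraic Fock space\<close>

abbreviation poly_factors :: "(nat \<Rightarrow> 'b::unital_cstar_algebra law) \<Rightarrow> nat list \<Rightarrow> ('b ncpoly, 'b) bimod list" where
  "poly_factors \<mu> s \<equiv> word_factors (\<lambda>j. preL2 (\<mu> j)) (\<lambda>_. 1) s"

lemma word_factors_simps:
  "word_factors H \<xi> [] = []" "word_factors H \<xi> (j # s) = bm_compl (H j) (\<xi> j) # word_factors H \<xi> s"
  by (simp_all add: word_factors_def)

lemma bm_compl_simps:
  "bm_inner (bm_compl H \<xi>) = bm_inner H" "bm_left (bm_compl H \<xi>) = bm_left H"
  "h \<in> bm_carrier (bm_compl H \<xi>) \<longleftrightarrow> h \<in> bm_carrier H \<and> bm_inner H h \<xi> = 0"
  by (simp_all add: bm_compl_def)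

lemma elt_left_poly_factors:
  "length ps = length s \<Longrightarrow> elt_left (poly_factors \<mu> s) a (ps, b) = lact a (ps, b)"
  by (cases s; cases ps) (simp_all add: word_factors_simps bm_compl_simps preL2_def)

locale tree_laws =
  fixes N :: nat and T :: "nat list set" and \<mu> :: "nat \<Rightarrow> 'b::unital_cstar_algebra law"
  assumes T: "T \<in> Tree N" and laws: "\<And>j. j \<in> {1..N} \<Longrightarrow> \<mu> j \<in> laws"
begin

lemma lawI: "j \<in> {1..N} \<Longrightarrow> law (\<mu> j)"
  using laws by unfold_locales

abbreviation W :: "nat list \<Rightarrow> ('b ncpoly, 'b) bimod list" where
  "W \<equiv> poly_factors \<mu>"

abbreviation L :: "nat \<Rightarrow> nat list \<Rightarrow> ('b ncpoly, 'b) bimod list" where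
  "L j s \<equiv> preL2 (\<mu> j) # W s"

definition fock :: "('b entry list, 'b) bimod" where
  "fock = keyed_sum T W"

text \<open>Words s with j s outside the tree are kept, because \<open>strip j\<close> sends their
  summands into a block as well; the truncation comes only afterwards, in
  \<open>word_X\<close>.\<close>

definition block_words :: "nat \<Rightarrow> nat list set" where
  "block_words j = {s \<in> T. s = [] \<or> hd s \<noteq> j}"

definition block :: "nat \<Rightarrow> ('b entry list, 'b) bimod" where
  "block j = keyed_sum (block_words j) (L j)"

lemma pre_correspondence_poly_compl:
  assumes "j \<in> {1..N}" shows "pre_correspondence (bm_compl (preL2 (\<mu> j)) 1)"
proof -
  interpret law "\<mu> j" using lawI[OF assms] .
  show ?thesis by (rule pre.pre_correspondence_compl) (simp_all add: preL2_simps)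
qed

lemma W_factor:
  assumes "s \<in> T" "H \<in> set (W s)" shows "pre_correspondence H"
  using assms Tree_alternating(1)[OF T assms(1)] pre_correspondence_poly_compl
  by (auto simp: word_factors_def)

lemma L_factor:
  assumes "j \<in> {1..N}" "s \<in> T" "H \<in> set (L j s)" shows "pre_correspondence H"
proof -
  interpret law "\<mu> j" using lawI[OF assms(1)] .
  show ?thesis using assms W_factor pre.pre_correspondence_axioms by auto
qed

sublocale fock: pre_correspondence fock
  unfolding fock_def using W_factor by (rule pre_correspondence_keyed_sum)

lemma block_pre: "j \<in> {1..N} \<Longrightarrow> pre_correspondence (block j)"
  unfolding block_def using L_factor by (intro pre_correspondence_keyed_sum) (auto simp: block_words_def)

lemma fock_simps:
  "bm_zero fock = []" "bm_add fock u v = u @ v"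
  "bm_right fock u b = map (\<lambda>e. (fst e, fst (snd e), snd (snd e) * b)) u"
  "bm_inner fock u v = (\<Sum>e\<leftarrow>u. \<Sum>f\<leftarrow>v. key_inner W e f)"
  by (simp_all add: fock_def keyed_sum_def)

lemma fock_memI: "(\<And>e. e \<in> set u \<Longrightarrow> [e] \<in> bm_carrier fock) \<Longrightarrow> u \<in> bm_carrier fock"
  and fock_memD: "u \<in> bm_carrier fock \<Longrightarrow> e \<in> set u \<Longrightarrow> [e] \<in> bm_carrier fock"
  and block_memI: "(\<And>e. e \<in> set y \<Longrightarrow> [e] \<in> bm_carrier (block j)) \<Longrightarrow> y \<in> bm_carrier (block j)"
  and block_memD: "y \<in> bm_carrier (block j) \<Longrightarrow> e \<in> set y \<Longrightarrow> [e] \<in> bm_carrier (block j)"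
  by (simp_all add: fock_def block_def keyed_sum_def)

lemma fock_entry: "[(s, x)] \<in> bm_carrier fock \<longleftrightarrow> s \<in> T \<and> tensor_valid (W s) (fst x)"
  and block_entry: "[(s, x)] \<in> bm_carrier (block j) \<longleftrightarrow> s \<in> block_words j \<and> tensor_valid (L j s) (fst x)"
  by (simp_all add: fock_def block_def keyed_sum_def)

lemma tensor_valid_length: "tensor_valid (W s) ps \<Longrightarrow> length ps = length s"
  by (auto simp: word_factors_def dest: list_all2_lengthD)

lemma fock_left: "u \<in> bm_carrier fock \<Longrightarrow> bm_left fock a u = formal_left a u"
  by (auto simp: fock_def keyed_sum_def formal_left_def tensor_valid_length elt_left_poly_factors)

text \<open>Orthogonality to 1 is the vanishing of \<mu>(\<open>star p\<close>), hence of \<mu>(p):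
  the legs of a valid tensor are the centered polynomials.\<close>

lemma tensor_valid_Cons:
  assumes "j \<in> {1..N}"
  shows "tensor_valid (W (j # s)) (p # ps) \<longleftrightarrow> \<mu> j p = 0 \<and> tensor_valid (W s) ps"
proof -
  interpret law "\<mu> j" using lawI[OF assms] .
  have "star (\<mu> j p) = 0 \<longleftrightarrow> \<mu> j p = 0" by (metis star_star star_zero)
  then show ?thesis by (simp add: word_factors_simps bm_compl_simps preL2_simps law_star)
qed

lemma law_center: "j \<in> {1..N} \<Longrightarrow> \<mu> j (center (\<mu> j) p) = 0"
  using lawI[of j] by (simp add: center_def law.law_diff law.law_coef)

lemma lact_valid:
  assumes "s \<in> T" "tensor_valid (W s) ps" shows "tensor_valid (W s) (fst (lact a (ps, b)))"
  using elt_left_valid[of "W s" ps a b] W_factor[OF assms(1)] assms(2)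
  by (simp add: elt_left_poly_factors tensor_valid_length)

lemma block_cases:
  assumes "[y] \<in> bm_carrier (block j)"
  obtains t q qs c where "y = (t, q # qs, c)" "t \<in> T" "t = [] \<or> hd t \<noteq> j" "tensor_valid (W t) qs"
  using assms by (cases y) (auto simp: block_entry block_words_def list_all2_Cons2)

lemma block_entryI:
  assumes "t \<in> T" "t = [] \<or> hd t \<noteq> j" "tensor_valid (W t) qs"
  shows "[(t, q # qs, c)] \<in> bm_carrier (block j)"
  using assms by (simp add: block_entry block_words_def preL2_def)

lemma strip_mem:
  assumes e: "[e] \<in> bm_carrier fock" shows "[strip j e] \<in> bm_carrier (block j)"
proof -
  obtain s ps b where eq: "e = (s, ps, b)" by (cases e)
  have v: "s \<in> T" "tensor_valid (W s) ps" using e by (simp_all add: eq fock_entry)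
  show ?thesis
  proof (cases "s \<noteq> [] \<and> hd s = j")
    case True
    then obtain s' where s: "s = j # s'" by (cases s) auto
    obtain p ps' where "ps = p # ps'" "tensor_valid (W s') ps'"
      using v(2) by (auto simp: s word_factors_simps list_all2_Cons2)
    then show ?thesis
      using v(1) Tree_tl[OF T] Tree_Cons(2)[OF T] by (auto simp: eq strip_def s intro!: block_entryI)
  next
    case False
    then show ?thesis using v by (auto simp: eq strip_def intro!: block_entryI)
  qed
qed

lemma emit_mem:
  assumes y: "[y] \<in> bm_carrier (block j)" and jT: "j # fst y \<in> T"
  shows "emit (\<mu> j) j y \<in> bm_carrier fock"
proof -
  obtain t q qs c where eq: "y = (t, q # qs, c)" and t: "t \<in> T" "tensor_valid (W t) qs"
    using y by (rule block_cases)
  have j: "j \<in> {1..N}" using jT Tree_Cons(1)[OF T] by simp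
  show ?thesis
  proof (rule fock_memI)
    fix e assume "e \<in> set (emit (\<mu> j) j y)"
    then consider "e = (j # t, center (\<mu> j) q # qs, c)" | "e = (t, lact (\<mu> j q) (qs, c))"
      by (auto simp: emit_def eq)
    then show "[e] \<in> bm_carrier fock"
    proof cases
      case 1
      then show ?thesis
        using t jT law_center[OF j] by (simp add: eq fock_entry tensor_valid_Cons[OF j])
    next
      case 2
      then show ?thesis using t lact_valid[OF t] by (simp add: fock_entry)
    qed
  qed
qed

lemma mult_hd_mem:
  assumes "[y] \<in> bm_carrier (block j)" shows "[mult_hd y] \<in> bm_carrier (block j)"
  using assms by (elim block_cases) (auto simp: mult_hd_def intro: block_entryI)

lemma fst_mult_hd [simp]: "fst (mult_hd y) = fst y"
  by (simp add: mult_hd_def)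

lemma word_X_mem: "[e] \<in> bm_carrier fock \<Longrightarrow> word_X \<mu> T j e \<in> bm_carrier fock"
  using fock.zero_mem by (auto simp: word_X_def Let_def fock_simps intro!: emit_mem mult_hd_mem strip_mem)

lemma formal_X_mem: "v \<in> bm_carrier fock \<Longrightarrow> formal_X \<mu> T j v \<in> bm_carrier fock"
  by (rule fock_memI) (auto simp: formal_X_def dest: fock_memD intro: fock_memD[OF word_X_mem])

lemma formal_sum_X_mem: "v \<in> bm_carrier fock \<Longrightarrow> formal_sum_X N \<mu> T v \<in> bm_carrier fock"
  by (rule fock_memI) (auto simp: formal_sum_X_def intro: fock_memD[OF formal_X_mem])

section \<open>One index j: passing between words and blocks\<close>

context
  fixes j :: nat
  assumes j: "j \<in> {1..N}"
begin

interpretation law "\<mu> j" using lawI[OF j] .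

lemma block_inner:
  "pair_inner (L j s) (p # ps, b) (q # qs, c) = star b * elt_inner (W s) (\<mu> j (star p * q)) ps qs * c"
  by (simp add: pair_inner_def preL2_simps coef_one)

text \<open>\<open>emit\<close> is adjoint to \<open>strip\<close>. If e begins with j, its first
  leg is centered and sees only the centered part of q; otherwise e sees only the part along the
  vacuum.\<close>

lemma key_inner_emit:
  assumes e: "[e] \<in> bm_carrier fock" and y: "[y] \<in> bm_carrier (block j)"
  shows "(\<Sum>z\<leftarrow>emit (\<mu> j) j y. key_inner W e z) = key_inner (L j) (strip j e) y"
proof -
  obtain t q qs c where yq: "y = (t, q # qs, c)" and t: "t \<in> T" "t = [] \<or> hd t \<noteq> j" "tensor_valid (W t) qs"
    using y by (rule block_cases)
  obtain s ps b where eq: "e = (s, ps, b)" by (cases e)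
  have v: "s \<in> T" "tensor_valid (W s) ps" using e by (simp_all add: eq fock_entry)
  show ?thesis
  proof (cases "s \<noteq> [] \<and> hd s = j")
    case True
    then obtain s' where s: "s = j # s'" by (cases s) auto
    obtain p ps' where ps: "ps = p # ps'" using v(2) by (auto simp: s word_factors_simps list_all2_Cons2)
    have p: "\<mu> j p = 0" "tensor_valid (W s') ps'" using v(2) j by (auto simp: s ps tensor_valid_Cons)
    have "star (\<mu> j p) = 0" using p by (simp add: star_zero)
    then have "\<mu> j (star p * center (\<mu> j) q) = \<mu> j (star p * q)"
      by (simp add: center_def right_diff_distrib law_diff law_right law_star)
    moreover have "s \<noteq> t" using t s by auto
    moreover have "s' \<in> T" using Tree_tl[OF T] v(1) s by simp
    ultimately show ?thesis
      using p t by (auto simp: emit_def eq yq strip_def key_inner_def s ps block_inner pair_inner_def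
          word_factors_simps bm_compl_simps preL2_simps coef_one)
  next
    case False
    then have "s \<noteq> j # t" by auto
    moreover have "pair_inner (W t) (ps, b) (lact (\<mu> j q) (qs, c)) =
        star b * elt_inner (W t) (\<mu> j q) ps qs * c" if "s = t"
      using elt_inner_left[of "W t" ps qs 1 "\<mu> j q" c] W_factor t v that
      by (simp add: pair_inner_def elt_left_poly_factors tensor_valid_length mult.assoc)
    ultimately show ?thesis
      using False v t by (auto simp: emit_def eq yq strip_def key_inner_def block_inner star_one)
  qed
qed

text \<open>\<open>emit\<close> after \<open>strip\<close> returns the entry itself together with
  one null entry, whose first leg or coefficient is zero. By \<open>key_inner_emit\<close> this
  means that \<open>strip\<close> is isometric.\<close>

lemma key_inner_strip:
  assumes e: "[e] \<in> bm_carrier fock" and f: "[f] \<in> bm_carrier fock"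
  shows "key_inner W e f = key_inner (L j) (strip j e) (strip j f)"
proof -
  obtain t qs c where fq: "f = (t, qs, c)" by (cases f)
  have w: "t \<in> T" "tensor_valid (W t) qs" using f by (simp_all add: fq fock_entry)
  show ?thesis
  proof (cases "t \<noteq> [] \<and> hd t = j")
    case False
    have y: "[strip j f] \<in> bm_carrier (block j)" by (rule strip_mem[OF f])
    have "strip j f = (t, 1 # qs, c)" using False by (simp add: strip_def fq)
    then have "emit (\<mu> j) j (strip j f) = [(j # t, 0 # qs, c), (t, lact 1 (qs, c))]"
      by (simp add: emit_def center_def law_one coef_one)
    moreover have "lact 1 (qs, c) = (qs, c)" by (cases qs) (simp_all add: coef_one)
    moreover have "key_inner W e (j # t, 0 # qs, c) = 0"
    proof (cases "fst e = j # t")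
      case True
      then obtain p ps b where "e = (j # t, p # ps, b)" "tensor_valid (W t) ps"
        using e by (cases e) (auto simp: fock_entry word_factors_simps list_all2_Cons2)
      then show ?thesis
        using w elt_inner_zero[of "W t" ps qs] W_factor[OF w(1)]
        by (simp add: key_inner_def pair_inner_def word_factors_simps bm_compl_simps preL2_simps law_zero)
    qed (simp add: key_inner_def)
    ultimately show ?thesis using key_inner_emit[OF e y] by (simp add: fq)
  next
    case True
    then obtain t' where t: "t = j # t'" by (cases t) auto
    obtain q qs' where qs: "qs = q # qs'" using w(2) by (auto simp: t word_factors_simps list_all2_Cons2)
    have q: "\<mu> j q = 0" "tensor_valid (W t') qs'" using w(2) j by (auto simp: t qs tensor_valid_Cons)
    have y: "[strip j f] \<in> bm_carrier (block j)" by (rule strip_mem[OF f])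
    have t': "t' \<in> T" using Tree_tl[OF T] w(1) t by simp
    have "strip j f = (t', q # qs', c)" by (simp add: strip_def fq t qs)
    then have em: "emit (\<mu> j) j (strip j f) = [(j # t', q # qs', c), (t', lact 0 (qs', c))]"
      by (simp add: emit_def center_def q coef_zero)
    have "key_inner W e (t', lact 0 (qs', c)) = 0"
    proof (cases "fst e = t'")
      case True
      then have "tensor_valid (W t') (fst (snd e))" using e by (cases e) (simp add: fock_entry)
      then show ?thesis
        using True elt_inner_left[of "W t'" "fst (snd e)" qs' 1 0 c] W_factor[OF t'] q(2)
          elt_inner_zero[of "W t'" "fst (snd e)" qs']
        by (simp add: key_inner_def pair_inner_def mult.assoc elt_left_poly_factors tensor_valid_length)
    qed (simp add: key_inner_def)
    then show ?thesis using key_inner_emit[OF e y] em by (simp add: fq t qs)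
  qed
qed

text \<open>The splitting of q into \<mu>(q) and its centered part is orthogonal, so
  \<open>emit\<close> is isometric on the blocks whose word j s lies in the tree.\<close>

lemma inner_emit_emit:
  assumes y: "[y] \<in> bm_carrier (block j)" and z: "[z] \<in> bm_carrier (block j)" and jT: "j # fst y \<in> T"
  shows "(\<Sum>e\<leftarrow>emit (\<mu> j) j y. \<Sum>f\<leftarrow>emit (\<mu> j) j z. key_inner W e f) = key_inner (L j) y z"
proof -
  obtain t q qs c where yq: "y = (t, q # qs, c)" and t: "t \<in> T" "t = [] \<or> hd t \<noteq> j" "tensor_valid (W t) qs"
    using y by (rule block_cases)
  obtain s p ps b where zp: "z = (s, p # ps, b)" and s: "s \<in> T" "s = [] \<or> hd s \<noteq> j" "tensor_valid (W s) ps"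
    using z by (rule block_cases)
  have "[e] \<in> bm_carrier fock" if "e \<in> set (emit (\<mu> j) j y)" for e
    using emit_mem[OF y jT] that by (rule fock_memD)
  then have "(\<Sum>e\<leftarrow>emit (\<mu> j) j y. \<Sum>f\<leftarrow>emit (\<mu> j) j z. key_inner W e f) =
      (\<Sum>e\<leftarrow>emit (\<mu> j) j y. key_inner (L j) (strip j e) z)"
    by (intro arg_cong[where f = sum_list] map_cong HOL.refl key_inner_emit z) auto
  also have "\<dots> = key_inner (L j) (t, center (\<mu> j) q # qs, c) z
      + key_inner (L j) (t, 1 # fst (lact (\<mu> j q) (qs, c)), snd (lact (\<mu> j q) (qs, c))) z"
    using t by (auto simp: emit_def yq strip_def)
  also have "\<dots> = key_inner (L j) y z"
  proof (cases "s = t")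
    case True
    note WF = W_factor[OF t(1)]
    have lv: "tensor_valid (W t) (fst (lact (\<mu> j q) (qs, c)))" by (rule lact_valid[OF t(1,3)])
    have "star (snd (lact (\<mu> j q) (qs, c))) * elt_inner (W t) (\<mu> j p) (fst (lact (\<mu> j q) (qs, c))) ps =
        star c * elt_inner (W t) (star (\<mu> j q) * \<mu> j p) qs ps"
      using elt_inner_left'[OF WF t(3), of ps "\<mu> j q" c "\<mu> j p"] s t True
      by (simp add: elt_left_poly_factors tensor_valid_length)
    moreover have "\<mu> j (star (center (\<mu> j) q) * p) = \<mu> j (star q * p) - star (\<mu> j q) * \<mu> j p"
      by (simp add: center_def star_diff star_coef left_diff_distrib law_diff law_left)
    ultimately show ?thesis
      using t s lv True WF
      by (simp add: yq zp key_inner_def block_inner star_one elt_inner_diff[OF WF]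
          left_diff_distrib right_diff_distrib)
  qed (simp add: key_inner_def yq zp)
  finally show ?thesis .
qed

lemma key_inner_mult_hd:
  assumes y: "[y] \<in> bm_carrier (block j)" and z: "[z] \<in> bm_carrier (block j)"
  shows "key_inner (L j) (mult_hd y) z = key_inner (L j) y (mult_hd z)"
proof -
  obtain t q qs c where yq: "y = (t, q # qs, c)" and t: "t \<in> T" "t = [] \<or> hd t \<noteq> j" "tensor_valid (W t) qs"
    using y by (rule block_cases)
  obtain s p ps b where zp: "z = (s, p # ps, b)" and s: "s \<in> T" "s = [] \<or> hd s \<noteq> j" "tensor_valid (W s) ps"
    using z by (rule block_cases)
  show ?thesis using t s
    by (cases "t = s") (auto simp: yq zp key_inner_def mult_hd_def block_inner star_mult star_indet mult.assoc)
qed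

lemma inner_word_X:
  assumes e: "[e] \<in> bm_carrier fock" and f: "[f] \<in> bm_carrier fock"
  shows "(\<Sum>z\<leftarrow>word_X \<mu> T j f. key_inner W e z) =
    (if j # fst (strip j f) \<in> T then key_inner (L j) (strip j e) (mult_hd (strip j f)) else 0)"
  using key_inner_emit[OF e mult_hd_mem[OF strip_mem[OF f]]] by (simp add: word_X_def Let_def)

text \<open>Both sides are the form of multiplication by X between \<open>strip j e\<close> and
  \<open>strip j f\<close>. The condition on the tree agrees as well, since only equal stripped
  words pair nontrivially.\<close>

lemma inner_word_X_adjoint:
  assumes e: "[e] \<in> bm_carrier fock" and f: "[f] \<in> bm_carrier fock"
  shows "(\<Sum>z\<leftarrow>word_X \<mu> T j f. key_inner W e z) = (\<Sum>z\<leftarrow>word_X \<mu> T j e. key_inner W z f)"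
proof -
  have k: "key_inner W z f = star (key_inner W f z)" if "z \<in> set (word_X \<mu> T j e)" for z
  proof -
    have "[z] \<in> bm_carrier fock" using word_X_mem[OF e] that by (rule fock_memD)
    from fock.star_inner[OF f this] show ?thesis by (simp add: fock_simps)
  qed
  have b: "star (key_inner (L j) y z) = key_inner (L j) z y"
    if "[y] \<in> bm_carrier (block j)" "[z] \<in> bm_carrier (block j)" for y z
    using pre_hilbert.star_inner[OF pre_correspondence.axioms(1)[OF block_pre[OF j]] that]
    by (simp add: block_def keyed_sum_def)
  note y = strip_mem[OF e, of j] strip_mem[OF f, of j]
  have "(\<Sum>z\<leftarrow>word_X \<mu> T j e. key_inner W z f) = star (\<Sum>z\<leftarrow>word_X \<mu> T j e. key_inner W f z)"
    using k by (simp add: star_sum_list o_def cong: map_cong)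
  also have "\<dots> = (if j # fst (strip j e) \<in> T then key_inner (L j) (mult_hd (strip j e)) (strip j f) else 0)"
    unfolding inner_word_X[OF f e] using b[OF y(2) mult_hd_mem[OF y(1)]] by (simp add: star_zero)
  also have "\<dots> = (if j # fst (strip j f) \<in> T then key_inner (L j) (strip j e) (mult_hd (strip j f)) else 0)"
    using key_inner_mult_hd[OF y] by (auto simp: key_inner_def)
  finally show ?thesis unfolding inner_word_X[OF e f] by simp
qed

lemma inner_formal_X:
  assumes u: "u \<in> bm_carrier fock" and v: "v \<in> bm_carrier fock"
  shows "bm_inner fock u (formal_X \<mu> T j v) = bm_inner fock (formal_X \<mu> T j u) v"
proof -
  have "bm_inner fock u (formal_X \<mu> T j v) = (\<Sum>e\<leftarrow>u. \<Sum>f\<leftarrow>v. \<Sum>z\<leftarrow>word_X \<mu> T j f. key_inner W e z)"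
    by (simp add: fock_simps formal_X_def sum_list_concat_map)
  also have "\<dots> = (\<Sum>e\<leftarrow>u. \<Sum>f\<leftarrow>v. \<Sum>z\<leftarrow>word_X \<mu> T j e. key_inner W z f)"
    by (intro arg_cong[where f = sum_list] map_cong HOL.refl inner_word_X_adjoint fock_memD[OF u] fock_memD[OF v])
  also have "\<dots> = (\<Sum>e\<leftarrow>u. \<Sum>z\<leftarrow>word_X \<mu> T j e. \<Sum>f\<leftarrow>v. key_inner W z f)"
    by (intro arg_cong[where f = sum_list] map_cong HOL.refl sum_list_swap)
  also have "\<dots> = bm_inner fock (formal_X \<mu> T j u) v"
    by (simp add: fock_simps formal_X_def sum_list_concat_map)
  finally show ?thesis .
qed

text \<open>\<open>formal_X\<close> is \<open>strip\<close>, then X on the first leg of the blocks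
  that are kept, then \<open>emit\<close>. The outer maps are isometric, and
  \<open>tensor_map_bound\<close> controls the middle one block by block.\<close>

lemma formal_X_bound:
  assumes v: "v \<in> bm_carrier fock"
  shows "fock.seminorm (formal_X \<mu> T j v) \<le> law_rad (\<mu> j) * fock.seminorm v"
proof -
  interpret B: pre_correspondence "block j" by (rule block_pre[OF j])
  define y where "y = map (strip j) v"
  define y' where "y' = filter (\<lambda>e. j # fst e \<in> T) y"
  define x where "x = map mult_hd y'"
  have y: "y \<in> bm_carrier (block j)"
    by (rule block_memI) (unfold y_def set_map, elim imageE, simp add: strip_mem fock_memD[OF v])
  have x: "x \<in> bm_carrier (block j)"
    by (rule block_memI) (unfold x_def y'_def set_map, elim imageE, simp add: mult_hd_mem block_memD[OF y])
  have Xv: "formal_X \<mu> T j v = concat (map (emit (\<mu> j) j) x)"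
    by (simp add: x_def y'_def y_def formal_X_def word_X_def Let_def) (induction v; simp add: word_X_def Let_def)
  have 1: "bm_inner fock v v = bm_inner (block j) y y"
    using fock_memD[OF v] key_inner_strip
    by (simp add: fock_simps block_def keyed_sum_def y_def o_def cong: map_cong)
  have "bm_inner fock (formal_X \<mu> T j v) (formal_X \<mu> T j v) =
      (\<Sum>a\<leftarrow>x. \<Sum>e\<leftarrow>emit (\<mu> j) j a. \<Sum>b\<leftarrow>x. \<Sum>f\<leftarrow>emit (\<mu> j) j b. key_inner W e f)"
    unfolding Xv by (simp add: fock_simps sum_list_concat_map)
  also have "\<dots> = (\<Sum>a\<leftarrow>x. \<Sum>b\<leftarrow>x. \<Sum>e\<leftarrow>emit (\<mu> j) j a. \<Sum>f\<leftarrow>emit (\<mu> j) j b. key_inner W e f)"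
    by (intro arg_cong[where f = sum_list] map_cong HOL.refl sum_list_swap)
  also have "\<dots> = (\<Sum>a\<leftarrow>x. \<Sum>b\<leftarrow>x. key_inner (L j) a b)"
    by (intro arg_cong[where f = sum_list] map_cong HOL.refl inner_emit_emit block_memD[OF x])
      (auto simp: x_def y'_def)
  finally have 2: "bm_inner fock (formal_X \<mu> T j v) (formal_X \<mu> T j v) = bm_inner (block j) x x"
    by (simp add: block_def keyed_sum_def)
  define K where "K = fst ` set y"
  have K: "finite K" "fst ` set y \<subseteq> K" "fst ` set x \<subseteq> K" "K \<subseteq> T"
    using y by (simp_all add: K_def x_def y'_def block_def keyed_sum_def block_words_def image_image)
      (auto simp: image_iff)
  have cx: "component s x = (if j # s \<in> T then pre.tensor_map (component s y) else [])" for s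
    unfolding x_def y'_def
    by (induction y) (auto simp: mult_hd_def pre.tensor_map_def case_prod_beta')
  have "cpos (\<Sum>s\<in>K. (law_rad (\<mu> j))\<^sup>2 *\<^sub>R bm_inner (pretensor (L j s)) (component s y) (component s y)
      - bm_inner (pretensor (L j s)) (component s x) (component s x))"
  proof (rule cpos_sum)
    fix s assume "s \<in> K"
    then have s: "s \<in> T" using K by blast
    have c: "component s y \<in> bm_carrier (pretensor (L j s))"
      by (rule component_mem[OF y[unfolded block_def]])
    interpret P: pre_correspondence "pretensor (L j s)"
      using L_factor[OF j s] by (rule pre_correspondence_pretensor)
    show "cpos ((law_rad (\<mu> j))\<^sup>2 *\<^sub>R bm_inner (pretensor (L j s)) (component s y) (component s y)
      - bm_inner (pretensor (L j s)) (component s x) (component s x))"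
    proof (cases "j # s \<in> T")
      case True
      show ?thesis unfolding cx using True pre.tensor_map_bound[OF W_factor[OF s] c] by simp
    next
      \<comment> \<open>A block that is cut off contributes nothing to x, so positivity of the part
        of y remains.\<close>
      case False
      then show ?thesis unfolding cx
        using cpos_scaleR[OF P.inner_pos[OF c], of "(law_rad (\<mu> j))\<^sup>2"] by (simp add: pretensor_simps)
    qed
  qed
  then have "cpos ((law_rad (\<mu> j))\<^sup>2 *\<^sub>R bm_inner (block j) y y - bm_inner (block j) x x)"
    unfolding block_def keyed_sum_inner[OF K(1,2)] keyed_sum_inner[OF K(1,3)]
    by (simp add: sum_subtractf scaleR_sum_right)
  from cpos_norm_mono[OF B.inner_pos[OF x] this]
  have "norm (bm_inner fock (formal_X \<mu> T j v) (formal_X \<mu> T j v)) \<le> (law_rad (\<mu> j))\<^sup>2 * norm (bm_inner fock v v)"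
    unfolding 1 2 by simp
  then have "(fock.seminorm (formal_X \<mu> T j v))\<^sup>2 \<le> (law_rad (\<mu> j) * fock.seminorm v)\<^sup>2"
    by (simp add: power_mult_distrib fock.seminorm_square)
  then show ?thesis by (rule power2_le_imp_le) (simp add: law_rad_nonneg)
qed

end

end

lemma ncpoly_abs: "\<exists>e. p = abs_ncpoly e"
  by (rule exI[of _ "rep_ncpoly p"]) (simp add: Quotient3_abs_rep[OF Quotient3_ncpoly])

section \<open>The formal convolution is a law\<close>

context tree_laws
begin

definition total_rad :: real where
  "total_rad = (\<Sum>j=1..N. law_rad (\<mu> j))"

lemma total_rad_nonneg: "total_rad \<ge> 0"
  unfolding total_rad_def using lawI by (intro sum_nonneg law.law_rad_nonneg) auto

lemma seminorm_formal_sum_X: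
  assumes v: "v \<in> bm_carrier fock"
  shows "fock.seminorm (formal_sum_X N \<mu> T v) \<le> total_rad * fock.seminorm v"
proof -
  have "fock.seminorm (concat (map (\<lambda>j. formal_X \<mu> T j v) js)) \<le> (\<Sum>j\<leftarrow>js. law_rad (\<mu> j)) * fock.seminorm v \<and>
      concat (map (\<lambda>j. formal_X \<mu> T j v) js) \<in> bm_carrier fock" if "set js \<subseteq> {1..N}" for js
    using that
  proof (induction js)
    case Nil
    show ?case using fock.zero_mem by (simp add: fock.seminorm_def fock_simps)
  next
    case (Cons j js)
    let ?u = "formal_X \<mu> T j v" and ?w = "concat (map (\<lambda>j. formal_X \<mu> T j v) js)"
    have u: "?u \<in> bm_carrier fock" by (rule formal_X_mem[OF v])
    have w: "?w \<in> bm_carrier fock" "fock.seminorm ?w \<le> (\<Sum>j\<leftarrow>js. law_rad (\<mu> j)) * fock.seminorm v"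
      using Cons by auto
    have "fock.seminorm (bm_add fock ?u ?w) \<le> fock.seminorm ?u + fock.seminorm ?w"
      by (rule fock.seminorm_add[OF u w(1)])
    also have "\<dots> \<le> law_rad (\<mu> j) * fock.seminorm v + (\<Sum>j\<leftarrow>js. law_rad (\<mu> j)) * fock.seminorm v"
      using Cons.prems by (intro add_mono formal_X_bound v w(2)) auto
    finally show ?case using fock.add_mem[OF u w(1)] by (simp add: fock_simps algebra_simps)
  qed
  moreover have "set [1..<Suc N] \<subseteq> {1..N}" by auto
  ultimately have "fock.seminorm (formal_sum_X N \<mu> T v) \<le> (\<Sum>j\<leftarrow>[1..<Suc N]. law_rad (\<mu> j)) * fock.seminorm v"
    unfolding formal_sum_X_def by blast
  also have "(\<Sum>j\<leftarrow>[1..<Suc N]. law_rad (\<mu> j)) = total_rad"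
    unfolding total_rad_def
    by (metis (no_types, lifting) atLeastLessThanSuc_atLeastAtMost distinct_upt set_upt sum_list_distinct_conv_sum_set)
  finally show ?thesis .
qed

lemma inner_formal_sum_X:
  assumes u: "u \<in> bm_carrier fock" and v: "v \<in> bm_carrier fock"
  shows "bm_inner fock u (formal_sum_X N \<mu> T v) = bm_inner fock (formal_sum_X N \<mu> T u) v"
proof -
  have "bm_inner fock u (concat (map (\<lambda>j. formal_X \<mu> T j v) js)) = bm_inner fock (concat (map (\<lambda>j. formal_X \<mu> T j u) js)) v"
    if "set js \<subseteq> {1..N}" for js
    using that
  proof (induction js)
    case (Cons j js)
    then have "bm_inner fock u (formal_X \<mu> T j v) = bm_inner fock (formal_X \<mu> T j u) v"
      using u v by (intro inner_formal_X) auto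
    then show ?case using Cons by (simp add: fock_simps sum_list_addf)
  qed (simp add: fock_simps)
  moreover have "set [1..<Suc N] \<subseteq> {1..N}" by auto
  ultimately show ?thesis unfolding formal_sum_X_def by blast
qed

abbreviation evl :: "'b ncexp \<Rightarrow> 'b entry list \<Rightarrow> 'b entry list" where
  "evl \<equiv> formal_eval N \<mu> T"

lemma evl_mem: "v \<in> bm_carrier fock \<Longrightarrow> evl e v \<in> bm_carrier fock"
proof (induction e arbitrary: v)
  case (NC_const b)
  then show ?case using fock.left_mem[where u=v and a=b] by (simp add: fock_left)
next
  case (NC_add p q)
  then show ?case using fock.add_mem[of "evl p v" "evl q v"] by (simp add: fock_simps)
qed (simp_all add: formal_sum_X_mem)

lemma inner_append:
  assumes "u \<in> bm_carrier fock" "v \<in> bm_carrier fock" "w \<in> bm_carrier fock"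
  shows "bm_inner fock w (u @ v) = bm_inner fock w u + bm_inner fock w v"
    and "bm_inner fock (u @ v) w = bm_inner fock u w + bm_inner fock v w"
  using fock.inner_add[OF assms] fock.inner_add_left[OF assms] by (simp_all add: fock_simps)

lemma inner_evl:
  assumes "u \<in> bm_carrier fock" "v \<in> bm_carrier fock"
  shows "bm_inner fock u (evl e v) = bm_inner fock (evl (exp_star e) u) v"
  using assms
proof (induction e arbitrary: u v)
  case (NC_const b)
  then show ?case using fock.inner_left[where u=v and w=u and a=b] by (simp add: fock_left)
qed (simp_all add: inner_formal_sum_X inner_append evl_mem)

abbreviation rmul :: "'b entry list \<Rightarrow> 'b \<Rightarrow> 'b entry list" where
  "rmul u b \<equiv> map (\<lambda>e. (fst e, fst (snd e), snd (snd e) * b)) u"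

lemma lact_right: "lact a (ps, b * c) = (fst (lact a (ps, b)), snd (lact a (ps, b)) * c)"
  by (cases ps) (simp_all add: mult.assoc)

lemma word_X_right:
  "word_X \<mu> T j (fst e, fst (snd e), snd (snd e) * b) = rmul (word_X \<mu> T j e) b"
  by (auto simp: word_X_def strip_def Let_def emit_def mult_hd_def lact_right)

lemma evl_right: "evl e (rmul v b) = rmul (evl e v) b"
proof (induction e arbitrary: v)
  case (NC_const a)
  show ?case by (auto simp: formal_left_def lact_right)
next
  case NC_var
  have "formal_X \<mu> T j (rmul v b) = rmul (formal_X \<mu> T j v) b" for j
    by (induction v) (simp_all add: formal_X_def word_X_right)
  then show ?case by (simp add: formal_sum_X_def map_concat o_def)
qed simp_all

lemma inner_left_scalar:
  assumes "u \<in> bm_carrier fock" "v \<in> bm_carrier fock"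
  shows "bm_inner fock u (bm_left fock (c *\<^sub>C 1) v) = bm_inner fock u (bm_right fock v (c *\<^sub>C 1))"
  using assms by (simp add: fock.inner_left_scaleC fock.inner_left_one fock.inner_right mult_scaleC_right)

text \<open>Equality here is weak, so for products the left factor is first moved to the other side
  by \<open>inner_evl\<close>. Centrality of scalars holds because a scalar acts alike from both
  sides and every operator commutes with the right action.\<close>

lemma inner_nceq:
  assumes "nceq e e'" "u \<in> bm_carrier fock" "v \<in> bm_carrier fock"
  shows "bm_inner fock u (evl e v) = bm_inner fock u (evl e' v)"
  using assms
proof (induction arbitrary: u v rule: nceq.induct)
  case (cong_mult p p' q q')
  have "bm_inner fock u (evl p (evl q v)) = bm_inner fock (evl (exp_star p) u) (evl q v)"
    using cong_mult.prems by (simp add: inner_evl evl_mem)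
  also have "\<dots> = bm_inner fock (evl (exp_star p) u) (evl q' v)"
    using cong_mult by (simp add: evl_mem)
  also have "\<dots> = bm_inner fock u (evl p (evl q' v))"
    using cong_mult.prems by (simp add: inner_evl evl_mem)
  finally show ?case using cong_mult by (simp add: evl_mem)
next
  case (add_zero p)
  then show ?case
    using fock.inner_left_zero[of v u] fock.left_mem[where u=v and a=0]
    by (simp add: inner_append evl_mem fock_left)
next
  case (add_neg p)
  have m: "evl p v \<in> bm_carrier fock" using add_neg by (simp add: evl_mem)
  then show ?case
    using add_neg fock.inner_left_add[where u="evl p v" and w=u and a="- 1" and b=1] fock.inner_left_zero[of v u]
      fock.inner_left_zero[of "evl p v" u] fock.left_mem[OF m, of "- 1"] fock.inner_left_one[of "evl p v" u]
    by (simp add: inner_append fock_left)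
next
  case (distrib_left p q r)
  then show ?case
    using inner_append[of "evl q v" "evl r v"] fock.add_mem[of "evl q v" "evl r v"]
    by (simp add: inner_evl[of u] evl_mem inner_append fock_simps(2))
next
  case (mult_one_left p)
  then show ?case using fock.inner_left_one[of "evl p v" u] by (simp add: fock_left evl_mem)
next
  case (mult_one_right p)
  then show ?case
    using fock.inner_left_one[of v "evl (exp_star p) u"] fock.left_mem[where u=v and a=1]
    by (simp add: fock_left evl_mem inner_evl[of u])
next
  case (const_add a b)
  then show ?case
    using fock.inner_left_add[where u=v and w=u and a=a and b=b] fock.left_mem[where u=v] by (simp add: fock_left inner_append)
next
  case (const_mult a b)
  then show ?case
    using fock.inner_left_mult[where u=v and w=u and a=a and b=b] fock.left_mem[where u=v and a=b] by (simp add: fock_left)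
next
  case (scalar_central c)
  note uv = scalar_central.prems
  have "bm_inner fock u (formal_sum_X N \<mu> T (bm_left fock (c *\<^sub>C 1) v)) =
      bm_inner fock u (formal_sum_X N \<mu> T (bm_right fock v (c *\<^sub>C 1)))"
    using uv by (simp add: inner_formal_sum_X inner_left_scalar formal_sum_X_mem fock.left_mem fock.right_mem)
  also have "\<dots> = bm_inner fock u (bm_right fock (formal_sum_X N \<mu> T v) (c *\<^sub>C 1))"
    using evl_right[where e=NC_var and v=v] by (simp add: fock_simps)
  also have "\<dots> = bm_inner fock u (bm_left fock (c *\<^sub>C 1) (formal_sum_X N \<mu> T v))"
    using uv by (simp add: inner_left_scalar formal_sum_X_mem)
  finally show ?case using uv by (simp add: fock_left formal_sum_X_mem)
qed (simp_all add: inner_append evl_mem)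

lemma vac_mem: "formal_vac \<in> bm_carrier fock"
  using T by (simp add: formal_vac_def fock_entry Tree_def word_factors_simps)

lemma formal_expect_eq:
  assumes v: "v \<in> bm_carrier fock" shows "formal_expect v = bm_inner fock formal_vac v"
proof -
  have "(if fst e = [] then snd (snd e) else 0) = key_inner W ([], [], 1) e" for e :: "'b entry"
    by (cases "fst e") (simp_all add: key_inner_def pair_inner_def word_factors_simps star_one)
  then show ?thesis unfolding formal_expect_def by (simp add: fock_simps formal_vac_def)
qed

lemma formal_expect_left:
  assumes v: "v \<in> bm_carrier fock" shows "formal_expect (formal_left a v) = a * formal_expect v"
proof -
  have "snd (lact a (snd e)) = a * snd (snd e)" if "e \<in> set v" "fst e = []" for e
    using fock_memD[OF v that(1)] that(2) by (cases e) (auto simp: fock_entry word_factors_simps)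
  then have *: "(if fst e = [] then snd (lact a (snd e)) else 0) = a * (if fst e = [] then snd (snd e) else 0)"
    if "e \<in> set v" for e
    using that by simp
  have "formal_expect (formal_left a v) = (\<Sum>e\<leftarrow>v. if fst e = [] then snd (lact a (snd e)) else 0)"
    by (simp add: formal_expect_def formal_left_def o_def cong: if_cong)
  also have "\<dots> = (\<Sum>e\<leftarrow>v. a * (if fst e = [] then snd (snd e) else 0))"
    by (intro arg_cong[where f = sum_list] map_cong HOL.refl *)
  finally show ?thesis by (simp add: formal_expect_def sum_list_const_mult)
qed

lemma formal_expect_right: "formal_expect (rmul v b) = formal_expect v * b"
  by (induction v) (auto simp: formal_expect_def algebra_simps)

abbreviation conv :: "'b law" where
  "conv \<equiv> formal_law N \<mu> T"

text \<open>\<open>formal_law\<close> evaluates the representative picked by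
  \<open>rep_ncpoly\<close>; by \<open>inner_nceq\<close> every equivalent expression gives the same
  value.\<close>

lemma conv_abs: "conv (abs_ncpoly e) = formal_expect (evl e formal_vac)"
proof -
  have "nceq (rep_ncpoly (abs_ncpoly e)) e"
    by (rule rep_abs_rsp_left[OF Quotient3_ncpoly]) (rule nceq.refl)
  from inner_nceq[OF this vac_mem vac_mem] show ?thesis
    by (simp add: formal_law_def formal_expect_eq evl_mem vac_mem)
qed

lemma conv_add: "conv (p + q) = conv p + conv q"
proof -
  obtain e f where "p = abs_ncpoly e" "q = abs_ncpoly f" using ncpoly_abs by metis
  then show ?thesis by (simp add: plus_ncpoly.abs_eq conv_abs formal_expect_def)
qed

lemma conv_one: "conv 1 = 1"
  by (simp add: one_ncpoly.abs_eq conv_abs formal_left_def formal_vac_def formal_expect_def)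

lemma conv_bimod: "conv (coef a * p * coef b) = a * conv p * b"
proof -
  obtain e where e: "p = abs_ncpoly e" using ncpoly_abs by metis
  have "formal_left b formal_vac = rmul formal_vac b" by (simp add: formal_left_def formal_vac_def)
  moreover have "rmul (evl e formal_vac) b \<in> bm_carrier fock"
    using fock.right_mem[OF evl_mem[OF vac_mem]] by (simp add: fock_simps)
  ultimately show ?thesis
    by (simp add: e coef.abs_eq times_ncpoly.abs_eq conv_abs evl_right formal_expect_right
        formal_expect_left mult.assoc)
qed

lemma conv_sum: "conv (sum f A) = (\<Sum>k\<in>A. conv (f k))"
proof -
  have "conv 0 = 0" using conv_add[of 0 0] by simp
  then show ?thesis by (induction A rule: infinite_finite_induct) (simp_all add: conv_add)
qed

lemma conv_star_mult:
  "conv (star (abs_ncpoly e) * abs_ncpoly f) = bm_inner fock (evl e formal_vac) (evl f formal_vac)"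
proof -
  have "star (abs_ncpoly e) = abs_ncpoly (exp_star e)" by (simp add: star_ncpoly.abs_eq)
  moreover have "exp_star (exp_star e) = e" by (induction e) (simp_all add: star_star)
  ultimately show ?thesis
    by (simp add: times_ncpoly.abs_eq conv_abs formal_expect_eq evl_mem vac_mem inner_evl[of formal_vac])
qed

text \<open>The matrix is a sum of Gram matrices of vectors obtained from the vacuum, hence
  nonnegative as a form, and \<open>mat_positive_iff\<close> supplies the factorization that the
  definition asks for.\<close>

lemma conv_cp: "completely_positive conv"
  unfolding completely_positive_def
proof (intro allI)
  fix m and P :: "nat \<Rightarrow> nat \<Rightarrow> 'b ncpoly"
  define e where "e k i = rep_ncpoly (P k i)" for k i
  have P: "P k i = abs_ncpoly (e k i)" for k i
    by (simp add: e_def Quotient3_abs_rep[OF Quotient3_ncpoly])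
  define x where "x k i = evl (e k i) formal_vac" for k i
  have x: "x k i \<in> bm_carrier fock" for k i by (simp add: x_def evl_mem vac_mem)
  have "mat_nonneg m (\<lambda>i j. \<Sum>k<m. bm_inner fock (x k i) (x k j))"
    unfolding mat_nonneg_def
  proof (intro conjI allI impI)
    show "star (\<Sum>k<m. bm_inner fock (x k i) (x k j)) = (\<Sum>k<m. bm_inner fock (x k j) (x k i))" for i j
      by (simp add: star_sum fock.star_inner x)
    fix z :: "nat \<Rightarrow> 'b"
    have "(\<Sum>i<m. \<Sum>j<m. star (z i) * (\<Sum>k<m. bm_inner fock (x k i) (x k j)) * z j) =
        (\<Sum>i<m. \<Sum>j<m. \<Sum>k<m. bm_inner fock (bm_right fock (x k i) (z i)) (bm_right fock (x k j) (z j)))"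
      by (intro sum.cong HOL.refl)
        (simp add: fock.inner_right fock.inner_right_left x fock.right_mem sum_distrib_left sum_distrib_right mult.assoc)
    also have "\<dots> = (\<Sum>i<m. \<Sum>k<m. \<Sum>j<m. bm_inner fock (bm_right fock (x k i) (z i)) (bm_right fock (x k j) (z j)))"
      by (intro sum.cong HOL.refl sum.swap)
    also have "\<dots> = (\<Sum>k<m. \<Sum>i<m. \<Sum>j<m. bm_inner fock (bm_right fock (x k i) (z i)) (bm_right fock (x k j) (z j)))"
      by (rule sum.swap)
    finally show "cpos (\<Sum>i<m. \<Sum>j<m. star (z i) * (\<Sum>k<m. bm_inner fock (x k i) (x k j)) * z j)"
      by (simp add: cpos_sum x fock.right_mem fock.gram_sum_pos)
  qed
  then show "mat_positive m (\<lambda>i j. conv (\<Sum>k<m. star (P k i) * P k j))"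
    unfolding mat_positive_iff conv_sum P conv_star_mult x_def .
qed

text \<open>Coefficients and X are applied one at a time to the vacuum, a unit vector. The constant
  1 in front is what lets the radius be read off.\<close>

lemma conv_moment:
  fixes bs :: "'b list"
  shows "norm (conv (nc_monomial b bs)) \<le> total_rad ^ length bs * (norm b * prod_list (map norm bs))"
proof -
  have v1: "fock.seminorm formal_vac = 1"
    by (simp add: fock.seminorm_def fock_simps formal_vac_def key_inner_def pair_inner_def star_one word_factors_simps)
  have "\<exists>e. nc_monomial b bs = abs_ncpoly e \<and>
      fock.seminorm (evl e formal_vac) \<le> total_rad ^ length bs * (norm b * prod_list (map norm bs))"
  proof (induction bs arbitrary: b)
    case Nil
    have "fock.seminorm (bm_left fock b formal_vac) \<le> norm b * fock.seminorm formal_vac"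
      by (rule fock.seminorm_left[OF vac_mem])
    then show ?case
      by (intro exI[of _ "NC_const b"]) (simp add: nc_monomial_Nil coef.abs_eq fock_left vac_mem v1)
  next
    case (Cons c cs)
    obtain e where e: "nc_monomial c cs = abs_ncpoly e"
      "fock.seminorm (evl e formal_vac) \<le> total_rad ^ length cs * (norm c * prod_list (map norm cs))"
      using Cons by blast
    let ?v = "evl e formal_vac"
    have v: "?v \<in> bm_carrier fock" "formal_sum_X N \<mu> T ?v \<in> bm_carrier fock"
      by (simp_all add: evl_mem vac_mem formal_sum_X_mem)
    have "fock.seminorm (bm_left fock b (formal_sum_X N \<mu> T ?v)) \<le> norm b * fock.seminorm (formal_sum_X N \<mu> T ?v)"
      by (rule fock.seminorm_left[OF v(2)])
    also have "\<dots> \<le> norm b * (total_rad * fock.seminorm ?v)"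
      by (intro mult_left_mono seminorm_formal_sum_X v(1)) simp
    also have "\<dots> \<le> norm b * (total_rad * (total_rad ^ length cs * (norm c * prod_list (map norm cs))))"
      by (intro mult_left_mono e(2) total_rad_nonneg) simp
    finally show ?case
      by (intro exI[of _ "NC_mult (NC_const b) (NC_mult NC_var e)"])
        (simp add: nc_monomial_Cons coef.abs_eq indet.abs_eq times_ncpoly.abs_eq e(1) fock_left v mult_ac)
  qed
  then obtain e where e: "nc_monomial b bs = abs_ncpoly e"
    "fock.seminorm (evl e formal_vac) \<le> total_rad ^ length bs * (norm b * prod_list (map norm bs))" by blast
  have "norm (conv (nc_monomial b bs)) = norm (bm_inner fock formal_vac (evl e formal_vac))"
    by (simp add: e(1) conv_abs formal_expect_eq evl_mem vac_mem)
  also have "\<dots> \<le> fock.seminorm formal_vac * fock.seminorm (evl e formal_vac)"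
    by (intro fock.Cauchy_Schwarz vac_mem evl_mem)
  finally show ?thesis using e(2) v1 by simp
qed

lemma conv_exp_bound: "e > 0 \<Longrightarrow> exp_bound conv 1 (total_rad + e)"
  unfolding exp_bound_def
proof (intro allI)
  fix b :: 'b and bs :: "'b list" assume e: "e > 0"
  have "total_rad ^ length bs * (norm b * prod_list (map norm bs)) \<le>
      (total_rad + e) ^ length bs * (norm b * prod_list (map norm bs))"
    using e total_rad_nonneg by (intro mult_right_mono power_mono) (auto simp: prod_list_norm_nonneg)
  then show "norm (conv (nc_monomial b bs)) \<le> 1 * (total_rad + e) ^ length bs * (norm b * prod_list (map norm bs))"
    using conv_moment[of b bs] by simp
qed

lemma conv_law: "conv \<in> laws"
proof -
  have "\<exists>M>0. \<exists>R>0. exp_bound conv M R"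
    using conv_exp_bound[of 1] total_rad_nonneg by (intro exI[of _ 1] conjI exI[of _ "total_rad + 1"]) auto
  then show ?thesis by (simp add: laws_def conv_one conv_add conv_bimod conv_cp)
qed

lemma conv_rad: "law_rad conv \<le> total_rad"
proof (rule field_le_epsilon)
  fix e :: real assume "e > 0"
  then have "total_rad + e \<in> {R. R > 0 \<and> (\<exists>M>0. exp_bound conv M R)}"
    using conv_exp_bound[of e] total_rad_nonneg by (auto intro!: exI[of _ 1])
  then show "law_rad conv \<le> total_rad + e"
    unfolding law_rad_def by (rule cInf_lower) (auto intro!: bdd_belowI[of _ 0])
qed

end

section \<open>The \<open>T\<close>-free convolution in terms of the algebraic model\<close>

lemma cpos_sum_eq_0:
  assumes "cpos a" "cpos b" "a + b = 0" shows "a = 0" "b = 0"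
proof -
  show "a = 0" using assms by (intro cpos_antisym) (simp_all add: eq_neg_iff_add_eq_0[symmetric])
  then show "b = 0" using assms by simp
qed

section \<open>Formal sums inside the completed tree space\<close>

context tree_laws
begin

lemma fock_Cons:
  assumes "e # v \<in> bm_carrier fock" shows "[e] \<in> bm_carrier fock" "v \<in> bm_carrier fock"
  using fock_memD[OF assms] by (auto intro: fock_memI)

definition LH :: "nat \<Rightarrow> ('b ncpoly completion, 'b) bimod" where "LH j = L2 (\<mu> j)"

definition L\<xi> :: "nat \<Rightarrow> 'b ncpoly completion" where "L\<xi> j = L2_one (\<mu> j)"

abbreviation F :: "nat list \<Rightarrow> ('b ncpoly completion, 'b) bimod list" where
  "F \<equiv> word_factors LH L\<xi>"

lemma F_factor:
  assumes "s \<in> T" "H \<in> set (F s)" shows "pre_correspondence H"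
  using assms Tree_alternating(1)[OF T assms(1)] law.pre_correspondence_L2_compl[OF lawI]
  by (auto simp: word_factors_def LH_def L\<xi>_def)

lemma F_pretensor: "s \<in> T \<Longrightarrow> pre_correspondence (pretensor (F s))"
  using F_factor by (rule pre_correspondence_pretensor)

definition emb_word :: "nat list \<Rightarrow> 'b ncpoly list \<Rightarrow> 'b ncpoly completion list" where
  "emb_word s ps = map2 (\<lambda>j p. cl_embed (preL2 (\<mu> j)) p) s ps"

lemma emb_word_simps [simp]:
  "emb_word [] ps = []" "emb_word (j # s) (p # ps) = cl_embed (preL2 (\<mu> j)) p # emb_word s ps"
  by (simp_all add: emb_word_def)

definition emb_component :: "nat list \<Rightarrow> 'b entry list \<Rightarrow> ('b ncpoly completion, 'b) pretensor" where
  "emb_component t v = map (\<lambda>x. (emb_word t (fst x), snd x)) (component t v)"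

lemma emb_component_simps [simp]:
  "emb_component t [] = []" "emb_component t (u @ v) = emb_component t u @ emb_component t v"
  "emb_component t (e # u) =
    (if fst e = t then (emb_word t (fst (snd e)), snd (snd e)) # emb_component t u else emb_component t u)"
  by (simp_all add: emb_component_def)

definition emb_vector :: "'b entry list \<Rightarrow> nat list \<Rightarrow> ('b ncpoly completion, 'b) tensor" where
  "emb_vector v = (\<lambda>t\<in>T. cl_embed (pretensor (F t)) (emb_component t v))"

lemma emb_word_valid:
  "s \<in> T \<Longrightarrow> tensor_valid (W s) ps \<Longrightarrow> tensor_valid (F s) (emb_word s ps)"
proof (induction s arbitrary: ps)
  case (Cons j s)
  have j: "j \<in> {1..N}" by (rule Tree_Cons(1)[OF T Cons.prems(1)])
  interpret law "\<mu> j" using lawI[OF j] .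
  obtain p ps' where ps: "ps = p # ps'"
    using Cons.prems(2) by (auto simp: word_factors_simps list_all2_Cons2)
  have "\<mu> j p = 0" "tensor_valid (W s) ps'" using Cons.prems(2) tensor_valid_Cons[OF j] by (simp_all add: ps)
  moreover have "s \<in> T" using Tree_tl[OF T Cons.prems(1)] .
  ultimately show ?case
    using Cons.IH[of ps'] by (simp add: ps word_factors_simps bm_compl_simps LH_def L\<xi>_def emb_simps law_star star_zero)
qed (simp add: word_factors_simps)

lemma emb_component_mem:
  assumes "v \<in> bm_carrier fock" "t \<in> T"
  shows "emb_component t v \<in> bm_carrier (pretensor (F t))"
  using assms(1)
proof (induction v)
  case (Cons e v)
  have "[e] \<in> bm_carrier fock" "v \<in> bm_carrier fock"
    using fock_Cons[OF Cons.prems] by simp_all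
  then show ?case
    using Cons.IH emb_word_valid[OF assms(2)] by (cases e) (auto simp: pretensor_simps fock_entry)
qed (simp add: pretensor_simps)

abbreviation tree_mod :: "(nat list \<Rightarrow> ('b ncpoly completion, 'b) tensor, 'b) bimod" where
  "tree_mod \<equiv> tree_space LH L\<xi> T"

lemma word_space_eq: "word_space LH L\<xi> t = completion (pretensor (F t))"
  by (simp add: word_space_def tensor_def)

lemma tree_mod_simps:
  "bm_zero tree_mod = (\<lambda>s\<in>T. cl_embed (pretensor (F s)) [])"
  "bm_add tree_mod v w = (\<lambda>s\<in>T. bm_add (completion (pretensor (F s))) (v s) (w s))"
  "bm_left tree_mod b v = (\<lambda>s\<in>T. bm_left (completion (pretensor (F s))) b (v s))"
  "bm_inner tree_mod v w = (\<Sum>\<^sub>\<infinity>s\<in>T. bm_inner (completion (pretensor (F s))) (v s) (w s))"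
  by (auto simp: tree_space_def bm_dsum_def word_space_eq completion_def pretensor_simps)

lemma emb_vector_zero: "emb_vector [] = bm_zero tree_mod"
  by (simp add: emb_vector_def tree_mod_simps)

lemma emb_vector_add:
  assumes "u \<in> bm_carrier fock" "v \<in> bm_carrier fock"
  shows "bm_add tree_mod (emb_vector u) (emb_vector v) = emb_vector (u @ v)"
  unfolding tree_mod_simps emb_vector_def
proof (rule restrict_ext)
  fix s assume s: "s \<in> T"
  then interpret P: pre_correspondence "pretensor (F s)" by (rule F_pretensor)
  show "bm_add (completion (pretensor (F s))) ((\<lambda>t\<in>T. cl_embed (pretensor (F t)) (emb_component t u)) s)
      ((\<lambda>t\<in>T. cl_embed (pretensor (F t)) (emb_component t v)) s)
    = cl_embed (pretensor (F s)) (emb_component s (u @ v))"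
    using s assms by (simp add: P.cl_embed_add emb_component_mem) (simp add: pretensor_simps)
qed

lemma elt_left_F:
  assumes "s \<in> T" "tensor_valid (W s) ps"
  shows "elt_left (F s) a (emb_word s ps, b) = (emb_word s (fst (lact a (ps, b))), snd (lact a (ps, b)))"
proof (cases s)
  case (Cons j s')
  then have j: "j \<in> {1..N}" using Tree_Cons(1)[OF T] assms(1) by simp
  interpret law "\<mu> j" using lawI[OF j] .
  obtain p ps' where ps: "ps = p # ps'"
    using assms(2) by (auto simp: Cons word_factors_simps list_all2_Cons2)
  show ?thesis by (simp add: Cons ps word_factors_simps bm_compl_simps LH_def emb_simps)
next
  case Nil
  then show ?thesis using assms by (simp add: word_factors_simps)
qed

lemma emb_component_left:
  assumes "v \<in> bm_carrier fock" "t \<in> T"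
  shows "bm_left (pretensor (F t)) a (emb_component t v) = emb_component t (formal_left a v)"
  using assms(1)
proof (induction v)
  case (Cons e v)
  have "[e] \<in> bm_carrier fock" "v \<in> bm_carrier fock"
    using fock_Cons[OF Cons.prems] by simp_all
  then show ?case
    using Cons.IH elt_left_F[of t _ a] by (cases e) (auto simp: pretensor_simps fock_entry formal_left_def)
qed (simp add: pretensor_simps formal_left_def)

lemma emb_vector_left:
  assumes "v \<in> bm_carrier fock"
  shows "bm_left tree_mod a (emb_vector v) = emb_vector (formal_left a v)"
  unfolding tree_mod_simps emb_vector_def
proof (rule restrict_ext)
  fix s assume s: "s \<in> T"
  then interpret P: pre_correspondence "pretensor (F s)" by (rule F_pretensor)
  show "bm_left (completion (pretensor (F s))) a ((\<lambda>t\<in>T. cl_embed (pretensor (F t)) (emb_component t v)) s)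
    = cl_embed (pretensor (F s)) (emb_component s (formal_left a v))"
    using s assms by (simp add: P.cl_embed_left emb_component_mem emb_component_left)
qed

lemma vacuum_eq: "vacuum LH L\<xi> T = emb_vector formal_vac"
  by (auto simp: vacuum_def emb_vector_def formal_vac_def word_space_eq completion_def pretensor_simps
      word_factors_simps fun_eq_iff restrict_def)

text \<open>The vacuum lives on the empty word alone, so the infinite sum has a single nonzero
  term.\<close>

lemma inner_vacuum:
  assumes v: "v \<in> bm_carrier fock"
  shows "bm_inner tree_mod (vacuum LH L\<xi> T) (emb_vector v) = formal_expect v"
proof -
  have nil: "[] \<in> T" using T by (simp add: Tree_def)
  have summand: "bm_inner (completion (pretensor (F s))) (vacuum LH L\<xi> T s) (emb_vector v s) =
      bm_inner (pretensor (F s)) (emb_component s formal_vac) (emb_component s v)" if s: "s \<in> T" for s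
  proof -
    interpret P: pre_correspondence "pretensor (F s)" using s by (rule F_pretensor)
    show ?thesis
      unfolding vacuum_eq emb_vector_def using s v vac_mem by (simp add: P.inner_cl_embed emb_component_mem)
  qed
  have "bm_inner tree_mod (vacuum LH L\<xi> T) (emb_vector v) =
      (\<Sum>\<^sub>\<infinity>s\<in>T. bm_inner (pretensor (F s)) (emb_component s formal_vac) (emb_component s v))"
    unfolding tree_mod_simps by (intro infsum_cong summand)
  also have "\<dots> = (\<Sum>\<^sub>\<infinity>s\<in>{[]}. bm_inner (pretensor (F s)) (emb_component s formal_vac) (emb_component s v))"
    using nil by (intro infsum_cong_neutral) (auto simp: formal_vac_def pretensor_simps)
  also have "\<dots> = (\<Sum>f\<leftarrow>emb_component [] v. snd f)"
    by (simp add: formal_vac_def pretensor_simps pair_inner_def word_factors_simps star_one)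
  also have "\<dots> = formal_expect v"
    by (induction v) (auto simp: formal_expect_def)
  finally show ?thesis .
qed

end

subsection \<open>The action of \<open>X\<close> on a pair of words\<close>

locale tree_pair = tree_laws N T \<mu>
  for N :: nat and T :: "nat list set" and \<mu> :: "nat \<Rightarrow> 'b::unital_cstar_algebra law" +
  fixes j :: nat and t :: "nat list"
  assumes jt: "j # t \<in> T"
begin

lemma jN: "j \<in> {1..N}" and t_hd: "t = [] \<or> hd t \<noteq> j" and tT: "t \<in> T"
  using Tree_Cons[OF T jt] Tree_tl[OF T jt] by auto

sublocale law "\<mu> j" using lawI[OF jN] .

abbreviation "G \<equiv> left_factors LH L\<xi> j t"

lemma G_eq: "G = L2 (\<mu> j) # F t"
  by (simp add: left_factors_def LH_def)

lemma F_Cons: "F (j # t) = bm_compl (L2 (\<mu> j)) (L2_one (\<mu> j)) # F t"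
  by (simp add: word_factors_simps LH_def L\<xi>_def)

sublocale Pt: pre_correspondence "pretensor (F t)" using tT by (rule F_pretensor)

sublocale Pjt: pre_correspondence "pretensor (F (j # t))" using jt by (rule F_pretensor)

lemma G_factor: "H \<in> set G \<Longrightarrow> pre_correspondence H"
  using F_factor[OF tT] L2.pre_correspondence_axioms by (auto simp: G_eq)

sublocale PG: pre_correspondence "pretensor G" using G_factor by (rule pre_correspondence_pretensor)

definition add_vac :: "('b ncpoly completion, 'b) pretensor \<Rightarrow> ('b ncpoly completion, 'b) pretensor" where
  "add_vac = map (\<lambda>(hs, b). (L\<xi> j # hs, b))"

lemma add_vac_mem: "u \<in> bm_carrier (pretensor (F t)) \<Longrightarrow> add_vac u \<in> bm_carrier (pretensor G)"
  by (auto simp: add_vac_def pretensor_simps G_eq L\<xi>_def emb_simps)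

lemma incl_mem: "u \<in> bm_carrier (pretensor (F (j # t))) \<Longrightarrow> u \<in> bm_carrier (pretensor G)"
  by (fastforce simp: pretensor_simps G_eq F_Cons list_all2_Cons2 bm_compl_simps)

lemma inner_add_vac:
  "bm_inner (pretensor G) (add_vac u) (add_vac v) = bm_inner (pretensor (F t)) u v"
  by (simp add: add_vac_def pretensor_simps o_def case_prod_beta' pair_inner_def G_eq L\<xi>_def emb_simps
      coef_one star_one law_one)

lemma elt_inner_incl: "elt_inner (F (j # t)) a hs ks = elt_inner G a hs ks"
  by (cases hs; cases ks) (simp_all add: G_eq F_Cons bm_compl_simps)

lemma inner_incl: "bm_inner (pretensor G) u v = bm_inner (pretensor (F (j # t))) u v"
  by (simp add: pretensor_simps pair_inner_def elt_inner_incl)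

lemma inner_add_vac_incl:
  assumes u: "u \<in> bm_carrier (pretensor (F t))" and v: "v \<in> bm_carrier (pretensor (F (j # t)))"
  shows "bm_inner (pretensor G) (add_vac u) v = 0"
proof -
  have "pair_inner G (L\<xi> j # fst e, snd e) f = 0" if "e \<in> set u" "f \<in> set v" for e f
  proof -
    have e: "tensor_valid (F t) (fst e)" and f: "tensor_valid (F (j # t)) (fst f)"
      using u v that by (auto simp: pretensor_simps)
    obtain k ks where k: "fst f = k # ks" "k \<in> bm_carrier (L2 (\<mu> j))" "bm_inner (L2 (\<mu> j)) k (emb 1) = 0"
      "tensor_valid (F t) ks"
      using f by (auto simp: F_Cons list_all2_Cons2 bm_compl_simps emb_simps)
    have "bm_inner (L2 (\<mu> j)) (emb 1) k = 0"
      using L2.star_inner[OF k(2) emb_simps(1)[of 1]] k(3) by (simp add: star_zero)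
    then show ?thesis
      using e k elt_inner_zero[OF F_factor[OF tT] e k(4)]
      by (simp add: pair_inner_def G_eq L\<xi>_def emb_simps L2.inner_left_one)
  qed
  then show ?thesis
    by (simp add: pretensor_simps add_vac_def o_def case_prod_beta' cong: map_cong)
qed

lemma dist_add_vac:
  assumes "u \<in> bm_carrier (pretensor (F t))" "v \<in> bm_carrier (pretensor (F t))"
  shows "bm_dist (pretensor G) (add_vac u) (add_vac v) \<le> 1 * bm_dist (pretensor (F t)) u v"
proof -
  have "PG.diff (add_vac u) (add_vac v) = add_vac (Pt.diff u v)"
    by (simp add: PG.diff_def Pt.diff_def pretensor_simps add_vac_def o_def case_prod_beta')
  then show ?thesis
    by (simp add: PG.bm_dist_eq Pt.bm_dist_eq PG.seminorm_def Pt.seminorm_def inner_add_vac)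
qed

lemma dist_incl:
  "bm_dist (pretensor G) (id u) (id v) \<le> 1 * bm_dist (pretensor (F (j # t))) u v"
  by (simp add: PG.bm_dist_eq Pjt.bm_dist_eq PG.seminorm_def Pjt.seminorm_def inner_incl
      PG.diff_def Pjt.diff_def pretensor_simps(2,4))

lemma left_iso_class:
  assumes f: "f \<in> bm_Cauchy (pretensor (F t))" and g: "g \<in> bm_Cauchy (pretensor (F (j # t)))"
  shows "(\<lambda>n. add_vac (f n) @ g n) \<in> bm_Cauchy (pretensor G)"
    and "left_iso LH L\<xi> j t (cl_class (pretensor (F t)) f, cl_class (pretensor (F (j # t))) g) =
      cl_class (pretensor G) (\<lambda>n. add_vac (f n) @ g n)"
proof -
  note 1 = cl_extend_class[OF Pt.pre_hilbert_axioms PG.pre_hilbert_axioms add_vac_mem dist_add_vac f]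
  have "id u \<in> bm_carrier (pretensor G)" if "u \<in> bm_carrier (pretensor (F (j # t)))" for u
    using incl_mem[OF that] by simp
  note 2 = cl_extend_class[OF Pjt.pre_hilbert_axioms PG.pre_hilbert_axioms this dist_incl g]
  note 3 = PG.add_completion[OF 1(1) 2(1)]
  show "(\<lambda>n. add_vac (f n) @ g n) \<in> bm_Cauchy (pretensor G)" using 3(1) by (simp add: pretensor_simps)
  show "left_iso LH L\<xi> j t (cl_class (pretensor (F t)) f, cl_class (pretensor (F (j # t))) g) =
      cl_class (pretensor G) (\<lambda>n. add_vac (f n) @ g n)"
    using 1(2) 2(2) 3(2) by (simp add: left_iso_def tensor_def add_vac_def pretensor_simps(2) id_def)
qed

abbreviation "V1 \<equiv> bm_carrier (word_space LH L\<xi> t)"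
abbreviation "V2 \<equiv> bm_carrier (word_space LH L\<xi> (j # t))"

text \<open>The two summands have orthogonal images by \<open>inner_add_vac_incl\<close>, so inner
  products add on representatives; the identity then passes to limits of Cauchy sequences.\<close>

lemma inner_left_iso:
  assumes A: "A \<in> V1" and B: "B \<in> V2" and A': "A' \<in> V1" and B': "B' \<in> V2"
  shows "bm_inner (completion (pretensor G)) (left_iso LH L\<xi> j t (A, B)) (left_iso LH L\<xi> j t (A', B')) =
    bm_inner (completion (pretensor (F t))) A A' + bm_inner (completion (pretensor (F (j # t)))) B B'"
proof -
  obtain f where f: "f \<in> bm_Cauchy (pretensor (F t))" "A = cl_class (pretensor (F t)) f"
    using A unfolding word_space_eq by (rule Pt.completion_cases)
  obtain f' where f': "f' \<in> bm_Cauchy (pretensor (F t))" "A' = cl_class (pretensor (F t)) f'"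
    using A' unfolding word_space_eq by (rule Pt.completion_cases)
  obtain g where g: "g \<in> bm_Cauchy (pretensor (F (j # t)))" "B = cl_class (pretensor (F (j # t))) g"
    using B unfolding word_space_eq by (rule Pjt.completion_cases)
  obtain g' where g': "g' \<in> bm_Cauchy (pretensor (F (j # t)))" "B' = cl_class (pretensor (F (j # t))) g'"
    using B' unfolding word_space_eq by (rule Pjt.completion_cases)
  note l = left_iso_class[OF f(1) g(1)] left_iso_class[OF f'(1) g'(1)]
  have eq: "bm_inner (pretensor G) (add_vac u @ w) (add_vac u' @ w') =
      bm_inner (pretensor (F t)) u u' + bm_inner (pretensor (F (j # t))) w w'"
    if m: "u \<in> bm_carrier (pretensor (F t))" "u' \<in> bm_carrier (pretensor (F t))"
      "w \<in> bm_carrier (pretensor (F (j # t)))" "w' \<in> bm_carrier (pretensor (F (j # t)))" for u u' w w'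
  proof -
    note mG = add_vac_mem[OF m(1)] add_vac_mem[OF m(2)] incl_mem[OF m(3)] incl_mem[OF m(4)]
    have "bm_inner (pretensor G) (bm_add (pretensor G) (add_vac u) w) (bm_add (pretensor G) (add_vac u') w') =
        bm_inner (pretensor G) (add_vac u) (add_vac u') + bm_inner (pretensor G) (add_vac u) w' +
        (star (bm_inner (pretensor G) (add_vac u') w) + bm_inner (pretensor G) w w')"
      using mG by (simp add: PG.inner_simps PG.star_inner algebra_simps)
    then show ?thesis
      using m by (simp add: inner_add_vac inner_add_vac_incl inner_incl[of w w'] star_zero pretensor_simps(2))
  qed
  show ?thesis
    unfolding f(2) g(2) f'(2) g'(2) l(2,4)
  proof (rule LIMSEQ_unique[OF PG.inner_completion[OF l(1,3)]])
    show "(\<lambda>n. bm_inner (pretensor G) (add_vac (f n) @ g n) (add_vac (f' n) @ g' n)) \<longlonglongrightarrow>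
        bm_inner (completion (pretensor (F t))) (cl_class (pretensor (F t)) f) (cl_class (pretensor (F t)) f') +
        bm_inner (completion (pretensor (F (j # t)))) (cl_class (pretensor (F (j # t))) g) (cl_class (pretensor (F (j # t))) g')"
      unfolding eq[OF Pt.CauchyD[OF f(1)] Pt.CauchyD[OF f'(1)] Pjt.CauchyD[OF g(1)] Pjt.CauchyD[OF g'(1)]]
      by (intro tendsto_add Pt.inner_completion Pjt.inner_completion f g f' g')
  qed
qed

text \<open>Preserving inner products forces two preimages to be at distance zero, and completions
  are separated. Hence \<open>inv_into\<close> in \<open>pair_action\<close> returns any preimage
  that one can exhibit.\<close>

lemma inj_left_iso: "inj_on (left_iso LH L\<xi> j t) (V1 \<times> V2)"
proof (rule inj_onI, clarify)
  fix A B A' B'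
  assume m: "A \<in> V1" "B \<in> V2" "A' \<in> V1" "B' \<in> V2"
    and eq: "left_iso LH L\<xi> j t (A, B) = left_iso LH L\<xi> j t (A', B')"
  interpret C1: pre_correspondence "completion (pretensor (F t))" by (rule Pt.pre_correspondence_completion)
  interpret C2: pre_correspondence "completion (pretensor (F (j # t)))" by (rule Pjt.pre_correspondence_completion)
  note m' = m[unfolded word_space_eq]
  let ?i1 = "bm_inner (completion (pretensor (F t)))" and ?i2 = "bm_inner (completion (pretensor (F (j # t))))"
  have a: "?i1 A A + ?i2 B B = ?i1 A A' + ?i2 B B'"
    using inner_left_iso[OF m(1,2,1,2)] inner_left_iso[OF m(1,2,3,4)] eq by simp
  have b: "?i1 A' A' + ?i2 B' B' = ?i1 A' A + ?i2 B' B"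
    using inner_left_iso[OF m(3,4,3,4)] inner_left_iso[OF m(3,4,1,2)] eq by simp
  have "?i1 (C1.diff A A') (C1.diff A A') + ?i2 (C2.diff B B') (C2.diff B B') =
      ((?i1 A A + ?i2 B B) - (?i1 A A' + ?i2 B B')) + ((?i1 A' A' + ?i2 B' B') - (?i1 A' A + ?i2 B' B))"
    using m' by (simp add: C1.inner_simps C2.inner_simps algebra_simps)
  also have "\<dots> = 0" unfolding a b by simp
  finally have s: "?i1 (C1.diff A A') (C1.diff A A') + ?i2 (C2.diff B B') (C2.diff B B') = 0" .
  note z = cpos_sum_eq_0[OF C1.inner_pos[OF C1.diff_mem[OF m'(1,3)]] C2.inner_pos[OF C2.diff_mem[OF m'(2,4)]] s]
  show "A = A' \<and> B = B'"
    using Pt.completion_separated[OF m'(1,3)] Pjt.completion_separated[OF m'(2,4)] z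
    by (simp add: C1.bm_dist_eq C2.bm_dist_eq C1.seminorm_def C2.seminorm_def)
qed

lemma left_iso_embed:
  assumes "u \<in> bm_carrier (pretensor (F t))" "w \<in> bm_carrier (pretensor (F (j # t)))"
  shows "left_iso LH L\<xi> j t (cl_embed (pretensor (F t)) u, cl_embed (pretensor (F (j # t))) w) =
    cl_embed (pretensor G) (add_vac u @ w)"
  using left_iso_class(2)[OF Pt.const_Cauchy[OF assms(1)] Pjt.const_Cauchy[OF assms(2)]]
  by (simp add: cl_embed_def)

lemma op_tensor_id_embed:
  assumes "y \<in> bm_carrier (pretensor G)"
  shows "op_tensor_id G (L2_mult_X (\<mu> j)) (cl_embed (pretensor G) y) = cl_embed (pretensor G) (L2.tensor_map y)"
    and "L2.tensor_map y \<in> bm_carrier (pretensor G)"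
proof -
  note FF = F_factor[OF tT]
  show "L2.tensor_map y \<in> bm_carrier (pretensor G)"
    using L2.tensor_map_mem[where Hs="F t", OF FF] assms by (simp add: G_eq)
  show "op_tensor_id G (L2_mult_X (\<mu> j)) (cl_embed (pretensor G) y) = cl_embed (pretensor G) (L2.tensor_map y)"
    unfolding op_tensor_id_def L2.tensor_map_def[symmetric]
    by (rule cl_extend_embed[OF PG.pre_hilbert_axioms PG.pre_hilbert_axioms
          L2.tensor_map_mem[where Hs="F t", OF FF, folded G_eq]
          L2.tensor_map_dist[where Hs="F t", OF FF, folded G_eq] assms])
qed

text \<open>Splitting off the centered part: \<open>q \<otimes> h = \<xi> \<otimes> \<mu>(q) h + (q - \<mu>(q)) \<otimes> h\<close>.\<close>

lemma inner_split:
  assumes z: "z \<in> bm_carrier (pretensor G)" and ps: "tensor_valid (W t) ps"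
  shows "bm_inner (pretensor G) z [(emb q # emb_word t ps, b)] =
    bm_inner (pretensor G) z
      [(L\<xi> j # emb_word t (fst (lact (\<mu> j q) (ps, b))), snd (lact (\<mu> j q) (ps, b))),
       (emb (center (\<mu> j) q) # emb_word t ps, b)]"
proof -
  have "pair_inner G e (emb q # emb_word t ps, b) =
      pair_inner G e (L\<xi> j # emb_word t (fst (lact (\<mu> j q) (ps, b))), snd (lact (\<mu> j q) (ps, b))) +
      pair_inner G e (emb (center (\<mu> j) q) # emb_word t ps, b)" if "e \<in> set z" for e
  proof -
    have "tensor_valid G (fst e)" using z that by (auto simp: pretensor_simps)
    then obtain k ks where k: "fst e = k # ks" "k \<in> bm_carrier (L2 (\<mu> j))" "tensor_valid (F t) ks"
      by (auto simp: G_eq list_all2_Cons2)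
    note ev = emb_word_valid[OF tT ps]
    note FF = F_factor[OF tT]
    have "emb q = bm_add (L2 (\<mu> j)) (bm_right (L2 (\<mu> j)) (emb 1) (\<mu> j q)) (emb (center (\<mu> j) q))"
      by (simp add: emb_simps center_def)
    then have iq: "bm_inner (L2 (\<mu> j)) k (emb q) = bm_inner (L2 (\<mu> j)) k (emb 1) * \<mu> j q + bm_inner (L2 (\<mu> j)) k (emb (center (\<mu> j) q))"
      using k(2) by (simp add: L2.inner_add L2.inner_right emb_simps(1) L2.right_mem)
    have el: "elt_inner (F t) a ks (emb_word t (fst (lact c (ps, b)))) * snd (lact c (ps, b)) =
        elt_inner (F t) (a * c) ks (emb_word t ps) * b" for a c
      using elt_inner_left[OF FF k(3) ev, of a c b] by (simp add: elt_left_F[OF tT ps])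
    have "pair_inner G e (L\<xi> j # emb_word t (fst (lact (\<mu> j q) (ps, b))), snd (lact (\<mu> j q) (ps, b))) =
        star (snd e) * (elt_inner (F t) (bm_inner (L2 (\<mu> j)) k (emb 1) * \<mu> j q) ks (emb_word t ps) * b)"
      unfolding el[symmetric] using k
      by (simp add: pair_inner_def G_eq L\<xi>_def emb_simps(7) L2.inner_left_one emb_simps(1) mult.assoc)
    then show ?thesis
      using k iq by (simp add: pair_inner_def G_eq L2.inner_left_one emb_simps(1) elt_inner_add[OF FF k(3) ev] algebra_simps)
  qed
  then show ?thesis by (simp add: pretensor_simps cong: map_cong)
qed

text \<open>Entry by entry, only the words t and j t meet this block, and there
  \<open>inner_split\<close> is exactly the rule by which \<open>emit\<close> separates the product
  with X. \<open>cl_embed_eqI\<close> later turns this weak equation into an equality.\<close>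

lemma inner_pair:
  assumes z: "z \<in> bm_carrier (pretensor G)" and v: "v \<in> bm_carrier fock"
  shows "bm_inner (pretensor G) z (L2.tensor_map (add_vac (emb_component t v) @ emb_component (j # t) v)) =
    bm_inner (pretensor G) z (add_vac (emb_component t (formal_X \<mu> T j v)) @ emb_component (j # t) (formal_X \<mu> T j v))"
  using v
proof (induction v)
  case Nil
  show ?case by (simp add: formal_X_def L2.tensor_map_def add_vac_def)
next
  case (Cons e v)
  have e: "[e] \<in> bm_carrier fock" and v: "v \<in> bm_carrier fock"
    using fock_Cons[OF Cons.prems] by simp_all
  have app: "bm_inner (pretensor G) z (u @ w) = bm_inner (pretensor G) z u + bm_inner (pretensor G) z w" for u w
    by (simp add: pretensor_simps sum_list_addf)
  have av: "add_vac (u @ w) = add_vac u @ add_vac w" "L2.tensor_map (u @ w) = L2.tensor_map u @ L2.tensor_map w" for u w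
    by (simp_all add: add_vac_def L2.tensor_map_def)
  have single: "bm_inner (pretensor G) z (L2.tensor_map (add_vac (emb_component t [e]) @ emb_component (j # t) [e])) =
    bm_inner (pretensor G) z (add_vac (emb_component t (word_X \<mu> T j e)) @ emb_component (j # t) (word_X \<mu> T j e))"
  proof -
    obtain s ps b where eq: "e = (s, ps, b)" by (cases e)
    have s: "s \<in> T" "tensor_valid (W s) ps" using e by (simp_all add: eq fock_entry)
    have ne: "t \<noteq> j # t" by (metis not_Cons_self2)
    consider "s = t" | "s = j # t" | "s \<noteq> t" "s \<noteq> j # t" by blast
    then show ?thesis
    proof cases
      case 1
      have "L2.tensor_map (add_vac (emb_component t [e]) @ emb_component (j # t) [e]) = [(emb (indet * 1) # emb_word t ps, b)]"
        using 1 ne by (simp add: eq add_vac_def L2.tensor_map_def L\<xi>_def emb_simps)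
      moreover have "word_X \<mu> T j e = [(j # t, center (\<mu> j) (indet * 1) # ps, b), (t, lact (\<mu> j (indet * 1)) (ps, b))]"
        using 1 t_hd jt by (auto simp: eq word_X_def strip_def emit_def mult_hd_def Let_def)
      ultimately show ?thesis
        using inner_split[OF z, of ps "indet * 1" b] s 1 ne by (simp add: add_vac_def)
    next
      case 2
      obtain p ps' where ps: "ps = p # ps'" using s by (auto simp: 2 word_factors_simps list_all2_Cons2)
      have v: "tensor_valid (W t) ps'" using s tensor_valid_Cons[OF jN] by (simp add: 2 ps)
      have "L2.tensor_map (add_vac (emb_component t [e]) @ emb_component (j # t) [e]) = [(emb (indet * p) # emb_word t ps', b)]"
        using 2 ne by (simp add: eq ps add_vac_def L2.tensor_map_def emb_simps)
      moreover have "word_X \<mu> T j e = [(j # t, center (\<mu> j) (indet * p) # ps', b), (t, lact (\<mu> j (indet * p)) (ps', b))]"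
        using 2 jt by (auto simp: eq ps word_X_def strip_def emit_def mult_hd_def Let_def)
      ultimately show ?thesis
        using inner_split[OF z v, of "indet * p" b] ne by (simp add: add_vac_def)
    next
      case 3
      have "fst (strip j e) \<in> block_words j"
        using strip_mem[OF e, of j] by (cases "strip j e") (simp add: block_entry)
      then have st: "fst (strip j e) \<noteq> t" "fst (strip j e) \<noteq> j # t"
        using 3 by (auto simp: eq strip_def neq_Nil_conv block_words_def)
      then have "emb_component t (word_X \<mu> T j e) = [] \<and> emb_component (j # t) (word_X \<mu> T j e) = []"
        using t_hd by (auto simp: word_X_def emit_def Let_def)
      then show ?thesis using 3 by (simp add: eq add_vac_def L2.tensor_map_def)
    qed
  qed
  have X: "formal_X \<mu> T j (e # v) = word_X \<mu> T j e @ formal_X \<mu> T j v" by (simp add: formal_X_def)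
  have ec: "emb_component s (e # v) = emb_component s [e] @ emb_component s v" for s by simp
  have "bm_inner (pretensor G) z (L2.tensor_map (add_vac (emb_component t (e # v)) @ emb_component (j # t) (e # v))) =
      bm_inner (pretensor G) z (L2.tensor_map (add_vac (emb_component t [e]) @ emb_component (j # t) [e])) +
      bm_inner (pretensor G) z (L2.tensor_map (add_vac (emb_component t v) @ emb_component (j # t) v))"
    unfolding ec av app by (simp only: ac_simps)
  also have "\<dots> = bm_inner (pretensor G) z (add_vac (emb_component t (word_X \<mu> T j e)) @ emb_component (j # t) (word_X \<mu> T j e)) +
      bm_inner (pretensor G) z (add_vac (emb_component t (formal_X \<mu> T j v)) @ emb_component (j # t) (formal_X \<mu> T j v))"
    unfolding single Cons.IH[OF v] ..
  also have "\<dots> = bm_inner (pretensor G) z (add_vac (emb_component t (formal_X \<mu> T j (e # v))) @ emb_component (j # t) (formal_X \<mu> T j (e # v)))"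
    unfolding X emb_component_simps(2) av app by (simp only: ac_simps)
  finally show ?case .
qed

text \<open>The image of the pair under X \<otimes> id is again the image of an explicit pair, which
  \<open>inj_left_iso\<close> identifies as the value of the inverse.\<close>

lemma pair_action_emb:
  assumes v: "v \<in> bm_carrier fock"
  shows "pair_action LH L\<xi> j (L2_mult_X (\<mu> j)) t (emb_vector v t, emb_vector v (j # t)) =
    (emb_vector (formal_X \<mu> T j v) t, emb_vector (formal_X \<mu> T j v) (j # t))"
proof -
  let ?v' = "formal_X \<mu> T j v"
  have v': "?v' \<in> bm_carrier fock" by (rule formal_X_mem[OF v])
  note m = emb_component_mem[OF v tT] emb_component_mem[OF v jt]
  note m' = emb_component_mem[OF v' tT] emb_component_mem[OF v' jt]
  have mG: "add_vac u @ w \<in> bm_carrier (pretensor G)"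
    if "u \<in> bm_carrier (pretensor (F t))" "w \<in> bm_carrier (pretensor (F (j # t)))" for u w
    using PG.add_mem[OF add_vac_mem[OF that(1)] incl_mem[OF that(2)]] by (simp add: pretensor_simps(2))
  have ev: "emb_vector u t = cl_embed (pretensor (F t)) (emb_component t u)"
    "emb_vector u (j # t) = cl_embed (pretensor (F (j # t))) (emb_component (j # t) u)" for u
    using tT jt by (simp_all add: emb_vector_def)
  have "op_tensor_id G (L2_mult_X (\<mu> j)) (left_iso LH L\<xi> j t (emb_vector v t, emb_vector v (j # t))) =
      cl_embed (pretensor G) (L2.tensor_map (add_vac (emb_component t v) @ emb_component (j # t) v))"
    unfolding ev left_iso_embed[OF m] by (rule op_tensor_id_embed(1)[OF mG[OF m]])
  also have "\<dots> = cl_embed (pretensor G) (add_vac (emb_component t ?v') @ emb_component (j # t) ?v')"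
    by (rule PG.cl_embed_eqI[OF op_tensor_id_embed(2)[OF mG[OF m]] mG[OF m'] inner_pair[OF _ v]])
  also have "\<dots> = left_iso LH L\<xi> j t (emb_vector ?v' t, emb_vector ?v' (j # t))"
    unfolding ev left_iso_embed[OF m'] ..
  finally show ?thesis
    unfolding pair_action_def using m'
    by (subst inv_into_f_f[OF inj_left_iso, symmetric])
      (auto simp: ev word_space_eq Pt.cl_embed_mem Pjt.cl_embed_mem)
qed

end

section \<open>The tree representation on formal sums\<close>

context tree_laws
begin

lemma tree_rep_emb:
  assumes j: "j \<in> {1..N}" and v: "v \<in> bm_carrier fock"
  shows "tree_rep LH L\<xi> T j (L2_mult_X (\<mu> j)) (emb_vector v) = emb_vector (formal_X \<mu> T j v)"
proof
  fix t
  show "tree_rep LH L\<xi> T j (L2_mult_X (\<mu> j)) (emb_vector v) t = emb_vector (formal_X \<mu> T j v) t"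
  proof (cases "t \<in> T")
    case False
    then show ?thesis by (simp add: tree_rep_def emb_vector_def)
  next
    case t: True
    consider t' where "t = j # t'" | "\<not> (t \<noteq> [] \<and> hd t = j)" "j # t \<in> T" | "\<not> (t \<noteq> [] \<and> hd t = j)" "j # t \<notin> T"
      by (cases t) auto
    then show ?thesis
    proof cases
      case (1 t')
      then interpret tree_pair N T \<mu> j t' using t by unfold_locales simp
      show ?thesis using t pair_action_emb[OF v] by (simp add: tree_rep_def 1)
    next
      case 2
      then interpret tree_pair N T \<mu> j t by unfold_locales
      show ?thesis using t 2 pair_action_emb[OF v] by (auto simp: tree_rep_def)
    next
      case 3
      have "emb_component t (word_X \<mu> T j e) = []" for e
        using 3 by (auto simp: word_X_def emit_def Let_def)
      then have "emb_component t (formal_X \<mu> T j v) = []"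
        by (induction v) (simp_all add: formal_X_def)
      then show ?thesis using t 3
        by (auto simp: tree_rep_def emb_vector_def word_space_eq completion_def pretensor_simps)
    qed
  qed
qed

lemma op_sum_emb:
  assumes v: "v \<in> bm_carrier fock"
  shows "op_sum tree_mod (map (\<lambda>j. tree_rep LH L\<xi> T j (L2_mult_X (\<mu> j))) [1..<Suc N]) (emb_vector v) =
    emb_vector (formal_sum_X N \<mu> T v)"
proof -
  have "op_sum tree_mod (map (\<lambda>j. tree_rep LH L\<xi> T j (L2_mult_X (\<mu> j))) js) (emb_vector v) =
      emb_vector (concat (map (\<lambda>j. formal_X \<mu> T j v) js))" if "set js \<subseteq> {1..N}" for js
    using that
  proof (induction js)
    case Nil
    show ?case by (simp add: op_sum_def emb_vector_zero)
  next
    case (Cons j js)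
    have m: "concat (map (\<lambda>j. formal_X \<mu> T j v) js) \<in> bm_carrier fock"
      by (rule fock_memI) (auto intro: fock_memD[OF formal_X_mem[OF v]])
    show ?case
      using Cons emb_vector_add[OF formal_X_mem[OF v] m] by (simp add: op_sum_def tree_rep_emb v)
  qed
  moreover have "set [1..<Suc N] \<subseteq> {1..N}" by auto
  ultimately show ?thesis unfolding formal_sum_X_def by blast
qed

lemma op_eval_emb:
  assumes v: "v \<in> bm_carrier fock"
  shows "op_eval tree_mod (op_sum tree_mod (map (\<lambda>j. tree_rep LH L\<xi> T j (L2_mult_X (\<mu> j))) [1..<Suc N])) e (emb_vector v) =
    emb_vector (formal_eval N \<mu> T e v)"
  using v by (induction e arbitrary: v) (simp_all add: emb_vector_left op_sum_emb emb_vector_add evl_mem del: upt_Suc One_nat_def)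

end

lemma tree_conv_eq_formal_law:
  fixes \<mu> :: "nat \<Rightarrow> 'b::unital_cstar_algebra law"
  assumes T: "T \<in> Tree N" and \<mu>: "\<mu> \<in> tuples N laws"
  shows "tree_conv N T \<mu> = formal_law N \<mu> T"
proof -
  interpret tree_laws N T \<mu> using T \<mu> by unfold_locales (auto simp: PiE_def)
  have "LH = (\<lambda>j. L2 (\<mu> j))" "L\<xi> = (\<lambda>j. L2_one (\<mu> j))" by (auto simp: LH_def L\<xi>_def)
  then have "tree_conv N T \<mu> = op_law tree_mod (vacuum LH L\<xi> T)
      (op_sum tree_mod (map (\<lambda>j. tree_rep LH L\<xi> T j (L2_mult_X (\<mu> j))) [1..<Suc N]))"
    using \<mu> by (simp add: tree_conv_def Let_def del: upt_Suc One_nat_def)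
  also have "\<dots> = formal_law N \<mu> T"
  proof
    fix p
    show "op_law tree_mod (vacuum LH L\<xi> T)
      (op_sum tree_mod (map (\<lambda>j. tree_rep LH L\<xi> T j (L2_mult_X (\<mu> j))) [1..<Suc N])) p = formal_law N \<mu> T p"
      unfolding op_law_def by (subst (2) vacuum_eq)
        (simp add: op_eval_emb vac_mem evl_mem inner_vacuum formal_law_def del: upt_Suc One_nat_def)
  qed
  finally show ?thesis .
qed

section \<open>Dilations\<close>

context
  fixes c :: real
begin

definition dil_poly :: "'b::unital_cstar_algebra ncpoly \<Rightarrow> 'b ncpoly" where
  "dil_poly = nc_eval coef (complex_of_real c *\<^sub>C indet)"

text \<open>Substitution of c X on expressions rather than on polynomials, because
  \<open>formal_eval\<close> recurses on expressions.\<close>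

primrec dil_exp :: "'b::unital_cstar_algebra ncexp \<Rightarrow> 'b ncexp" where
  "dil_exp (NC_const b) = NC_const b"
| "dil_exp NC_var = NC_mult (NC_const (complex_of_real c *\<^sub>C 1)) NC_var"
| "dil_exp (NC_add p q) = NC_add (dil_exp p) (dil_exp q)"
| "dil_exp (NC_mult p q) = NC_mult (dil_exp p) (dil_exp q)"

lemma dil_eq: "dil c \<mu> p = \<mu> (dil_poly p)"
  by (simp add: dil_def dil_poly_def)

lemma dil_poly_abs: "dil_poly (abs_ncpoly e) = abs_ncpoly (dil_exp e)"
proof -
  have "dil_poly (abs_ncpoly e) = exp_eval coef (complex_of_real c *\<^sub>C indet) e"
    unfolding dil_poly_def by (rule nc_eval_abs[OF unital_hom_coef])
  also have "\<dots> = abs_ncpoly (dil_exp e)"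
    by (induction e) (simp_all add: coef.abs_eq indet.abs_eq plus_ncpoly.abs_eq times_ncpoly.abs_eq scaleC_ncpoly.abs_eq)
  finally show ?thesis .
qed

lemma dil_poly_add: "dil_poly (p + q) = dil_poly p + dil_poly q"
  and dil_poly_mult: "dil_poly (p * q) = dil_poly p * dil_poly q"
  using ncpoly_abs[of p] ncpoly_abs[of q]
  by (auto simp: plus_ncpoly.abs_eq times_ncpoly.abs_eq dil_poly_abs)

lemma dil_poly_coef: "dil_poly (coef b) = coef b"
  by (simp add: coef.abs_eq dil_poly_abs)

lemma dil_poly_indet: "dil_poly indet = coef (complex_of_real c *\<^sub>C 1) * indet"
  by (simp add: indet.abs_eq coef.abs_eq times_ncpoly.abs_eq dil_poly_abs)

lemma dil_poly_one: "dil_poly 1 = 1"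
  using dil_poly_coef[of 1] by (simp add: coef_one)

lemma dil_poly_diff: "dil_poly (p - q) = dil_poly p - dil_poly q"
  using dil_poly_add[of "p - q" q] by simp

lemma dil_poly_sum: "dil_poly (sum f A) = (\<Sum>k\<in>A. dil_poly (f k))"
proof -
  have "dil_poly 0 = 0" using dil_poly_add[of 0 0] by simp
  then show ?thesis by (induction A rule: infinite_finite_induct) (simp_all add: dil_poly_add)
qed

lemma dil_poly_star:
  fixes p :: "'b::unital_cstar_algebra ncpoly"
  shows "dil_poly (star p) = star (dil_poly p)"
proof (induction p rule: ncpoly_induct)
  case indet
  have "coef (complex_of_real c *\<^sub>C 1) * indet = indet * coef (complex_of_real c *\<^sub>C (1 :: 'b))"
    by (simp add: coef_scaleC coef_one mult_scaleC_left mult_scaleC_right)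
  then show ?case by (simp add: star_indet dil_poly_indet star_mult star_coef star_scaleC star_one)
qed (simp_all add: star_coef dil_poly_coef star_add star_mult dil_poly_add dil_poly_mult)

lemma dil_poly_monomial: "dil_poly (nc_monomial b bs) = complex_of_real (c ^ length bs) *\<^sub>C nc_monomial b bs"
proof (induction bs arbitrary: b)
  case Nil
  show ?case by (simp add: nc_monomial_Nil dil_poly_coef scaleC_one)
next
  case (Cons a as)
  show ?case
    by (simp add: nc_monomial_Cons dil_poly_mult dil_poly_coef dil_poly_indet Cons coef_scaleC coef_one
        mult_scaleC_left mult_scaleC_right scaleC_scaleC mult.commute)
qed

lemma dil_law:
  assumes \<mu>: "\<mu> \<in> laws" shows "dil c \<mu> \<in> laws"
proof -
  interpret law \<mu> using \<mu> by unfold_locales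
  obtain M R where MR: "M > 0" "R > 0" "exp_bound \<mu> M R" using \<mu> by (auto simp: laws_def)
  \<comment> \<open>The summand 1 keeps the rate positive when c = 0.\<close>
  define R' where "R' = \<bar>c\<bar> * R + 1"
  have R': "R' > 0" "\<bar>c\<bar> * R \<le> R'" using MR by (simp_all add: R'_def add_nonneg_pos)
  have "norm (dil c \<mu> (nc_monomial b bs)) \<le> M * R' ^ length bs * (norm b * prod_list (map norm bs))" for b bs
  proof -
    let ?w = "norm b * prod_list (map norm bs)"
    have "norm (dil c \<mu> (nc_monomial b bs)) = \<bar>c\<bar> ^ length bs * norm (\<mu> (nc_monomial b bs))"
      by (simp add: dil_eq dil_poly_monomial law_scaleC norm_scaleC power_abs norm_power)
    also have "\<dots> \<le> \<bar>c\<bar> ^ length bs * (M * R ^ length bs * ?w)"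
      using MR(3) by (intro mult_left_mono) (auto simp: exp_bound_def)
    also have "\<dots> = (\<bar>c\<bar> * R) ^ length bs * (M * ?w)" by (simp add: power_mult_distrib mult_ac)
    also have "\<dots> \<le> R' ^ length bs * (M * ?w)"
      using R' MR by (intro mult_right_mono power_mono) (auto simp: prod_list_norm_nonneg)
    finally show ?thesis by (simp add: mult_ac)
  qed
  then have "exp_bound (dil c \<mu>) M R'" by (simp add: exp_bound_def)
  moreover have "completely_positive (dil c \<mu>)"
    using law_cp by (simp add: completely_positive_def dil_eq dil_poly_sum dil_poly_mult dil_poly_star)
  ultimately show ?thesis
    using MR(1) R'(1) by (auto simp: laws_def dil_eq dil_poly_one law_one dil_poly_add law_add
        dil_poly_mult dil_poly_coef law_bimod)
qed

definition dil_entry :: "'b::unital_cstar_algebra entry \<Rightarrow> 'b entry" where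
  "dil_entry e = (fst e, map dil_poly (fst (snd e)), snd (snd e))"

end

section \<open>Dilations in the algebraic model\<close>

definition entry_wf :: "'b entry \<Rightarrow> bool" where
  "entry_wf e \<longleftrightarrow> length (fst (snd e)) = length (fst e)"

lemma length_lact [simp]: "length (fst (lact a x)) = length (fst x)"
  by (cases "(a, x)" rule: lact.cases) auto

lemma lact_mult: "lact (a * b) x = lact a (lact b x)"
  by (cases "(b, x)" rule: lact.cases) (simp_all add: coef_mult mult.assoc)

text \<open>Matching lengths guarantee a first leg after stripping, so that \<open>hd\<close> and
  \<open>tl\<close> in \<open>mult_hd\<close> and \<open>emit\<close> never meet an empty list and
  commute with the substitution.\<close>

lemma strip_wf:
  assumes "entry_wf e"
  obtains s q qs b where "strip j e = (s, q # qs, b)" "length qs = length s"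
proof -
  obtain s ps b where e: "e = (s, ps, b)" by (cases e)
  show thesis
  proof (cases "s \<noteq> [] \<and> hd s = j")
    case True
    then obtain s' q qs where "s = j # s'" "ps = q # qs" "length qs = length s'"
      using assms by (cases s; cases ps) (auto simp: e entry_wf_def)
    then show thesis using that by (simp add: e strip_def)
  next
    case False
    then show thesis using that assms by (auto simp: e strip_def entry_wf_def)
  qed
qed

lemma word_X_wf:
  assumes "entry_wf e" "z \<in> set (word_X \<mu> T j e)" shows "entry_wf z"
proof -
  obtain s q qs b where "strip j e = (s, q # qs, b)" "length qs = length s" by (rule strip_wf[OF assms(1)])
  then show ?thesis
    using assms(2) by (auto simp: word_X_def emit_def mult_hd_def entry_wf_def Let_def split: if_splits)
qed

lemma formal_sum_X_wf: "\<forall>e\<in>set v. entry_wf e \<Longrightarrow> \<forall>e\<in>set (formal_sum_X N \<mu> T v). entry_wf e"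
  using word_X_wf by (fastforce simp: formal_sum_X_def formal_X_def)

lemma formal_left_wf: "\<forall>e\<in>set v. entry_wf e \<Longrightarrow> \<forall>e\<in>set (formal_left a v). entry_wf e"
  by (auto simp: formal_left_def entry_wf_def)

lemma formal_eval_wf: "\<forall>e\<in>set v. entry_wf e \<Longrightarrow> \<forall>e\<in>set (formal_eval N \<mu> T p v). entry_wf e"
proof (induction p arbitrary: v)
  case (NC_const b)
  then show ?case using formal_left_wf[of v b] by simp
next
  case NC_var
  then show ?case using formal_sum_X_wf[of v N \<mu> T] by simp
next
  case (NC_add p q)
  show ?case using NC_add.IH[OF NC_add.prems] by (simp add: ball_Un)
next
  case (NC_mult p q)
  show ?case using NC_mult.IH(1)[OF NC_mult.IH(2)[OF NC_mult.prems]] by simp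
qed

context tree_laws
begin

context
  fixes c :: real
begin

definition \<mu>c :: "nat \<Rightarrow> 'b law" where
  "\<mu>c = (\<lambda>i\<in>{1..N}. dil c (\<mu> i))"

abbreviation sc :: 'b where "sc \<equiv> complex_of_real c *\<^sub>C 1"

lemma lact_dil: "(map (dil_poly c) (fst (lact a (qs, b))), snd (lact a (qs, b))) = lact a (map (dil_poly c) qs, b)"
  by (cases qs) (simp_all add: dil_poly_mult dil_poly_coef)

text \<open>The law \<open>dil c \<mu>\<close> is \<mu> after substitution, so substituting c X
  commutes with centering; the factor c that X produces comes out of both emitted entries as a left
  scalar.\<close>

lemma word_X_dil:
  assumes e: "entry_wf e"
  shows "map (dil_entry c) (word_X \<mu>c T j e) = formal_left sc (word_X \<mu> T j (dil_entry c e))"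
proof -
  obtain s q qs b where se: "strip j e = (s, q # qs, b)" by (rule strip_wf[OF e])
  have sd: "strip j (dil_entry c e) = (s, dil_poly c q # map (dil_poly c) qs, b)"
    using se by (auto simp: strip_def dil_entry_def dil_poly_one split: if_splits)
  show ?thesis
  proof (cases "j # s \<in> T")
    case False
    then show ?thesis by (simp add: word_X_def se sd Let_def formal_left_def)
  next
    case True
    have j: "j \<in> {1..N}" by (rule Tree_Cons(1)[OF T True])
    interpret law "\<mu> j" using lawI[OF j] .
    define r where "r = indet * dil_poly c q"
    have dq: "dil_poly c (indet * q) = coef sc * r"
      by (simp add: dil_poly_mult dil_poly_indet r_def mult.assoc)
    have mc: "\<mu>c j p = \<mu> j (dil_poly c p)" for p using j by (simp add: \<mu>c_def dil_eq)
    have c1: "dil_poly c (center (\<mu>c j) (indet * q)) = coef sc * center (\<mu> j) r"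
      unfolding center_def dil_poly_diff mc dq law_left dil_poly_coef
      by (simp add: coef_mult right_diff_distrib)
    have "word_X \<mu>c T j e = [(j # s, center (\<mu>c j) (indet * q) # qs, b), (s, lact (sc * \<mu> j r) (qs, b))]"
      using True by (simp add: word_X_def se Let_def emit_def mult_hd_def mc dq law_left)
    moreover have "word_X \<mu> T j (dil_entry c e) =
        [(j # s, center (\<mu> j) r # map (dil_poly c) qs, b), (s, lact (\<mu> j r) (map (dil_poly c) qs, b))]"
      using True by (simp add: word_X_def sd Let_def emit_def mult_hd_def r_def)
    ultimately show ?thesis
      using lact_dil[of "sc * \<mu> j r" qs b]
      by (simp add: formal_left_def dil_entry_def c1 lact_mult)
  qed
qed

lemma formal_sum_X_dil:
  assumes v: "\<forall>e\<in>set v. entry_wf e"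
  shows "map (dil_entry c) (formal_sum_X N \<mu>c T v) = formal_left sc (formal_sum_X N \<mu> T (map (dil_entry c) v))"
proof -
  have "map (dil_entry c) (formal_X \<mu>c T j v) = formal_left sc (formal_X \<mu> T j (map (dil_entry c) v))" for j
    using v by (induction v) (simp_all add: formal_X_def formal_left_def word_X_dil)
  then have "map (dil_entry c) (concat (map (\<lambda>j. formal_X \<mu>c T j v) js)) =
      formal_left sc (concat (map (\<lambda>j. formal_X \<mu> T j (map (dil_entry c) v)) js))" for js
    by (induction js) (simp_all add: formal_left_def)
  then show ?thesis by (simp only: formal_sum_X_def)
qed

lemma formal_eval_dil:
  assumes "\<forall>e\<in>set v. entry_wf e"
  shows "map (dil_entry c) (formal_eval N \<mu>c T p v) = formal_eval N \<mu> T (dil_exp c p) (map (dil_entry c) v)"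
  using assms
proof (induction p arbitrary: v)
  case (NC_const b)
  show ?case using lact_dil by (auto simp: formal_left_def dil_entry_def)
next
  case NC_var
  then show ?case by (simp add: formal_sum_X_dil)
qed (simp_all add: formal_eval_wf)

lemma tree_laws_dil: "tree_laws N T \<mu>c"
  using T laws by unfold_locales (simp_all add: \<mu>c_def dil_law)

text \<open>Substitution changes polynomial legs only; the coefficients of the empty word, and with
  them the expectation, stay the same.\<close>

lemma formal_law_dil: "formal_law N \<mu>c T = dil c (formal_law N \<mu> T)"
proof
  fix p :: "'b ncpoly"
  interpret d: tree_laws N T \<mu>c by (rule tree_laws_dil)
  obtain e where p: "p = abs_ncpoly e" using ncpoly_abs by blast
  have ex: "formal_expect (map (dil_entry c) v) = formal_expect v" for v :: "'b entry list"
    by (simp add: formal_expect_def o_def dil_entry_def cong: if_cong)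
  have "map (dil_entry c) formal_vac = (formal_vac :: 'b entry list)"
    by (simp add: formal_vac_def dil_entry_def)
  then have "formal_law N \<mu>c T p = formal_expect (formal_eval N \<mu> T (dil_exp c e) formal_vac)"
    unfolding p d.conv_abs using formal_eval_dil[of formal_vac e] ex
    by (metis empty_iff empty_set entry_wf_def formal_vac_def fst_conv list.size(3) set_ConsD snd_conv)
  then show "formal_law N \<mu>c T p = dil c (formal_law N \<mu> T) p"
    by (simp add: dil_eq p dil_poly_abs conv_abs)
qed

end

end

section \<open>Moments\<close>

fun monomial_vec :: "nat \<Rightarrow> (nat \<Rightarrow> 'b::unital_cstar_algebra law) \<Rightarrow> nat list set \<Rightarrow> 'b \<Rightarrow> 'b list \<Rightarrow> 'b entry list" where
  "monomial_vec N \<mu> T b [] = formal_left b formal_vac"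
| "monomial_vec N \<mu> T b (c # cs) = formal_left b (formal_sum_X N \<mu> T (monomial_vec N \<mu> T c cs))"

lemma (in tree_laws) conv_monomial: "conv (nc_monomial b bs) = formal_expect (monomial_vec N \<mu> T b bs)"
proof -
  have "\<exists>e. nc_monomial b bs = abs_ncpoly e \<and> evl e formal_vac = monomial_vec N \<mu> T b bs"
  proof (induction bs arbitrary: b)
    case Nil
    show ?case by (intro exI[of _ "NC_const b"]) (simp add: nc_monomial_Nil coef.abs_eq)
  next
    case (Cons c cs)
    obtain e where "nc_monomial c cs = abs_ncpoly e" "evl e formal_vac = monomial_vec N \<mu> T c cs"
      using Cons by blast
    then show ?case
      by (intro exI[of _ "NC_mult (NC_const b) (NC_mult NC_var e)"])
        (simp add: nc_monomial_Cons coef.abs_eq indet.abs_eq times_ncpoly.abs_eq)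
  qed
  then show ?thesis by (metis conv_abs)
qed

subsection \<open>Dependence on the tree\<close>

lemma length_word_X:
  "z \<in> set (word_X \<mu> T j e) \<Longrightarrow> length (fst z) \<le> Suc (length (fst e))"
  by (auto simp: word_X_def emit_def strip_def mult_hd_def Let_def split: if_splits)

lemma length_monomial_vec:
  "e \<in> set (monomial_vec N \<mu> T b bs) \<Longrightarrow> length (fst e) \<le> length bs"
proof (induction bs arbitrary: b e)
  case (Cons c cs)
  then show ?case
    using length_word_X by (fastforce simp: formal_left_def formal_sum_X_def formal_X_def)
qed (simp add: formal_left_def formal_vac_def)

text \<open>The tree enters only through tests whether j s belongs to it, and with at most l
  applications of X to the vacuum the tested words have length at most l.\<close>

lemma monomial_vec_cong:
  assumes TT: "tree_ball l T = tree_ball l T'" and "length bs \<le> l"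
  shows "monomial_vec N \<mu> T b bs = monomial_vec N \<mu> T' b bs"
  using assms(2)
proof (induction bs arbitrary: b)
  case (Cons c cs)
  have "word_X \<mu> T j e = word_X \<mu> T' j e" if "e \<in> set (monomial_vec N \<mu> T c cs)" for j e
  proof -
    have len: "length (j # fst (strip j e)) \<le> l"
      using length_monomial_vec[OF that] Cons.prems by (auto simp: strip_def)
    have "j # fst (strip j e) \<in> tree_ball l T \<longleftrightarrow> j # fst (strip j e) \<in> tree_ball l T'"
      by (simp only: TT)
    then have "j # fst (strip j e) \<in> T \<longleftrightarrow> j # fst (strip j e) \<in> T'"
      using len by (simp add: tree_ball_def)
    then show ?thesis by (simp add: word_X_def Let_def)
  qed
  then have "formal_X \<mu> T j (monomial_vec N \<mu> T c cs) = formal_X \<mu> T' j (monomial_vec N \<mu> T c cs)" for j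
    by (simp add: formal_X_def cong: map_cong)
  then show ?case using Cons by (simp add: formal_sum_X_def del: upt_Suc)
qed simp

text \<open>The supremum in \<open>tree_dist\<close> exceeds L or is infinite, so the balls agree at
  some l \<ge> L, and smaller balls are restrictions of larger ones.\<close>

lemma tree_dist_less:
  assumes d: "tree_dist T T' < exp (- real L)" shows "tree_ball L T = tree_ball L T'"
proof -
  define S where "S = {l. tree_ball l T = tree_ball l T'}"
  have "\<exists>l\<ge>L. l \<in> S"
  proof (cases "bdd_above S")
    case True
    then have S: "L < Sup S" using d by (simp add: tree_dist_def S_def Let_def)
    \<comment> \<open>\<open>Sup\<close> of the empty set of naturals is 0, which cannot exceed L; a
      bounded nonempty set attains it.\<close>
    then have "S \<noteq> {}" by (auto simp: Sup_nat_def)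
    then have "Sup S \<in> S" using True by (simp add: Sup_nat_def bdd_above_nat)
    then show ?thesis using S by (intro exI[of _ "Sup S"]) simp
  next
    case False
    then show ?thesis by (meson bdd_aboveI nle_le)
  qed
  then obtain l where l: "l \<ge> L" "tree_ball l T = tree_ball l T'" by (auto simp: S_def)
  have "tree_ball L X = {s \<in> tree_ball l X. length s \<le> L}" for X
    using l(1) by (auto simp: tree_ball_def)
  then show ?thesis using l(2) by simp
qed

subsection \<open>The metric on laws\<close>

definition unit_args :: "nat \<Rightarrow> ('b::unital_cstar_algebra \<times> 'b list) set" where
  "unit_args l = {(b, bs). norm b \<le> 1 \<and> length bs = l \<and> (\<forall>c\<in>set bs. norm c \<le> 1)}"

lemma multilinear_norm_eq: "multilinear_norm l \<Lambda> = (SUP x\<in>unit_args l. norm (\<Lambda> (fst x) (snd x)))"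
proof -
  have "{norm (\<Lambda> b bs) |b bs. norm b \<le> 1 \<and> length bs = l \<and> (\<forall>c\<in>set bs. norm c \<le> 1)} =
      (\<lambda>x. norm (\<Lambda> (fst x) (snd x))) ` unit_args l"
    by (force simp: unit_args_def image_iff)
  then show ?thesis by (simp add: multilinear_norm_def)
qed

lemma unit_args_nonempty: "(0, replicate l 0) \<in> unit_args l" "unit_args l \<noteq> {}"
proof -
  show *: "(0, replicate l 0) \<in> unit_args l" by (simp add: unit_args_def)
  show "unit_args l \<noteq> {}" using * by blast
qed

lemma prod_list_norm_le_1: "\<forall>c\<in>set bs. norm c \<le> 1 \<Longrightarrow> prod_list (map norm bs) \<le> 1"
  by (induction bs) (auto intro: mult_le_one prod_list_norm_nonneg)

lemma law_dist_le:
  assumes C: "C \<ge> 0"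
    and le: "\<And>l b bs. l \<ge> 1 \<Longrightarrow> (b, bs) \<in> unit_args l \<Longrightarrow>
      norm (\<mu> (nc_monomial b bs) - \<nu> (nc_monomial b bs)) \<le> C * (2 * R) ^ l"
    and R: "R \<ge> 0"
  shows "law_dist R \<mu> \<nu> \<le> C"
  unfolding law_dist_def
proof (rule cSUP_least)
  fix l :: nat assume l: "l \<in> {1..}"
  show "multilinear_norm l (\<lambda>b bs. Mom \<mu> b bs - Mom \<nu> b bs) / (2 * R) ^ l \<le> C"
  proof (cases "R = 0")
    \<comment> \<open>For l \<ge> 1 the divisor is 0, and division by zero yields 0.\<close>
    case True
    then show ?thesis using l C by (simp add: power_0_left)
  next
    case False
    have "multilinear_norm l (\<lambda>b bs. Mom \<mu> b bs - Mom \<nu> b bs) \<le> C * (2 * R) ^ l"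
      unfolding multilinear_norm_eq Mom_def
      using le l by (intro cSUP_least unit_args_nonempty(2)) auto
    then show ?thesis using False R by (simp add: divide_le_eq)
  qed
qed simp

lemma laws_radD:
  assumes "\<mu> \<in> laws_rad R" shows "\<mu> \<in> laws" "law_rad \<mu> \<le> R"
  using assms by (auto simp: laws_rad_def)

lemma norm_moment_unit:
  assumes \<mu>: "\<mu> \<in> laws_rad R" and x: "(b, bs) \<in> unit_args l"
  shows "norm (\<mu> (nc_monomial b bs)) \<le> R ^ l"
proof -
  interpret law \<mu> using laws_radD(1)[OF \<mu>] by unfold_locales
  have R: "0 \<le> R" using law_rad_nonneg laws_radD(2)[OF \<mu>] by simp
  have "norm (\<mu> (nc_monomial b bs)) \<le> law_rad \<mu> ^ length bs * (norm b * prod_list (map norm bs))"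
    by (rule norm_moment)
  also have "\<dots> \<le> R ^ length bs * (1 * 1)"
    using x R laws_radD(2)[OF \<mu>] law_rad_nonneg
    by (intro mult_mono power_mono prod_list_norm_le_1) (auto simp: unit_args_def prod_list_norm_nonneg)
  finally show ?thesis using x by (simp add: unit_args_def)
qed

text \<open>Radius at most 1 bounds each moment on unit arguments by 1, so the suprema are over
  bounded sets and dominate their members; general arguments follow by scaling with
  \<open>sgn\<close>.\<close>

lemma law_dist_1_moment:
  assumes \<mu>: "\<mu> \<in> laws_rad 1" and \<nu>: "\<nu> \<in> laws_rad 1"
  shows "law_dist 1 \<mu> \<nu> \<ge> 0"
    and "norm (\<mu> (nc_monomial b bs) - \<nu> (nc_monomial b bs)) \<le>
      law_dist 1 \<mu> \<nu> * 2 ^ length bs * (norm b * prod_list (map norm bs))"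
proof -
  interpret m: law \<mu> using laws_radD(1)[OF \<mu>] by unfold_locales
  interpret n: law \<nu> using laws_radD(1)[OF \<nu>] by unfold_locales
  define f where "f l = multilinear_norm l (\<lambda>b bs. Mom \<mu> b bs - Mom \<nu> b bs)" for l
  have n2: "norm (\<mu> (nc_monomial b bs) - \<nu> (nc_monomial b bs)) \<le> 2" if "(b, bs) \<in> unit_args l" for b bs l
    using norm_triangle_ineq4[of "\<mu> (nc_monomial b bs)" "\<nu> (nc_monomial b bs)"]
      norm_moment_unit[OF \<mu> that] norm_moment_unit[OF \<nu> that] by simp
  have bd: "bdd_above ((\<lambda>x. norm (\<mu> (nc_monomial (fst x) (snd x)) - \<nu> (nc_monomial (fst x) (snd x)))) ` unit_args l)" for l
    using n2 by (intro bdd_aboveI2[where M = 2]) auto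
  have up: "norm (\<mu> (nc_monomial b bs) - \<nu> (nc_monomial b bs)) \<le> f l" if "(b, bs) \<in> unit_args l" for b bs l
    unfolding f_def multilinear_norm_eq Mom_def using cSUP_upper[OF that bd] by simp
  have f2: "f l \<le> 2" for l
    unfolding f_def multilinear_norm_eq Mom_def using n2 by (intro cSUP_least unit_args_nonempty(2)) auto
  have f0: "f l \<ge> 0" for l
    using up[OF unit_args_nonempty(1)] norm_ge_zero order_trans by blast
  have "f l / (2 * 1) ^ l \<le> 2" for l
    using f2[of l] f0[of l] by (simp add: divide_le_eq) (smt (verit) one_le_power)
  then have bd': "bdd_above ((\<lambda>l. f l / (2 * 1) ^ l) ` {1..})" by (intro bdd_aboveI2[where M = 2]) auto
  have d: "f l / (2 * 1) ^ l \<le> law_dist 1 \<mu> \<nu>" if "l \<ge> 1" for l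
    unfolding law_dist_def f_def[symmetric] using that by (intro cSUP_upper bd') auto
  show d0: "law_dist 1 \<mu> \<nu> \<ge> 0" using d[of 1] f0[of 1] by simp
  have fl: "norm (\<mu> (nc_monomial b bs) - \<nu> (nc_monomial b bs)) \<le> law_dist 1 \<mu> \<nu> * 2 ^ l"
    if x: "(b, bs) \<in> unit_args l" for b bs l
  proof (cases "l = 0")
    \<comment> \<open>The metric omits order 0, where any two laws agree.\<close>
    case True
    then have "bs = []" using x by (simp add: unit_args_def)
    then show ?thesis using d0 by (simp add: nc_monomial_Nil m.law_coef n.law_coef)
  next
    case False
    then show ?thesis using d[of l] up[OF x] by (simp add: divide_le_eq)
  qed
  have sc: "nc_monomial b bs = complex_of_real (norm b * prod_list (map norm bs)) *\<^sub>C nc_monomial (sgn b) (map sgn bs)" for b :: 'a and bs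
  proof (induction bs arbitrary: b)
    case Nil
    have "b = complex_of_real (norm b) *\<^sub>C sgn b" by (cases "b = 0") (simp_all add: scaleR_eq_scaleC[symmetric] sgn_div_norm scaleC_zero_left)
    then have "coef b = complex_of_real (norm b) *\<^sub>C coef (sgn b)" by (metis coef_scaleC)
    then show ?case by (simp add: nc_monomial_Nil)
  next
    case (Cons c cs)
    have "b = complex_of_real (norm b) *\<^sub>C sgn b" by (cases "b = 0") (simp_all add: scaleR_eq_scaleC[symmetric] sgn_div_norm scaleC_zero_left)
    then have "coef b = complex_of_real (norm b) *\<^sub>C coef (sgn b)" by (metis coef_scaleC)
    then have "nc_monomial b (c # cs) = (complex_of_real (norm b) *\<^sub>C coef (sgn b)) *
        (indet * (complex_of_real (norm c * prod_list (map norm cs)) *\<^sub>C nc_monomial (sgn c) (map sgn cs)))"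
      using Cons[of c] by (simp add: nc_monomial_Cons)
    then show ?case
      by (simp add: nc_monomial_Cons mult_scaleC_left mult_scaleC_right scaleC_scaleC mult_ac)
  qed
  let ?w = "norm b * prod_list (map norm bs)"
  have "(sgn b, map sgn bs) \<in> unit_args (length bs)" by (auto simp: unit_args_def norm_sgn)
  from fl[OF this]
  have "?w * norm (\<mu> (nc_monomial (sgn b) (map sgn bs)) - \<nu> (nc_monomial (sgn b) (map sgn bs))) \<le> ?w * (law_dist 1 \<mu> \<nu> * 2 ^ length bs)"
    by (intro mult_left_mono) (simp_all add: prod_list_norm_nonneg)
  moreover have "norm (\<mu> (nc_monomial b bs) - \<nu> (nc_monomial b bs)) =
      ?w * norm (\<mu> (nc_monomial (sgn b) (map sgn bs)) - \<nu> (nc_monomial (sgn b) (map sgn bs)))"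
    unfolding sc[of b bs] m.law_scaleC n.law_scaleC scaleC_diff_right[symmetric] norm_scaleC
    by (simp add: prod_list_norm_nonneg abs_mult del: of_real_mult)
  ultimately show "norm (\<mu> (nc_monomial b bs) - \<nu> (nc_monomial b bs)) \<le>
      law_dist 1 \<mu> \<nu> * 2 ^ length bs * (norm b * prod_list (map norm bs))"
    by (simp add: mult_ac)
qed

section \<open>Lipschitz dependence on the laws\<close>

text \<open>Families depending on a parameter \<open>\<omega>\<close> and on a tuple of laws of radius at most one: the scalars
  occurring in the algebraic model are bounded and Lipschitz in the laws, uniformly in \<open>\<omega>\<close>.\<close>

definition tuple_dist :: "nat \<Rightarrow> (nat \<Rightarrow> 'b::unital_cstar_algebra law) \<Rightarrow> (nat \<Rightarrow> 'b law) \<Rightarrow> real" where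
  "tuple_dist N \<mu> \<nu> = (\<Sum>j=1..N. law_dist 1 (\<mu> j) (\<nu> j))"

lemma tuple_entry: "\<mu> \<in> tuples N S \<Longrightarrow> j \<in> {1..N} \<Longrightarrow> \<mu> j \<in> S"
  by (auto simp: PiE_def)

lemma tuple_dist_nonneg:
  assumes "\<mu> \<in> tuples N (laws_rad 1)" "\<nu> \<in> tuples N (laws_rad 1)"
  shows "tuple_dist N \<mu> \<nu> \<ge> 0"
  unfolding tuple_dist_def
  by (intro sum_nonneg law_dist_1_moment(1) tuple_entry[OF assms(1)] tuple_entry[OF assms(2)])

lemma law_dist_le_tuple_dist:
  assumes "\<mu> \<in> tuples N (laws_rad 1)" "\<nu> \<in> tuples N (laws_rad 1)" "j \<in> {1..N}"
  shows "law_dist 1 (\<mu> j) (\<nu> j) \<le> tuple_dist N \<mu> \<nu>"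
  unfolding tuple_dist_def using assms
  by (intro member_le_sum) (auto intro!: law_dist_1_moment(1) dest: tuple_entry)

context
  fixes \<Omega> :: "'o set" and N :: nat
begin

abbreviation law_tuples :: "(nat \<Rightarrow> 'b::unital_cstar_algebra law) set" where
  "law_tuples \<equiv> tuples N (laws_rad 1)"

definition lip :: "('o \<Rightarrow> (nat \<Rightarrow> 'b::unital_cstar_algebra law) \<Rightarrow> 'b) \<Rightarrow> bool" where
  "lip g \<longleftrightarrow> (\<exists>K\<ge>0. \<forall>\<omega>\<in>\<Omega>. \<forall>\<mu>\<in>law_tuples. \<forall>\<nu>\<in>law_tuples.
     norm (g \<omega> \<mu>) \<le> K \<and> norm (g \<omega> \<mu> - g \<omega> \<nu>) \<le> K * tuple_dist N \<mu> \<nu>)"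

lemma lipE:
  assumes "lip g"
  obtains K where "K \<ge> 0" "\<And>\<omega> \<mu>. \<omega> \<in> \<Omega> \<Longrightarrow> \<mu> \<in> law_tuples \<Longrightarrow> norm (g \<omega> \<mu>) \<le> K"
    "\<And>\<omega> \<mu> \<nu>. \<omega> \<in> \<Omega> \<Longrightarrow> \<mu> \<in> law_tuples \<Longrightarrow> \<nu> \<in> law_tuples \<Longrightarrow>
      norm (g \<omega> \<mu> - g \<omega> \<nu>) \<le> K * tuple_dist N \<mu> \<nu>"
  using assms unfolding lip_def by blast

lemma lipI:
  fixes g :: "'o \<Rightarrow> (nat \<Rightarrow> 'b::unital_cstar_algebra law) \<Rightarrow> 'b"
  assumes "K \<ge> 0" "L \<ge> 0" "\<And>\<omega> \<mu>. \<omega> \<in> \<Omega> \<Longrightarrow> \<mu> \<in> law_tuples \<Longrightarrow> norm (g \<omega> \<mu>) \<le> K"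
    "\<And>\<omega> \<mu> \<nu>. \<omega> \<in> \<Omega> \<Longrightarrow> \<mu> \<in> law_tuples \<Longrightarrow> \<nu> \<in> law_tuples \<Longrightarrow>
      norm (g \<omega> \<mu> - g \<omega> \<nu>) \<le> L * tuple_dist N \<mu> \<nu>"
  shows "lip g"
  unfolding lip_def
proof (intro exI[of _ "max K L"] conjI ballI)
  fix \<omega> and \<mu> \<nu> :: "nat \<Rightarrow> 'b law" assume a: "\<omega> \<in> \<Omega>" "\<mu> \<in> law_tuples" "\<nu> \<in> law_tuples"
  show "norm (g \<omega> \<mu>) \<le> max K L" using assms(3)[OF a(1,2)] by simp
  have "L * tuple_dist N \<mu> \<nu> \<le> max K L * tuple_dist N \<mu> \<nu>"
    using tuple_dist_nonneg[OF a(2,3)] by (intro mult_right_mono) auto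
  then show "norm (g \<omega> \<mu> - g \<omega> \<nu>) \<le> max K L * tuple_dist N \<mu> \<nu>" using assms(4)[OF a] by simp
qed (use assms(1) in simp)

lemma lip_const: "(\<And>\<omega>. \<omega> \<in> \<Omega> \<Longrightarrow> norm (f \<omega>) \<le> K) \<Longrightarrow> K \<ge> 0 \<Longrightarrow> lip (\<lambda>\<omega> \<mu>. f \<omega>)"
  by (rule lipI[of K 0]) auto

lemma lip_add:
  fixes g h :: "'o \<Rightarrow> (nat \<Rightarrow> 'b::unital_cstar_algebra law) \<Rightarrow> 'b"
  assumes "lip g" "lip h" shows "lip (\<lambda>\<omega> \<mu>. g \<omega> \<mu> + h \<omega> \<mu>)"
proof -
  obtain K where K: "K \<ge> 0" "\<And>\<omega> \<mu>. \<omega> \<in> \<Omega> \<Longrightarrow> \<mu> \<in> law_tuples \<Longrightarrow> norm (g \<omega> \<mu>) \<le> K"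
    "\<And>\<omega> \<mu> \<nu>. \<omega> \<in> \<Omega> \<Longrightarrow> \<mu> \<in> law_tuples \<Longrightarrow> \<nu> \<in> law_tuples \<Longrightarrow> norm (g \<omega> \<mu> - g \<omega> \<nu>) \<le> K * tuple_dist N \<mu> \<nu>"
    using assms(1) by (rule lipE) blast
  obtain L where L: "L \<ge> 0" "\<And>\<omega> \<mu>. \<omega> \<in> \<Omega> \<Longrightarrow> \<mu> \<in> law_tuples \<Longrightarrow> norm (h \<omega> \<mu>) \<le> L"
    "\<And>\<omega> \<mu> \<nu>. \<omega> \<in> \<Omega> \<Longrightarrow> \<mu> \<in> law_tuples \<Longrightarrow> \<nu> \<in> law_tuples \<Longrightarrow> norm (h \<omega> \<mu> - h \<omega> \<nu>) \<le> L * tuple_dist N \<mu> \<nu>"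
    using assms(2) by (rule lipE) blast
  show ?thesis
  proof (rule lipI[of "K + L" "K + L"])
    fix \<omega> and \<mu> \<nu> :: "nat \<Rightarrow> 'b law" assume a: "\<omega> \<in> \<Omega>" "\<mu> \<in> law_tuples"
    show "norm (g \<omega> \<mu> + h \<omega> \<mu>) \<le> K + L" using K(2)[OF a] L(2)[OF a] by (rule norm_triangle_mono)
    assume b: "\<nu> \<in> law_tuples"
    have "norm ((g \<omega> \<mu> - g \<omega> \<nu>) + (h \<omega> \<mu> - h \<omega> \<nu>)) \<le> K * tuple_dist N \<mu> \<nu> + L * tuple_dist N \<mu> \<nu>"
      using K(3)[OF a b] L(3)[OF a b] by (rule norm_triangle_mono)
    then show "norm (g \<omega> \<mu> + h \<omega> \<mu> - (g \<omega> \<nu> + h \<omega> \<nu>)) \<le> (K + L) * tuple_dist N \<mu> \<nu>"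
      by (simp add: algebra_simps)
  qed (use K L in auto)
qed

lemma lip_uminus: "lip g \<Longrightarrow> lip (\<lambda>\<omega> \<mu>. - g \<omega> \<mu>)"
  by (simp add: lip_def norm_minus_commute)

lemma lip_mult:
  fixes g h :: "'o \<Rightarrow> (nat \<Rightarrow> 'b::unital_cstar_algebra law) \<Rightarrow> 'b"
  assumes "lip g" "lip h" shows "lip (\<lambda>\<omega> \<mu>. g \<omega> \<mu> * h \<omega> \<mu>)"
proof -
  obtain K where K: "K \<ge> 0" "\<And>\<omega> \<mu>. \<omega> \<in> \<Omega> \<Longrightarrow> \<mu> \<in> law_tuples \<Longrightarrow> norm (g \<omega> \<mu>) \<le> K"
    "\<And>\<omega> \<mu> \<nu>. \<omega> \<in> \<Omega> \<Longrightarrow> \<mu> \<in> law_tuples \<Longrightarrow> \<nu> \<in> law_tuples \<Longrightarrow> norm (g \<omega> \<mu> - g \<omega> \<nu>) \<le> K * tuple_dist N \<mu> \<nu>"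
    using assms(1) by (rule lipE) blast
  obtain L where L: "L \<ge> 0" "\<And>\<omega> \<mu>. \<omega> \<in> \<Omega> \<Longrightarrow> \<mu> \<in> law_tuples \<Longrightarrow> norm (h \<omega> \<mu>) \<le> L"
    "\<And>\<omega> \<mu> \<nu>. \<omega> \<in> \<Omega> \<Longrightarrow> \<mu> \<in> law_tuples \<Longrightarrow> \<nu> \<in> law_tuples \<Longrightarrow> norm (h \<omega> \<mu> - h \<omega> \<nu>) \<le> L * tuple_dist N \<mu> \<nu>"
    using assms(2) by (rule lipE) blast
  show ?thesis
  proof (rule lipI[of "K * L" "2 * K * L"])
    fix \<omega> and \<mu> \<nu> :: "nat \<Rightarrow> 'b law" assume a: "\<omega> \<in> \<Omega>" "\<mu> \<in> law_tuples"
    show "norm (g \<omega> \<mu> * h \<omega> \<mu>) \<le> K * L"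
      using K(2)[OF a] L(2)[OF a] K(1) by (intro order_trans[OF norm_mult_ineq] mult_mono) auto
    assume b: "\<nu> \<in> law_tuples"
    have "norm ((g \<omega> \<mu> - g \<omega> \<nu>) * h \<omega> \<mu> + g \<omega> \<nu> * (h \<omega> \<mu> - h \<omega> \<nu>)) \<le>
        (K * tuple_dist N \<mu> \<nu>) * L + K * (L * tuple_dist N \<mu> \<nu>)"
      using K L a b tuple_dist_nonneg[OF a(2) b]
      by (intro norm_triangle_mono order_trans[OF norm_mult_ineq] mult_mono) auto
    then show "norm (g \<omega> \<mu> * h \<omega> \<mu> - g \<omega> \<nu> * h \<omega> \<nu>) \<le> 2 * K * L * tuple_dist N \<mu> \<nu>"
      by (simp add: algebra_simps)
  qed (use K L in auto)
qed

text \<open>Split the difference into the change of the law at a fixed monomial and the change of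
  the monomial under a fixed law. The first is a difference of moments, whence the power of 2; the
  second is estimated in \<open>preL2 (\<nu> j)\<close>, where X has norm at most 1 and the changes
  of the coefficients telescope.\<close>

lemma lip_monomial:
  fixes g :: "'o \<Rightarrow> (nat \<Rightarrow> 'b::unital_cstar_algebra law) \<Rightarrow> 'b"
  assumes j: "j \<in> {1..N}" and g: "lip g" and gs: "\<And>h. h \<in> set gs \<Longrightarrow> lip h"
  shows "lip (\<lambda>\<omega> \<mu>. \<mu> j (nc_monomial (g \<omega> \<mu>) (map (\<lambda>h. h \<omega> \<mu>) gs)))"
proof -
  define m where "m g gs \<omega> \<mu> = nc_monomial (g \<omega> \<mu>) (map (\<lambda>h. h \<omega> \<mu>) gs)"
    for g :: "'o \<Rightarrow> (nat \<Rightarrow> 'b law) \<Rightarrow> 'b" and gs \<omega> \<mu>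
  have w: "\<exists>K\<ge>0. \<forall>\<omega>\<in>\<Omega>. \<forall>\<mu>\<in>law_tuples. norm (g \<omega> \<mu>) * prod_list (map norm (map (\<lambda>h. h \<omega> \<mu>) gs)) \<le> K"
    if "lip g" "\<And>h. h \<in> set gs \<Longrightarrow> lip h" for g :: "'o \<Rightarrow> (nat \<Rightarrow> 'b law) \<Rightarrow> 'b" and gs
    using that
  proof (induction gs arbitrary: g)
    case Nil
    obtain K where "K \<ge> 0" "\<And>\<omega> \<mu>. \<omega> \<in> \<Omega> \<Longrightarrow> \<mu> \<in> law_tuples \<Longrightarrow> norm (g \<omega> \<mu>) \<le> K"
      using Nil(1) by (rule lipE) blast
    then show ?case by auto
  next
    case (Cons h hs)
    obtain K where K: "K \<ge> 0" "\<And>\<omega> \<mu>. \<omega> \<in> \<Omega> \<Longrightarrow> \<mu> \<in> law_tuples \<Longrightarrow> norm (g \<omega> \<mu>) \<le> K"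
      using Cons.prems(1) by (rule lipE) blast
    obtain L where L: "L \<ge> 0" "\<And>\<omega> \<mu>. \<omega> \<in> \<Omega> \<Longrightarrow> \<mu> \<in> law_tuples \<Longrightarrow> norm (h \<omega> \<mu>) * prod_list (map norm (map (\<lambda>h. h \<omega> \<mu>) hs)) \<le> L"
      using Cons.IH[of h] Cons.prems(2) by auto
    have "norm (g \<omega> \<mu>) * (norm (h \<omega> \<mu>) * prod_list (map norm (map (\<lambda>h. h \<omega> \<mu>) hs))) \<le> K * L"
      if "\<omega> \<in> \<Omega>" "\<mu> \<in> law_tuples" for \<omega> \<mu>
      using K(2)[OF that] L(2)[OF that] K(1) prod_list_norm_nonneg[of "map (\<lambda>h. h \<omega> \<mu>) hs"]
      by (intro mult_mono) auto
    then show ?case using K L by (intro exI[of _ "K * L"]) auto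
  qed
  have lawj: "law (\<mu> j)" "law_rad (\<mu> j) \<le> 1" if "\<mu> \<in> law_tuples" for \<mu> :: "nat \<Rightarrow> 'b law"
    using laws_radD[OF tuple_entry[OF that j]] by (auto intro: law.intro)
  have dif: "\<exists>K\<ge>0. \<forall>\<omega>\<in>\<Omega>. \<forall>\<mu>\<in>law_tuples. \<forall>\<nu>\<in>law_tuples.
      pre_hilbert.seminorm (preL2 (\<nu> j)) (m g gs \<omega> \<mu> - m g gs \<omega> \<nu>) \<le> K * tuple_dist N \<mu> \<nu>"
    if "lip g" "\<And>h. h \<in> set gs \<Longrightarrow> lip h" for g gs
    using that
  proof (induction gs arbitrary: g)
    case Nil
    obtain K where K: "K \<ge> 0" "\<And>\<omega> \<mu> \<nu>. \<omega> \<in> \<Omega> \<Longrightarrow> \<mu> \<in> law_tuples \<Longrightarrow> \<nu> \<in> law_tuples \<Longrightarrow> norm (g \<omega> \<mu> - g \<omega> \<nu>) \<le> K * tuple_dist N \<mu> \<nu>"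
      using Nil(1) by (rule lipE) blast
    have "pre_hilbert.seminorm (preL2 (\<nu> j)) (m g [] \<omega> \<mu> - m g [] \<omega> \<nu>) \<le> K * tuple_dist N \<mu> \<nu>"
      if a: "\<omega> \<in> \<Omega>" "\<mu> \<in> law_tuples" "\<nu> \<in> law_tuples" for \<omega> \<mu> \<nu>
    proof -
      interpret n: law "\<nu> j" by (rule lawj(1)[OF a(3)])
      have "m g [] \<omega> \<mu> - m g [] \<omega> \<nu> = nc_monomial (g \<omega> \<mu> - g \<omega> \<nu>) []"
        by (simp add: m_def nc_monomial_Nil coef_diff)
      then show ?thesis using n.seminorm_monomial[of "g \<omega> \<mu> - g \<omega> \<nu>" "[]"] K(2)[OF a] by simp
    qed
    then show ?case using K(1) by blast
  next
    case (Cons h hs)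
    obtain K where K: "K \<ge> 0" "\<And>\<omega> \<mu>. \<omega> \<in> \<Omega> \<Longrightarrow> \<mu> \<in> law_tuples \<Longrightarrow> norm (g \<omega> \<mu>) \<le> K"
      "\<And>\<omega> \<mu> \<nu>. \<omega> \<in> \<Omega> \<Longrightarrow> \<mu> \<in> law_tuples \<Longrightarrow> \<nu> \<in> law_tuples \<Longrightarrow> norm (g \<omega> \<mu> - g \<omega> \<nu>) \<le> K * tuple_dist N \<mu> \<nu>"
      using Cons.prems(1) by (rule lipE) blast
    obtain L where L: "L \<ge> 0" "\<And>\<omega> \<mu> \<nu>. \<omega> \<in> \<Omega> \<Longrightarrow> \<mu> \<in> law_tuples \<Longrightarrow> \<nu> \<in> law_tuples \<Longrightarrow>
        pre_hilbert.seminorm (preL2 (\<nu> j)) (m h hs \<omega> \<mu> - m h hs \<omega> \<nu>) \<le> L * tuple_dist N \<mu> \<nu>"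
      using Cons.IH[of h] Cons.prems(2) by auto
    obtain P where P: "P \<ge> 0" "\<And>\<omega> \<mu>. \<omega> \<in> \<Omega> \<Longrightarrow> \<mu> \<in> law_tuples \<Longrightarrow>
        norm (h \<omega> \<mu>) * prod_list (map norm (map (\<lambda>h. h \<omega> \<mu>) hs)) \<le> P"
      using w[of h hs] Cons.prems(2) by auto
    have "pre_hilbert.seminorm (preL2 (\<nu> j)) (m g (h # hs) \<omega> \<mu> - m g (h # hs) \<omega> \<nu>) \<le> (K * L + K * P) * tuple_dist N \<mu> \<nu>"
      if a: "\<omega> \<in> \<Omega>" "\<mu> \<in> law_tuples" "\<nu> \<in> law_tuples" for \<omega> \<mu> \<nu>
    proof -
      interpret n: law "\<nu> j" by (rule lawj(1)[OF a(3)])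
      note D = tuple_dist_nonneg[OF a(2,3)]
      note r1 = lawj(2)[OF a(3)]
      let ?x = "m h hs \<omega> \<mu> - m h hs \<omega> \<nu>" and ?y = "m h hs \<omega> \<nu>"
      have X: "n.pre.seminorm (indet * p) \<le> n.pre.seminorm p" for p
        using n.seminorm_indet[of p] mult_right_mono[OF r1, of "n.pre.seminorm p"] by simp
      have cX: "n.pre.seminorm (coef b * (indet * p)) \<le> norm b * n.pre.seminorm p" for b p
        using n.pre.seminorm_left[of "indet * p" b] mult_left_mono[OF X, of "norm b" p]
        by (simp add: n.preL2_simps)
      have y: "n.pre.seminorm ?y \<le> P"
      proof -
        have "n.pre.seminorm ?y \<le> law_rad (\<nu> j) ^ length hs * (norm (h \<omega> \<nu>) * prod_list (map norm (map (\<lambda>h. h \<omega> \<nu>) hs)))"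
          using n.seminorm_monomial[of "h \<omega> \<nu>" "map (\<lambda>h. h \<omega> \<nu>) hs"] by (simp add: m_def)
        also have "\<dots> \<le> 1 * P"
          using P(2)[OF a(1,3)] power_le_one[OF n.law_rad_nonneg r1]
            prod_list_norm_nonneg[of "map (\<lambda>h. h \<omega> \<nu>) hs"] by (intro mult_mono) auto
        finally show ?thesis by simp
      qed
      \<comment> \<open>One step of the telescoping: first the tail changes, then the leading
        coefficient.\<close>
      have "m g (h # hs) \<omega> \<mu> - m g (h # hs) \<omega> \<nu> =
          coef (g \<omega> \<mu>) * (indet * ?x) + coef (g \<omega> \<mu> - g \<omega> \<nu>) * (indet * ?y)"
        by (simp add: m_def nc_monomial_Cons coef_diff algebra_simps)
      then have "n.pre.seminorm (m g (h # hs) \<omega> \<mu> - m g (h # hs) \<omega> \<nu>) \<le>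
          n.pre.seminorm (coef (g \<omega> \<mu>) * (indet * ?x)) + n.pre.seminorm (coef (g \<omega> \<mu> - g \<omega> \<nu>) * (indet * ?y))"
        using n.pre.seminorm_add[of "coef (g \<omega> \<mu>) * (indet * ?x)" "coef (g \<omega> \<mu> - g \<omega> \<nu>) * (indet * ?y)"]
        by (simp add: n.preL2_simps)
      also have "\<dots> \<le> norm (g \<omega> \<mu>) * n.pre.seminorm ?x + norm (g \<omega> \<mu> - g \<omega> \<nu>) * n.pre.seminorm ?y"
        by (intro add_mono cX)
      also have "\<dots> \<le> K * (L * tuple_dist N \<mu> \<nu>) + (K * tuple_dist N \<mu> \<nu>) * P"
        using K L(2)[OF a] a y D by (intro add_mono mult_mono) auto
      finally show ?thesis by (simp add: algebra_simps)
    qed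
    then show ?case using K(1) L(1) P(1) by (intro exI[of _ "K * L + K * P"]) auto
  qed
  obtain P where P: "P \<ge> 0" "\<And>\<omega> \<mu>. \<omega> \<in> \<Omega> \<Longrightarrow> \<mu> \<in> law_tuples \<Longrightarrow>
      norm (g \<omega> \<mu>) * prod_list (map norm (map (\<lambda>h. h \<omega> \<mu>) gs)) \<le> P"
    using w[of g gs, OF g gs] by auto
  obtain L where L: "L \<ge> 0" "\<And>\<omega> \<mu> \<nu>. \<omega> \<in> \<Omega> \<Longrightarrow> \<mu> \<in> law_tuples \<Longrightarrow> \<nu> \<in> law_tuples \<Longrightarrow>
      pre_hilbert.seminorm (preL2 (\<nu> j)) (m g gs \<omega> \<mu> - m g gs \<omega> \<nu>) \<le> L * tuple_dist N \<mu> \<nu>"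
    using dif[of g gs, OF g gs] by auto
  have "lip (\<lambda>\<omega> \<mu>. \<mu> j (m g gs \<omega> \<mu>))"
  proof (rule lipI[of P "2 ^ length gs * P + L"])
    fix \<omega> and \<mu> :: "nat \<Rightarrow> 'b law" assume a: "\<omega> \<in> \<Omega>" "\<mu> \<in> law_tuples"
    interpret l: law "\<mu> j" by (rule lawj(1)[OF a(2)])
    have "norm (\<mu> j (m g gs \<omega> \<mu>)) \<le> law_rad (\<mu> j) ^ length gs * (norm (g \<omega> \<mu>) * prod_list (map norm (map (\<lambda>h. h \<omega> \<mu>) gs)))"
      using l.norm_moment[of "g \<omega> \<mu>" "map (\<lambda>h. h \<omega> \<mu>) gs"] by (simp add: m_def)
    also have "\<dots> \<le> 1 * P"
      using P(2)[OF a] power_le_one[OF l.law_rad_nonneg lawj(2)[OF a(2)]]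
        prod_list_norm_nonneg[of "map (\<lambda>h. h \<omega> \<mu>) gs"] by (intro mult_mono) auto
    finally show "norm (\<mu> j (m g gs \<omega> \<mu>)) \<le> P" by simp
    fix \<nu> :: "nat \<Rightarrow> 'b law" assume b: "\<nu> \<in> law_tuples"
    interpret n: law "\<nu> j" by (rule lawj(1)[OF b])
    note D = tuple_dist_nonneg[OF a(2) b]
    have "norm (\<mu> j (m g gs \<omega> \<mu>) - \<nu> j (m g gs \<omega> \<mu>)) \<le>
        law_dist 1 (\<mu> j) (\<nu> j) * 2 ^ length gs * (norm (g \<omega> \<mu>) * prod_list (map norm (map (\<lambda>h. h \<omega> \<mu>) gs)))"
      using law_dist_1_moment(2)[OF tuple_entry[OF a(2) j] tuple_entry[OF b j], of "g \<omega> \<mu>" "map (\<lambda>h. h \<omega> \<mu>) gs"]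
      by (simp add: m_def)
    also have "\<dots> \<le> tuple_dist N \<mu> \<nu> * 2 ^ length gs * P"
      using P(2)[OF a] D law_dist_le_tuple_dist[OF a(2) b j]
        prod_list_norm_nonneg[of "map (\<lambda>h. h \<omega> \<mu>) gs"] by (intro mult_mono) auto
    finally have 1: "norm (\<mu> j (m g gs \<omega> \<mu>) - \<nu> j (m g gs \<omega> \<mu>)) \<le> tuple_dist N \<mu> \<nu> * 2 ^ length gs * P" .
    have "norm (bm_inner (preL2 (\<nu> j)) 1 (m g gs \<omega> \<mu> - m g gs \<omega> \<nu>)) \<le> n.pre.seminorm 1 * n.pre.seminorm (m g gs \<omega> \<mu> - m g gs \<omega> \<nu>)"
      by (rule n.pre.Cauchy_Schwarz) (simp_all add: n.preL2_simps)
    also have "n.pre.seminorm 1 = 1" by (simp add: n.pre.seminorm_def n.preL2_simps star_one n.law_one)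
    finally have 2: "norm (\<nu> j (m g gs \<omega> \<mu>) - \<nu> j (m g gs \<omega> \<nu>)) \<le> L * tuple_dist N \<mu> \<nu>"
      using L(2)[OF a b] by (simp add: n.preL2_simps star_one n.law_diff)
    have "norm ((\<mu> j (m g gs \<omega> \<mu>) - \<nu> j (m g gs \<omega> \<mu>)) + (\<nu> j (m g gs \<omega> \<mu>) - \<nu> j (m g gs \<omega> \<nu>))) \<le>
        tuple_dist N \<mu> \<nu> * 2 ^ length gs * P + L * tuple_dist N \<mu> \<nu>"
      using 1 2 by (rule norm_triangle_mono)
    then show "norm (\<mu> j (m g gs \<omega> \<mu>) - \<nu> j (m g gs \<omega> \<nu>)) \<le> (2 ^ length gs * P + L) * tuple_dist N \<mu> \<nu>"
      by (simp add: algebra_simps)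
  qed (use P L in auto)
  then show ?thesis by (simp add: m_def)
qed

text \<open>The number of monomials and their orders are fixed and only the coefficients vary, so
  Lipschitz dependence is expressed through coefficients instead of a norm on polynomials.\<close>

inductive lip_poly :: "('o \<Rightarrow> (nat \<Rightarrow> 'b::unital_cstar_algebra law) \<Rightarrow> 'b ncpoly) \<Rightarrow> bool" where
  lip_poly_zero: "lip_poly (\<lambda>\<omega> \<mu>. 0)"
| lip_poly_add_monomial: "lip g \<Longrightarrow> (\<And>h. h \<in> set gs \<Longrightarrow> lip h) \<Longrightarrow> lip_poly p \<Longrightarrow>
    lip_poly (\<lambda>\<omega> \<mu>. nc_monomial (g \<omega> \<mu>) (map (\<lambda>h. h \<omega> \<mu>) gs) + p \<omega> \<mu>)"

lemma lip_one: "lip (\<lambda>\<omega> \<mu>. 1)"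
  by (rule lip_const[of _ 1]) auto

lemma lip_poly_add:
  assumes "lip_poly p" "lip_poly q" shows "lip_poly (\<lambda>\<omega> \<mu>. p \<omega> \<mu> + q \<omega> \<mu>)"
  using assms(1)
proof induction
  case (lip_poly_add_monomial g gs p)
  from lip_poly.lip_poly_add_monomial[OF this(1,2,4)] show ?case by (simp add: add.assoc)
qed (use assms(2) in simp)

lemma lip_poly_coef: "lip g \<Longrightarrow> lip_poly (\<lambda>\<omega> \<mu>. coef (g \<omega> \<mu>))"
  using lip_poly.lip_poly_add_monomial[OF _ _ lip_poly_zero, of g "[]"] by (simp add: nc_monomial_Nil)

lemma lip_poly_coef_mult:
  assumes "lip a" "lip_poly p" shows "lip_poly (\<lambda>\<omega> \<mu>. coef (a \<omega> \<mu>) * p \<omega> \<mu>)"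
  using assms(2)
proof induction
  case lip_poly_zero
  show ?case by (simp add: lip_poly.lip_poly_zero)
next
  case (lip_poly_add_monomial g gs p)
  from lip_poly.lip_poly_add_monomial[OF lip_mult[OF assms(1) this(1)] this(2,4)]
  show ?case by (simp add: semiring_class.distrib_left coef_mult_monomial)
qed

lemma lip_poly_indet_mult:
  assumes "lip_poly p" shows "lip_poly (\<lambda>\<omega> \<mu>. indet * p \<omega> \<mu>)"
  using assms
proof induction
  case lip_poly_zero
  show ?case by (simp add: lip_poly.lip_poly_zero)
next
  case (lip_poly_add_monomial g gs p)
  have "lip_poly (\<lambda>\<omega> \<mu>. nc_monomial ((\<lambda>\<omega> \<mu>. 1) \<omega> \<mu>) (map (\<lambda>h. h \<omega> \<mu>) (g # gs)) + indet * p \<omega> \<mu>)"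
    using lip_poly_add_monomial by (intro lip_poly.lip_poly_add_monomial lip_one) auto
  then show ?case by (simp add: semiring_class.distrib_left indet_mult_monomial)
qed

text \<open>Centering nests the laws: \<open>\<mu> j\<close> is applied to polynomials whose
  coefficients already contain values of laws. Lipschitz coefficients are closed under this.\<close>

lemma lip_law:
  fixes p :: "'o \<Rightarrow> (nat \<Rightarrow> 'b::unital_cstar_algebra law) \<Rightarrow> 'b ncpoly"
  assumes "j \<in> {1..N}" "lip_poly p" shows "lip (\<lambda>\<omega> \<mu>. \<mu> j (p \<omega> \<mu>))"
proof -
  \<comment> \<open>Additivity of \<open>\<mu> j\<close> is available only on tuples of laws, and
    \<open>lip\<close> looks only at those.\<close>
  have cong: "lip g" if "lip f" "\<And>\<omega> \<mu>. \<mu> \<in> law_tuples \<Longrightarrow> f \<omega> \<mu> = g \<omega> \<mu>" for f g :: "'o \<Rightarrow> (nat \<Rightarrow> 'b law) \<Rightarrow> 'b"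
    using that by (auto simp: lip_def)
  have l: "law (\<mu> j)" if "\<mu> \<in> law_tuples" for \<mu> :: "nat \<Rightarrow> 'b law"
    using laws_radD(1)[OF tuple_entry[OF that assms(1)]] by unfold_locales
  show ?thesis using assms(2)
  proof induction
    case lip_poly_zero
    show ?case by (rule cong[OF lip_const[of "\<lambda>_. 0" 0]]) (auto simp: law.law_zero[OF l])
  next
    case (lip_poly_add_monomial g gs p)
    show ?case
      by (rule cong[OF lip_add[OF lip_monomial[OF assms(1) lip_poly_add_monomial(1,2)] lip_poly_add_monomial(4)]])
        (simp_all add: law.law_add[OF l])
  qed
qed

text \<open>The recorded length guarantees that the list splits when the letter j is stripped off a
  word.\<close>

inductive lip_list :: "nat \<Rightarrow> ('o \<Rightarrow> (nat \<Rightarrow> 'b::unital_cstar_algebra law) \<Rightarrow> 'b ncpoly list) \<Rightarrow> bool" where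
  lip_list_Nil: "lip_list 0 (\<lambda>\<omega> \<mu>. [])"
| lip_list_Cons: "lip_poly p \<Longrightarrow> lip_list n F \<Longrightarrow> lip_list (Suc n) (\<lambda>\<omega> \<mu>. p \<omega> \<mu> # F \<omega> \<mu>)"

text \<open>Words are constants of the family, so every test for membership in the tree is decided
  once for all arguments and laws, and the vector keeps its shape.\<close>

inductive lip_vec :: "('o \<Rightarrow> (nat \<Rightarrow> 'b::unital_cstar_algebra law) \<Rightarrow> 'b entry list) \<Rightarrow> bool" where
  lip_vec_Nil: "lip_vec (\<lambda>\<omega> \<mu>. [])"
| lip_vec_Cons: "lip_list (length s) F \<Longrightarrow> lip b \<Longrightarrow> lip_vec V \<Longrightarrow> lip_vec (\<lambda>\<omega> \<mu>. (s, F \<omega> \<mu>, b \<omega> \<mu>) # V \<omega> \<mu>)"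

lemma lip_lact:
  assumes a: "lip a" and F: "lip_list n F" and b: "lip b"
  shows "\<exists>F' b'. lip_list n F' \<and> lip b' \<and> (\<forall>\<omega> \<mu>. lact (a \<omega> \<mu>) (F \<omega> \<mu>, b \<omega> \<mu>) = (F' \<omega> \<mu>, b' \<omega> \<mu>))"
  using F
proof cases
  case lip_list_Nil
  then show ?thesis using lip_mult[OF a b] lip_list.lip_list_Nil by fastforce
next
  case (lip_list_Cons p m G)
  then show ?thesis
    using b lip_list.lip_list_Cons[OF lip_poly_coef_mult[OF a lip_list_Cons(3)] lip_list_Cons(4)]
    by (intro exI[of _ "\<lambda>\<omega> \<mu>. coef (a \<omega> \<mu>) * p \<omega> \<mu> # G \<omega> \<mu>"] exI[of _ b]) simp
qed

lemma lip_vec_append: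
  assumes "lip_vec U" "lip_vec V" shows "lip_vec (\<lambda>\<omega> \<mu>. U \<omega> \<mu> @ V \<omega> \<mu>)"
  using assms(1)
proof induction
  case (lip_vec_Cons s F b U)
  from lip_vec.lip_vec_Cons[OF this(1,2,4)] show ?case by simp
qed (use assms(2) in simp)

lemma lip_vec_left:
  assumes a: "lip a" and V: "lip_vec V" shows "lip_vec (\<lambda>\<omega> \<mu>. formal_left (a \<omega> \<mu>) (V \<omega> \<mu>))"
  using V
proof induction
  case lip_vec_Nil
  show ?case by (simp add: formal_left_def lip_vec.lip_vec_Nil)
next
  case (lip_vec_Cons s F b V)
  obtain F' b' where F': "lip_list (length s) F'" "lip b'"
    "\<And>\<omega> \<mu>. lact (a \<omega> \<mu>) (F \<omega> \<mu>, b \<omega> \<mu>) = (F' \<omega> \<mu>, b' \<omega> \<mu>)"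
    using lip_lact[OF a lip_vec_Cons(1,2)] by blast
  from lip_vec.lip_vec_Cons[OF F'(1,2) lip_vec_Cons(4)] show ?case by (simp add: formal_left_def F'(3))
qed

lemma lip_vec_emit:
  fixes q :: "'o \<Rightarrow> (nat \<Rightarrow> 'b::unital_cstar_algebra law) \<Rightarrow> 'b ncpoly"
  assumes j: "j \<in> {1..N}" and q: "lip_poly q" and F: "lip_list (length s) F" and b: "lip b"
  shows "lip_vec (\<lambda>\<omega> \<mu>. emit (\<mu> j) j (mult_hd (s, q \<omega> \<mu> # F \<omega> \<mu>, b \<omega> \<mu>)))"
proof -
  define r where "r \<omega> \<mu> = indet * q \<omega> \<mu>" for \<omega> \<mu>
  have r: "lip_poly r" unfolding r_def by (rule lip_poly_indet_mult[OF q])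
  have m: "lip (\<lambda>\<omega> \<mu>. \<mu> j (r \<omega> \<mu>))" by (rule lip_law[OF j r])
  have "lip_poly (\<lambda>\<omega> \<mu>. r \<omega> \<mu> + coef (- \<mu> j (r \<omega> \<mu>)))"
    by (intro lip_poly_add r lip_poly_coef lip_uminus m)
  moreover have "coef (- a) = - coef a" for a :: 'b using coef_diff[of 0 a] by (simp add: coef_zero)
  ultimately have c: "lip_poly (\<lambda>\<omega> \<mu>. center (\<mu> j) (r \<omega> \<mu>))" by (simp add: center_def)
  obtain F' b' where F': "lip_list (length s) F'" "lip b'"
    "\<And>\<omega> \<mu>. lact (\<mu> j (r \<omega> \<mu>)) (F \<omega> \<mu>, b \<omega> \<mu>) = (F' \<omega> \<mu>, b' \<omega> \<mu>)"
    using lip_lact[OF m F b] by blast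
  have "lip_vec (\<lambda>\<omega> \<mu>. [(j # s, center (\<mu> j) (r \<omega> \<mu>) # F \<omega> \<mu>, b \<omega> \<mu>), (s, F' \<omega> \<mu>, b' \<omega> \<mu>)])"
    using lip_list_Cons[OF c F] F' b by (intro lip_vec_Cons lip_vec_Nil) simp_all
  then show ?thesis by (simp add: emit_def mult_hd_def F'(3)[symmetric] r_def Let_def)
qed

lemma lip_vec_word_X:
  assumes T: "T \<in> Tree N" and F: "lip_list (length s) F" and b: "lip b"
  shows "lip_vec (\<lambda>\<omega> \<mu>. word_X \<mu> T j (s, F \<omega> \<mu>, b \<omega> \<mu>))"
proof (cases "s \<noteq> [] \<and> hd s = j")
  case True
  then obtain s' where s: "s = j # s'" by (cases s) auto
  have "lip_list (Suc (length s')) F" using F by (simp add: s)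
  then obtain p G where G: "F = (\<lambda>\<omega> \<mu>. p \<omega> \<mu> # G \<omega> \<mu>)" "lip_poly p" "lip_list (length s') G"
    by (cases rule: lip_list.cases) auto
  show ?thesis
  proof (cases "s \<in> T")
    case True
    then have "j \<in> {1..N}" using Tree_Cons(1)[OF T] s by blast
    from lip_vec_emit[OF this G(2,3) b] show ?thesis
      using True by (simp add: word_X_def strip_def s G(1) Let_def)
  next
    case False
    then show ?thesis by (simp add: word_X_def strip_def s Let_def lip_vec_Nil)
  qed
next
  case False
  then have st: "strip j (s, F \<omega> \<mu>, b \<omega> \<mu>) = (s, 1 # F \<omega> \<mu>, b \<omega> \<mu>)" for \<omega> \<mu> by (auto simp: strip_def)
  show ?thesis
  proof (cases "j # s \<in> T")
    case True
    then have "j \<in> {1..N}" using Tree_Cons(1)[OF T] by blast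
    moreover have "lip_poly (\<lambda>\<omega> \<mu>. 1)" using lip_poly_coef[OF lip_one] by (simp add: coef_one)
    ultimately have "lip_vec (\<lambda>\<omega> \<mu>. emit (\<mu> j) j (mult_hd (s, 1 # F \<omega> \<mu>, b \<omega> \<mu>)))"
      using lip_vec_emit[of j "\<lambda>\<omega> \<mu>. 1"] F b by blast
    then show ?thesis using True by (simp add: word_X_def st Let_def)
  next
    case False
    then show ?thesis by (simp add: word_X_def st Let_def lip_vec_Nil)
  qed
qed

lemma lip_vec_sum_X:
  assumes T: "T \<in> Tree N" and V: "lip_vec V" shows "lip_vec (\<lambda>\<omega> \<mu>. formal_sum_X N \<mu> T (V \<omega> \<mu>))"
proof -
  have X: "lip_vec (\<lambda>\<omega> \<mu>. formal_X \<mu> T j (V \<omega> \<mu>))" for j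
    using V
  proof induction
    case lip_vec_Nil
    show ?case by (simp add: formal_X_def lip_vec.lip_vec_Nil)
  next
    case (lip_vec_Cons s F b V)
    from lip_vec_append[OF lip_vec_word_X[OF T this(1,2)] this(4)] show ?case by (simp add: formal_X_def)
  qed
  have "lip_vec (\<lambda>\<omega> \<mu>. concat (map (\<lambda>j. formal_X \<mu> T j (V \<omega> \<mu>)) js))" for js
    by (induction js) (simp_all add: lip_vec_Nil lip_vec_append X)
  then show ?thesis by (simp only: formal_sum_X_def)
qed

lemma lip_vec_monomial:
  assumes T: "T \<in> Tree N" and g: "lip g" and gs: "\<And>h. h \<in> set gs \<Longrightarrow> lip h"
  shows "lip_vec (\<lambda>\<omega> \<mu>. monomial_vec N \<mu> T (g \<omega> \<mu>) (map (\<lambda>h. h \<omega> \<mu>) gs))"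
  using g gs
proof (induction gs arbitrary: g)
  case Nil
  have "lip_vec (\<lambda>\<omega> \<mu>. formal_vac)"
    unfolding formal_vac_def using lip_list_Nil by (intro lip_vec_Cons lip_vec_Nil lip_one) simp_all
  then show ?case using lip_vec_left Nil(1) by simp
next
  case (Cons h hs)
  then have "lip_vec (\<lambda>\<omega> \<mu>. monomial_vec N \<mu> T (h \<omega> \<mu>) (map (\<lambda>h. h \<omega> \<mu>) hs))" by simp
  then show ?case using lip_vec_left[OF Cons.prems(1) lip_vec_sum_X[OF T]] by simp
qed

lemma lip_expect: "lip_vec V \<Longrightarrow> lip (\<lambda>\<omega> \<mu>. formal_expect (V \<omega> \<mu>))"
proof (induction rule: lip_vec.induct)
  case lip_vec_Nil
  show ?case using lip_const[of "\<lambda>_. 0" 0] by (simp add: formal_expect_def)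
next
  case (lip_vec_Cons s F b V)
  then show ?case using lip_add[OF lip_vec_Cons(2,4)] by (cases "s = []") (simp_all add: formal_expect_def)
qed

end

text \<open>The arguments (b, bs) of the moment serve as the parameter \<omega>, which makes K
  uniform over them, as the norm of a multilinear map requires.\<close>

lemma monomial_vec_lipschitz:
  fixes N l :: nat
  assumes T: "T \<in> Tree N"
  obtains K where "K \<ge> 0"
    "\<And>b bs \<mu> \<nu>. (b :: 'b::unital_cstar_algebra, bs) \<in> unit_args l \<Longrightarrow> \<mu> \<in> tuples N (laws_rad 1) \<Longrightarrow> \<nu> \<in> tuples N (laws_rad 1) \<Longrightarrow>
      norm (formal_expect (monomial_vec N \<mu> T b bs) - formal_expect (monomial_vec N \<nu> T b bs)) \<le> K * tuple_dist N \<mu> \<nu>"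
proof -
  \<comment> \<open>The i-th argument as a coefficient function: bounded by 1 and constant in the
    laws.\<close>
  define gs :: "('b \<times> 'b list \<Rightarrow> (nat \<Rightarrow> 'b law) \<Rightarrow> 'b) list" where "gs = map (\<lambda>i \<omega> \<mu>. snd \<omega> ! i) [0..<l]"
  have "lip (unit_args l) N h" if "h \<in> set gs" for h
    using that by (auto simp: gs_def unit_args_def intro!: lip_const[where K = 1])
  moreover have "lip (unit_args l) N (\<lambda>\<omega> (\<mu> :: nat \<Rightarrow> 'b law). fst \<omega>)"
    by (rule lip_const[where K = 1]) (auto simp: unit_args_def)
  ultimately have "lip (unit_args l) N (\<lambda>\<omega> \<mu>. formal_expect (monomial_vec N \<mu> T (fst \<omega>) (map (\<lambda>h. h \<omega> \<mu>) gs)))"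
    by (intro lip_expect lip_vec_monomial[OF T])
  then obtain K where K: "K \<ge> 0" "\<And>\<omega> \<mu> \<nu>. \<omega> \<in> unit_args l \<Longrightarrow> \<mu> \<in> tuples N (laws_rad 1) \<Longrightarrow> \<nu> \<in> tuples N (laws_rad 1) \<Longrightarrow>
      norm (formal_expect (monomial_vec N \<mu> T (fst \<omega>) (map (\<lambda>h. h \<omega> \<mu>) gs)) -
        formal_expect (monomial_vec N \<nu> T (fst \<omega>) (map (\<lambda>h. h \<omega> \<nu>) gs))) \<le> K * tuple_dist N \<mu> \<nu>"
    by (rule lipE) blast
  have "map (\<lambda>h. h (b, bs) \<mu>) gs = bs" if "(b, bs) \<in> unit_args l" for b bs \<mu>
    using that by (auto simp: gs_def o_def unit_args_def map_nth)
  then show thesis using K(2)[of "(_, _)"] by (intro that[OF K(1)]) simp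
qed

section \<open>The convolution as a map into \<open>Func(B,N)\<close>\<close>

lemma laws_rad_subset: "laws_rad R \<subseteq> laws"
  by (auto simp: laws_rad_def)

lemma tuples_laws_rad: "\<mu> \<in> tuples N (laws_rad R) \<Longrightarrow> \<mu> \<in> tuples N laws"
  using laws_rad_subset by (auto simp: PiE_def)

lemma tree_lawsI: "T \<in> Tree N \<Longrightarrow> \<mu> \<in> tuples N laws \<Longrightarrow> tree_laws N T \<mu>"
  by unfold_locales (auto simp: PiE_def)

lemma tree_conv_laws_rad:
  assumes T: "T \<in> Tree N" and \<mu>: "\<mu> \<in> tuples N (laws_rad 1)"
  shows "tree_conv N T \<mu> \<in> laws_rad (real N)"
proof -
  interpret tree_laws N T \<mu> using T tuples_laws_rad[OF \<mu>] by (rule tree_lawsI)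
  have "total_rad \<le> (\<Sum>j=1..N. 1)"
    unfolding total_rad_def by (intro sum_mono laws_radD(2) tuple_entry[OF \<mu>])
  then show ?thesis
    using conv_law conv_rad by (simp add: tree_conv_eq_formal_law[OF T tuples_laws_rad[OF \<mu>]] laws_rad_def)
qed

lemma tree_conv_moment:
  assumes T: "T \<in> Tree N" and \<mu>: "\<mu> \<in> tuples N (laws_rad 1)"
  shows "tree_conv N T \<mu> (nc_monomial b bs) = formal_expect (monomial_vec N \<mu> T b bs)"
proof -
  interpret tree_laws N T \<mu> using T tuples_laws_rad[OF \<mu>] by (rule tree_lawsI)
  show ?thesis using conv_monomial by (simp add: tree_conv_eq_formal_law[OF T tuples_laws_rad[OF \<mu>]])
qed

text \<open>Moments of order above \<open>L\<close> contribute at most \<open>2 \<cdot> 2\<^sup>-\<^sup>L\<close> to the distance.\<close>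

lemma law_dist_truncate:
  fixes \<mu> \<nu> :: "'b::unital_cstar_algebra law"
  assumes \<mu>: "\<mu> \<in> laws_rad (real N)" and \<nu>: "\<nu> \<in> laws_rad (real N)"
    and C: "C \<ge> 2 * (1/2) ^ L"
    and low: "\<And>l b bs. l \<le> L \<Longrightarrow> (b, bs) \<in> unit_args l \<Longrightarrow> norm (\<mu> (nc_monomial b bs) - \<nu> (nc_monomial b bs)) \<le> C"
  shows "law_dist (real N) \<mu> \<nu> \<le> C"
proof (cases "N = 0")
  \<comment> \<open>For N = 0 every term of the supremum is a quotient by 0 and hence 0.\<close>
  case True
  have "C \<ge> 0" using C by (smt (verit) zero_le_power divide_nonneg_nonneg)
  moreover have "law_dist 0 \<mu> \<nu> = (SUP l\<in>{1..}. multilinear_norm l (\<lambda>b bs. Mom \<mu> b bs - Mom \<nu> b bs) / 0 ^ l)"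
    by (simp add: law_dist_def)
  moreover have "\<dots> = (SUP l\<in>{1::nat..}. 0 :: real)" by (intro SUP_cong) (auto simp: power_0_left)
  ultimately show ?thesis using True by (simp add: cSUP_const)
next
  case False
  have C0: "C \<ge> 0" using C by (smt (verit) zero_le_power divide_nonneg_nonneg)
  show ?thesis
  proof (rule law_dist_le[OF C0])
    fix l :: nat and b :: 'b and bs assume l: "l \<ge> 1" and x: "(b, bs) \<in> unit_args l"
    have N1: "real N \<ge> 1" using False by simp
    show "norm (\<mu> (nc_monomial b bs) - \<nu> (nc_monomial b bs)) \<le> C * (2 * real N) ^ l"
    proof (cases "l \<le> L")
      case True
      have "1 \<le> (2 * real N) ^ l" using N1 by (intro one_le_power) simp
      then have "C \<le> C * (2 * real N) ^ l" using C0 by (simp add: mult_le_cancel_left1)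
      then show ?thesis using low[OF True x] by simp
    next
      case False
      have "norm (\<mu> (nc_monomial b bs) - \<nu> (nc_monomial b bs)) \<le> real N ^ l + real N ^ l"
        using norm_moment_unit[OF \<mu> x] norm_moment_unit[OF \<nu> x] by (intro norm_triangle_le_diff) simp
      \<comment> \<open>Relative to (2 N)^l, the trivial bound on the two moments leaves 2 (1/2)^l,
        which decreases in l.\<close>
      also have "\<dots> = (2 * (1/2) ^ l) * (2 * real N) ^ l" by (simp add: power_mult_distrib power_one_over)
      also have "\<dots> \<le> C * (2 * real N) ^ l"
      proof (rule mult_right_mono)
        have "(1/2 :: real) ^ l \<le> (1/2) ^ L" using False by (intro power_decreasing) auto
        then show "2 * (1/2) ^ l \<le> C" using C by linarith
      qed simp
      finally show ?thesis .
    qed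
  qed simp
qed

lemma exists_half_power: "e > 0 \<Longrightarrow> \<exists>L. 2 * (1/2 :: real) ^ L < e"
  using real_arch_pow_inv[of "e / 2" "1/2"] by (auto simp: field_simps)

lemma tree_conv_uniformly_continuous:
  assumes T: "T \<in> Tree N" and e: "e > 0"
  shows "\<exists>\<delta>>0. \<forall>\<mu>\<in>tuples N (laws_rad 1). \<forall>\<nu>\<in>tuples N (laws_rad 1 :: 'b::unital_cstar_algebra law set).
    (\<forall>i\<in>{1..N}. law_dist 1 (\<mu> i) (\<nu> i) < \<delta>) \<longrightarrow>
    law_dist (real N) (tree_conv N T \<mu>) (tree_conv N T \<nu>) < e"
proof -
  obtain L where L: "2 * (1/2 :: real) ^ L < e / 2" using exists_half_power[of "e / 2"] e by auto
  have "\<exists>K\<ge>0. \<forall>b bs \<mu> \<nu>. (b :: 'b, bs) \<in> unit_args l \<longrightarrow> \<mu> \<in> tuples N (laws_rad 1) \<longrightarrow> \<nu> \<in> tuples N (laws_rad 1) \<longrightarrow>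
      norm (formal_expect (monomial_vec N \<mu> T b bs) - formal_expect (monomial_vec N \<nu> T b bs)) \<le> K * tuple_dist N \<mu> \<nu>" for l
    using monomial_vec_lipschitz[OF T, of l, where 'b = 'b] by metis
  then obtain K where K: "\<And>l. K l \<ge> 0" "\<And>l b bs \<mu> \<nu>. (b :: 'b, bs) \<in> unit_args l \<Longrightarrow> \<mu> \<in> tuples N (laws_rad 1) \<Longrightarrow> \<nu> \<in> tuples N (laws_rad 1) \<Longrightarrow>
      norm (formal_expect (monomial_vec N \<mu> T b bs) - formal_expect (monomial_vec N \<nu> T b bs)) \<le> K l * tuple_dist N \<mu> \<nu>"
    by metis
  \<comment> \<open>\<open>M\<close> dominates the finitely many Lipschitz constants up to order L
    and is positive by its summand 1; the factor N + 1 in \<delta> avoids division by zero for N =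
    0.\<close>
  define M where "M = (\<Sum>l\<le>L. K l) + 1"
  have M: "M > 0" using K(1) by (simp add: M_def add_nonneg_pos sum_nonneg)
  have KM: "K l \<le> M" if "l \<le> L" for l
    using member_le_sum[of l "{..L}" K] K(1) that by (simp add: M_def)
  define \<delta> where "\<delta> = e / 2 / (M * (real N + 1))"
  have \<delta>: "\<delta> > 0" using e M by (simp add: \<delta>_def)
  show ?thesis
  proof (intro exI[of _ \<delta>] conjI \<delta> ballI impI)
    fix \<mu> \<nu> :: "nat \<Rightarrow> 'b law"
    assume \<mu>: "\<mu> \<in> tuples N (laws_rad 1)" and \<nu>: "\<nu> \<in> tuples N (laws_rad 1)"
      and d: "\<forall>i\<in>{1..N}. law_dist 1 (\<mu> i) (\<nu> i) < \<delta>"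
    have "tuple_dist N \<mu> \<nu> \<le> (\<Sum>j=1..N. \<delta>)"
      unfolding tuple_dist_def using d by (intro sum_mono) (auto simp: less_imp_le)
    also have "\<dots> \<le> (real N + 1) * \<delta>" using \<delta> by simp
    finally have "M * tuple_dist N \<mu> \<nu> \<le> M * ((real N + 1) * \<delta>)" using M by (intro mult_left_mono) auto
    also have "\<dots> = e / 2" using M by (simp add: \<delta>_def)
    finally have MD: "M * tuple_dist N \<mu> \<nu> \<le> e / 2" .
    have "law_dist (real N) (tree_conv N T \<mu>) (tree_conv N T \<nu>) \<le> e / 2"
    proof (rule law_dist_truncate[OF tree_conv_laws_rad[OF T \<mu>] tree_conv_laws_rad[OF T \<nu>] less_imp_le[OF L]])
      fix l :: nat and b :: 'b and bs assume l: "l \<le> L" and x: "(b, bs) \<in> unit_args l"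
      have "norm (tree_conv N T \<mu> (nc_monomial b bs) - tree_conv N T \<nu> (nc_monomial b bs)) \<le> K l * tuple_dist N \<mu> \<nu>"
        unfolding tree_conv_moment[OF T \<mu>] tree_conv_moment[OF T \<nu>] by (rule K(2)[OF x \<mu> \<nu>])
      also have "\<dots> \<le> M * tuple_dist N \<mu> \<nu>"
        by (intro mult_right_mono KM l tuple_dist_nonneg \<mu> \<nu>)
      finally show "norm (tree_conv N T \<mu> (nc_monomial b bs) - tree_conv N T \<nu> (nc_monomial b bs)) \<le> e / 2"
        using MD by simp
    qed
    then show "law_dist (real N) (tree_conv N T \<mu>) (tree_conv N T \<nu>) < e" using e by simp
  qed
qed

lemma tree_conv_in_Func_laws:
  assumes T: "T \<in> Tree N"
  shows "(tree_conv N T :: (nat \<Rightarrow> 'b::unital_cstar_algebra law) \<Rightarrow> 'b law) \<in> Func_laws N"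
proof -
  note eq = tree_conv_eq_formal_law[OF T]
  have "(tree_conv N T :: (nat \<Rightarrow> 'b law) \<Rightarrow> 'b law) \<in> tuples N laws \<rightarrow>\<^sub>E laws"
  proof (rule PiE_I)
    fix \<mu> :: "nat \<Rightarrow> 'b law" assume \<mu>: "\<mu> \<in> tuples N laws"
    show "tree_conv N T \<mu> \<in> laws"
      unfolding eq[OF \<mu>] by (rule tree_laws.conv_law[OF tree_lawsI[OF T \<mu>]])
  qed (simp add: tree_conv_def)
  moreover have "law_rad (tree_conv N T \<mu>) \<le> (\<Sum>i=1..N. law_rad (\<mu> i))"
    if \<mu>: "\<mu> \<in> tuples N laws" for \<mu> :: "nat \<Rightarrow> 'b law"
    unfolding eq[OF \<mu>] using tree_laws.conv_rad[OF tree_lawsI[OF T \<mu>]]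
    by (simp add: tree_laws.total_rad_def[OF tree_lawsI[OF T \<mu>]])
  moreover have "tree_conv N T (\<lambda>i\<in>{1..N}. dil c (\<mu> i)) = dil c (tree_conv N T \<mu>)"
    if \<mu>: "\<mu> \<in> tuples N laws" for c and \<mu> :: "nat \<Rightarrow> 'b law"
  proof -
    interpret tree_laws N T \<mu> using T \<mu> by (rule tree_lawsI)
    have "(\<lambda>i\<in>{1..N}. dil c (\<mu> i)) \<in> tuples N laws"
      using tuple_entry[OF \<mu>] by (auto intro!: dil_law)
    from eq[OF this] show ?thesis using formal_law_dil[of c] by (simp only: eq[OF \<mu>] \<mu>c_def)
  qed
  moreover have "tree_conv N T ` tuples N (laws_rad 1) \<subseteq> (laws_rad (real N) :: 'b law set)"
    using tree_conv_laws_rad[OF T] by blast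
  ultimately show ?thesis
    unfolding Func_laws_def using tree_conv_uniformly_continuous[OF T] by blast
qed

text \<open>The empty convolution, which is the law of the zero operator, has radius 0. A member is
  needed because the supremum in \<open>func_dist\<close> over an empty set of reals would be
  unspecified.\<close>

lemma laws_rad_nonempty: "(laws_rad 1 :: 'b::unital_cstar_algebra law set) \<noteq> {}"
proof -
  interpret tree_laws 0 "{[]}" "\<lambda>_. undefined :: 'b law"
    by unfold_locales (auto simp: Tree_def alternating_def)
  have "law_rad conv \<le> 1" using conv_rad by (simp add: total_rad_def)
  then have "conv \<in> laws_rad 1" using conv_law by (simp add: laws_rad_def)
  then show ?thesis by blast
qed

theorem lemma5p11:
  fixes N :: nat
  shows "(tree_conv N :: nat list set \<Rightarrow> (nat \<Rightarrow> 'b::unital_cstar_algebra law) \<Rightarrow> 'b law)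
           \<in> Tree N \<rightarrow> Func_laws N \<and>
         (\<forall>T\<in>Tree N. \<forall>\<epsilon>>0. \<exists>\<delta>>0. \<forall>T'\<in>Tree N. tree_dist T T' < \<delta> \<longrightarrow>
            func_dist N (tree_conv N T :: (nat \<Rightarrow> 'b law) \<Rightarrow> 'b law) (tree_conv N T') < \<epsilon>)"
proof (intro conjI Pi_I ballI allI impI)
  show "tree_conv N T \<in> Func_laws N" if "T \<in> Tree N" for T by (rule tree_conv_in_Func_laws[OF that])
next
  fix T and \<epsilon> :: real assume T: "T \<in> Tree N" and "\<epsilon> > 0"
  then obtain L where L: "2 * (1/2 :: real) ^ L < \<epsilon>" using exists_half_power by blast
  show "\<exists>\<delta>>0. \<forall>T'\<in>Tree N. tree_dist T T' < \<delta> \<longrightarrow>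
      func_dist N (tree_conv N T :: (nat \<Rightarrow> 'b law) \<Rightarrow> 'b law) (tree_conv N T') < \<epsilon>"
  \<comment> \<open>At a distance below this, the trees have the same words up to length L. Moments
    up to order L then coincide for every tuple of laws, and only the tail counts.\<close>
  proof (intro exI[of _ "exp (- real L)"] conjI ballI impI)
    fix T' assume T': "T' \<in> Tree N" and d: "tree_dist T T' < exp (- real L)"
    note ball = tree_dist_less[OF d]
    have "tuples N (laws_rad 1 :: 'b law set) \<noteq> {}"
      using laws_rad_nonempty[where 'b = 'b] by (simp add: PiE_eq_empty_iff)
    then have "func_dist N (tree_conv N T :: (nat \<Rightarrow> 'b law) \<Rightarrow> 'b law) (tree_conv N T') \<le> 2 * (1/2) ^ L"
      unfolding func_dist_def
    proof (rule cSUP_least)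
      fix \<mu> :: "nat \<Rightarrow> 'b law" assume \<mu>: "\<mu> \<in> tuples N (laws_rad 1)"
      show "law_dist (real N) (tree_conv N T \<mu>) (tree_conv N T' \<mu>) \<le> 2 * (1/2) ^ L"
      proof (rule law_dist_truncate[OF tree_conv_laws_rad[OF T \<mu>] tree_conv_laws_rad[OF T' \<mu>] order_refl])
        fix l :: nat and b :: 'b and bs assume "l \<le> L" and "(b, bs) \<in> unit_args l"
        then have "length bs \<le> L" by (simp add: unit_args_def)
        then show "norm (tree_conv N T \<mu> (nc_monomial b bs) - tree_conv N T' \<mu> (nc_monomial b bs)) \<le> 2 * (1/2) ^ L"
          unfolding tree_conv_moment[OF T \<mu>] tree_conv_moment[OF T' \<mu>] monomial_vec_cong[OF ball \<open>length bs \<le> L\<close>]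
          by simp
      qed
    qed
    then show "func_dist N (tree_conv N T :: (nat \<Rightarrow> 'b law) \<Rightarrow> 'b law) (tree_conv N T') < \<epsilon>"
      using L by simp
  qed simp
qed

end
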